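(* Let $p$ be a prime, let $\Gamma\cong\mathbb{Z}_p$ be a group with topological generator $\gamma$, let $\Gamma^{(n)}=\overline{\langle\gamma^{p^n}\rangle}$ and $\Gamma_n=\Gamma/\Gamma^{(n)}\cong\mathbb{Z}/p^n\mathbb{Z}$, and let $\Lambda=\mathbb{Z}_p[[\Gamma]]=\varprojlim_n\mathbb{Z}_p[\Gamma_n]$. Let $X_0=(V_0,\vec E_0,o,t,\iota)$ be a finite connected graph with orientation $E_0^+$, and let $\alpha\colon\vec E_0\to\Gamma$ be a voltage assignment such that, for every $n\ge 0$, the derived graph $X_n$ of $(X_0,\Gamma_n,\alpha_n)$ is connected, where $\alpha_n$ is $\alpha$ composed with $\Gamma\to\Gamma_n$. Let $C(\infty)=\Lambda E_0^+$ and $D(\infty)=\Lambda V_0$ be free $\Lambda$-modules, and let $d\colon C(\infty)\to D(\infty)$ and $s\colon D(\infty)\to C(\infty)$ be the $\Lambda$-linear maps given on basis elements by $d(e)=\alpha(e)\,t(e)-o(e)$ for $e\in E_0^+$ and $s(v)=\sum_{e\in E_0^+,\,t(e)=v}\alpha(e)^{-1}e-\sum_{e\in E_0^+,\,o(e)=v}e$ for $v\in V_0$. Put $H(\infty)=\ker d$, $S(\infty)=\operatorname{im} s$, and $J(\infty)=C(\infty)/\big(S(\infty)+H(\infty)\big)$. Then for every $n\ge0$, the module $J(n)=J(\infty)\otimes_\Lambda\mathbb{Z}_p[\Gamma_n]$ is an extension of $\mathcal{J}(X_n)[p^\infty]$ by $\Gamma^{(n)}$, i.e. there is a short exact sequence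 $0\to\Gamma^{(n)}\to J(n)\to\mathcal{J}(X_n)[p^\infty]\to 0$, where $\mathcal{J}(X_n)[p^\infty]$ is the $p$-power torsion subgroup of the Jacobian of $X_n$.
   Context: A graph is a tuple $X=(V,\vec E,o,t,\iota)$ with vertex set $V$, directed edge set $\vec E$, incidence maps $o,t\colon\vec E\to V$, and a fixed-point-free involution $\iota$ on $\vec E$ with $o(\iota(e))=t(e)$, $t(\iota(e))=o(e)$ (loops and multiple edges allowed); an orientation is a partition $\vec E=E^+\sqcup E^-$ with $\iota(E^+)=E^-$. A $G$-valued voltage assignment is a map $\alpha\colon\vec E\to G$ with $\alpha(\iota(e))=\alpha(e)^{-1}$. The derived graph of $(X,G,\alpha)$ has vertex set $V\times G$, edge set $\vec E\times G$, with $o(e,g)=(o(e),g)$, $t(e,g)=(t(e),g\alpha(e))$, $\iota(e,g)=(\iota(e),g\alpha(e))$, and orientation $E^+\times G$. The Jacobian of a finite connected graph $X$ with orientation $E^+$ is $\mathcal{J}(X)=\mathbb{Z}E^+/\big(H_1(X,\mathbb{Z})+S(X,\mathbb{Z})\big)$, where $H_1(X,\mathbb{Z})$ is the kernel of $d\colon\mathbb{Z}E^+\to\mathbb{Z}V$, $d(e)=t(e)-o(e)$, and $S(X,\mathbb{Z})$ is the image of $s\colon\mathbb{Z}V\to\mathbb{Z}E^+$, $s(v)=\sum_{e\in E^+,t(e)=v}e-\sum_{e\in E^+,o(e)=v}e$; equivalently $\mathcal{J}(X)\cong\operatorname{Div}^0(X)/\operatorname{im}\Delta$ with $\Delta$ the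 graph Laplacian on $\mathbb{Z}V$. It is a finite abelian group. *)

theory Defs
  imports
    "HOL-Algebra.Module"
    "HOL-Algebra.IntRing"
    "HOL-Algebra.Generated_Groups"
    "HOL-Number_Theory.Residues"
    "HOL-Analysis.Function_Topology"
    "Graph_Theory.Digraph_Component"
    "Graph_Theory.Bidirected_Digraph"
begin

section \<open>Modules\<close>

text \<open>The multiplicative fields of a record of type \<open>module\<close> play no role in the
  library locale \<open>module\<close>; they are left unspecified below.\<close>

definition free_module ::
  "('a, 'm) ring_scheme \<Rightarrow> 's set \<Rightarrow> ('a, 's \<Rightarrow> 'a) module" where
  "free_module R S =
     \<lparr>carrier = {x \<in> S \<rightarrow>\<^sub>E carrier R. finite {s \<in> S. x s \<noteq> \<zero>\<^bsub>R\<^esub>}},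
      mult = undefined, one = undefined,
      zero = (\<lambda>s\<in>S. \<zero>\<^bsub>R\<^esub>),
      add = (\<lambda>x y. \<lambda>s\<in>S. x s \<oplus>\<^bsub>R\<^esub> y s),
      smult = (\<lambda>r x. \<lambda>s\<in>S. r \<otimes>\<^bsub>R\<^esub> x s)\<rparr>"

definition basis_elt :: "('a, 'm) ring_scheme \<Rightarrow> 's set \<Rightarrow> 's \<Rightarrow> ('s \<Rightarrow> 'a)" where
  "basis_elt R S s = (\<lambda>x\<in>S. if x = s then \<one>\<^bsub>R\<^esub> else \<zero>\<^bsub>R\<^esub>)"

text \<open>The linear map from the free module on \<open>S\<close> to \<open>M\<close> with prescribed values \<open>f\<close>
  on the basis.\<close>

definition lin_ext ::
  "('a, 'm) ring_scheme \<Rightarrow> 's set \<Rightarrow> ('a, 'b, 'k) module_scheme \<Rightarrow> ('s \<Rightarrow> 'b)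
     \<Rightarrow> ('s \<Rightarrow> 'a) \<Rightarrow> 'b" where
  "lin_ext R S M f x = (\<Oplus>\<^bsub>M\<^esub>s\<in>{s \<in> S. x s \<noteq> \<zero>\<^bsub>R\<^esub>}. x s \<odot>\<^bsub>M\<^esub> f s)"

definition quot_module ::
  "('a, 'b, 'k) module_scheme \<Rightarrow> 'b set \<Rightarrow> ('a, 'b set) module" where
  "quot_module M N =
     \<lparr>carrier = a_rcosets\<^bsub>M\<^esub> N,
      mult = undefined, one = undefined,
      zero = N,
      add = (<+>\<^bsub>M\<^esub>),
      smult = (\<lambda>r A. \<Union>x\<in>A. N +>\<^bsub>M\<^esub> (r \<odot>\<^bsub>M\<^esub> x))\<rparr>"

definition submodule_span ::
  "('a, 'm) ring_scheme \<Rightarrow> ('a, 'b) module \<Rightarrow> 'b set \<Rightarrow> 'b set" where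
  "submodule_span R M A = \<Inter>{H. submodule H R M \<and> A \<subseteq> H}"

text \<open>The tensor product of two modules over a commutative ring, as a quotient of the free
  module on all pairs.\<close>

definition tensor_relations ::
  "('a, 'm) ring_scheme \<Rightarrow> ('a, 'b, 'k) module_scheme \<Rightarrow> ('a, 'c, 'l) module_scheme
     \<Rightarrow> ('b \<times> 'c \<Rightarrow> 'a) set" where
  "tensor_relations R M N =
     (let P = carrier M \<times> carrier N; F = free_module R P; b = basis_elt R P in
        {b (x \<oplus>\<^bsub>M\<^esub> x', y) \<ominus>\<^bsub>F\<^esub> (b (x, y) \<oplus>\<^bsub>F\<^esub> b (x', y)) |
           x x' y. x \<in> carrier M \<and> x' \<in> carrier M \<and> y \<in> carrier N}
      \<union> {b (x, y \<oplus>\<^bsub>N\<^esub> y') \<ominus>\<^bsub>F\<^esub> (b (x, y) \<oplus>\<^bsub>F\<^esub> b (x, y')) |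
           x y y'. x \<in> carrier M \<and> y \<in> carrier N \<and> y' \<in> carrier N}
      \<union> {b (r \<odot>\<^bsub>M\<^esub> x, y) \<ominus>\<^bsub>F\<^esub> (r \<odot>\<^bsub>F\<^esub> b (x, y)) |
           r x y. r \<in> carrier R \<and> x \<in> carrier M \<and> y \<in> carrier N}
      \<union> {b (x, r \<odot>\<^bsub>N\<^esub> y) \<ominus>\<^bsub>F\<^esub> (r \<odot>\<^bsub>F\<^esub> b (x, y)) |
           r x y. r \<in> carrier R \<and> x \<in> carrier M \<and> y \<in> carrier N})"

definition tensor_product ::
  "('a, 'm) ring_scheme \<Rightarrow> ('a, 'b, 'k) module_scheme \<Rightarrow> ('a, 'c, 'l) module_scheme
     \<Rightarrow> ('a, ('b \<times> 'c \<Rightarrow> 'a) set) module" where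
  "tensor_product R M N =
     (let F = free_module R (carrier M \<times> carrier N)
      in quot_module F (submodule_span R F (tensor_relations R M N)))"

text \<open>A ring \<open>S\<close> as a module along a ring homomorphism \<open>h\<close> into \<open>S\<close>.\<close>

definition ring_as_module :: "('b, 'm) ring_scheme \<Rightarrow> ('a \<Rightarrow> 'b) \<Rightarrow> ('a, 'b) module" where
  "ring_as_module S h =
     \<lparr>carrier = carrier S, mult = mult S, one = \<one>\<^bsub>S\<^esub>, zero = \<zero>\<^bsub>S\<^esub>, add = ring.add S,
      smult = (\<lambda>r x. h r \<otimes>\<^bsub>S\<^esub> x)\<rparr>"

text \<open>The library's \<open>short_exact_sequence\<close> requires the three groups to share one element
  type, hence this heterogeneous version of \<open>0 \<rightarrow> A \<rightarrow> B \<rightarrow> C \<rightarrow> 0\<close>.\<close>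

definition short_exact ::
  "('a, 'k) monoid_scheme \<Rightarrow> ('a \<Rightarrow> 'b) \<Rightarrow> ('b, 'l) monoid_scheme \<Rightarrow> ('b \<Rightarrow> 'c)
     \<Rightarrow> ('c, 'm) monoid_scheme \<Rightarrow> bool" where
  "short_exact A f B g C \<longleftrightarrow>
     group_hom A B f \<and> group_hom B C g \<and>
     inj_on f (carrier A) \<and> f ` carrier A = kernel B C g \<and> g ` carrier B = carrier C"

definition p_power_torsion :: "nat \<Rightarrow> ('a, 'm) ring_scheme \<Rightarrow> ('a, 'm) monoid_scheme" where
  "p_power_torsion p M =
     (add_monoid M)\<lparr>carrier := {x \<in> carrier M. \<exists>k::nat. add_pow M (p ^ k) x = \<zero>\<^bsub>M\<^esub>}\<rparr>"


section \<open>Inverse limits, p-adic integers, group rings\<close>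

definition ring_lim :: "(nat \<Rightarrow> 'a ring) \<Rightarrow> (nat \<Rightarrow> 'a \<Rightarrow> 'a) \<Rightarrow> (nat \<Rightarrow> 'a) ring" where
  "ring_lim R f =
     \<lparr>carrier = {x. \<forall>n. x n \<in> carrier (R n) \<and> f n (x (Suc n)) = x n},
      mult = (\<lambda>x y n. x n \<otimes>\<^bsub>R n\<^esub> y n),
      one = (\<lambda>n. \<one>\<^bsub>R n\<^esub>),
      zero = (\<lambda>n. \<zero>\<^bsub>R n\<^esub>),
      add = (\<lambda>x y n. x n \<oplus>\<^bsub>R n\<^esub> y n)\<rparr>"

text \<open>Component \<open>n\<close> of a p-adic integer is its residue modulo \<open>p ^ (n + 1)\<close>; the trivial
  component modulo \<open>1\<close> is omitted because \<open>residue_ring 1\<close> is not a ring in the library.\<close>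

definition Zp :: "nat \<Rightarrow> (nat \<Rightarrow> int) ring" where
  "Zp p = ring_lim (\<lambda>n. residue_ring (int p ^ Suc n)) (\<lambda>n x. x mod int p ^ Suc n)"

definition Zp_topology :: "nat \<Rightarrow> (nat \<Rightarrow> int) topology" where
  "Zp_topology p =
     subtopology (product_topology (\<lambda>_. discrete_topology UNIV) UNIV) (carrier (Zp p))"

text \<open>Only meant for finite \<open>G\<close>.\<close>

definition group_ring :: "('a, 'm) ring_scheme \<Rightarrow> ('h, 'k) monoid_scheme \<Rightarrow> ('h \<Rightarrow> 'a) ring" where
  "group_ring R G =
     \<lparr>carrier = carrier G \<rightarrow>\<^sub>E carrier R,
      mult = (\<lambda>x y. \<lambda>g\<in>carrier G. \<Oplus>\<^bsub>R\<^esub>h\<in>carrier G. x h \<otimes>\<^bsub>R\<^esub> y (inv\<^bsub>G\<^esub> h \<otimes>\<^bsub>G\<^esub> g)),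
      one = basis_elt R (carrier G) \<one>\<^bsub>G\<^esub>,
      zero = (\<lambda>g\<in>carrier G. \<zero>\<^bsub>R\<^esub>),
      add = (\<lambda>x y. \<lambda>g\<in>carrier G. x g \<oplus>\<^bsub>R\<^esub> y g)\<rparr>"

text \<open>The map of group rings induced by a group homomorphism \<open>q\<close> from \<open>G\<close> to \<open>H\<close>.\<close>

definition group_ring_map ::
  "('a, 'm) ring_scheme \<Rightarrow> ('h, 'k) monoid_scheme \<Rightarrow> ('i, 'l) monoid_scheme \<Rightarrow> ('h \<Rightarrow> 'i)
     \<Rightarrow> ('h \<Rightarrow> 'a) \<Rightarrow> ('i \<Rightarrow> 'a)" where
  "group_ring_map R G H q x = (\<lambda>h\<in>carrier H. \<Oplus>\<^bsub>R\<^esub>g\<in>{g \<in> carrier G. q g = h}. x g)"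


section \<open>The Iwasawa algebra\<close>

definition Gamma_sub :: "nat \<Rightarrow> 'g monoid \<Rightarrow> 'g topology \<Rightarrow> 'g \<Rightarrow> nat \<Rightarrow> 'g set" where
  "Gamma_sub p G T \<gamma> n = T closure_of generate G {\<gamma> [^]\<^bsub>G\<^esub> (p ^ n)}"

definition Gamma_quot :: "nat \<Rightarrow> 'g monoid \<Rightarrow> 'g topology \<Rightarrow> 'g \<Rightarrow> nat \<Rightarrow> 'g set monoid" where
  "Gamma_quot p G T \<gamma> n = G Mod Gamma_sub p G T \<gamma> n"

definition layer_ring ::
  "nat \<Rightarrow> 'g monoid \<Rightarrow> 'g topology \<Rightarrow> 'g \<Rightarrow> nat \<Rightarrow> ('g set \<Rightarrow> nat \<Rightarrow> int) ring" where
  "layer_ring p G T \<gamma> n = group_ring (Zp p) (Gamma_quot p G T \<gamma> n)"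

type_synonym 'g iwasawa_elt = "nat \<Rightarrow> 'g set \<Rightarrow> nat \<Rightarrow> int"

text \<open>The transition maps are induced by the quotient maps sending a coset \<open>c\<close> of
  \<open>Gamma_sub p G T \<gamma> (n + 1)\<close> to the coset of \<open>Gamma_sub p G T \<gamma> n\<close> containing it.\<close>

definition Iwasawa :: "nat \<Rightarrow> 'g monoid \<Rightarrow> 'g topology \<Rightarrow> 'g \<Rightarrow> 'g iwasawa_elt ring" where
  "Iwasawa p G T \<gamma> =
     ring_lim (layer_ring p G T \<gamma>)
       (\<lambda>n. group_ring_map (Zp p) (Gamma_quot p G T \<gamma> (Suc n)) (Gamma_quot p G T \<gamma> n)
              (\<lambda>c. Gamma_sub p G T \<gamma> n <#>\<^bsub>G\<^esub> c))"

definition group_elt :: "nat \<Rightarrow> 'g monoid \<Rightarrow> 'g topology \<Rightarrow> 'g \<Rightarrow> 'g \<Rightarrow> 'g iwasawa_elt" where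
  "group_elt p G T \<gamma> g =
     (\<lambda>n. basis_elt (Zp p) (carrier (Gamma_quot p G T \<gamma> n)) (Gamma_sub p G T \<gamma> n #>\<^bsub>G\<^esub> g))"


section \<open>Graphs, voltage assignments, Jacobians\<close>

text \<open>A graph with vertex set, directed edges, incidence maps and fixed-point-free edge
  involution \<open>\<iota>\<close> is a \<open>bidirected_digraph X \<iota>\<close>, which extends \<open>\<iota>\<close> by the identity outside the
  edge set. Loops and multiple edges are allowed.\<close>

definition orientation :: "('v, 'e) pre_digraph \<Rightarrow> ('e \<Rightarrow> 'e) \<Rightarrow> 'e set \<Rightarrow> bool" where
  "orientation X \<iota> Ep \<longleftrightarrow> Ep \<subseteq> arcs X \<and> \<iota> ` Ep = arcs X - Ep"

definition voltage_assignment ::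
  "('v, 'e) pre_digraph \<Rightarrow> ('e \<Rightarrow> 'e) \<Rightarrow> ('g, 'm) monoid_scheme \<Rightarrow> ('e \<Rightarrow> 'g) \<Rightarrow> bool" where
  "voltage_assignment X \<iota> G \<alpha> \<longleftrightarrow>
     \<alpha> \<in> arcs X \<rightarrow> carrier G \<and> (\<forall>e\<in>arcs X. \<alpha> (\<iota> e) = inv\<^bsub>G\<^esub> \<alpha> e)"

definition derived_graph ::
  "('v, 'e) pre_digraph \<Rightarrow> ('g, 'm) monoid_scheme \<Rightarrow> ('e \<Rightarrow> 'g) \<Rightarrow> ('v \<times> 'g, 'e \<times> 'g) pre_digraph"
  where
  "derived_graph X G \<alpha> =
     \<lparr>verts = verts X \<times> carrier G,
      arcs = arcs X \<times> carrier G,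
      tail = (\<lambda>(e, g). (tail X e, g)),
      head = (\<lambda>(e, g). (head X e, g \<otimes>\<^bsub>G\<^esub> \<alpha> e))\<rparr>"

definition derived_rev ::
  "('v, 'e) pre_digraph \<Rightarrow> ('e \<Rightarrow> 'e) \<Rightarrow> ('g, 'm) monoid_scheme \<Rightarrow> ('e \<Rightarrow> 'g)
     \<Rightarrow> 'e \<times> 'g \<Rightarrow> 'e \<times> 'g" where
  "derived_rev X \<iota> G \<alpha> =
     (\<lambda>(e, g). if e \<in> arcs X \<and> g \<in> carrier G then (\<iota> e, g \<otimes>\<^bsub>G\<^esub> \<alpha> e) else (e, g))"

lemma derived_graph_bidirected:
  assumes "bidirected_digraph X \<iota>" "group G" "voltage_assignment X \<iota> G \<alpha>"
  shows "bidirected_digraph (derived_graph X G \<alpha>) (derived_rev X \<iota> G \<alpha>)"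
proof -
  interpret X: bidirected_digraph X \<iota> by fact
  interpret G: group G by fact
  have \<alpha>: "\<alpha> e \<in> carrier G" "\<alpha> (\<iota> e) = inv\<^bsub>G\<^esub> \<alpha> e" if "e \<in> arcs X" for e
    using assms(3) that by (auto simp: voltage_assignment_def)
  have wf: "wf_digraph (derived_graph X G \<alpha>)"
    by (rule wf_digraph.intro) (auto simp: derived_graph_def \<alpha>)
  then show ?thesis
  proof (rule wf_digraph.bidirected_digraphI)
    fix a assume "a \<in> arcs (derived_graph X G \<alpha>)"
    then obtain e g where a: "a = (e, g)" "e \<in> arcs X" "g \<in> carrier G"
      by (auto simp: derived_graph_def)
    show "derived_rev X \<iota> G \<alpha> a \<noteq> a"
      using a X.arev_neq[of e] by (simp add: derived_rev_def)
    show "derived_rev X \<iota> G \<alpha> (derived_rev X \<iota> G \<alpha> a) = a"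
      using a \<alpha>[of e] by (simp add: derived_rev_def G.m_assoc)
    show "tail (derived_graph X G \<alpha>) (derived_rev X \<iota> G \<alpha> a) = head (derived_graph X G \<alpha>) a"
      using a by (simp add: derived_rev_def derived_graph_def)
  qed (auto simp: derived_graph_def derived_rev_def split: if_splits)
qed

lemma derived_graph_orientation:
  assumes "bidirected_digraph X \<iota>" "group G" "voltage_assignment X \<iota> G \<alpha>"
    and "orientation X \<iota> Ep"
  shows "orientation (derived_graph X G \<alpha>) (derived_rev X \<iota> G \<alpha>) (Ep \<times> carrier G)"
proof -
  interpret X: bidirected_digraph X \<iota> by fact
  interpret G: group G by fact
  have \<alpha>: "\<alpha> e \<in> carrier G" if "e \<in> arcs X" for e
    using assms(3) that by (auto simp: voltage_assignment_def)
  have Ep: "Ep \<subseteq> arcs X" "\<iota> ` Ep = arcs X - Ep"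
    using assms(4) by (auto simp: orientation_def)
  have "derived_rev X \<iota> G \<alpha> ` (Ep \<times> carrier G) = (arcs X - Ep) \<times> carrier G" (is "?L = ?R")
  proof (intro equalityI subsetI)
    fix y assume "y \<in> ?L"
    then obtain e g where y: "y = derived_rev X \<iota> G \<alpha> (e, g)" "e \<in> Ep" "g \<in> carrier G"
      by blast
    then have "e \<in> arcs X" "\<iota> e \<in> arcs X - Ep"
      using Ep(1) imageI[of e Ep \<iota>] unfolding Ep(2) by blast+
    then show "y \<in> ?R" using y \<alpha>[of e] by (simp add: derived_rev_def)
  next
    fix y assume "y \<in> ?R"
    then obtain e' g where e': "y = (e', g)" "e' \<in> \<iota> ` Ep" "g \<in> carrier G"
      unfolding Ep(2) by (elim SigmaE)
    then obtain e where "e \<in> Ep" "e' = \<iota> e" by (elim imageE)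
    with e' have y: "y = (\<iota> e, g)" "e \<in> Ep" "g \<in> carrier G" by simp_all
    then have e: "e \<in> arcs X" using Ep(1) by blast
    then have "y = derived_rev X \<iota> G \<alpha> (e, g \<otimes>\<^bsub>G\<^esub> inv\<^bsub>G\<^esub> \<alpha> e)"
      using y \<alpha>[OF e] by (simp add: derived_rev_def G.m_assoc)
    then show "y \<in> ?L" using y \<alpha>[OF e] by blast
  qed
  moreover have "arcs X \<times> carrier G - Ep \<times> carrier G = (arcs X - Ep) \<times> carrier G" by blast
  ultimately show ?thesis
    using Ep(1) by (simp add: orientation_def derived_graph_def Sigma_mono)
qed

definition boundary :: "('v, 'e) pre_digraph \<Rightarrow> 'e set \<Rightarrow> ('e \<Rightarrow> int) \<Rightarrow> ('v \<Rightarrow> int)" where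
  "boundary X Ep =
     (let D = free_module \<Z> (verts X); b = basis_elt \<Z> (verts X) in
      lin_ext \<Z> Ep D (\<lambda>e. b (head X e) \<ominus>\<^bsub>D\<^esub> b (tail X e)))"

definition star :: "('v, 'e) pre_digraph \<Rightarrow> 'e set \<Rightarrow> ('v \<Rightarrow> int) \<Rightarrow> ('e \<Rightarrow> int)" where
  "star X Ep =
     (let C = free_module \<Z> Ep; b = basis_elt \<Z> Ep in
      lin_ext \<Z> (verts X) C
        (\<lambda>v. (\<Oplus>\<^bsub>C\<^esub>e\<in>{e \<in> Ep. head X e = v}. b e) \<ominus>\<^bsub>C\<^esub> (\<Oplus>\<^bsub>C\<^esub>e\<in>{e \<in> Ep. tail X e = v}. b e)))"

definition jacobian :: "('v, 'e) pre_digraph \<Rightarrow> 'e set \<Rightarrow> (int, ('e \<Rightarrow> int) set) module" where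
  "jacobian X Ep =
     (let C = free_module \<Z> Ep; D = free_module \<Z> (verts X) in
      quot_module C (a_kernel C D (boundary X Ep) <+>\<^bsub>C\<^esub> star X Ep ` carrier D))"

text \<open>The action of \<open>G\<close> on the Jacobian of \<open>derived_graph X G \<alpha>\<close> induced by the deck
  transformations: \<open>h\<close> maps an edge \<open>(e, g)\<close> to \<open>(e, h g)\<close>. A class, being a coset in the
  edge module, is mapped to its elementwise image.\<close>

definition deck_edges ::
  "'e set \<Rightarrow> ('g, 'm) monoid_scheme \<Rightarrow> 'g \<Rightarrow> ('e \<times> 'g \<Rightarrow> int) \<Rightarrow> ('e \<times> 'g \<Rightarrow> int)" where
  "deck_edges Ep G h c = (\<lambda>(e, g)\<in>Ep \<times> carrier G. c (e, inv\<^bsub>G\<^esub> h \<otimes>\<^bsub>G\<^esub> g))"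

definition deck_jacobian ::
  "'e set \<Rightarrow> ('g, 'm) monoid_scheme \<Rightarrow> 'g \<Rightarrow> ('e \<times> 'g \<Rightarrow> int) set \<Rightarrow> ('e \<times> 'g \<Rightarrow> int) set" where
  "deck_jacobian Ep G h = image (deck_edges Ep G h)"


section \<open>The module J at infinite level and its layers\<close>

definition boundary_inf ::
  "nat \<Rightarrow> 'g monoid \<Rightarrow> 'g topology \<Rightarrow> 'g \<Rightarrow> ('v, 'e) pre_digraph \<Rightarrow> 'e set \<Rightarrow> ('e \<Rightarrow> 'g)
     \<Rightarrow> ('e \<Rightarrow> 'g iwasawa_elt) \<Rightarrow> ('v \<Rightarrow> 'g iwasawa_elt)" where
  "boundary_inf p G T \<gamma> X Ep \<alpha> =
     (let \<Lambda> = Iwasawa p G T \<gamma>; D = free_module \<Lambda> (verts X); b = basis_elt \<Lambda> (verts X) in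
      lin_ext \<Lambda> Ep D
        (\<lambda>e. (group_elt p G T \<gamma> (\<alpha> e) \<odot>\<^bsub>D\<^esub> b (head X e)) \<ominus>\<^bsub>D\<^esub> b (tail X e)))"

definition star_inf ::
  "nat \<Rightarrow> 'g monoid \<Rightarrow> 'g topology \<Rightarrow> 'g \<Rightarrow> ('v, 'e) pre_digraph \<Rightarrow> 'e set \<Rightarrow> ('e \<Rightarrow> 'g)
     \<Rightarrow> ('v \<Rightarrow> 'g iwasawa_elt) \<Rightarrow> ('e \<Rightarrow> 'g iwasawa_elt)" where
  "star_inf p G T \<gamma> X Ep \<alpha> =
     (let \<Lambda> = Iwasawa p G T \<gamma>; C = free_module \<Lambda> Ep; b = basis_elt \<Lambda> Ep in
      lin_ext \<Lambda> (verts X) C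
        (\<lambda>v. (\<Oplus>\<^bsub>C\<^esub>e\<in>{e \<in> Ep. head X e = v}. group_elt p G T \<gamma> (inv\<^bsub>G\<^esub> \<alpha> e) \<odot>\<^bsub>C\<^esub> b e)
              \<ominus>\<^bsub>C\<^esub> (\<Oplus>\<^bsub>C\<^esub>e\<in>{e \<in> Ep. tail X e = v}. b e)))"

definition J_inf ::
  "nat \<Rightarrow> 'g monoid \<Rightarrow> 'g topology \<Rightarrow> 'g \<Rightarrow> ('v, 'e) pre_digraph \<Rightarrow> 'e set \<Rightarrow> ('e \<Rightarrow> 'g)
     \<Rightarrow> ('g iwasawa_elt, ('e \<Rightarrow> 'g iwasawa_elt) set) module" where
  "J_inf p G T \<gamma> X Ep \<alpha> =
     (let \<Lambda> = Iwasawa p G T \<gamma>; C = free_module \<Lambda> Ep; D = free_module \<Lambda> (verts X) in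
      quot_module C
        (star_inf p G T \<gamma> X Ep \<alpha> ` carrier D <+>\<^bsub>C\<^esub> a_kernel C D (boundary_inf p G T \<gamma> X Ep \<alpha>)))"

definition J_layer ::
  "nat \<Rightarrow> 'g monoid \<Rightarrow> 'g topology \<Rightarrow> 'g \<Rightarrow> ('v, 'e) pre_digraph \<Rightarrow> 'e set \<Rightarrow> ('e \<Rightarrow> 'g) \<Rightarrow> nat
     \<Rightarrow> ('g iwasawa_elt,
         (('e \<Rightarrow> 'g iwasawa_elt) set \<times> ('g set \<Rightarrow> nat \<Rightarrow> int) \<Rightarrow> 'g iwasawa_elt) set) module" where
  "J_layer p G T \<gamma> X Ep \<alpha> n =
     tensor_product (Iwasawa p G T \<gamma>) (J_inf p G T \<gamma> X Ep \<alpha>)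
       (ring_as_module (layer_ring p G T \<gamma> n) (\<lambda>x. x n))"

end

(* The map d identifies J(oo) with im d / im (d s), where d s is the twisted Laplacian on D(oo).
   With omega_n = gamma^(p^n) - 1, base change gives J(n) = im d / (im (d s) + omega_n im d).
   Connectedness of the layers provides a loop of X_0 whose voltage is a topological generator, which
   forces im d to be the kernel of the total augmentation D(oo) -> Z_p; in particular it contains
   omega_n D(oo). Reducing coefficients modulo omega_n turns im d and im (d s) into the boundaries and
   principal divisors of X_n with p-adic coefficients, so the p-part of the Jacobian of X_n is
   im d / (im (d s) + omega_n D(oo)). The kernel of the projection from J(n) comes from
   omega_n D(oo) / omega_n im d, a copy of Z_p with trivial action, that is, of Gamma^(n); this maps
   injectively to J(n) because a harmonic function on the connected graph X_n is constant and thus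
   has zero differential. *)
theory Submission
  imports Defs
begin

section \<open>Quotient modules\<close>

text \<open>The computations use the loop voltage \<open>b\<close> in place of \<gamma>:
  \<open>omega n\<close> is b^(p^n) - 1. One element then serves two purposes, because b - 1 times a
  vertex is a boundary and b^(p^n) - 1 generates the kernel of the projection of \<Lambda> to level
  n. That this kernel is principal rests on reading \<Lambda> as measures on Z_p, where division by
  \<open>omega n\<close> becomes a difference equation. Positivity of the Laplacian is an integral
  fact with no p-adic counterpart. Harmonic p-adic functions are therefore tested against integral
  potentials whose Laplacian is N([u] - [w]), using symmetry and giving up the finitely many digits
  contained in N. The p-part of the Jacobian is reached without extending scalars: a p-adic chain is
  truncated to integers and multiplied by an integer \<open>u\<close> that is 1 modulo the p-part of
  N and divisible by the rest of N. Truncation errors then become principal divisors. The kernel of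
  J(n) onto the p-part is measured by the total augmentation, which is zero exactly on im d and has
  a section supported at one vertex.\<close>

context module
begin

lemma smult_minus_l:
  assumes "a \<in> carrier R" "b \<in> carrier R" "x \<in> carrier M"
  shows "(a \<ominus> b) \<odot>\<^bsub>M\<^esub> x = a \<odot>\<^bsub>M\<^esub> x \<ominus>\<^bsub>M\<^esub> b \<odot>\<^bsub>M\<^esub> x"
  unfolding a_minus_def using assms by (simp add: smult_l_distr smult_l_minus)

lemma smult_minus_r:
  assumes "a \<in> carrier R" "x \<in> carrier M" "y \<in> carrier M"
  shows "a \<odot>\<^bsub>M\<^esub> (x \<ominus>\<^bsub>M\<^esub> y) = a \<odot>\<^bsub>M\<^esub> x \<ominus>\<^bsub>M\<^esub> a \<odot>\<^bsub>M\<^esub> y"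
  unfolding a_minus_def using assms by (simp add: smult_r_distr smult_r_minus)

lemma submodule_abelian_subgroup:
  assumes "submodule N R M" shows "abelian_subgroup N M"
  by (intro abelian_subgroupI3 additive_subgroupI submodule.axioms(1)[OF assms] M.abelian_group_axioms)

lemma coset_eq_iff:
  assumes "submodule N R M" "x \<in> carrier M" "y \<in> carrier M"
  shows "N +>\<^bsub>M\<^esub> x = N +>\<^bsub>M\<^esub> y \<longleftrightarrow> x \<ominus>\<^bsub>M\<^esub> y \<in> N"
proof -
  interpret N: abelian_subgroup N M by (rule submodule_abelian_subgroup) fact
  note N = submodule.axioms(1)[OF assms(1)]
  show ?thesis
    using assms N N.a_rcos_self[of x] N.a_rcos_module[of y x] M.a_repr_independence[of x N y]
    by (auto simp: M.minus_eq)
qed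

lemma quot_module_carrier: "carrier (quot_module M N) = (\<lambda>x. N +>\<^bsub>M\<^esub> x) ` carrier M"
  by (auto simp: quot_module_def A_RCOSETS_def')

lemma quot_module_closed: "x \<in> carrier M \<Longrightarrow> N +>\<^bsub>M\<^esub> x \<in> carrier (quot_module M N)"
  unfolding quot_module_carrier by (rule imageI)

lemma quot_module_add:
  assumes "submodule N R M" "x \<in> carrier M" "y \<in> carrier M"
  shows "(N +>\<^bsub>M\<^esub> x) \<oplus>\<^bsub>quot_module M N\<^esub> (N +>\<^bsub>M\<^esub> y) = N +>\<^bsub>M\<^esub> (x \<oplus>\<^bsub>M\<^esub> y)"
  using abelian_subgroup.a_rcos_sum[OF submodule_abelian_subgroup] assms
  by (simp add: quot_module_def)

lemma quot_module_zero:
  assumes "submodule N R M"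
  shows "\<zero>\<^bsub>quot_module M N\<^esub> = N +>\<^bsub>M\<^esub> \<zero>\<^bsub>M\<^esub>"
  using M.a_coset_add_zero submoduleE(1)[OF assms] by (simp add: quot_module_def)

lemma coset_subset:
  assumes "submodule N R M" "x \<in> carrier M" "y \<in> N +>\<^bsub>M\<^esub> x"
  shows "y \<in> carrier M" "y \<ominus>\<^bsub>M\<^esub> x \<in> N"
proof -
  interpret N: abelian_subgroup N M by (rule submodule_abelian_subgroup) fact
  show y: "y \<in> carrier M"
    using assms M.a_r_coset_subset_G[of N x] N.a_subset by blast
  show "y \<ominus>\<^bsub>M\<^esub> x \<in> N"
    using assms N.a_rcos_module[of x y] y by (simp add: M.minus_eq)
qed

text \<open>The action on cosets is defined as a union over all representatives, which avoids a
  choice. The union collapses because two representatives differ by an element of \<open>N\<close>,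
  and \<open>N\<close> is stable under scalars.\<close>

lemma quot_module_smult:
  assumes N: "submodule N R M" and "x \<in> carrier M" "r \<in> carrier R"
  shows "r \<odot>\<^bsub>quot_module M N\<^esub> (N +>\<^bsub>M\<^esub> x) = N +>\<^bsub>M\<^esub> (r \<odot>\<^bsub>M\<^esub> x)"
proof -
  interpret N: abelian_subgroup N M by (rule submodule_abelian_subgroup) fact
  have "N +>\<^bsub>M\<^esub> (r \<odot>\<^bsub>M\<^esub> y) = N +>\<^bsub>M\<^esub> (r \<odot>\<^bsub>M\<^esub> x)" if "y \<in> N +>\<^bsub>M\<^esub> x" for y
  proof -
    have y: "y \<in> carrier M" "y \<ominus>\<^bsub>M\<^esub> x \<in> N"
      by (rule coset_subset[OF N assms(2) that])+
    have "r \<odot>\<^bsub>M\<^esub> (y \<ominus>\<^bsub>M\<^esub> x) = r \<odot>\<^bsub>M\<^esub> y \<ominus>\<^bsub>M\<^esub> r \<odot>\<^bsub>M\<^esub> x"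
      using y assms by (intro smult_minus_r)
    moreover have "r \<odot>\<^bsub>M\<^esub> (y \<ominus>\<^bsub>M\<^esub> x) \<in> N"
      using submoduleE(4)[OF N] y assms by blast
    ultimately show ?thesis
      using coset_eq_iff[OF N, of "r \<odot>\<^bsub>M\<^esub> y" "r \<odot>\<^bsub>M\<^esub> x"] y assms by auto
  qed
  moreover have "N +>\<^bsub>M\<^esub> x \<noteq> {}" using N.a_rcos_self assms by blast
  ultimately have "(\<Union>y\<in>N +>\<^bsub>M\<^esub> x. N +>\<^bsub>M\<^esub> (r \<odot>\<^bsub>M\<^esub> y)) = N +>\<^bsub>M\<^esub> (r \<odot>\<^bsub>M\<^esub> x)"
    by blast
  then show ?thesis by (simp add: quot_module_def)
qed

lemma quot_module_module:
  assumes N: "submodule N R M" shows "module R (quot_module M N)"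
proof -
  let ?Q = "quot_module M N"
  note s = quot_module_add[OF N] quot_module_zero[OF N] quot_module_smult[OF N]
  \<comment> \<open>Each module axiom is reduced to the same axiom of \<open>M\<close> on
    representatives.\<close>
  have E: "P x" if "x \<in> carrier ?Q" "\<And>y. y \<in> carrier M \<Longrightarrow> P (N +>\<^bsub>M\<^esub> y)" for P x
    using that unfolding quot_module_carrier by blast
  show ?thesis
  proof (intro moduleI)
    show "cring R" ..
    show "abelian_group ?Q"
    proof (rule abelian_groupI)
      show "\<exists>y\<in>carrier ?Q. y \<oplus>\<^bsub>?Q\<^esub> x = \<zero>\<^bsub>?Q\<^esub>" if "x \<in> carrier ?Q" for x
        using that
      proof (rule E)
        fix y assume y: "y \<in> carrier M"
        show "\<exists>z\<in>carrier ?Q. z \<oplus>\<^bsub>?Q\<^esub> (N +>\<^bsub>M\<^esub> y) = \<zero>\<^bsub>?Q\<^esub>"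
          by (rule bexI[of _ "N +>\<^bsub>M\<^esub> (\<ominus>\<^bsub>M\<^esub> y)"]) (use y in \<open>simp_all add: s M.l_neg quot_module_closed\<close>)
      qed
    qed (erule E | simp add: s quot_module_closed M.a_assoc | simp add: s M.a_comm)+
  qed (erule E | simp add: s quot_module_closed smult_l_distr smult_r_distr smult_assoc1)+
qed

lemma quot_module_class_zero_iff:
  assumes "submodule N R M" "x \<in> carrier M"
  shows "N +>\<^bsub>M\<^esub> x = \<zero>\<^bsub>quot_module M N\<^esub> \<longleftrightarrow> x \<in> N"
proof -
  have "\<ominus>\<^bsub>M\<^esub> \<zero>\<^bsub>M\<^esub> = \<zero>\<^bsub>M\<^esub>" by (rule M.minus_equality) auto
  then have "x \<ominus>\<^bsub>M\<^esub> \<zero>\<^bsub>M\<^esub> = x" using assms(2) unfolding M.minus_eq by (metis M.r_zero)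
  then show ?thesis
    using coset_eq_iff[OF assms(1), of x "\<zero>\<^bsub>M\<^esub>"] assms
    by (simp add: quot_module_zero)
qed

end

lemma submodule_span_submodule:
  fixes M :: "('a, 'b) module"
  assumes "module R M" "A \<subseteq> carrier M"
  shows "submodule (submodule_span R M A) R M" "A \<subseteq> submodule_span R M A"
proof -
  interpret module R M by fact
  show "submodule (submodule_span R M A) R M"
  proof (rule submoduleI)
    \<comment> \<open>The whole module is one of the intersected submodules, so the intersection
      stays inside the carrier.\<close>
    show "submodule_span R M A \<subseteq> carrier M"
      using carrier_is_submodule assms by (auto simp: submodule_span_def)
    show "\<zero>\<^bsub>M\<^esub> \<in> submodule_span R M A"
      using submodule.axioms(1) subgroup.one_closed by (fastforce simp: submodule_span_def)
  qed (auto simp: submodule_span_def submoduleE)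
qed (auto simp: submodule_span_def)

lemma submodule_span_least:
  assumes "submodule H R M" "A \<subseteq> H" shows "submodule_span R M A \<subseteq> H"
  using assms by (auto simp: submodule_span_def)

section \<open>Free modules\<close>

lemma free_module_simps:
  "x \<in> carrier (free_module R S) \<longleftrightarrow> x \<in> S \<rightarrow>\<^sub>E carrier R \<and> finite {s \<in> S. x s \<noteq> \<zero>\<^bsub>R\<^esub>}"
  "\<zero>\<^bsub>free_module R S\<^esub> = (\<lambda>s\<in>S. \<zero>\<^bsub>R\<^esub>)"
  "x \<oplus>\<^bsub>free_module R S\<^esub> y = (\<lambda>s\<in>S. x s \<oplus>\<^bsub>R\<^esub> y s)"
  "r \<odot>\<^bsub>free_module R S\<^esub> x = (\<lambda>s\<in>S. r \<otimes>\<^bsub>R\<^esub> x s)"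
  by (auto simp: free_module_def)

context cring
begin

lemma free_module_module: "module R (free_module R S)"
proof (intro moduleI abelian_groupI)
  let ?F = "free_module R S"
  show "cring R" ..
  fix x y assume x: "x \<in> carrier ?F" and y: "y \<in> carrier ?F"
  have "{s \<in> S. x s \<oplus> y s \<noteq> \<zero>} \<subseteq> {s \<in> S. x s \<noteq> \<zero>} \<union> {s \<in> S. y s \<noteq> \<zero>}" by auto
  with x y show "x \<oplus>\<^bsub>?F\<^esub> y \<in> carrier ?F"
    by (auto simp: free_module_simps PiE_iff intro: finite_subset cong: conj_cong)
  show "x \<oplus>\<^bsub>?F\<^esub> y = y \<oplus>\<^bsub>?F\<^esub> x"
    using x y by (auto simp: free_module_simps PiE_iff fun_eq_iff a_comm)
next
  let ?F = "free_module R S"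
  fix x assume x: "x \<in> carrier ?F"
  have "{s \<in> S. \<ominus> x s \<noteq> \<zero>} \<subseteq> {s \<in> S. x s \<noteq> \<zero>}" by auto
  with x show "\<exists>y\<in>carrier ?F. y \<oplus>\<^bsub>?F\<^esub> x = \<zero>\<^bsub>?F\<^esub>"
    by (intro bexI[of _ "\<lambda>s\<in>S. \<ominus> x s"])
      (auto simp: free_module_simps PiE_iff l_neg intro: finite_subset cong: conj_cong)
next
  let ?F = "free_module R S"
  fix r x assume x: "x \<in> carrier ?F" "r \<in> carrier R"
  have "{s \<in> S. r \<otimes> x s \<noteq> \<zero>} \<subseteq> {s \<in> S. x s \<noteq> \<zero>}" using x by auto
  with x show "r \<odot>\<^bsub>?F\<^esub> x \<in> carrier ?F"
    by (auto simp: free_module_simps PiE_iff intro: finite_subset cong: conj_cong)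
qed (auto simp: free_module_simps PiE_iff extensional_def fun_eq_iff a_assoc l_distr r_distr m_assoc)

lemma free_module_a_inv:
  assumes "x \<in> carrier (free_module R S)"
  shows "\<ominus>\<^bsub>free_module R S\<^esub> x = (\<lambda>s\<in>S. \<ominus> x s)"
proof -
  let ?F = "free_module R S"
  interpret F: module R ?F by (rule free_module_module)
  have "\<ominus>\<^bsub>?F\<^esub> x = (\<ominus> \<one>) \<odot>\<^bsub>?F\<^esub> x" using assms by (simp add: F.smult_l_minus)
  also have "\<dots> = (\<lambda>s\<in>S. \<ominus> x s)"
    using assms by (auto simp: free_module_simps PiE_iff l_minus fun_eq_iff)
  finally show ?thesis .
qed

lemma free_module_minus:
  assumes "x \<in> carrier (free_module R S)" "y \<in> carrier (free_module R S)"
  shows "x \<ominus>\<^bsub>free_module R S\<^esub> y = (\<lambda>s\<in>S. x s \<ominus> y s)"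
proof -
  interpret F: module R "free_module R S" by (rule free_module_module)
  show ?thesis using assms
    unfolding F.minus_eq free_module_a_inv[OF assms(2)] by (auto simp: free_module_simps minus_eq fun_eq_iff)
qed

text \<open>Evaluation at a point is additive; for an infinite index set both sums take the default
  value zero.\<close>

lemma free_module_finsum:
  assumes "f \<in> A \<rightarrow> carrier (free_module R S)" "s \<in> S"
  shows "(\<Oplus>\<^bsub>free_module R S\<^esub>i\<in>A. f i) s = (\<Oplus>i\<in>A. f i s)"
proof -
  let ?F = "free_module R S"
  interpret F: module R ?F by (rule free_module_module)
  show ?thesis
  proof (cases "finite A")
    case True
    then show ?thesis using assms(1)
    proof (induction A)
      case empty
      then show ?case using assms(2) by (simp add: free_module_simps)
    next
      case (insert a A)
      then have "f i s \<in> carrier R" if "i \<in> insert a A" for i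
        using that assms(2) by (auto simp: free_module_simps PiE_iff Pi_iff)
      then show ?case using insert assms(2)
        by (simp add: F.M.finsum_insert finsum_insert Pi_iff) (simp add: free_module_simps)
    qed
  next
    case False
    then show ?thesis using assms(2)
      by (simp add: F.M.finsum_infinite finsum_infinite free_module_simps)
  qed
qed

lemma basis_elt_closed: "basis_elt R S s \<in> carrier (free_module R S)"
proof -
  have "{x \<in> S. basis_elt R S s x \<noteq> \<zero>} \<subseteq> {s}" by (auto simp: basis_elt_def)
  then show ?thesis by (auto simp: free_module_simps basis_elt_def intro: finite_subset)
qed

lemma free_module_decomp:
  assumes x: "x \<in> carrier (free_module R S)"
  shows "x = (\<Oplus>\<^bsub>free_module R S\<^esub>s\<in>{s \<in> S. x s \<noteq> \<zero>}. x s \<odot>\<^bsub>free_module R S\<^esub> basis_elt R S s)"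
proof -
  let ?F = "free_module R S" and ?A = "{s \<in> S. x s \<noteq> \<zero>}"
  interpret F: module R ?F by (rule free_module_module)
  have cl: "x s \<odot>\<^bsub>?F\<^esub> basis_elt R S s \<in> carrier ?F" if "s \<in> ?A" for s
    using that x by (intro F.smult_closed basis_elt_closed) (auto simp: free_module_simps PiE_iff)
  then have sc: "(\<Oplus>\<^bsub>?F\<^esub>s\<in>?A. x s \<odot>\<^bsub>?F\<^esub> basis_elt R S s) \<in> carrier ?F"
    by (intro F.M.finsum_closed) auto
  have *: "(\<Oplus>\<^bsub>?F\<^esub>s\<in>?A. x s \<odot>\<^bsub>?F\<^esub> basis_elt R S s) t = x t" if t: "t \<in> S" for t
  proof -
    have xc: "x s \<in> carrier R" if "s \<in> S" for s
      using that x by (auto simp: free_module_simps PiE_iff)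
    have "(\<Oplus>\<^bsub>?F\<^esub>s\<in>?A. x s \<odot>\<^bsub>?F\<^esub> basis_elt R S s) t = (\<Oplus>s\<in>?A. (x s \<odot>\<^bsub>?F\<^esub> basis_elt R S s) t)"
      using cl t by (intro free_module_finsum) auto
    also have "\<dots> = (\<Oplus>s\<in>?A. if t = s then x s else \<zero>)"
      using t xc by (intro finsum_cong') (auto simp: free_module_simps basis_elt_def)
    also have "\<dots> = x t"
    proof (cases "t \<in> ?A")
      case True
      then show ?thesis using finsum_singleton[of t ?A x] x xc by (auto simp: free_module_simps)
    next
      case False
      then have "(\<Oplus>s\<in>?A. if t = s then x s else \<zero>) = (\<Oplus>s\<in>?A. \<zero>)"
        by (intro finsum_cong') auto
      then show ?thesis using False t by (simp add: finsum_zero)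
    qed
    finally show ?thesis .
  qed
  show ?thesis
    by (rule extensionalityI[of _ S]) (use x sc * in \<open>auto simp: free_module_simps PiE_iff\<close>)
qed

end

locale lin_ext_setup = module +
  fixes S f
  assumes f: "f \<in> S \<rightarrow> carrier M"
begin

abbreviation "F \<equiv> free_module R S"

text \<open>\<open>lin_ext\<close> sums over the support of its argument, which changes from one
  argument to the next. A common finite index set makes the values at several arguments
  comparable.\<close>

lemma lin_ext_superset:
  assumes x: "x \<in> carrier F" and A: "finite A" "A \<subseteq> S" "{s \<in> S. x s \<noteq> \<zero>} \<subseteq> A"
  shows "lin_ext R S M f x = (\<Oplus>\<^bsub>M\<^esub>s\<in>A. x s \<odot>\<^bsub>M\<^esub> f s)"
  unfolding lin_ext_def
  using f x A by (intro M.add.finprod_mono_neutral_cong_left) (auto simp: free_module_simps PiE_iff Pi_iff subset_iff)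

lemma lin_ext_closed:
  assumes x: "x \<in> carrier F" shows "lin_ext R S M f x \<in> carrier M"
  unfolding lin_ext_def
  using f x by (intro M.finsum_closed) (auto simp: free_module_simps PiE_iff Pi_iff)

lemma lin_ext_add:
  assumes x: "x \<in> carrier F" and y: "y \<in> carrier F"
  shows "lin_ext R S M f (x \<oplus>\<^bsub>F\<^esub> y) = lin_ext R S M f x \<oplus>\<^bsub>M\<^esub> lin_ext R S M f y"
proof -
  interpret F: module R F by (rule free_module_module)
  let ?A = "{s \<in> S. x s \<noteq> \<zero>} \<union> {s \<in> S. y s \<noteq> \<zero>}"
  have A: "finite ?A" "?A \<subseteq> S" using x y by (auto simp: free_module_simps)
  have "{s \<in> S. (x \<oplus>\<^bsub>F\<^esub> y) s \<noteq> \<zero>} \<subseteq> ?A" by (auto simp: free_module_simps)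
  then have "lin_ext R S M f (x \<oplus>\<^bsub>F\<^esub> y) = (\<Oplus>\<^bsub>M\<^esub>s\<in>?A. (x \<oplus>\<^bsub>F\<^esub> y) s \<odot>\<^bsub>M\<^esub> f s)"
    using A x y by (intro lin_ext_superset) auto
  also have "\<dots> = (\<Oplus>\<^bsub>M\<^esub>s\<in>?A. x s \<odot>\<^bsub>M\<^esub> f s \<oplus>\<^bsub>M\<^esub> y s \<odot>\<^bsub>M\<^esub> f s)"
    using f x y by (intro M.finsum_cong') (auto simp: free_module_simps PiE_iff Pi_iff smult_l_distr)
  also have "\<dots> = (\<Oplus>\<^bsub>M\<^esub>s\<in>?A. x s \<odot>\<^bsub>M\<^esub> f s) \<oplus>\<^bsub>M\<^esub> (\<Oplus>\<^bsub>M\<^esub>s\<in>?A. y s \<odot>\<^bsub>M\<^esub> f s)"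
    using f x y by (intro M.finsum_addf) (auto simp: free_module_simps PiE_iff Pi_iff)
  also have "(\<Oplus>\<^bsub>M\<^esub>s\<in>?A. x s \<odot>\<^bsub>M\<^esub> f s) = lin_ext R S M f x"
    using A x by (intro lin_ext_superset[symmetric]) auto
  also have "(\<Oplus>\<^bsub>M\<^esub>s\<in>?A. y s \<odot>\<^bsub>M\<^esub> f s) = lin_ext R S M f y"
    using A y by (intro lin_ext_superset[symmetric]) auto
  finally show ?thesis .
qed

lemma lin_ext_smult:
  assumes x: "x \<in> carrier F" and r: "r \<in> carrier R"
  shows "lin_ext R S M f (r \<odot>\<^bsub>F\<^esub> x) = r \<odot>\<^bsub>M\<^esub> lin_ext R S M f x"
proof -
  interpret F: module R F by (rule free_module_module)
  let ?A = "{s \<in> S. x s \<noteq> \<zero>}"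
  have A: "finite ?A" "?A \<subseteq> S" using x by (auto simp: free_module_simps)
  have "{s \<in> S. (r \<odot>\<^bsub>F\<^esub> x) s \<noteq> \<zero>} \<subseteq> ?A" using r by (auto simp: free_module_simps)
  then have "lin_ext R S M f (r \<odot>\<^bsub>F\<^esub> x) = (\<Oplus>\<^bsub>M\<^esub>s\<in>?A. (r \<odot>\<^bsub>F\<^esub> x) s \<odot>\<^bsub>M\<^esub> f s)"
    using A x r by (intro lin_ext_superset) auto
  also have "\<dots> = (\<Oplus>\<^bsub>M\<^esub>s\<in>?A. r \<odot>\<^bsub>M\<^esub> (x s \<odot>\<^bsub>M\<^esub> f s))"
    using f x r by (intro M.finsum_cong') (auto simp: free_module_simps PiE_iff Pi_iff smult_assoc1)
  also have "\<dots> = r \<odot>\<^bsub>M\<^esub> lin_ext R S M f x"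
    using f x r A unfolding lin_ext_def
    by (intro finsum_smult_ldistr[symmetric]) (auto simp: free_module_simps PiE_iff Pi_iff)
  finally show ?thesis .
qed

lemma lin_ext_minus:
  assumes x: "x \<in> carrier F" and y: "y \<in> carrier F"
  shows "lin_ext R S M f (x \<ominus>\<^bsub>F\<^esub> y) = lin_ext R S M f x \<ominus>\<^bsub>M\<^esub> lin_ext R S M f y"
proof -
  interpret F: module R F by (rule free_module_module)
  have "x \<ominus>\<^bsub>F\<^esub> y = x \<oplus>\<^bsub>F\<^esub> ((\<ominus> \<one>) \<odot>\<^bsub>F\<^esub> y)"
    using y by (simp add: F.M.minus_eq F.smult_l_minus)
  then show ?thesis using x y
    by (simp add: lin_ext_add lin_ext_smult lin_ext_closed smult_l_minus M.minus_eq)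
qed

lemma lin_ext_basis:
  assumes "s \<in> S" shows "lin_ext R S M f (basis_elt R S s) = f s"
proof -
  have "{t \<in> S. basis_elt R S s t \<noteq> \<zero>} \<subseteq> {s}" by (auto simp: basis_elt_def)
  then have "lin_ext R S M f (basis_elt R S s) = (\<Oplus>\<^bsub>M\<^esub>t\<in>{s}. basis_elt R S s t \<odot>\<^bsub>M\<^esub> f t)"
    using assms by (intro lin_ext_superset basis_elt_closed) auto
  also have "\<dots> = f s" using assms f by (simp add: basis_elt_def Pi_iff)
  finally show ?thesis .
qed

end

section \<open>Tensor products along a surjective ring homomorphism\<close>

locale tensor_setup = M?: module R M + N?: module R N for R (structure) and M (structure) and N (structure)
begin

abbreviation "P \<equiv> carrier M \<times> carrier N"
abbreviation "FP \<equiv> free_module R P"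
abbreviation "W \<equiv> submodule_span R FP (tensor_relations R M N)"
abbreviation "b \<equiv> basis_elt R P"
abbreviation "TP \<equiv> tensor_product R M N"
abbreviation "tens x y \<equiv> W +>\<^bsub>FP\<^esub> b (x, y)"

sublocale FP: module R FP by (rule free_module_module)

lemma tensor_relationsI:
  "x \<in> carrier M \<Longrightarrow> x' \<in> carrier M \<Longrightarrow> y \<in> carrier N \<Longrightarrow>
    b (x \<oplus>\<^bsub>M\<^esub> x', y) \<ominus>\<^bsub>FP\<^esub> (b (x, y) \<oplus>\<^bsub>FP\<^esub> b (x', y)) \<in> tensor_relations R M N"
  "x \<in> carrier M \<Longrightarrow> y \<in> carrier N \<Longrightarrow> y' \<in> carrier N \<Longrightarrow>
    b (x, y \<oplus>\<^bsub>N\<^esub> y') \<ominus>\<^bsub>FP\<^esub> (b (x, y) \<oplus>\<^bsub>FP\<^esub> b (x, y')) \<in> tensor_relations R M N"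
  "r \<in> carrier R \<Longrightarrow> x \<in> carrier M \<Longrightarrow> y \<in> carrier N \<Longrightarrow>
    b (r \<odot>\<^bsub>M\<^esub> x, y) \<ominus>\<^bsub>FP\<^esub> (r \<odot>\<^bsub>FP\<^esub> b (x, y)) \<in> tensor_relations R M N"
  "r \<in> carrier R \<Longrightarrow> x \<in> carrier M \<Longrightarrow> y \<in> carrier N \<Longrightarrow>
    b (x, r \<odot>\<^bsub>N\<^esub> y) \<ominus>\<^bsub>FP\<^esub> (r \<odot>\<^bsub>FP\<^esub> b (x, y)) \<in> tensor_relations R M N"
  unfolding tensor_relations_def Let_def Un_iff mem_Collect_eq by metis+

lemma tensor_relations_subset: "tensor_relations R M N \<subseteq> carrier FP"
  unfolding tensor_relations_def Let_def
  by (auto intro!: FP.M.minus_closed FP.M.a_closed basis_elt_closed FP.smult_closed)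

lemma W_submodule: "submodule W R FP" and W_relations: "tensor_relations R M N \<subseteq> W"
  using submodule_span_submodule[OF FP.module_axioms tensor_relations_subset] by auto

lemma TP_eq: "TP = quot_module FP W"
  by (simp add: tensor_product_def Let_def)

lemma TP_module: "module R TP"
  unfolding TP_eq by (rule FP.quot_module_module[OF W_submodule])

lemma tens_closed: "tens x y \<in> carrier TP"
  unfolding TP_eq FP.quot_module_carrier by (rule imageI[OF basis_elt_closed])

lemma tens_add_left:
  assumes "x \<in> carrier M" "x' \<in> carrier M" "y \<in> carrier N"
  shows "tens (x \<oplus>\<^bsub>M\<^esub> x') y = tens x y \<oplus>\<^bsub>TP\<^esub> tens x' y"
proof -
  have "b (x \<oplus>\<^bsub>M\<^esub> x', y) \<ominus>\<^bsub>FP\<^esub> (b (x, y) \<oplus>\<^bsub>FP\<^esub> b (x', y)) \<in> W"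
    using assms by (intro subsetD[OF W_relations] tensor_relationsI)
  then show ?thesis unfolding TP_eq
    using W_submodule by (simp add: FP.quot_module_add basis_elt_closed FP.coset_eq_iff)
qed

lemma tens_smult_left:
  assumes "r \<in> carrier R" "x \<in> carrier M" "y \<in> carrier N"
  shows "tens (r \<odot>\<^bsub>M\<^esub> x) y = r \<odot>\<^bsub>TP\<^esub> tens x y"
proof -
  have "b (r \<odot>\<^bsub>M\<^esub> x, y) \<ominus>\<^bsub>FP\<^esub> (r \<odot>\<^bsub>FP\<^esub> b (x, y)) \<in> W"
    using assms by (intro subsetD[OF W_relations] tensor_relationsI)
  then show ?thesis unfolding TP_eq
    using W_submodule assms by (simp add: FP.quot_module_smult basis_elt_closed FP.coset_eq_iff)
qed

lemma tens_smult_right: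
  assumes "r \<in> carrier R" "x \<in> carrier M" "y \<in> carrier N"
  shows "tens x (r \<odot>\<^bsub>N\<^esub> y) = r \<odot>\<^bsub>TP\<^esub> tens x y"
proof -
  have "b (x, r \<odot>\<^bsub>N\<^esub> y) \<ominus>\<^bsub>FP\<^esub> (r \<odot>\<^bsub>FP\<^esub> b (x, y)) \<in> W"
    using assms by (intro subsetD[OF W_relations] tensor_relationsI)
  then show ?thesis unfolding TP_eq
    using W_submodule assms by (simp add: FP.quot_module_smult basis_elt_closed FP.coset_eq_iff)
qed

text \<open>Pure tensors generate: an element is the class of a finite combination of basis vectors,
  and the class of a basis vector is a pure tensor.\<close>

lemma tensor_subset_submodule:
  assumes H: "submodule H R TP" and gen: "\<And>x y. x \<in> carrier M \<Longrightarrow> y \<in> carrier N \<Longrightarrow> tens x y \<in> H"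
  shows "carrier TP \<subseteq> H"
proof
  interpret TP: module R TP by (rule TP_module)
  fix t assume "t \<in> carrier TP"
  then obtain z where z: "z \<in> carrier FP" "t = W +>\<^bsub>FP\<^esub> z"
    unfolding TP_eq FP.quot_module_carrier by blast
  have *: "(\<Oplus>\<^bsub>FP\<^esub>s\<in>A. z s \<odot>\<^bsub>FP\<^esub> b s) \<in> carrier FP \<and>
     W +>\<^bsub>FP\<^esub> (\<Oplus>\<^bsub>FP\<^esub>s\<in>A. z s \<odot>\<^bsub>FP\<^esub> b s) \<in> H" if "finite A" "A \<subseteq> P" for A
    using that
  proof (induction A)
    case empty
    have "\<zero>\<^bsub>TP\<^esub> \<in> H"
      using subgroup.one_closed[OF submodule.axioms(1)[OF H]] by simp
    then show ?case using FP.quot_module_zero[OF W_submodule] by (simp add: TP_eq)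
  next
    case (insert s A)
    have zs: "z s' \<odot>\<^bsub>FP\<^esub> b s' \<in> carrier FP" if "s' \<in> insert s A" for s'
      using that insert z by (intro FP.smult_closed basis_elt_closed) (auto simp: free_module_simps PiE_iff)
    have zr: "z s \<in> carrier R" using insert z by (auto simp: free_module_simps PiE_iff)
    obtain x y where s: "s = (x, y)" "x \<in> carrier M" "y \<in> carrier N" using insert by auto
    have "W +>\<^bsub>FP\<^esub> (z s \<odot>\<^bsub>FP\<^esub> b s) = z s \<odot>\<^bsub>TP\<^esub> tens x y"
      using zr s by (simp add: TP_eq FP.quot_module_smult[OF W_submodule] basis_elt_closed)
    also have "\<dots> \<in> H" using gen s zr TP.submoduleE(4)[OF H] by blast
    finally have 1: "W +>\<^bsub>FP\<^esub> (z s \<odot>\<^bsub>FP\<^esub> b s) \<in> H" .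
    have eq: "(\<Oplus>\<^bsub>FP\<^esub>s\<in>insert s A. z s \<odot>\<^bsub>FP\<^esub> b s)
        = z s \<odot>\<^bsub>FP\<^esub> b s \<oplus>\<^bsub>FP\<^esub> (\<Oplus>\<^bsub>FP\<^esub>s\<in>A. z s \<odot>\<^bsub>FP\<^esub> b s)"
      using insert zs by (intro FP.M.finsum_insert) auto
    have IH: "(\<Oplus>\<^bsub>FP\<^esub>s\<in>A. z s \<odot>\<^bsub>FP\<^esub> b s) \<in> carrier FP"
      "W +>\<^bsub>FP\<^esub> (\<Oplus>\<^bsub>FP\<^esub>s\<in>A. z s \<odot>\<^bsub>FP\<^esub> b s) \<in> H"
      using insert by auto
    have "W +>\<^bsub>FP\<^esub> (\<Oplus>\<^bsub>FP\<^esub>s\<in>insert s A. z s \<odot>\<^bsub>FP\<^esub> b s)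
       = (W +>\<^bsub>FP\<^esub> (z s \<odot>\<^bsub>FP\<^esub> b s)) \<oplus>\<^bsub>TP\<^esub> (W +>\<^bsub>FP\<^esub> (\<Oplus>\<^bsub>FP\<^esub>s\<in>A. z s \<odot>\<^bsub>FP\<^esub> b s))"
      unfolding eq TP_eq using zs IH by (intro FP.quot_module_add[OF W_submodule, symmetric]) auto
    also have "\<dots> \<in> H" using 1 IH TP.submoduleE(5)[OF H] by blast
    finally show ?case using eq zs IH by simp
  qed
  have "finite {s \<in> P. z s \<noteq> \<zero>}" using z by (simp add: free_module_simps)
  from *[OF this] show "t \<in> H"
    using free_module_decomp[OF z(1)] z(2) by auto
qed

text \<open>The part of the universal property that detects nonzero tensors: the linear extension of
  a bilinear map kills the relations, hence their span, hence every pair whose tensor is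
  zero.\<close>

lemma bilinear_vanishes:
  assumes "module R K"
    and \<beta>: "\<And>x y. x \<in> carrier M \<Longrightarrow> y \<in> carrier N \<Longrightarrow> \<beta> (x, y) \<in> carrier K"
    and add_left: "\<And>x x' y. x \<in> carrier M \<Longrightarrow> x' \<in> carrier M \<Longrightarrow> y \<in> carrier N \<Longrightarrow>
       \<beta> (x \<oplus>\<^bsub>M\<^esub> x', y) = \<beta> (x, y) \<oplus>\<^bsub>K\<^esub> \<beta> (x', y)"
    and add_right: "\<And>x y y'. x \<in> carrier M \<Longrightarrow> y \<in> carrier N \<Longrightarrow> y' \<in> carrier N \<Longrightarrow>
       \<beta> (x, y \<oplus>\<^bsub>N\<^esub> y') = \<beta> (x, y) \<oplus>\<^bsub>K\<^esub> \<beta> (x, y')"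
    and smult_left: "\<And>r x y. r \<in> carrier R \<Longrightarrow> x \<in> carrier M \<Longrightarrow> y \<in> carrier N \<Longrightarrow>
       \<beta> (r \<odot>\<^bsub>M\<^esub> x, y) = r \<odot>\<^bsub>K\<^esub> \<beta> (x, y)"
    and smult_right: "\<And>r x y. r \<in> carrier R \<Longrightarrow> x \<in> carrier M \<Longrightarrow> y \<in> carrier N \<Longrightarrow>
       \<beta> (x, r \<odot>\<^bsub>N\<^esub> y) = r \<odot>\<^bsub>K\<^esub> \<beta> (x, y)"
    and xy: "x \<in> carrier M" "y \<in> carrier N" "tens x y = \<zero>\<^bsub>TP\<^esub>"
  shows "\<beta> (x, y) = \<zero>\<^bsub>K\<^esub>"
proof -
  interpret K: module R K by fact
  interpret L: lin_ext_setup R K P \<beta> by unfold_locales (use \<beta> in auto)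
  let ?L = "lin_ext R P K \<beta>"
  let ?H = "{z \<in> carrier FP. ?L z = \<zero>\<^bsub>K\<^esub>}"
  note bc = basis_elt_closed[of P]
  have L0: "?L \<zero>\<^bsub>FP\<^esub> = \<zero>\<^bsub>K\<^esub>"
    using L.lin_ext_minus[of "b (x, y)" "b (x, y)"] bc L.lin_ext_closed[OF bc, of "(x, y)"]
    by (simp add: FP.M.minus_eq K.M.minus_eq FP.M.r_neg K.M.r_neg)
  have H: "submodule ?H R FP"
  proof (rule FP.submoduleI)
    fix a assume a: "a \<in> ?H"
    then have "?L (\<zero>\<^bsub>FP\<^esub> \<ominus>\<^bsub>FP\<^esub> a) = \<zero>\<^bsub>K\<^esub>"
      using L0 by (simp add: L.lin_ext_minus K.M.minus_eq)
    then show "\<ominus>\<^bsub>FP\<^esub> a \<in> ?H" using a by (simp add: FP.M.minus_eq)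
  qed (auto simp: L0 L.lin_ext_add L.lin_ext_smult)
  have Lb: "?L (b s) = \<beta> s" if "s \<in> P" for s using L.lin_ext_basis that by blast
  have D: "u \<ominus>\<^bsub>FP\<^esub> v \<in> ?H" if "u \<in> carrier FP" "v \<in> carrier FP" "?L u = ?L v" for u v
    using that L.lin_ext_closed[of v] by (simp add: L.lin_ext_minus K.M.minus_eq K.M.r_neg)
  \<comment> \<open>Each of the four families consists of differences of two elements with equal
    image, so \<open>D\<close> treats them uniformly.\<close>
  have "tensor_relations R M N \<subseteq> ?H"
    unfolding tensor_relations_def Let_def
    by (intro Un_least subsetI; elim CollectE exE conjE; hypsubst; intro D)
      (simp_all add: bc FP.smult_closed FP.M.a_closed L.lin_ext_add L.lin_ext_smult Lb
        add_left add_right smult_left smult_right)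
  then have "W \<subseteq> ?H" by (rule submodule_span_least[OF H])
  moreover have "b (x, y) \<in> W"
    using xy(3) FP.quot_module_class_zero_iff[OF W_submodule bc] by (simp add: TP_eq)
  ultimately show ?thesis using Lb xy by auto
qed

end

lemma ring_as_module_module:
  assumes "cring R" "cring S" "h \<in> ring_hom R S"
  shows "module R (ring_as_module S h)"
proof -
  interpret R: cring R by fact
  interpret S: cring S by fact
  have "abelian_group (ring_as_module S h)"
    by (rule abelian_groupI) (auto simp: ring_as_module_def S.a_ac intro: S.l_neg)
  then show ?thesis
    using assms(3)
    by (intro moduleI R.is_cring) (auto simp: ring_as_module_def ring_hom_def Pi_iff S.l_distr S.r_distr S.m_assoc)
qed

text \<open>Here \<open>c\<close> generates the kernel of the base change map \<open>h\<close>, so that the tensor product is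
  \<open>M / c M\<close>.\<close>

lemma tensor_product_quotient:
  fixes R (structure) and M (structure) and S (structure)
  assumes M: "module R M" and S: "cring S" and h: "h \<in> ring_hom R S"
    and onto: "h ` carrier R = carrier S" and c: "c \<in> carrier R"
    and ker: "\<And>r. r \<in> carrier R \<Longrightarrow> h r = \<zero>\<^bsub>S\<^esub> \<longleftrightarrow> (\<exists>q\<in>carrier R. r = c \<otimes>\<^bsub>R\<^esub> q)"
  defines "TP \<equiv> tensor_product R M (ring_as_module S h)"
  obtains t where "module R TP" "t ` carrier M = carrier TP"
    "\<And>x y. x \<in> carrier M \<Longrightarrow> y \<in> carrier M \<Longrightarrow> t (x \<oplus>\<^bsub>M\<^esub> y) = t x \<oplus>\<^bsub>TP\<^esub> t y"
    "\<And>r x. r \<in> carrier R \<Longrightarrow> x \<in> carrier M \<Longrightarrow> t (r \<odot>\<^bsub>M\<^esub> x) = r \<odot>\<^bsub>TP\<^esub> t x"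
    "\<And>x. x \<in> carrier M \<Longrightarrow> t x = \<zero>\<^bsub>TP\<^esub> \<longleftrightarrow> (\<exists>y\<in>carrier M. x = c \<odot>\<^bsub>M\<^esub> y)"
proof -
  let ?N = "ring_as_module S h"
  interpret M: module R M by fact
  interpret S: cring S by fact
  interpret N: module R ?N by (rule ring_as_module_module[OF M.R.is_cring S h])
  interpret tensor_setup R M ?N by unfold_locales
  interpret TP: module R TP unfolding TP_def by (rule TP_module)
  interpret h: ring_hom_cring R S h using h by unfold_locales
  define t where "t x = tens x \<one>\<^bsub>S\<^esub>" for x
  have NC: "carrier ?N = carrier S" by (simp add: ring_as_module_def)
  have one: "\<one>\<^bsub>S\<^esub> \<in> carrier ?N" by (simp add: NC)
  have smult_one: "r \<odot>\<^bsub>?N\<^esub> \<one>\<^bsub>S\<^esub> = h r" if "r \<in> carrier R" for r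
    using that by (simp add: ring_as_module_def)
  have t_add: "t (x \<oplus>\<^bsub>M\<^esub> y) = t x \<oplus>\<^bsub>TP\<^esub> t y" if "x \<in> carrier M" "y \<in> carrier M" for x y
    using that one by (simp add: t_def TP_def tens_add_left)
  have t_smult: "t (r \<odot>\<^bsub>M\<^esub> x) = r \<odot>\<^bsub>TP\<^esub> t x" if "r \<in> carrier R" "x \<in> carrier M" for r x
    using that one by (simp add: t_def TP_def tens_smult_left)
  have tens_t: "tens x (h r) = t (r \<odot>\<^bsub>M\<^esub> x)" if "r \<in> carrier R" "x \<in> carrier M" for r x
  proof -
    have "tens x (h r) = tens x (r \<odot>\<^bsub>?N\<^esub> \<one>\<^bsub>S\<^esub>)" using smult_one that by simp
    also have "\<dots> = t (r \<odot>\<^bsub>M\<^esub> x)" using that one by (simp add: tens_smult_right t_def tens_smult_left)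
    finally show ?thesis .
  qed
  have t_closed: "t x \<in> carrier TP" for x by (simp add: t_def tens_closed TP_def)
  have t_zero: "t \<zero>\<^bsub>M\<^esub> = \<zero>\<^bsub>TP\<^esub>"
    using t_smult[of \<zero> "\<zero>\<^bsub>M\<^esub>"] t_closed by simp
  \<comment> \<open>For surjectivity: the image is a submodule that contains every pure tensor,
    because a second factor \<open>h r\<close> moves to the left as the scalar
    \<open>r\<close>.\<close>
  have "submodule (t ` carrier M) R TP"
  proof (rule TP.submoduleI)
    show "\<zero>\<^bsub>TP\<^esub> \<in> t ` carrier M" using t_zero by (metis M.M.zero_closed imageI)
    fix a assume "a \<in> t ` carrier M"
    then obtain x where x: "x \<in> carrier M" "a = t x" by blast
    have "\<ominus>\<^bsub>TP\<^esub> t x = t ((\<ominus> \<one>) \<odot>\<^bsub>M\<^esub> x)"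
      using x t_closed by (simp only: t_smult M.R.a_inv_closed M.R.one_closed TP.smult_l_minus TP.smult_one)
    then show "\<ominus>\<^bsub>TP\<^esub> a \<in> t ` carrier M" using x by blast
  next
    fix a b assume "a \<in> t ` carrier M" "b \<in> t ` carrier M"
    then show "a \<oplus>\<^bsub>TP\<^esub> b \<in> t ` carrier M"
      using t_add by (elim imageE) (metis M.M.a_closed imageI)
  next
    fix r a assume "r \<in> carrier R" "a \<in> t ` carrier M"
    then show "r \<odot>\<^bsub>TP\<^esub> a \<in> t ` carrier M"
      using t_smult by (elim imageE) (metis M.smult_closed imageI)
  qed (use t_closed in auto)
  then have "carrier TP \<subseteq> t ` carrier M"
    unfolding TP_def
  proof (rule tensor_subset_submodule)
    fix x y assume "x \<in> carrier M" "y \<in> carrier ?N"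
    then obtain r where "r \<in> carrier R" "y = h r" unfolding NC onto[symmetric] by blast
    then show "tens x y \<in> t ` carrier M" using \<open>x \<in> carrier M\<close> tens_t by auto
  qed
  then have img: "t ` carrier M = carrier TP" using t_closed by auto
  have t0: "t x = \<zero>\<^bsub>TP\<^esub> \<longleftrightarrow> (\<exists>y\<in>carrier M. x = c \<odot>\<^bsub>M\<^esub> y)" if x: "x \<in> carrier M" for x
  proof
    assume "\<exists>y\<in>carrier M. x = c \<odot>\<^bsub>M\<^esub> y"
    then obtain y where y: "y \<in> carrier M" "x = c \<odot>\<^bsub>M\<^esub> y" by blast
    have "h c = \<zero>\<^bsub>S\<^esub>" using ker[OF c] c by (metis M.R.one_closed M.R.r_one)
    then have "t x = tens y (h \<zero>)" using y c tens_t[of c y] by simp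
    also have "\<dots> = \<zero>\<^bsub>TP\<^esub>" using tens_t[of \<zero> y] y t_zero by simp
    finally show "t x = \<zero>\<^bsub>TP\<^esub>" .
  next
    assume tx: "t x = \<zero>\<^bsub>TP\<^esub>"
    \<comment> \<open>Vanishing in the tensor product is tested against M / c M. The pairing sends
      \<open>m\<close> and \<open>h r\<close> to the class of \<open>r m\<close>; it does not depend
      on \<open>r\<close> because the kernel of \<open>h\<close> consists of the multiples of
      \<open>c\<close>.\<close>
    define cM where "cM = (\<lambda>y. c \<odot>\<^bsub>M\<^esub> y) ` carrier M"
    have sub: "submodule cM R M"
      unfolding cM_def
    proof (rule M.submoduleI)
      show "((\<lambda>y. c \<odot>\<^bsub>M\<^esub> y) ` carrier M) \<subseteq> carrier M" using c by auto
      show "\<zero>\<^bsub>M\<^esub> \<in> ((\<lambda>y. c \<odot>\<^bsub>M\<^esub> y) ` carrier M)" using c by (intro image_eqI[of _ _ "\<zero>\<^bsub>M\<^esub>"]) auto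
      fix a assume "a \<in> ((\<lambda>y. c \<odot>\<^bsub>M\<^esub> y) ` carrier M)"
      then obtain y where "y \<in> carrier M" "a = c \<odot>\<^bsub>M\<^esub> y" by blast
      then show "\<ominus>\<^bsub>M\<^esub> a \<in> ((\<lambda>y. c \<odot>\<^bsub>M\<^esub> y) ` carrier M)" using c
        by (intro image_eqI[of _ _ "\<ominus>\<^bsub>M\<^esub> y"]) (auto simp: M.smult_r_minus)
    next
      fix a b assume "a \<in> ((\<lambda>y. c \<odot>\<^bsub>M\<^esub> y) ` carrier M)" "b \<in> ((\<lambda>y. c \<odot>\<^bsub>M\<^esub> y) ` carrier M)"
      then obtain y z where "y \<in> carrier M" "a = c \<odot>\<^bsub>M\<^esub> y" "z \<in> carrier M" "b = c \<odot>\<^bsub>M\<^esub> z" by blast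
      then show "a \<oplus>\<^bsub>M\<^esub> b \<in> ((\<lambda>y. c \<odot>\<^bsub>M\<^esub> y) ` carrier M)" using c
        by (intro image_eqI[of _ _ "y \<oplus>\<^bsub>M\<^esub> z"]) (auto simp: M.smult_r_distr)
    next
      fix r a assume r: "r \<in> carrier R" and "a \<in> ((\<lambda>y. c \<odot>\<^bsub>M\<^esub> y) ` carrier M)"
      then obtain y where "y \<in> carrier M" "a = c \<odot>\<^bsub>M\<^esub> y" by blast
      then show "r \<odot>\<^bsub>M\<^esub> a \<in> ((\<lambda>y. c \<odot>\<^bsub>M\<^esub> y) ` carrier M)" using c r
        by (intro image_eqI[of _ _ "r \<odot>\<^bsub>M\<^esub> y"]) (auto simp: M.smult_assoc1[symmetric] M.R.m_comm)
    qed
    let ?K = "quot_module M cM"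
    interpret K: module R ?K by (rule M.quot_module_module[OF sub])
    define g where "g s = (SOME r. r \<in> carrier R \<and> h r = s)" for s
    have g: "g s \<in> carrier R" "h (g s) = s" if "s \<in> carrier S" for s
    proof -
      have "\<exists>r. r \<in> carrier R \<and> h r = s" using that unfolding onto[symmetric] by blast
      from someI_ex[OF this] show "g s \<in> carrier R" "h (g s) = s" by (auto simp: g_def)
    qed
    have same: "cM +>\<^bsub>M\<^esub> (r \<odot>\<^bsub>M\<^esub> m) = cM +>\<^bsub>M\<^esub> (r' \<odot>\<^bsub>M\<^esub> m)"
      if rr: "r \<in> carrier R" "r' \<in> carrier R" "h r = h r'" "m \<in> carrier M" for r r' m
    proof -
      have "h (r \<ominus> r') = \<zero>\<^bsub>S\<^esub>" using that by (simp add: M.R.minus_eq S.r_neg)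
      then obtain q where q: "q \<in> carrier R" "r \<ominus> r' = c \<otimes> q"
        using ker[OF M.R.minus_closed[OF rr(1,2)]] by blast
      have "r \<odot>\<^bsub>M\<^esub> m \<ominus>\<^bsub>M\<^esub> r' \<odot>\<^bsub>M\<^esub> m = (r \<ominus> r') \<odot>\<^bsub>M\<^esub> m"
        using that(1,2,4) by (rule M.smult_minus_l[symmetric])
      also have "\<dots> = c \<odot>\<^bsub>M\<^esub> (q \<odot>\<^bsub>M\<^esub> m)" using q c that by (simp add: M.smult_assoc1)
      also have "\<dots> \<in> cM" using q that by (simp add: cM_def)
      finally show ?thesis using M.coset_eq_iff[OF sub] that by simp
    qed
    define \<beta> where "\<beta> = (\<lambda>(m, s). cM +>\<^bsub>M\<^esub> (g s \<odot>\<^bsub>M\<^esub> m))"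
    have \<beta>: "\<beta> (m, h r) = cM +>\<^bsub>M\<^esub> (r \<odot>\<^bsub>M\<^esub> m)" if "r \<in> carrier R" "m \<in> carrier M" for m r
      using that same[of "g (h r)" r m] g by (simp add: \<beta>_def)
    note [simp] = M.quot_module_add[OF sub] M.quot_module_smult[OF sub] M.quot_module_closed
    have ex: "\<exists>r\<in>carrier R. y = h r" if "y \<in> carrier ?N" for y
      using that unfolding NC onto[symmetric] by blast
    have "\<beta> (x, \<one>\<^bsub>S\<^esub>) = \<zero>\<^bsub>?K\<^esub>"
    proof (rule bilinear_vanishes[OF K.module_axioms])
      fix m y assume "m \<in> carrier M" "y \<in> carrier ?N"
      then show "\<beta> (m, y) \<in> carrier ?K" using ex[of y] by (auto simp: \<beta>)
    next
      fix m m' y assume "m \<in> carrier M" "m' \<in> carrier M" "y \<in> carrier ?N"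
      then show "\<beta> (m \<oplus>\<^bsub>M\<^esub> m', y) = \<beta> (m, y) \<oplus>\<^bsub>?K\<^esub> \<beta> (m', y)"
        using ex[of y] by (auto simp: \<beta> M.smult_r_distr)
    next
      fix m y y' assume m: "m \<in> carrier M" "y \<in> carrier ?N" "y' \<in> carrier ?N"
      then obtain r r' where r: "r \<in> carrier R" "r' \<in> carrier R" "y = h r" "y' = h r'" using ex by meson
      have "y \<oplus>\<^bsub>?N\<^esub> y' = h (r \<oplus> r')" using r by (simp add: ring_as_module_def)
      then show "\<beta> (m, y \<oplus>\<^bsub>?N\<^esub> y') = \<beta> (m, y) \<oplus>\<^bsub>?K\<^esub> \<beta> (m, y')"
        using m r by (simp add: \<beta> M.smult_l_distr del: h.hom_add)
    next
      fix r m y assume "r \<in> carrier R" "m \<in> carrier M" "y \<in> carrier ?N"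
      then show "\<beta> (r \<odot>\<^bsub>M\<^esub> m, y) = r \<odot>\<^bsub>?K\<^esub> \<beta> (m, y)"
        using ex[of y] by (auto simp: \<beta> M.smult_assoc1[symmetric] M.R.m_comm)
    next
      fix r m y assume m: "r \<in> carrier R" "m \<in> carrier M" "y \<in> carrier ?N"
      then obtain r' where r: "r' \<in> carrier R" "y = h r'" using ex by meson
      have "r \<odot>\<^bsub>?N\<^esub> y = h (r \<otimes> r')" using r m by (simp add: ring_as_module_def)
      then show "\<beta> (m, r \<odot>\<^bsub>?N\<^esub> y) = r \<odot>\<^bsub>?K\<^esub> \<beta> (m, y)"
        using m r by (simp add: \<beta> M.smult_assoc1 del: h.hom_mult)
    next
      show "tens x \<one>\<^bsub>S\<^esub> = \<zero>\<^bsub>tensor_product R M ?N\<^esub>" using tx by (simp add: t_def TP_def)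
    qed (use x one in auto)
    moreover have "\<beta> (x, \<one>\<^bsub>S\<^esub>) = cM +>\<^bsub>M\<^esub> x"
      using \<beta>[of \<one> x] x by simp
    ultimately have "x \<in> cM" using M.quot_module_class_zero_iff[OF sub x] by simp
    then show "\<exists>y\<in>carrier M. x = c \<odot>\<^bsub>M\<^esub> y" by (auto simp: cM_def)
  qed
  show ?thesis by (rule that[OF _ img t_add t_smult t0]) (unfold_locales, auto)
qed

text \<open>Base change of \<open>C / N\<close> along \<open>R \<rightarrow> R / c R\<close> is \<open>C / (N + c C)\<close>.\<close>

lemma tensor_quot_module:
  fixes R (structure) and C (structure) and S (structure)
  assumes C: "module R C" and N: "submodule N R C" and S: "cring S" and h: "h \<in> ring_hom R S"
    and onto: "h ` carrier R = carrier S" and c: "c \<in> carrier R"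
    and ker: "\<And>r. r \<in> carrier R \<Longrightarrow> h r = \<zero>\<^bsub>S\<^esub> \<longleftrightarrow> (\<exists>q\<in>carrier R. r = c \<otimes>\<^bsub>R\<^esub> q)"
  defines "TP \<equiv> tensor_product R (quot_module C N) (ring_as_module S h)"
  obtains t where "module R TP" "t ` carrier C = carrier TP"
    "\<And>x y. x \<in> carrier C \<Longrightarrow> y \<in> carrier C \<Longrightarrow> t (x \<oplus>\<^bsub>C\<^esub> y) = t x \<oplus>\<^bsub>TP\<^esub> t y"
    "\<And>r x. r \<in> carrier R \<Longrightarrow> x \<in> carrier C \<Longrightarrow> t (r \<odot>\<^bsub>C\<^esub> x) = r \<odot>\<^bsub>TP\<^esub> t x"
    "\<And>x. x \<in> carrier C \<Longrightarrow> t x = \<zero>\<^bsub>TP\<^esub> \<longleftrightarrow> (\<exists>y\<in>carrier C. x \<ominus>\<^bsub>C\<^esub> c \<odot>\<^bsub>C\<^esub> y \<in> N)"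
proof -
  interpret C: module R C by fact
  let ?Q = "quot_module C N"
  note Q = C.quot_module_carrier C.quot_module_add[OF N] C.quot_module_smult[OF N]
  have QM: "module R ?Q" by (rule C.quot_module_module[OF N])
  obtain t where t: "module R TP" "t ` carrier ?Q = carrier TP"
    "\<And>x y. x \<in> carrier ?Q \<Longrightarrow> y \<in> carrier ?Q \<Longrightarrow> t (x \<oplus>\<^bsub>?Q\<^esub> y) = t x \<oplus>\<^bsub>TP\<^esub> t y"
    "\<And>r x. r \<in> carrier R \<Longrightarrow> x \<in> carrier ?Q \<Longrightarrow> t (r \<odot>\<^bsub>?Q\<^esub> x) = r \<odot>\<^bsub>TP\<^esub> t x"
    "\<And>x. x \<in> carrier ?Q \<Longrightarrow> t x = \<zero>\<^bsub>TP\<^esub> \<longleftrightarrow> (\<exists>y\<in>carrier ?Q. x = c \<odot>\<^bsub>?Q\<^esub> y)"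
    using tensor_product_quotient[OF QM S h onto c ker, folded TP_def] by blast
  show ?thesis
  proof (rule that[of "\<lambda>x. t (N +>\<^bsub>C\<^esub> x)"])
    show "(\<lambda>x. t (N +>\<^bsub>C\<^esub> x)) ` carrier C = carrier TP"
      using t(2) by (auto simp: Q image_image)
    show "t (N +>\<^bsub>C\<^esub> (x \<oplus>\<^bsub>C\<^esub> y)) = t (N +>\<^bsub>C\<^esub> x) \<oplus>\<^bsub>TP\<^esub> t (N +>\<^bsub>C\<^esub> y)"
      if "x \<in> carrier C" "y \<in> carrier C" for x y
      using t(3)[of "N +>\<^bsub>C\<^esub> x" "N +>\<^bsub>C\<^esub> y"] that by (auto simp: Q)
    show "t (N +>\<^bsub>C\<^esub> (r \<odot>\<^bsub>C\<^esub> x)) = r \<odot>\<^bsub>TP\<^esub> t (N +>\<^bsub>C\<^esub> x)"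
      if "r \<in> carrier R" "x \<in> carrier C" for r x
      using t(4)[of r "N +>\<^bsub>C\<^esub> x"] that by (auto simp: Q)
    show "t (N +>\<^bsub>C\<^esub> x) = \<zero>\<^bsub>TP\<^esub> \<longleftrightarrow> (\<exists>y\<in>carrier C. x \<ominus>\<^bsub>C\<^esub> c \<odot>\<^bsub>C\<^esub> y \<in> N)" if "x \<in> carrier C" for x
      using t(5)[of "N +>\<^bsub>C\<^esub> x"] that c by (auto simp: Q C.coset_eq_iff[OF N])
  qed (rule t(1))
qed

section \<open>Finite sums in abelian monoids\<close>

context abelian_monoid
begin

lemma finsum_swap:
  assumes "finite A" "finite B" "\<And>x y. x \<in> A \<Longrightarrow> y \<in> B \<Longrightarrow> f x y \<in> carrier G"
  shows "(\<Oplus>x\<in>A. \<Oplus>y\<in>B. f x y) = (\<Oplus>y\<in>B. \<Oplus>x\<in>A. f x y)"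
  using assms(1,3)
proof (induction A)
  case empty
  then show ?case by simp
next
  case (insert a A)
  then have "(\<Oplus>x\<in>insert a A. \<Oplus>y\<in>B. f x y) = (\<Oplus>y\<in>B. f a y) \<oplus> (\<Oplus>y\<in>B. \<Oplus>x\<in>A. f x y)"
    by (subst finsum_insert) (auto intro!: finsum_closed)
  also have "\<dots> = (\<Oplus>y\<in>B. f a y \<oplus> (\<Oplus>x\<in>A. f x y))"
    using insert by (intro finsum_addf[symmetric]) (auto intro!: finsum_closed)
  also have "\<dots> = (\<Oplus>y\<in>B. \<Oplus>x\<in>insert a A. f x y)"
    using insert by (intro finsum_cong' refl) (auto intro!: finsum_closed simp: finsum_insert Pi_iff)
  finally show ?case .
qed

lemma finsum_delta:
  assumes "finite A" "a \<in> A" "f a \<in> carrier G"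
  shows "(\<Oplus>x\<in>A. if x = a then f x else \<zero>) = f a"
proof -
  have "(\<Oplus>x\<in>A. if x = a then f x else \<zero>) = (\<Oplus>x\<in>{a}. f x)"
    using assms by (intro add.finprod_mono_neutral_cong_right) auto
  then show ?thesis using assms by simp
qed

lemma finsum_filter:
  assumes "finite A" "\<And>x. x \<in> A \<Longrightarrow> f x \<in> carrier G"
  shows "(\<Oplus>x\<in>{x \<in> A. P x}. f x) = (\<Oplus>x\<in>A. if P x then f x else \<zero>)"
  using assms by (intro add.finprod_mono_neutral_cong_left) auto

lemma finsum_fibres:
  assumes "finite A" "finite B" "\<And>x. x \<in> A \<Longrightarrow> f x \<in> carrier G" "\<And>x. x \<in> A \<Longrightarrow> q x \<in> B"
  shows "(\<Oplus>y\<in>B. \<Oplus>x\<in>{x \<in> A. q x = y}. f x) = (\<Oplus>x\<in>A. f x)"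
proof -
  have "(\<Oplus>y\<in>B. \<Oplus>x\<in>{x \<in> A. q x = y}. f x) = (\<Oplus>y\<in>B. \<Oplus>x\<in>A. if q x = y then f x else \<zero>)"
    using assms by (intro finsum_cong' refl finsum_filter) (auto intro!: finsum_closed)
  also have "\<dots> = (\<Oplus>x\<in>A. \<Oplus>y\<in>B. if q x = y then f x else \<zero>)"
    using assms by (intro finsum_swap) auto
  also have "\<dots> = (\<Oplus>x\<in>A. f x)"
  proof (rule finsum_cong'[OF refl])
    show "(\<Oplus>y\<in>B. if q x = y then f x else \<zero>) = f x" if "x \<in> A" for x
      using finsum_delta[of B "q x" "\<lambda>_. f x"] assms that by (simp add: eq_commute)
  qed (use assms in auto)
  finally show ?thesis .
qed

lemma finsum_bij:
  assumes "bij_betw h A B" "\<And>y. y \<in> B \<Longrightarrow> f y \<in> carrier G"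
  shows "(\<Oplus>y\<in>B. f y) = (\<Oplus>x\<in>A. f (h x))"
proof -
  have "B = h ` A" "inj_on h A" using assms(1) by (auto simp: bij_betw_def)
  then show ?thesis using assms(2) by (simp add: finsum_reindex Pi_iff)
qed

end

section \<open>Inverse limits of rings\<close>

locale ring_system =
  fixes R :: "nat \<Rightarrow> 'a ring" and f :: "nat \<Rightarrow> 'a \<Rightarrow> 'a"
  assumes cring: "\<And>n. cring (R n)" and hom: "\<And>n. f n \<in> ring_hom (R (Suc n)) (R n)"
begin

lemma ring_lim_carrier:
  "x \<in> carrier (ring_lim R f) \<longleftrightarrow> (\<forall>n. x n \<in> carrier (R n) \<and> f n (x (Suc n)) = x n)"
  by (simp add: ring_lim_def)

lemma ring_lim_cring: "cring (ring_lim R f)"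
proof -
  let ?L = "ring_lim R f"
  note cr = cring.cring_simprules[OF cring]
  have f: "ring_hom_cring (R (Suc n)) (R n) (f n)" for n
    by (intro ring_hom_cring.intro ring_hom_cring_axioms.intro cring hom)
  note fh = ring_hom_add[OF hom] ring_hom_mult[OF hom] ring_hom_one[OF hom]
  have r1: "x \<otimes>\<^bsub>R n\<^esub> \<one>\<^bsub>R n\<^esub> = x" if "x \<in> carrier (R n)" for n x
  proof -
    interpret cring "R n" by (rule cring)
    show ?thesis using that by simp
  qed
  show ?thesis
  proof (rule cringI)
    show "abelian_group ?L"
    proof (rule abelian_groupI)
      fix x assume x: "x \<in> carrier ?L"
      have "f n (\<ominus>\<^bsub>R (Suc n)\<^esub> x (Suc n)) = \<ominus>\<^bsub>R n\<^esub> x n" for n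
      proof -
        interpret ring_hom_cring "R (Suc n)" "R n" "f n" by (rule f)
        show ?thesis using x by (simp add: ring_lim_carrier)
      qed
      then show "\<exists>y\<in>carrier ?L. y \<oplus>\<^bsub>?L\<^esub> x = \<zero>\<^bsub>?L\<^esub>"
        using x by (intro bexI[of _ "\<lambda>n. \<ominus>\<^bsub>R n\<^esub> x n"]) (auto simp: ring_lim_def cr)
    next
      have "f n \<zero>\<^bsub>R (Suc n)\<^esub> = \<zero>\<^bsub>R n\<^esub>" for n
      proof -
        interpret ring_hom_cring "R (Suc n)" "R n" "f n" by (rule f)
        show ?thesis by simp
      qed
      then show "\<zero>\<^bsub>?L\<^esub> \<in> carrier ?L" by (simp add: ring_lim_def cr)
    qed (auto simp: ring_lim_def cr fh)
    show "comm_monoid ?L"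
      by (rule comm_monoidI) (auto simp: ring_lim_def cr fh r1)
  qed (auto simp: ring_lim_def cr)
qed

lemma eval_hom: "(\<lambda>x. x n) \<in> ring_hom (ring_lim R f) (R n)"
  by (auto simp: ring_lim_def intro!: ring_hom_memI)

lemma eval_hom_cring: "ring_hom_cring (ring_lim R f) (R n) (\<lambda>x. x n)"
  by (intro ring_hom_cring.intro ring_hom_cring_axioms.intro ring_lim_cring cring eval_hom)

end

section \<open>Group rings of finite abelian groups\<close>

locale group_ring_setup = R?: cring R + G?: comm_group G for R (structure) and G (structure) +
  assumes finite_carrier: "finite (carrier G)"
begin

abbreviation "RG \<equiv> group_ring R G"

lemma RG_carrier: "x \<in> carrier RG \<longleftrightarrow> x \<in> carrier G \<rightarrow>\<^sub>E carrier R"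
  by (simp add: group_ring_def)

lemma RG_closed: "x \<in> carrier RG \<Longrightarrow> g \<in> carrier G \<Longrightarrow> x g \<in> carrier R"
  by (auto simp: RG_carrier)

lemma RG_eqI:
  assumes "x \<in> carrier RG" "y \<in> carrier RG" "\<And>g. g \<in> carrier G \<Longrightarrow> x g = y g"
  shows "x = y"
  using assms by (intro extensionalityI[of _ "carrier G"]) (auto simp: RG_carrier PiE_iff)

lemma RG_mult_apply:
  "g \<in> carrier G \<Longrightarrow> (x \<otimes>\<^bsub>RG\<^esub> y) g = (\<Oplus>\<^bsub>R\<^esub>h\<in>carrier G. x h \<otimes>\<^bsub>R\<^esub> y (inv\<^bsub>G\<^esub> h \<otimes>\<^bsub>G\<^esub> g))"
  by (simp add: group_ring_def)

lemma RG_mult_closed: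
  assumes "x \<in> carrier RG" "y \<in> carrier RG" shows "x \<otimes>\<^bsub>RG\<^esub> y \<in> carrier RG"
  using assms by (auto simp: group_ring_def intro!: R.finsum_closed)

lemma bij_translate: "a \<in> carrier G \<Longrightarrow> bij_betw (\<lambda>k. a \<otimes>\<^bsub>G\<^esub> k) (carrier G) (carrier G)"
  by (rule bij_betwI[where g = "\<lambda>k. inv\<^bsub>G\<^esub> a \<otimes>\<^bsub>G\<^esub> k"]) (auto simp: G.m_assoc[symmetric])

lemma bij_reflect: "a \<in> carrier G \<Longrightarrow> bij_betw (\<lambda>k. inv\<^bsub>G\<^esub> k \<otimes>\<^bsub>G\<^esub> a) (carrier G) (carrier G)"
  by (rule bij_betwI[where g = "\<lambda>k. inv\<^bsub>G\<^esub> k \<otimes>\<^bsub>G\<^esub> a"]) (auto simp: G.inv_mult G.m_ac G.inv_solve_left)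

lemma inv_mult_cancel:
  assumes "a \<in> carrier G" "b \<in> carrier G" shows "inv\<^bsub>G\<^esub> (inv\<^bsub>G\<^esub> a \<otimes>\<^bsub>G\<^esub> b) \<otimes>\<^bsub>G\<^esub> b = a"
  using assms by (simp add: G.inv_mult G.m_assoc)

text \<open>Reindexing the convolution by k \<mapsto> k^-1 g exchanges the arguments of the two
  factors; that the remaining argument (k^-1 g)^-1 g collapses to k uses commutativity of
  \<open>G\<close>.\<close>

lemma RG_mult_comm:
  assumes "x \<in> carrier RG" "y \<in> carrier RG" shows "x \<otimes>\<^bsub>RG\<^esub> y = y \<otimes>\<^bsub>RG\<^esub> x"
proof (rule RG_eqI)
  fix g assume g: "g \<in> carrier G"
  have "(x \<otimes>\<^bsub>RG\<^esub> y) g = (\<Oplus>\<^bsub>R\<^esub>k\<in>carrier G. x (inv\<^bsub>G\<^esub> k \<otimes>\<^bsub>G\<^esub> g) \<otimes>\<^bsub>R\<^esub> y (inv\<^bsub>G\<^esub> (inv\<^bsub>G\<^esub> k \<otimes>\<^bsub>G\<^esub> g) \<otimes>\<^bsub>G\<^esub> g))"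
    unfolding RG_mult_apply[OF g]
    by (rule R.finsum_bij[OF bij_reflect[OF g]]) (use RG_closed[OF assms(1)] RG_closed[OF assms(2)] g in auto)
  also have "\<dots> = (\<Oplus>\<^bsub>R\<^esub>k\<in>carrier G. y k \<otimes>\<^bsub>R\<^esub> x (inv\<^bsub>G\<^esub> k \<otimes>\<^bsub>G\<^esub> g))"
    using assms g by (intro R.finsum_cong' refl) (auto simp: inv_mult_cancel R.m_comm RG_closed[OF assms(1)] RG_closed[OF assms(2)])
  also have "\<dots> = (y \<otimes>\<^bsub>RG\<^esub> x) g" unfolding RG_mult_apply[OF g] ..
  finally show "(x \<otimes>\<^bsub>RG\<^esub> y) g = (y \<otimes>\<^bsub>RG\<^esub> x) g" .
qed (use assms in \<open>auto intro: RG_mult_closed\<close>)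

text \<open>Exchange of the two summations, followed by a translation of the inner variable by
  \<open>h\<close>.\<close>

lemma RG_mult_assoc:
  assumes "x \<in> carrier RG" "y \<in> carrier RG" "z \<in> carrier RG"
  shows "(x \<otimes>\<^bsub>RG\<^esub> y) \<otimes>\<^bsub>RG\<^esub> z = x \<otimes>\<^bsub>RG\<^esub> (y \<otimes>\<^bsub>RG\<^esub> z)"
proof (rule RG_eqI)
  fix g assume g: "g \<in> carrier G"
  note cl = RG_closed[OF assms(1)] RG_closed[OF assms(2)] RG_closed[OF assms(3)]
  have "((x \<otimes>\<^bsub>RG\<^esub> y) \<otimes>\<^bsub>RG\<^esub> z) g
     = (\<Oplus>\<^bsub>R\<^esub>k\<in>carrier G. (\<Oplus>\<^bsub>R\<^esub>h\<in>carrier G. x h \<otimes>\<^bsub>R\<^esub> y (inv\<^bsub>G\<^esub> h \<otimes>\<^bsub>G\<^esub> k)) \<otimes>\<^bsub>R\<^esub> z (inv\<^bsub>G\<^esub> k \<otimes>\<^bsub>G\<^esub> g))"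
    using g cl unfolding RG_mult_apply[OF g]
    by (intro R.finsum_cong' refl) (auto simp: RG_mult_apply intro!: R.finsum_closed)
  also have "\<dots> = (\<Oplus>\<^bsub>R\<^esub>k\<in>carrier G. \<Oplus>\<^bsub>R\<^esub>h\<in>carrier G. x h \<otimes>\<^bsub>R\<^esub> y (inv\<^bsub>G\<^esub> h \<otimes>\<^bsub>G\<^esub> k) \<otimes>\<^bsub>R\<^esub> z (inv\<^bsub>G\<^esub> k \<otimes>\<^bsub>G\<^esub> g))"
    using g cl finite_carrier
    by (intro R.finsum_cong' refl) (auto simp: R.finsum_ldistr intro!: R.finsum_closed)
  also have "\<dots> = (\<Oplus>\<^bsub>R\<^esub>h\<in>carrier G. \<Oplus>\<^bsub>R\<^esub>k\<in>carrier G. x h \<otimes>\<^bsub>R\<^esub> y (inv\<^bsub>G\<^esub> h \<otimes>\<^bsub>G\<^esub> k) \<otimes>\<^bsub>R\<^esub> z (inv\<^bsub>G\<^esub> k \<otimes>\<^bsub>G\<^esub> g))"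
    using g cl finite_carrier by (intro R.finsum_swap) auto
  also have "\<dots> = (\<Oplus>\<^bsub>R\<^esub>h\<in>carrier G. \<Oplus>\<^bsub>R\<^esub>k\<in>carrier G. x h \<otimes>\<^bsub>R\<^esub> (y k \<otimes>\<^bsub>R\<^esub> z (inv\<^bsub>G\<^esub> k \<otimes>\<^bsub>G\<^esub> (inv\<^bsub>G\<^esub> h \<otimes>\<^bsub>G\<^esub> g))))"
  proof (rule R.finsum_cong'[OF refl])
    fix h assume h: "h \<in> carrier G"
    have "(\<Oplus>\<^bsub>R\<^esub>k\<in>carrier G. x h \<otimes>\<^bsub>R\<^esub> y (inv\<^bsub>G\<^esub> h \<otimes>\<^bsub>G\<^esub> k) \<otimes>\<^bsub>R\<^esub> z (inv\<^bsub>G\<^esub> k \<otimes>\<^bsub>G\<^esub> g))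
      = (\<Oplus>\<^bsub>R\<^esub>k\<in>carrier G. x h \<otimes>\<^bsub>R\<^esub> y (inv\<^bsub>G\<^esub> h \<otimes>\<^bsub>G\<^esub> (h \<otimes>\<^bsub>G\<^esub> k)) \<otimes>\<^bsub>R\<^esub> z (inv\<^bsub>G\<^esub> (h \<otimes>\<^bsub>G\<^esub> k) \<otimes>\<^bsub>G\<^esub> g))"
      by (rule R.finsum_bij[OF bij_translate[OF h]]) (use g h cl in auto)
    also have "\<dots> = (\<Oplus>\<^bsub>R\<^esub>k\<in>carrier G. x h \<otimes>\<^bsub>R\<^esub> (y k \<otimes>\<^bsub>R\<^esub> z (inv\<^bsub>G\<^esub> k \<otimes>\<^bsub>G\<^esub> (inv\<^bsub>G\<^esub> h \<otimes>\<^bsub>G\<^esub> g))))"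
      using g h cl
      by (intro R.finsum_cong' refl) (auto simp: R.m_assoc G.m_assoc[symmetric] G.inv_mult_group)
    finally show "(\<Oplus>\<^bsub>R\<^esub>k\<in>carrier G. x h \<otimes>\<^bsub>R\<^esub> y (inv\<^bsub>G\<^esub> h \<otimes>\<^bsub>G\<^esub> k) \<otimes>\<^bsub>R\<^esub> z (inv\<^bsub>G\<^esub> k \<otimes>\<^bsub>G\<^esub> g)) = \<dots>" .
  qed (use g cl in \<open>auto intro!: R.finsum_closed\<close>)
  also have "\<dots> = (\<Oplus>\<^bsub>R\<^esub>h\<in>carrier G. x h \<otimes>\<^bsub>R\<^esub> (y \<otimes>\<^bsub>RG\<^esub> z) (inv\<^bsub>G\<^esub> h \<otimes>\<^bsub>G\<^esub> g))"
    using g cl finite_carrier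
    by (intro R.finsum_cong' refl) (auto simp: R.finsum_rdistr RG_mult_apply intro!: R.finsum_closed)
  also have "\<dots> = (x \<otimes>\<^bsub>RG\<^esub> (y \<otimes>\<^bsub>RG\<^esub> z)) g" unfolding RG_mult_apply[OF g] ..
  finally show "((x \<otimes>\<^bsub>RG\<^esub> y) \<otimes>\<^bsub>RG\<^esub> z) g = (x \<otimes>\<^bsub>RG\<^esub> (y \<otimes>\<^bsub>RG\<^esub> z)) g" .
qed (use assms in \<open>auto intro: RG_mult_closed\<close>)

lemma basis_elt_RG: "a \<in> carrier G \<Longrightarrow> basis_elt R (carrier G) a \<in> carrier RG"
  by (auto simp: RG_carrier basis_elt_def)

lemma basis_elt_mult:
  assumes a: "a \<in> carrier G" and x: "x \<in> carrier RG" and g: "g \<in> carrier G"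
  shows "(basis_elt R (carrier G) a \<otimes>\<^bsub>RG\<^esub> x) g = x (inv\<^bsub>G\<^esub> a \<otimes>\<^bsub>G\<^esub> g)"
proof -
  have "(basis_elt R (carrier G) a \<otimes>\<^bsub>RG\<^esub> x) g
     = (\<Oplus>\<^bsub>R\<^esub>h\<in>carrier G. if h = a then x (inv\<^bsub>G\<^esub> h \<otimes>\<^bsub>G\<^esub> g) else \<zero>\<^bsub>R\<^esub>)"
    unfolding RG_mult_apply[OF g] using assms RG_closed[OF x]
    by (intro R.finsum_cong' refl) (auto simp: basis_elt_def)
  also have "\<dots> = x (inv\<^bsub>G\<^esub> a \<otimes>\<^bsub>G\<^esub> g)"
    using a g RG_closed[OF x] finite_carrier by (intro R.finsum_delta) auto
  finally show ?thesis .
qed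

lemma RG_cring: "cring RG"
proof (rule cringI)
  show "abelian_group RG"
  proof (rule abelian_groupI)
    fix x assume x: "x \<in> carrier RG"
    then show "\<exists>y\<in>carrier RG. y \<oplus>\<^bsub>RG\<^esub> x = \<zero>\<^bsub>RG\<^esub>"
      by (intro bexI[of _ "\<lambda>g\<in>carrier G. \<ominus>\<^bsub>R\<^esub> x g"]) (auto simp: group_ring_def R.l_neg PiE_iff fun_eq_iff)
  qed (auto simp: group_ring_def R.a_ac PiE_iff fun_eq_iff extensional_def)
  show "comm_monoid RG"
  proof (rule comm_monoidI)
    have one: "\<one>\<^bsub>RG\<^esub> = basis_elt R (carrier G) \<one>\<^bsub>G\<^esub>" by (simp add: group_ring_def)
    show "\<one>\<^bsub>RG\<^esub> \<in> carrier RG" unfolding one by (rule basis_elt_RG) simp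
    show "\<one>\<^bsub>RG\<^esub> \<otimes>\<^bsub>RG\<^esub> x = x" if "x \<in> carrier RG" for x
      unfolding one using that
      by (intro RG_eqI) (auto simp: basis_elt_mult intro!: RG_mult_closed basis_elt_RG)
  qed (auto intro: RG_mult_closed RG_mult_assoc RG_mult_comm)
  fix x y z assume xyz: "x \<in> carrier RG" "y \<in> carrier RG" "z \<in> carrier RG"
  have add: "u \<oplus>\<^bsub>RG\<^esub> v \<in> carrier RG" if "u \<in> carrier RG" "v \<in> carrier RG" for u v
    using that by (auto simp: group_ring_def)
  show "(x \<oplus>\<^bsub>RG\<^esub> y) \<otimes>\<^bsub>RG\<^esub> z = x \<otimes>\<^bsub>RG\<^esub> z \<oplus>\<^bsub>RG\<^esub> y \<otimes>\<^bsub>RG\<^esub> z"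
  proof (rule RG_eqI)
    fix g assume g: "g \<in> carrier G"
    note cl = RG_closed[OF xyz(1)] RG_closed[OF xyz(2)] RG_closed[OF xyz(3)]
    have "((x \<oplus>\<^bsub>RG\<^esub> y) \<otimes>\<^bsub>RG\<^esub> z) g = (\<Oplus>\<^bsub>R\<^esub>h\<in>carrier G. x h \<otimes>\<^bsub>R\<^esub> z (inv\<^bsub>G\<^esub> h \<otimes>\<^bsub>G\<^esub> g) \<oplus>\<^bsub>R\<^esub> y h \<otimes>\<^bsub>R\<^esub> z (inv\<^bsub>G\<^esub> h \<otimes>\<^bsub>G\<^esub> g))"
      unfolding RG_mult_apply[OF g] using g cl
      by (intro R.finsum_cong' refl) (auto simp: group_ring_def R.l_distr)
    also have "\<dots> = (x \<otimes>\<^bsub>RG\<^esub> z) g \<oplus>\<^bsub>R\<^esub> (y \<otimes>\<^bsub>RG\<^esub> z) g"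
      unfolding RG_mult_apply[OF g] using g cl by (intro R.finsum_addf) auto
    finally show "((x \<oplus>\<^bsub>RG\<^esub> y) \<otimes>\<^bsub>RG\<^esub> z) g = (x \<otimes>\<^bsub>RG\<^esub> z \<oplus>\<^bsub>RG\<^esub> y \<otimes>\<^bsub>RG\<^esub> z) g"
      using g by (simp add: group_ring_def)
  qed (use xyz in \<open>auto intro!: RG_mult_closed add\<close>)
qed

end

text \<open>The product needs an argument: for fixed \<open>k\<close>, translation by k^-1 carries
  the fibre of \<open>q\<close> over \<open>h\<close> to the fibre over q(k)^-1 h. The inner sum
  therefore depends on \<open>k\<close> only through \<open>q k\<close>, and the outer sum can be
  grouped by fibres.\<close>

lemma group_ring_map_hom:
  assumes R: "cring R" and G: "comm_group G" "finite (carrier G)"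
    and H: "comm_group H" "finite (carrier H)" and q: "q \<in> hom G H"
  shows "group_ring_map R G H q \<in> ring_hom (group_ring R G) (group_ring R H)"
proof -
  interpret R: cring R by fact
  interpret G: group_ring_setup R G by (intro group_ring_setup.intro group_ring_setup_axioms.intro R G)
  interpret H: group_ring_setup R H by (intro group_ring_setup.intro group_ring_setup_axioms.intro R H)
  interpret q: group_hom G H q using q by unfold_locales
  let ?m = "group_ring_map R G H q"
  have m_closed: "?m x \<in> carrier H.RG" if "x \<in> carrier G.RG" for x
    using G.RG_closed[OF that] by (auto simp: H.RG_carrier group_ring_map_def intro!: R.finsum_closed)
  have m_apply: "?m x h = (\<Oplus>\<^bsub>R\<^esub>g\<in>{g \<in> carrier G. q g = h}. x g)" if "h \<in> carrier H" for x h
    using that by (simp add: group_ring_map_def)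
  show ?thesis
  proof (rule ring_hom_memI)
    fix x y assume xy: "x \<in> carrier G.RG" "y \<in> carrier G.RG"
    note cl = G.RG_closed[OF xy(1)] G.RG_closed[OF xy(2)]
    show "?m (x \<oplus>\<^bsub>G.RG\<^esub> y) = ?m x \<oplus>\<^bsub>H.RG\<^esub> ?m y"
    proof
      fix h
      have "(\<Oplus>\<^bsub>R\<^esub>g\<in>{g \<in> carrier G. q g = h}. (x \<oplus>\<^bsub>G.RG\<^esub> y) g) = (\<Oplus>\<^bsub>R\<^esub>g\<in>{g \<in> carrier G. q g = h}. x g \<oplus>\<^bsub>R\<^esub> y g)"
        using cl by (intro R.finsum_cong' refl) (auto simp: group_ring_def)
      also have "\<dots> = (\<Oplus>\<^bsub>R\<^esub>g\<in>{g \<in> carrier G. q g = h}. x g) \<oplus>\<^bsub>R\<^esub> (\<Oplus>\<^bsub>R\<^esub>g\<in>{g \<in> carrier G. q g = h}. y g)"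
        using cl by (intro R.finsum_addf) auto
      finally show "?m (x \<oplus>\<^bsub>G.RG\<^esub> y) h = (?m x \<oplus>\<^bsub>H.RG\<^esub> ?m y) h"
        by (simp add: group_ring_map_def group_ring_def)
    qed
    show "?m (x \<otimes>\<^bsub>G.RG\<^esub> y) = ?m x \<otimes>\<^bsub>H.RG\<^esub> ?m y"
    proof (rule H.RG_eqI)
      fix h assume h: "h \<in> carrier H"
      let ?F = "\<lambda>h. {g \<in> carrier G. q g = h}"
      have fin: "finite (?F h)" for h using G.finite_carrier by simp
      have "?m (x \<otimes>\<^bsub>G.RG\<^esub> y) h = (\<Oplus>\<^bsub>R\<^esub>g\<in>?F h. \<Oplus>\<^bsub>R\<^esub>k\<in>carrier G. x k \<otimes>\<^bsub>R\<^esub> y (inv\<^bsub>G\<^esub> k \<otimes>\<^bsub>G\<^esub> g))"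
        unfolding m_apply[OF h] using cl
        by (intro R.finsum_cong' refl) (auto simp: G.RG_mult_apply intro!: R.finsum_closed)
      also have "\<dots> = (\<Oplus>\<^bsub>R\<^esub>k\<in>carrier G. \<Oplus>\<^bsub>R\<^esub>g\<in>?F h. x k \<otimes>\<^bsub>R\<^esub> y (inv\<^bsub>G\<^esub> k \<otimes>\<^bsub>G\<^esub> g))"
        using cl fin G.finite_carrier by (intro R.finsum_swap) auto
      also have "\<dots> = (\<Oplus>\<^bsub>R\<^esub>k\<in>carrier G. x k \<otimes>\<^bsub>R\<^esub> ?m y (inv\<^bsub>H\<^esub> q k \<otimes>\<^bsub>H\<^esub> h))"
      proof (rule R.finsum_cong'[OF refl])
        fix k assume k: "k \<in> carrier G"
        have "(\<Oplus>\<^bsub>R\<^esub>g\<in>?F h. x k \<otimes>\<^bsub>R\<^esub> y (inv\<^bsub>G\<^esub> k \<otimes>\<^bsub>G\<^esub> g)) = x k \<otimes>\<^bsub>R\<^esub> (\<Oplus>\<^bsub>R\<^esub>g\<in>?F h. y (inv\<^bsub>G\<^esub> k \<otimes>\<^bsub>G\<^esub> g))"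
          using k cl fin by (intro R.finsum_rdistr[symmetric]) auto
        also have "(\<Oplus>\<^bsub>R\<^esub>g\<in>?F h. y (inv\<^bsub>G\<^esub> k \<otimes>\<^bsub>G\<^esub> g)) = (\<Oplus>\<^bsub>R\<^esub>g\<in>?F (inv\<^bsub>H\<^esub> q k \<otimes>\<^bsub>H\<^esub> h). y g)"
        proof (rule R.finsum_bij[symmetric])
          show "bij_betw (\<lambda>g. inv\<^bsub>G\<^esub> k \<otimes>\<^bsub>G\<^esub> g) (?F h) (?F (inv\<^bsub>H\<^esub> q k \<otimes>\<^bsub>H\<^esub> h))"
            by (rule bij_betwI[where g = "\<lambda>g. k \<otimes>\<^bsub>G\<^esub> g"])
              (use k h in \<open>auto simp: G.G.m_assoc[symmetric] H.G.m_assoc[symmetric]\<close>)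
        qed (use cl in auto)
        finally show "(\<Oplus>\<^bsub>R\<^esub>g\<in>?F h. x k \<otimes>\<^bsub>R\<^esub> y (inv\<^bsub>G\<^esub> k \<otimes>\<^bsub>G\<^esub> g)) = x k \<otimes>\<^bsub>R\<^esub> ?m y (inv\<^bsub>H\<^esub> q k \<otimes>\<^bsub>H\<^esub> h)"
          using h k by (simp add: m_apply)
      qed (use cl h H.RG_closed[OF m_closed[OF xy(2)]] in auto)
      also have "\<dots> = (\<Oplus>\<^bsub>R\<^esub>l\<in>carrier H. \<Oplus>\<^bsub>R\<^esub>k\<in>?F l. x k \<otimes>\<^bsub>R\<^esub> ?m y (inv\<^bsub>H\<^esub> q k \<otimes>\<^bsub>H\<^esub> h))"
        using G.finite_carrier H.finite_carrier cl h H.RG_closed[OF m_closed[OF xy(2)]]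
        by (intro R.finsum_fibres[symmetric]) auto
      also have "\<dots> = (\<Oplus>\<^bsub>R\<^esub>l\<in>carrier H. ?m x l \<otimes>\<^bsub>R\<^esub> ?m y (inv\<^bsub>H\<^esub> l \<otimes>\<^bsub>H\<^esub> h))"
      proof (rule R.finsum_cong'[OF refl])
        fix l assume l: "l \<in> carrier H"
        have "(\<Oplus>\<^bsub>R\<^esub>k\<in>?F l. x k \<otimes>\<^bsub>R\<^esub> ?m y (inv\<^bsub>H\<^esub> q k \<otimes>\<^bsub>H\<^esub> h)) = (\<Oplus>\<^bsub>R\<^esub>k\<in>?F l. x k \<otimes>\<^bsub>R\<^esub> ?m y (inv\<^bsub>H\<^esub> l \<otimes>\<^bsub>H\<^esub> h))"
          using cl h l H.RG_closed[OF m_closed[OF xy(2)]] by (intro R.finsum_cong' refl) auto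
        also have "\<dots> = ?m x l \<otimes>\<^bsub>R\<^esub> ?m y (inv\<^bsub>H\<^esub> l \<otimes>\<^bsub>H\<^esub> h)"
          unfolding m_apply[OF l] using cl h l fin H.RG_closed[OF m_closed[OF xy(2)]]
          by (intro R.finsum_ldistr[symmetric]) auto
        finally show "(\<Oplus>\<^bsub>R\<^esub>k\<in>?F l. x k \<otimes>\<^bsub>R\<^esub> ?m y (inv\<^bsub>H\<^esub> q k \<otimes>\<^bsub>H\<^esub> h)) = \<dots>" .
      qed (use h H.RG_closed[OF m_closed[OF xy(2)]] H.RG_closed[OF m_closed[OF xy(1)]] in auto)
      also have "\<dots> = (?m x \<otimes>\<^bsub>H.RG\<^esub> ?m y) h" unfolding H.RG_mult_apply[OF h] ..
      finally show "?m (x \<otimes>\<^bsub>G.RG\<^esub> y) h = (?m x \<otimes>\<^bsub>H.RG\<^esub> ?m y) h" .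
    qed (use xy m_closed in \<open>auto intro!: H.RG_mult_closed G.RG_mult_closed\<close>)
  next
    have "?m (basis_elt R (carrier G) \<one>\<^bsub>G\<^esub>) = basis_elt R (carrier H) \<one>\<^bsub>H\<^esub>"
    proof (rule H.RG_eqI)
      fix h assume h: "h \<in> carrier H"
      have "?m (basis_elt R (carrier G) \<one>\<^bsub>G\<^esub>) h
        = (\<Oplus>\<^bsub>R\<^esub>g\<in>{g \<in> carrier G. q g = h}. if g = \<one>\<^bsub>G\<^esub> then \<one>\<^bsub>R\<^esub> else \<zero>\<^bsub>R\<^esub>)"
        unfolding m_apply[OF h] by (intro R.finsum_cong' refl) (auto simp: basis_elt_def)
      also have "\<dots> = (if h = \<one>\<^bsub>H\<^esub> then \<one>\<^bsub>R\<^esub> else \<zero>\<^bsub>R\<^esub>)"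
      proof (cases "h = \<one>\<^bsub>H\<^esub>")
        case True
        then show ?thesis
          using R.finsum_delta[of "{g \<in> carrier G. q g = h}" "\<one>\<^bsub>G\<^esub>" "\<lambda>_. \<one>\<^bsub>R\<^esub>"] G.finite_carrier by simp
      next
        case False
        then have "(\<Oplus>\<^bsub>R\<^esub>g\<in>{g \<in> carrier G. q g = h}. if g = \<one>\<^bsub>G\<^esub> then \<one>\<^bsub>R\<^esub> else \<zero>\<^bsub>R\<^esub>) = (\<Oplus>\<^bsub>R\<^esub>g\<in>{g \<in> carrier G. q g = h}. \<zero>\<^bsub>R\<^esub>)"
          by (intro R.finsum_cong' refl) auto
        then show ?thesis using False by (simp add: R.finsum_zero)
      qed
      finally show "?m (basis_elt R (carrier G) \<one>\<^bsub>G\<^esub>) h = basis_elt R (carrier H) \<one>\<^bsub>H\<^esub> h"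
        using h by (simp add: basis_elt_def)
    qed (auto intro!: m_closed G.basis_elt_RG H.basis_elt_RG)
    then show "?m \<one>\<^bsub>G.RG\<^esub> = \<one>\<^bsub>H.RG\<^esub>" by (simp add: group_ring_def)
  qed (use m_closed in auto)
qed

section \<open>The p-adic integers\<close>

locale padic =
  fixes p :: nat
  assumes prime_p: "prime p"
begin

text \<open>The modulus of component \<open>k\<close> of an element of \<open>Zp\<close>, whose
  components start at the residue modulo p.\<close>

abbreviation q :: "nat \<Rightarrow> int" where "q k \<equiv> int p ^ Suc k"

lemma p_gt_1: "int p > 1"
  using prime_gt_1_nat[OF prime_p] by simp

lemma q_gt_1: "q k > 1"
  using p_gt_1 by (intro one_less_power) auto

lemma q_pos: "q k > 0"
  using q_gt_1[of k] by linarith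

lemma q_dvd: "i \<le> j \<Longrightarrow> q i dvd q j"
  by (intro le_imp_power_dvd) auto

lemma residue_cring: "cring (residue_ring (q k))"
  using residues.cring[of "q k"] q_gt_1 by (simp add: residues_def)

lemma Zp_ring_system: "ring_system (\<lambda>n. residue_ring (q n)) (\<lambda>n x. x mod q n)"
proof (rule ring_system.intro)
  fix n
  have "(x mod q (Suc n)) mod q n = x mod q n" for x
    by (rule mod_mod_cancel) (rule q_dvd, simp)
  then show "(\<lambda>x. x mod q n) \<in> ring_hom (residue_ring (q (Suc n))) (residue_ring (q n))"
    using q_gt_1[of n] q_pos[of n]
    by (intro ring_hom_memI) (auto simp: residue_ring_def mod_simps simp del: power_Suc)
qed (rule residue_cring)

sublocale Zp: ring_system "\<lambda>n. residue_ring (q n)" "\<lambda>n x. x mod q n"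
  rewrites "ring_lim (\<lambda>n. residue_ring (q n)) (\<lambda>n x. x mod q n) \<equiv> Zp p"
  by (rule Zp_ring_system) (simp add: Zp_def)

sublocale Zp: cring "Zp p"
  by (rule Zp.ring_lim_cring)

lemma Zp_carrier:
  "x \<in> carrier (Zp p) \<longleftrightarrow> (\<forall>n. 0 \<le> x n \<and> x n < q n \<and> x (Suc n) mod q n = x n)"
  by (auto simp: Zp.ring_lim_carrier residue_ring_def)

lemma Zp_simps:
  "(x \<oplus>\<^bsub>Zp p\<^esub> y) n = (x n + y n) mod q n"
  "(x \<otimes>\<^bsub>Zp p\<^esub> y) n = (x n * y n) mod q n"
  "\<zero>\<^bsub>Zp p\<^esub> n = 0" "\<one>\<^bsub>Zp p\<^esub> n = 1"
  by (simp_all add: Zp_def ring_lim_def residue_ring_def)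

lemma Zp_bounds:
  assumes "x \<in> carrier (Zp p)" shows "0 \<le> x n" "x n < q n"
  using assms by (auto simp: Zp_carrier)

lemma Zp_mod_self: "x \<in> carrier (Zp p) \<Longrightarrow> x n mod q n = x n"
  using Zp_bounds by simp

lemma Zp_coherent:
  assumes x: "x \<in> carrier (Zp p)" and "i \<le> j" shows "x j mod q i = x i"
  using assms(2)
proof (induction rule: dec_induct)
  case base
  then show ?case using Zp_mod_self[OF x] by simp
next
  case (step j)
  have "x (Suc j) mod q i = x (Suc j) mod q j mod q i"
    using step q_dvd by (intro mod_mod_cancel[symmetric]) auto
  also have "\<dots> = x j mod q i" using x by (auto simp: Zp_carrier)
  finally show ?case using step by simp
qed

lemma Zp_cong: "x \<in> carrier (Zp p) \<Longrightarrow> i \<le> j \<Longrightarrow> [x j = x i] (mod q i)"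
  using Zp_coherent[of x i j] Zp_mod_self[of x i] by (simp add: cong_def)

lemma Zp_uminus:
  assumes "x \<in> carrier (Zp p)" shows "(\<ominus>\<^bsub>Zp p\<^esub> x) n = (- x n) mod q n"
proof -
  have c: "\<ominus>\<^bsub>Zp p\<^esub> x \<in> carrier (Zp p)" using assms by simp
  have "(\<ominus>\<^bsub>Zp p\<^esub> x \<oplus>\<^bsub>Zp p\<^esub> x) n = 0" using assms by (simp add: Zp.l_neg Zp_simps)
  then have "((\<ominus>\<^bsub>Zp p\<^esub> x) n + x n) mod q n = 0" by (simp add: Zp_simps)
  then have "[(\<ominus>\<^bsub>Zp p\<^esub> x) n = - x n] (mod q n)" by (simp add: cong_iff_dvd_diff mod_eq_0_iff_dvd del: power_Suc)
  then show ?thesis using Zp_mod_self[OF c] by (simp add: cong_def)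
qed

lemma Zp_minus:
  assumes "x \<in> carrier (Zp p)" "y \<in> carrier (Zp p)" shows "(x \<ominus>\<^bsub>Zp p\<^esub> y) n = (x n - y n) mod q n"
  using assms unfolding a_minus_def by (simp add: Zp_simps Zp_uminus mod_simps del: power_Suc)

lemma Zp_finsum:
  assumes "f \<in> A \<rightarrow> carrier (Zp p)" shows "(\<Oplus>\<^bsub>Zp p\<^esub>i\<in>A. f i) k = (\<Sum>i\<in>A. f i k) mod q k"
  using assms
proof (induction A rule: infinite_finite_induct)
  case (insert x F)
  then show ?case
    by (simp add: Zp.finsum_insert Pi_iff Zp_simps mod_simps del: power_Suc)
qed (auto simp: Zp_simps Zp.finsum_infinite)

text \<open>The p-adic numbers built below come from integer sequences that are coherent only up to
  congruence; reducing each term gives an actual element of \<open>Zp\<close>.\<close>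

lemma Zp_of_coherent:
  assumes "\<And>k. [y (Suc k) = y k] (mod q k)"
  shows "(\<lambda>k. y k mod q k) \<in> carrier (Zp p)"
proof -
  have "y (Suc k) mod q (Suc k) mod q k = y k mod q k" for k
  proof -
    have "y (Suc k) mod q (Suc k) mod q k = y (Suc k) mod q k"
      by (rule mod_mod_cancel) (rule q_dvd, simp)
    then show ?thesis using assms[of k] by (simp add: cong_def)
  qed
  then show ?thesis using q_pos by (simp add: Zp_carrier del: power_Suc)
qed

end

section \<open>Integral Laplacians of finite connected graphs\<close>

text \<open>Gaussian elimination without division: cross-multiplication with a pivot
  \<open>M b a\<close> removes the unknown \<open>a\<close> from the other equations, which stay
  integral.\<close>

lemma homogeneous_system_nontrivial:
  fixes M :: "'b \<Rightarrow> 'a \<Rightarrow> int"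
  assumes "finite B" "finite A" "card B < card A"
  shows "\<exists>x. (\<exists>a\<in>A. x a \<noteq> 0) \<and> (\<forall>b\<in>B. (\<Sum>a\<in>A. M b a * x a) = 0)"
  using assms
proof (induction B arbitrary: A M rule: finite_induct)
  case empty
  then have "A \<noteq> {}" by auto
  then show ?case by (intro exI[of _ "\<lambda>_. 1"]) auto
next
  case (insert b B)
  show ?case
  proof (cases "\<forall>a\<in>A. M b a = 0")
    case True
    obtain x where "\<exists>a\<in>A. x a \<noteq> 0" "\<forall>b\<in>B. (\<Sum>a\<in>A. M b a * x a) = 0"
      using insert.IH[of A M] insert.prems insert.hyps by (auto simp: card_insert_disjoint)
    then show ?thesis using True by (intro exI[of _ x]) auto
  next
    case False
    then obtain a where a: "a \<in> A" "M b a \<noteq> 0" by blast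
    let ?A = "A - {a}"
    have card: "card B < card ?A" using insert a by auto
    obtain x where x: "\<exists>a'\<in>?A. x a' \<noteq> 0"
      "\<forall>b'\<in>B. (\<Sum>a'\<in>?A. (M b a * M b' a' - M b' a * M b a') * x a') = 0"
      using insert.IH[of ?A "\<lambda>b' a'. M b a * M b' a' - M b' a * M b a'"] card insert.prems by auto
    \<comment> \<open>Scaling the reduced solution by the pivot makes the value that equation
      \<open>b\<close> forces at \<open>a\<close> an integer.\<close>
    define z where "z a' = (if a' = a then - (\<Sum>a'\<in>?A. M b a' * x a') else M b a * x a')" for a'
    have split: "(\<Sum>a'\<in>A. M b' a' * z a') = - (M b' a * (\<Sum>a'\<in>?A. M b a' * x a')) + (\<Sum>a'\<in>?A. M b' a' * (M b a * x a'))" for b'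
    proof -
      have "(\<Sum>a'\<in>A. M b' a' * z a') = M b' a * z a + (\<Sum>a'\<in>?A. M b' a' * z a')"
        using a insert.prems by (intro sum.remove) auto
      also have "(\<Sum>a'\<in>?A. M b' a' * z a') = (\<Sum>a'\<in>?A. M b' a' * (M b a * x a'))"
        by (intro sum.cong) (auto simp: z_def)
      finally show ?thesis by (simp add: z_def)
    qed
    show ?thesis
    proof (intro exI[of _ z] conjI ballI)
      show "\<exists>a\<in>A. z a \<noteq> 0" using x(1) a by (auto simp: z_def)
      fix b' assume "b' \<in> insert b B"
      then show "(\<Sum>a\<in>A. M b' a * z a) = 0"
      proof
        assume "b' = b"
        then show ?thesis unfolding split by (simp add: sum_distrib_left algebra_simps)
      next
        assume "b' \<in> B"
        then have "(\<Sum>a'\<in>?A. (M b a * M b' a' - M b' a * M b a') * x a') = 0" using x by blast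
        then show ?thesis unfolding split
          by (simp add: sum_distrib_left algebra_simps sum_subtractf)
      qed
    qed
  qed
qed

text \<open>Connectedness has the form of an induction principle: a property that is invariant along
  edges spreads from one vertex to all. As the invariance is an equivalence, one orientation of each
  edge suffices.\<close>

locale fin_graph =
  fixes V :: "'v set" and E :: "'e set" and hd tl :: "'e \<Rightarrow> 'v"
  assumes finite_V: "finite V" and finite_E: "finite E"
    and hd: "e \<in> E \<Longrightarrow> hd e \<in> V" and tl: "e \<in> E \<Longrightarrow> tl e \<in> V"
    and nonempty: "V \<noteq> {}"
    and connected: "(\<And>e. e \<in> E \<Longrightarrow> P (hd e) \<longleftrightarrow> P (tl e)) \<Longrightarrow> u \<in> V \<Longrightarrow> w \<in> V \<Longrightarrow> P u \<Longrightarrow> P w"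
begin

definition bd :: "('e \<Rightarrow> int) \<Rightarrow> 'v \<Rightarrow> int" where
  "bd c v = (\<Sum>e\<in>{e\<in>E. hd e = v}. c e) - (\<Sum>e\<in>{e\<in>E. tl e = v}. c e)"

text \<open>The coefficient at \<open>e\<close> of the star map applied to the divisor with
  coefficients \<open>y\<close>.\<close>

definition st :: "('v \<Rightarrow> int) \<Rightarrow> 'e \<Rightarrow> int" where
  "st y e = y (hd e) - y (tl e)"

definition lap :: "('v \<Rightarrow> int) \<Rightarrow> 'v \<Rightarrow> int" where
  "lap y = bd (st y)"

lemma bd_add: "bd (\<lambda>e. a e + b e) v = bd a v + bd b v"
  and bd_diff: "bd (\<lambda>e. a e - b e) v = bd a v - bd b v"
  and bd_mult: "bd (\<lambda>e. k * a e) v = k * bd a v"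
  by (simp_all add: bd_def sum.distrib sum_subtractf sum_distrib_left algebra_simps)

lemma bd_sum: "bd (\<lambda>e. \<Sum>i\<in>I. a i e) v = (\<Sum>i\<in>I. bd (a i) v)"
  unfolding bd_def sum_subtractf by (simp add: sum.swap[of _ _ I])

lemma lap_add: "lap (\<lambda>e. a e + b e) v = lap a v + lap b v"
  and lap_diff: "lap (\<lambda>e. a e - b e) v = lap a v - lap b v"
  and lap_mult: "lap (\<lambda>e. k * a e) v = k * lap a v"
proof -
  have "st (\<lambda>v. a v + b v) = (\<lambda>e. st a e + st b e)" "st (\<lambda>v. a v - b v) = (\<lambda>e. st a e - st b e)"
    "st (\<lambda>v. k * a v) = (\<lambda>e. k * st a e)"
    by (auto simp: st_def algebra_simps)
  then show "lap (\<lambda>e. a e + b e) v = lap a v + lap b v" "lap (\<lambda>e. a e - b e) v = lap a v - lap b v"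
    "lap (\<lambda>e. k * a e) v = k * lap a v"
    by (simp_all add: lap_def bd_add bd_diff bd_mult)
qed

lemma lap_sum: "lap (\<lambda>e. \<Sum>i\<in>I. a i e) v = (\<Sum>i\<in>I. lap (a i) v)"
proof -
  have "st (\<lambda>v. \<Sum>i\<in>I. a i v) = (\<lambda>e. \<Sum>i\<in>I. st (a i) e)"
    by (auto simp: st_def sum_subtractf)
  then show ?thesis by (simp add: lap_def bd_sum)
qed

lemma bd_cong: "(\<And>e. e \<in> E \<Longrightarrow> a e = b e) \<Longrightarrow> bd a = bd b"
  by (auto simp: bd_def fun_eq_iff intro!: arg_cong2[where f = minus] sum.cong)

lemma lap_cong: "(\<And>v. v \<in> V \<Longrightarrow> a v = b v) \<Longrightarrow> lap a = lap b"
  unfolding lap_def by (intro bd_cong) (auto simp: st_def hd tl)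

lemma bd_dvd:
  assumes "\<And>e. e \<in> E \<Longrightarrow> k dvd c e" shows "k dvd bd c v"
  unfolding bd_def using assms by (intro dvd_diff dvd_sum) auto

text \<open>Summation by parts: \<open>bd\<close> and \<open>st\<close> are transposes of each
  other, since on either side an edge contributes its coefficient times the difference of
  \<open>y\<close> at its ends.\<close>

lemma bd_pairing: "(\<Sum>v\<in>V. y v * bd c v) = (\<Sum>e\<in>E. st y e * c e)"
proof -
  have "(\<Sum>v\<in>V. y v * (\<Sum>e\<in>{e\<in>E. h e = v}. c e)) = (\<Sum>e\<in>E. y (h e) * c e)"
    if "\<And>e. e \<in> E \<Longrightarrow> h e \<in> V" for h
  proof -
    have "(\<Sum>v\<in>V. y v * (\<Sum>e\<in>{e\<in>E. h e = v}. c e)) = (\<Sum>v\<in>V. \<Sum>e\<in>{e\<in>E. h e = v}. y (h e) * c e)"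
      by (auto simp: sum_distrib_left intro!: sum.cong)
    also have "\<dots> = (\<Sum>e\<in>E. y (h e) * c e)"
      using that finite_E finite_V by (intro sum.group) auto
    finally show ?thesis .
  qed
  from this[of hd] this[of tl] hd tl show ?thesis
    by (simp add: bd_def st_def right_diff_distrib left_diff_distrib sum_subtractf)
qed

lemma bd_sum_zero: "(\<Sum>v\<in>V. bd c v) = 0"
  using bd_pairing[of "\<lambda>_. 1" c] by (simp add: st_def)

lemma lap_pairing: "(\<Sum>v\<in>V. x v * lap y v) = (\<Sum>v\<in>V. y v * lap x v)"
  by (simp add: lap_def bd_pairing mult.commute)

lemma edge_constant:
  assumes "\<And>e. e \<in> E \<Longrightarrow> y (hd e) = y (tl e)" "u \<in> V" "w \<in> V" shows "y u = y w"
  using connected[of "\<lambda>v. y u = y v" u w] assms by simp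

text \<open>The pairing of \<open>y\<close> with its Laplacian is the Dirichlet energy, a sum of
  integer squares over the edges. This is the place where positivity enters.\<close>

lemma st_zero_if_lap_zero:
  assumes "\<And>v. v \<in> V \<Longrightarrow> lap y v = 0" "e \<in> E" shows "st y e = 0"
proof -
  have "(\<Sum>e\<in>E. st y e * st y e) = (\<Sum>v\<in>V. y v * lap y v)"
    by (simp add: lap_def bd_pairing)
  also have "\<dots> = 0" using assms by simp
  finally have "\<forall>e\<in>E. st y e * st y e = 0"
    using finite_E by (subst (asm) sum_nonneg_eq_0_iff) auto
  then show ?thesis using assms by simp
qed

lemma sum_zero_decomp:
  fixes q :: "'v \<Rightarrow> int"
  assumes "(\<Sum>v\<in>V. q v) = 0" "w \<in> V" "v \<in> V"
  shows "(\<Sum>u\<in>V. q u * (of_bool (v = u) - of_bool (v = w))) = q v"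
proof -
  have "(\<Sum>u\<in>V. q u * (of_bool (v = u) - of_bool (v = w))) = (\<Sum>u\<in>V. q u * of_bool (v = u)) - (\<Sum>u\<in>V. q u) * of_bool (v = w)"
    by (simp add: right_diff_distrib sum_subtractf sum_distrib_right)
  also have "(\<Sum>u\<in>V. q u * of_bool (v = u)) = q v"
    using assms finite_V by (simp add: of_bool_def if_distrib cong: if_cong)
  finally show ?thesis using assms by simp
qed

text \<open>A count of unknowns: the multiple \<open>N\<close> and the values of \<open>x\<close>
  away from \<open>w\<close> are card V unknowns for the card V - 1 equations at the vertices other
  than \<open>w\<close>. The equation at \<open>w\<close> follows because a Laplacian has degree
  zero.\<close>

lemma lap_multiple:
  assumes u: "u \<in> V" and w: "w \<in> V"
  obtains N x where "N \<noteq> 0" "\<And>v. v \<in> V \<Longrightarrow> lap x v = N * (of_bool (v = u) - of_bool (v = w))"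
proof (cases "u = w")
  case True
  then show ?thesis using that[of 1 "\<lambda>_. 0"] by (simp add: lap_def bd_def st_def)
next
  case False
  let ?d = "\<lambda>a v. of_bool (v = a) :: int"
  \<comment> \<open>The coordinate at \<open>w\<close> of a solution is the multiple \<open>N\<close>; the other coordinates form
    the potential \<open>x\<close>, which vanishes at \<open>w\<close>.\<close>
  define M where "M v a = (if a = w then - of_bool (v = u) else lap (?d a) v)" for v a
  have "card (V - {w}) < card V" using w finite_V by (rule_tac psubset_card_mono) auto
  then obtain z where z: "\<exists>a\<in>V. z a \<noteq> 0" "\<forall>v\<in>V - {w}. (\<Sum>a\<in>V. M v a * z a) = 0"
    using homogeneous_system_nontrivial[of "V - {w}" V M] finite_V by auto
  define x where "x v = (if v = w then 0 else z v)" for v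
  have x: "lap x v = (\<Sum>a\<in>V - {w}. z a * lap (?d a) v)" for v
  proof -
    have "x v = (\<Sum>a\<in>V - {w}. z a * ?d a v)" if "v \<in> V" for v
      using finite_V that by (simp add: x_def of_bool_def if_distrib cong: if_cong)
    then have "lap x = lap (\<lambda>v. \<Sum>a\<in>V - {w}. z a * ?d a v)" by (rule lap_cong)
    then show ?thesis by (simp add: lap_sum lap_mult)
  qed
  have 1: "lap x v = z w * of_bool (v = u)" if "v \<in> V - {w}" for v
  proof -
    have "0 = M v w * z w + (\<Sum>a\<in>V - {w}. M v a * z a)"
      using z(2) that sum.remove[OF finite_V w] by (metis (no_types, lifting))
    also have "(\<Sum>a\<in>V - {w}. M v a * z a) = lap x v"
      unfolding x by (intro sum.cong) (auto simp: M_def)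
    finally show ?thesis by (simp add: M_def)
  qed
  have "0 = (\<Sum>v\<in>V. lap x v)" by (simp add: lap_def bd_sum_zero)
  also have "\<dots> = lap x w + (\<Sum>v\<in>V - {w}. lap x v)" by (rule sum.remove[OF finite_V w])
  also have "(\<Sum>v\<in>V - {w}. lap x v) = (\<Sum>v\<in>V - {w}. z w * of_bool (v = u))"
    using 1 by (intro sum.cong) auto
  also have "\<dots> = z w" using u False finite_V by (simp add: of_bool_def if_distrib cong: if_cong)
  finally have 2: "lap x w = - z w" by simp
  have lx: "lap x v = z w * (of_bool (v = u) - of_bool (v = w))" if "v \<in> V" for v
    using 1[of v] 2 that False by (cases "v = w") auto
  \<comment> \<open>Otherwise \<open>x\<close> is harmonic, hence constant, hence zero like its
    value at \<open>w\<close>, and the solution is trivial.\<close>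
  have "z w \<noteq> 0"
  proof
    assume 0: "z w = 0"
    then have "x (hd e) = x (tl e)" if "e \<in> E" for e
      using st_zero_if_lap_zero[of x e] lx that by (simp add: st_def)
    then have "x v = x w" if "v \<in> V" for v using edge_constant that w by blast
    from this have "z v = 0" if "v \<in> V" for v
      using \<open>v \<in> V\<close> 0 by (metis x_def)
    then show False using z(1) by auto
  qed
  then show ?thesis using that lx by blast
qed

text \<open>An integral Green kernel: one multiple \<open>N\<close> valid for all vertices, namely
  the product of the individual ones, and the rescaled potentials. It is linear in the divisor, so
  it can be applied to each component of a p-adic divisor.\<close>

lemma lap_quasi_inverse:
  "\<exists>(N::int) \<Theta>. N \<noteq> 0 \<and>
    (\<forall>q. (\<Sum>v\<in>V. q v) = 0 \<longrightarrow> (\<forall>v\<in>V. lap (\<lambda>v. \<Sum>u\<in>V. q u * \<Theta> u v) v = N * q v))"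
proof -
  obtain w where w: "w \<in> V" using nonempty by blast
  have "\<exists>N x. N \<noteq> 0 \<and> (\<forall>v\<in>V. lap x v = N * (of_bool (v = u) - of_bool (v = w)))" if "u \<in> V" for u
    using lap_multiple[OF that w] by metis
  then obtain N x where N: "\<And>u. u \<in> V \<Longrightarrow> N u \<noteq> 0"
    and x: "\<And>u v. u \<in> V \<Longrightarrow> v \<in> V \<Longrightarrow> lap (x u) v = N u * (of_bool (v = u) - of_bool (v = w))" by metis
  define P where "P = (\<Prod>u\<in>V. N u)"
  define R where "R u = (\<Prod>u'\<in>V - {u}. N u')" for u
  have P: "P = R u * N u" if "u \<in> V" for u
    using prod.remove[OF finite_V that, of N] by (simp add: P_def R_def mult.commute)
  show ?thesis
  proof (intro exI[of _ P] exI[of _ "\<lambda>u v. R u * x u v"] conjI allI impI ballI)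
    show "P \<noteq> 0" using N finite_V by (simp add: P_def)
    fix q :: "'v \<Rightarrow> int" and v assume q: "(\<Sum>v\<in>V. q v) = 0" and v: "v \<in> V"
    have "lap (\<lambda>v. \<Sum>u\<in>V. q u * (R u * x u v)) v = (\<Sum>u\<in>V. q u * (R u * lap (x u) v))"
      by (simp add: lap_sum lap_mult)
    also have "\<dots> = (\<Sum>u\<in>V. P * (q u * (of_bool (v = u) - of_bool (v = w))))"
    proof (rule sum.cong[OF refl])
      show "q u * (R u * lap (x u) v) = P * (q u * (of_bool (v = u) - of_bool (v = w)))" if "u \<in> V" for u
        using P[OF that] by (simp add: x[OF that v])
    qed
    also have "\<dots> = P * q v"
      using sum_zero_decomp[OF q w v] by (simp add: sum_distrib_left[symmetric])
    finally show "lap (\<lambda>v. \<Sum>u\<in>V. q u * (R u * x u v)) v = P * q v" .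
  qed
qed

end

section \<open>p-adic kernel and cokernel of an integral graph Laplacian\<close>

locale fin_graph_padic = fin_graph V E hd tl + padic p
  for V :: "'v set" and E :: "'e set" and hd tl and p
begin

lemma coherent_cong:
  fixes y :: "nat \<Rightarrow> int"
  assumes "\<And>k. [y (Suc k) = y k] (mod q k)" "i \<le> j" shows "[y j = y i] (mod q i)"
  using assms(2)
proof (induction rule: dec_induct)
  case (step j)
  then show ?case
    using assms(1)[of j] q_dvd[of i j] cong_trans cong_dvd_modulus by blast
qed simp

lemma split_p_part:
  fixes N :: int assumes "N \<noteq> 0"
  obtains a M where "N = int p ^ a * M" "coprime M (int p)"
proof -
  have pr: "prime (int p)" using prime_p by simp
  then obtain M where "N = int p ^ multiplicity (int p) N * M" "\<not> int p dvd M"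
    using multiplicity_decompose'[OF assms, of "int p"] by (metis not_prime_unit)
  then show ?thesis using that pr prime_imp_coprime coprime_commute by metis
qed

lemma padic_lap_kernel:
  fixes y :: "'v \<Rightarrow> nat \<Rightarrow> int"
  assumes coh: "\<And>v k. v \<in> V \<Longrightarrow> [y v (Suc k) = y v k] (mod q k)"
    and ker: "\<And>v k. v \<in> V \<Longrightarrow> [lap (\<lambda>v. y v k) v = 0] (mod q k)"
    and e: "e \<in> E"
  shows "[y (hd e) k = y (tl e) k] (mod q k)"
proof -
  let ?u = "hd e" and ?w = "tl e"
  obtain N x where N: "N \<noteq> 0" "\<And>v. v \<in> V \<Longrightarrow> lap x v = N * (of_bool (v = ?u) - of_bool (v = ?w))"
    using lap_multiple[OF hd[OF e] tl[OF e]] by metis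
  obtain a M where M: "N = int p ^ a * M" "coprime M (int p)" using split_p_part[OF N(1)] .
  \<comment> \<open>The factor p^a in \<open>N\<close> costs \<open>a\<close> digits, which are
    taken from a later component.\<close>
  let ?j = "k + a"
  have "(\<Sum>v\<in>V. y v ?j * lap x v) = (\<Sum>v\<in>V. y v ?j * (N * of_bool (v = ?u))) - (\<Sum>v\<in>V. y v ?j * (N * of_bool (v = ?w)))"
    using N(2) by (simp add: right_diff_distrib sum_subtractf[symmetric])
  also have "\<dots> = N * (y ?u ?j - y ?w ?j)"
    using hd[OF e] tl[OF e] finite_V
    by (simp add: of_bool_def if_distrib right_diff_distrib mult.commute cong: if_cong)
  finally have "N * (y ?u ?j - y ?w ?j) = (\<Sum>v\<in>V. x v * lap (\<lambda>v. y v ?j) v)"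
    by (simp add: lap_pairing[of x])
  moreover have "q ?j dvd (\<Sum>v\<in>V. x v * lap (\<lambda>v. y v ?j) v)"
    using ker by (intro dvd_sum dvd_mult) (auto simp: cong_0_iff)
  ultimately have "int p ^ a * q k dvd int p ^ a * (M * (y ?u ?j - y ?w ?j))"
    by (simp add: M power_add ac_simps)
  then have "q k dvd M * (y ?u ?j - y ?w ?j)" using p_gt_1 by (simp del: power_Suc)
  then have "q k dvd y ?u ?j - y ?w ?j"
    using M(2) by (subst (asm) coprime_dvd_mult_right_iff) (auto simp: coprime_commute simp del: power_Suc)
  then have "[y ?u ?j = y ?w ?j] (mod q k)" by (simp add: cong_iff_dvd_diff)
  moreover have "[y ?u ?j = y ?u k] (mod q k)" "[y ?w ?j = y ?w k] (mod q k)"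
    using coherent_cong[of "y ?u" k ?j, OF coh[OF hd[OF e]]]
      coherent_cong[of "y ?w" k ?j, OF coh[OF tl[OF e]]] by simp_all
  ultimately show ?thesis by (meson cong_sym cong_trans)
qed

text \<open>Multiplication by \<open>u\<close> projects the cokernel of the Laplacian on degree zero divisors onto its
  \<open>p\<close>-primary part, on which it is the identity.\<close>

lemma p_primary_projector:
  obtains u :: int and K a :: nat where
    "\<And>d. (\<Sum>v\<in>V. d v) = 0 \<Longrightarrow> \<exists>Y. \<forall>v\<in>V. lap Y v = u * q K * d v"
    "\<And>d. (\<Sum>v\<in>V. d v) = 0 \<Longrightarrow> \<exists>Y. \<forall>v\<in>V. lap Y v = int p ^ a * u * d v"
    "\<And>d Z j. (\<Sum>v\<in>V. d v) = 0 \<Longrightarrow> (\<And>v. v \<in> V \<Longrightarrow> lap Z v = int p ^ j * d v) \<Longrightarrow>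
       \<exists>Y. \<forall>v\<in>V. lap Y v = d v - u * d v"
    "\<And>x Y. (\<And>v k. v \<in> V \<Longrightarrow> [x v (Suc k) = x v k] (mod q k)) \<Longrightarrow> (\<And>k. (\<Sum>v\<in>V. x v k) = 0) \<Longrightarrow>
       (\<And>v. v \<in> V \<Longrightarrow> lap Y v = u * x v K) \<Longrightarrow>
       \<exists>y. (\<forall>v\<in>V. \<forall>k. [y v (Suc k) = y v k] (mod q k)) \<and>
           (\<forall>v\<in>V. \<forall>k. [lap (\<lambda>v. y v k) v = x v k] (mod q k))"
proof -
  obtain N :: int and \<Theta> where "N \<noteq> 0" and
    \<Theta>: "\<And>q v. (\<Sum>v\<in>V. q v) = 0 \<Longrightarrow> v \<in> V \<Longrightarrow> lap (\<lambda>v. \<Sum>u\<in>V. q u * \<Theta> u v) v = N * q v"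
    using lap_quasi_inverse by blast
  obtain a M where M: "N = int p ^ a * M" "coprime M (int p)" using split_p_part[OF \<open>N \<noteq> 0\<close>] .
  have M': "coprime M (int p ^ k)" for k using M(2) by simp
  define minv where "minv k = (SOME m. [M * m = 1] (mod int p ^ k))" for k
  have minv: "[M * minv k = 1] (mod int p ^ k)" for k
    unfolding minv_def using cong_solve_coprime_int[OF M', of k] by (rule someI_ex)
  \<comment> \<open>The idempotent of the Chinese remainder theorem: N = p^a M annihilates the
    cokernel, and \<open>u\<close> is divisible by M and congruent to 1 modulo p^a.\<close>
  define u where "u = M * minv a"
  have u1: "int p ^ a dvd 1 - u"
    using minv[of a] by (simp add: u_def cong_iff_dvd_diff dvd_diff_commute)
  have mult: "\<exists>Y. \<forall>v\<in>V. lap Y v = N * t * d v" if "(\<Sum>v\<in>V. d v) = 0" for d t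
    using \<Theta>[OF that] by (intro exI[of _ "\<lambda>v. t * (\<Sum>u\<in>V. d u * \<Theta> u v)"]) (simp add: lap_mult)
  \<comment> \<open>Component \<open>a\<close> is deep enough for truncation: \<open>u * q a\<close>
    is a multiple of \<open>N\<close>, so it annihilates the cokernel.\<close>
  show ?thesis
  proof (rule that[of u a a])
    fix d assume d: "(\<Sum>v\<in>V. d v) = (0::int)"
    show "\<exists>Y. \<forall>v\<in>V. lap Y v = u * q a * d v"
      using mult[OF d, of "minv a * int p"] by (simp add: u_def M mult_ac)
    show "\<exists>Y. \<forall>v\<in>V. lap Y v = int p ^ a * u * d v"
      using mult[OF d, of "minv a"] by (simp add: u_def M mult_ac)
  next
    fix d Z j assume d: "(\<Sum>v\<in>V. d v) = (0::int)" and Z: "\<And>v. v \<in> V \<Longrightarrow> lap Z v = int p ^ j * d v"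
    \<comment> \<open>If p^j d is principal, write 1 as M \<open>minv j\<close> - p^j s. Then (1 -
      u) d splits into a multiple of p^a M d = N d and a multiple of p^j d, and both parts are
      principal.\<close>
    obtain t where t: "1 - u = int p ^ a * t" using u1 by (auto elim: dvdE)
    obtain s where s: "M * minv j - 1 = int p ^ j * s"
      using minv[of j] by (auto simp: cong_iff_dvd_diff elim: dvdE)
    obtain Y where Y: "\<forall>v\<in>V. lap Y v = N * (t * minv j) * d v" using mult[OF d] by blast
    have "lap (\<lambda>v. Y v - (1 - u) * s * Z v) v = d v - u * d v" if v: "v \<in> V" for v
    proof -
      have "lap (\<lambda>v. Y v - (1 - u) * s * Z v) v = lap Y v - (1 - u) * s * lap Z v"
        by (simp add: lap_diff lap_mult)
      also have "\<dots> = (1 - u) * d v * (M * minv j - int p ^ j * s)"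
        using Y v by (simp add: Z M t algebra_simps)
      also have "M * minv j - int p ^ j * s = 1" using s by simp
      finally show ?thesis by (simp add: algebra_simps)
    qed
    then show "\<exists>Y. \<forall>v\<in>V. lap Y v = d v - u * d v" by blast
  next
    fix x :: "'v \<Rightarrow> nat \<Rightarrow> int" and Y
    assume coh: "\<And>v k. v \<in> V \<Longrightarrow> [x v (Suc k) = x v k] (mod q k)"
      and sum: "\<And>k. (\<Sum>v\<in>V. x v k) = 0" and Y: "\<And>v. v \<in> V \<Longrightarrow> lap Y v = u * x v a"
    \<comment> \<open>Precision is raised by more than \<open>a\<close> digits, because
      \<open>z\<close> is obtained by a division by p^a.\<close>
    define j where "j k = k + a + 1" for k
    define z where "z k v = (x v (j k) - u * x v a) div int p ^ a" for k v
    have coh': "[x v k' = x v k] (mod q k)" if "v \<in> V" "k \<le> k'" for v k k'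
      using coherent_cong[of "x v", OF coh] that by blast
    have z: "x v (j k) - u * x v a = int p ^ a * z k v" if v: "v \<in> V" for k v
    proof -
      have "int p ^ a dvd q a" by (intro le_imp_power_dvd) simp
      \<comment> \<open>The numerator of \<open>z\<close> is (x_j - x_a) + (1 - u) x_a; coherence
        handles the first summand and the choice of \<open>u\<close> the second.\<close>
      moreover have "q a dvd x v (j k) - x v a"
        using coh'[OF v, of a "j k"] by (simp add: j_def cong_iff_dvd_diff)
      ultimately have "int p ^ a dvd (x v (j k) - x v a) + (1 - u) * x v a"
        using u1 by (intro dvd_add dvd_mult2[OF u1]) (rule dvd_trans)
      then show ?thesis by (simp add: z_def algebra_simps)
    qed
    have sz: "(\<Sum>v\<in>V. z k v) = 0" for k
    proof -
      have "int p ^ a * (\<Sum>v\<in>V. z k v) = (\<Sum>v\<in>V. x v (j k) - u * x v a)"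
        using z by (simp add: sum_distrib_left)
      also have "\<dots> = 0" using sum by (simp add: sum_subtractf sum_distrib_left[symmetric])
      finally show ?thesis using p_gt_1 by simp
    qed
    \<comment> \<open>\<open>Y\<close> already accounts for u x_a. The remainder p^a z is N z
      divided by M, so the Green kernel solves for it once M is inverted modulo \<open>q k\<close>,
      that is modulo the power k + 1 of p.\<close>
    define y where "y v k = Y v + minv (Suc k) * (\<Sum>u\<in>V. z k u * \<Theta> u v)" for v k
    have cz: "[z (Suc k) v = z k v] (mod q k)" if v: "v \<in> V" for v k
    proof -
      have "q (k + a) dvd x v (j (Suc k)) - x v (j k)"
      proof (rule dvd_trans)
        show "q (k + a) dvd q (j k)" by (rule q_dvd) (simp add: j_def)
        show "q (j k) dvd x v (j (Suc k)) - x v (j k)"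
          using coh'[OF v, of "j k" "j (Suc k)"] unfolding cong_iff_dvd_diff by (simp add: j_def)
      qed
      also have "x v (j (Suc k)) - x v (j k) = int p ^ a * (z (Suc k) v - z k v)"
        using z[OF v, of k] z[OF v, of "Suc k"] by (simp add: algebra_simps)
      finally have "int p ^ a * q k dvd int p ^ a * (z (Suc k) v - z k v)"
        by (simp add: power_add ac_simps)
      then show ?thesis using p_gt_1 by (simp add: cong_iff_dvd_diff del: power_Suc)
    qed
    have cm: "[minv (Suc (Suc k)) = minv (Suc k)] (mod q k)" for k
    proof -
      have "[M * minv (Suc (Suc k)) = 1] (mod q k)"
        by (rule cong_dvd_modulus[OF minv[of "Suc (Suc k)"] q_dvd]) simp
      then have "[M * minv (Suc (Suc k)) = M * minv (Suc k)] (mod q k)"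
        by (rule cong_trans[OF _ cong_sym[OF minv[of "Suc k"]]])
      then show ?thesis by (rule cong_mult_lcancel[OF M', THEN iffD1])
    qed
    have "[y v (Suc k) = y v k] (mod q k)" for v k
      unfolding y_def by (intro cong_add cong_mult cong_sum cong_refl cm cz)
    moreover have "[lap (\<lambda>v. y v k) v = x v k] (mod q k)" if v: "v \<in> V" for v k
    proof -
      have "lap (\<lambda>v. y v k) v = u * x v a + minv (Suc k) * (N * z k v)"
        using Y[OF v] \<Theta>[OF sz v] by (simp add: y_def lap_add lap_mult)
      also have "\<dots> = u * x v a + (M * minv (Suc k)) * (int p ^ a * z k v)" by (simp add: M)
      also have "[\<dots> = u * x v a + 1 * (int p ^ a * z k v)] (mod q k)"
        by (intro cong_add cong_mult cong_refl minv)
      also have "u * x v a + 1 * (int p ^ a * z k v) = x v (j k)" using z[OF v, of k] by simp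
      also have "[x v (j k) = x v k] (mod q k)" using coh'[OF v, of k "j k"] by (simp add: j_def)
      finally show ?thesis .
    qed
    ultimately show "\<exists>y. (\<forall>v\<in>V. \<forall>k. [y v (Suc k) = y v k] (mod q k)) \<and>
           (\<forall>v\<in>V. \<forall>k. [lap (\<lambda>v. y v k) v = x v k] (mod q k))" by blast
  qed
qed

end

section \<open>Division of p-adic measures by a difference operator\<close>

text \<open>Mixed radix: \<open>t\<close> is written as j + j' A.\<close>

lemma sum_lessThan_mult:
  fixes f :: "nat \<Rightarrow> 'a::comm_monoid_add"
  shows "(\<Sum>t<A*B. f t) = (\<Sum>j<A. \<Sum>j'<B. f (j + j' * A))"
proof -
  have "(\<Sum>t<A*B. f t) = (\<Sum>m<B. sum f {m*A..<m*A+A})"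
    by (simp add: sum.nat_group mult.commute)
  also have "\<dots> = (\<Sum>m<B. \<Sum>j<A. f (j + m*A))"
  proof (rule sum.cong[OF refl])
    show "sum f {m*A..<m*A+A} = (\<Sum>j<A. f (j + m*A))" for m
      using sum.shift_bounds_nat_ivl[of f 0 "m*A" A] by (simp add: lessThan_atLeast0 add.commute)
  qed
  finally show ?thesis by (simp add: sum.swap[of _ "{..<B}"])
qed

context padic
begin

text \<open>A p-adic measure on \<open>\<int>\<^sub>p\<close> is given by the masses \<open>a m i\<close> of the residue classes of \<open>i\<close>
  modulo \<open>p ^ m\<close>; these are coherent sequences of integers.\<close>

definition padic_measure :: "(nat \<Rightarrow> nat \<Rightarrow> nat \<Rightarrow> int) \<Rightarrow> bool" where
  "padic_measure a \<longleftrightarrow>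
     (\<forall>m i k. [a m (i + p ^ m) k = a m i k] (mod q k)) \<and>
     (\<forall>m i k. [(\<Sum>j<p. a (Suc m) (i + j * p ^ m) k) = a m i k] (mod q k)) \<and>
     (\<forall>m i k. [a m i (Suc k) = a m i k] (mod q k))"

lemma p_pow_pos: "p ^ n > 0"
  using prime_gt_0_nat[OF prime_p] by simp

lemma cong_iterate:
  fixes f :: "nat \<Rightarrow> int"
  assumes "\<And>i. [f (i + T) = f i] (mod Q)" shows "[f (i + t * T) = f i] (mod Q)"
proof (induction t)
  case (Suc t)
  then show ?case using assms[of "i + t * T"] cong_trans by (simp add: ac_simps) blast
qed simp

text \<open>The p^e terms repeat with period p^n in the index, so the sum is p^(e - n) times a
  shorter one; the bound on \<open>e\<close> makes this factor divisible by
  \<open>q k\<close>.\<close>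

lemma periodic_sum:
  fixes c :: "nat \<Rightarrow> int"
  assumes c: "\<And>i. [c (i + p ^ n) = c i] (mod q k)" and e: "n + k + 1 \<le> e"
  shows "[(\<Sum>j<p^e. c (i + j * p ^ m)) = 0] (mod q k)"
proof -
  define R where "R = p ^ (e - n)"
  have pe: "p ^ e = p ^ n * R" using e by (simp add: R_def power_add[symmetric])
  have "(\<Sum>j<p^e. c (i + j * p ^ m)) = (\<Sum>j<p^n. \<Sum>j'<R. c (i + j * p^m + (j' * p^m) * p^n))"
    unfolding pe sum_lessThan_mult by (simp add: algebra_simps)
  also have "[\<dots> = (\<Sum>j<p^n. \<Sum>j'<R. c (i + j * p^m))] (mod q k)"
    by (intro cong_sum cong_iterate c)
  also have "(\<Sum>j<p^n. \<Sum>j'<R. c (i + j * p^m)) = int R * (\<Sum>j<p^n. c (i + j * p^m))"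
    by (simp add: sum_distrib_left)
  also have "[\<dots> = 0] (mod q k)"
  proof -
    have "q k dvd int R" unfolding R_def of_nat_power using e by (intro le_imp_power_dvd) auto
    then show ?thesis by (simp add: cong_0_iff)
  qed
  finally show ?thesis .
qed

context
  fixes a :: "nat \<Rightarrow> nat \<Rightarrow> nat \<Rightarrow> int"
  assumes a: "padic_measure a"
begin

lemma measure_per: "[a m (i + p ^ m) k = a m i k] (mod q k)"
  and measure_push: "[(\<Sum>j<p. a (Suc m) (i + j * p ^ m) k) = a m i k] (mod q k)"
  and measure_coh: "[a m i (Suc k) = a m i k] (mod q k)"
  using a by (auto simp: padic_measure_def)

lemma measure_push_iterate: "[(\<Sum>j<p^e. a (m + e) (i + j * p ^ m) k) = a m i k] (mod q k)"
proof (induction e)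
  case (Suc e)
  have eq: "(\<Sum>j<p^Suc e. a (m + Suc e) (i + j * p ^ m) k)
      = (\<Sum>j<p^e. \<Sum>j'<p. a (Suc (m + e)) (i + j * p^m + j' * p^(m+e)) k)"
    using sum_lessThan_mult[of "\<lambda>j. a (m + Suc e) (i + j * p ^ m) k" "p^e" p]
    by (simp add: algebra_simps power_add)
  have "[(\<Sum>j<p^e. \<Sum>j'<p. a (Suc (m + e)) (i + j * p^m + j' * p^(m+e)) k)
      = (\<Sum>j<p^e. a (m + e) (i + j * p^m) k)] (mod q k)"
    by (intro cong_sum measure_push)
  then show ?case unfolding eq by (rule cong_trans[OF _ Suc.IH])
qed simp

text \<open>There is no nonzero translation-invariant measure with values in Z_p: subdividing a
  class into p^e classes at a deep level makes its mass divisible by an arbitrary power of p. This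
  gives the injectivity of multiplication by \<open>omega n\<close>.\<close>

lemma measure_periodic_zero:
  assumes "\<And>m i k. [a m (i + p ^ n) k = a m i k] (mod q k)"
  shows "[a m i k = 0] (mod q k)"
proof -
  let ?e = "n + k + 1"
  have "[(\<Sum>j<p^?e. a (m + ?e) (i + j * p ^ m) k) = 0] (mod q k)"
    using periodic_sum[of "\<lambda>i. a (m + ?e) i k" n k ?e i m] assms by simp
  then show ?thesis using measure_push_iterate[of m ?e i k] by (meson cong_sym cong_trans)
qed

text \<open>On each finite level the difference equation is solved by the partial sums \<open>psum\<close>. Solutions on one level
  differ by \<open>p ^ n\<close>-periodic functions, which become divisible by a high power of \<open>p\<close> when they are pushed
  forward from a high level; hence the push-forwards stabilise.\<close>

definition psum :: "nat \<Rightarrow> nat \<Rightarrow> nat \<Rightarrow> nat \<Rightarrow> int" where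
  "psum n M k i = (\<Sum>l<i div p^n. a M (i mod p^n + Suc l * p^n) k)"

definition push_psum :: "nat \<Rightarrow> nat \<Rightarrow> nat \<Rightarrow> nat \<Rightarrow> nat \<Rightarrow> int" where
  "push_psum n m k e i = (\<Sum>j<p^e. psum n (m + e) k (i + j * p^m))"

lemma psum_step: "psum n M k (i + p^n) = psum n M k i + a M (i + p^n) k"
  using p_pow_pos[of n] by (simp add: psum_def algebra_simps)

lemma psum_steps: "psum n M k (i + t * p^n) = psum n M k i + (\<Sum>l<t. a M (i + p^n + l * p^n) k)"
proof (induction t)
  case (Suc t)
  have "psum n M k (i + Suc t * p^n) = psum n M k (i + t * p^n + p^n)" by (simp add: algebra_simps)
  also have "\<dots> = psum n M k (i + t * p^n) + a M (i + t * p^n + p^n) k" by (rule psum_step)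
  finally show ?case using Suc by (simp add: algebra_simps)
qed simp

lemma psum_coh: "[psum n M (Suc k) i = psum n M k i] (mod q k)"
  unfolding psum_def by (intro cong_sum measure_coh)

context
  fixes n
  assumes zero: "\<And>i k. [a n i k = 0] (mod q k)"
begin

text \<open>Going once around the residues modulo p^M adds the masses, at level M, of all subclasses
  of one class modulo p^n. Their sum is the mass at level n, which vanishes by \<open>zero\<close>.
  So this hypothesis is the solvability condition of the difference equation.\<close>

lemma psum_per:
  assumes "n \<le> M" shows "[psum n M k (i + p^M) = psum n M k i] (mod q k)"
proof -
  obtain e where M: "M = n + e" using assms le_Suc_ex by blast
  have "psum n M k (i + p^M) = psum n M k i + (\<Sum>l<p^e. a (n + e) (i + p^n + l * p^n) k)"
    using psum_steps[of n M k i "p^e"] by (simp add: M power_add mult.commute)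
  also have "[\<dots> = psum n M k i + 0] (mod q k)"
    by (intro cong_add cong_refl cong_trans[OF measure_push_iterate zero])
  finally show ?thesis by simp
qed

lemma push_psum_Suc:
  assumes e: "n + k + 1 \<le> e"
  shows "[push_psum n m k (Suc e) i = push_psum n m k e i] (mod q k)"
proof -
  let ?M = "m + e"
  define c where "c i = (\<Sum>j'<p. psum n (Suc ?M) k (i + j' * p^?M)) - psum n ?M k i" for i
  have per: "[c (i + p^n) = c i] (mod q k)" for i
  proof -
    have "c (i + p^n) - c i = (\<Sum>j'<p. a (Suc ?M) (i + p^n + j' * p^?M) k) - a ?M (i + p^n) k"
    proof -
      have "psum n (Suc ?M) k (i + p^n + j' * p^?M) = psum n (Suc ?M) k (i + j' * p^?M) + a (Suc ?M) (i + p^n + j' * p^?M) k" for j'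
        using psum_step[of n "Suc ?M" k "i + j' * p^?M"] by (simp add: ac_simps)
      then show ?thesis by (simp add: c_def psum_step sum.distrib)
    qed
    also have "[\<dots> = 0] (mod q k)"
      using measure_push[of ?M "i + p^n" k] by (simp add: cong_iff_dvd_diff)
    finally show ?thesis by (simp add: cong_iff_dvd_diff)
  qed
  have "push_psum n m k (Suc e) i = (\<Sum>j<p^e. \<Sum>j'<p. psum n (Suc ?M) k (i + j * p^m + j' * p^?M))"
    unfolding push_psum_def
    using sum_lessThan_mult[of "\<lambda>j. psum n (m + Suc e) k (i + j * p^m)" "p^e" p]
    by (simp add: algebra_simps power_add)
  then have "push_psum n m k (Suc e) i - push_psum n m k e i = (\<Sum>j<p^e. c (i + j * p^m))"
    by (simp add: push_psum_def c_def sum_subtractf)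
  then show ?thesis using periodic_sum[of c n k e i m, OF per e] by (simp add: cong_iff_dvd_diff)
qed

text \<open>\<open>n + k + 1\<close> is the depth at which \<open>push_psum_Suc\<close> makes the
  push-forward stable modulo \<open>q k\<close>.\<close>

definition quotient_measure :: "nat \<Rightarrow> nat \<Rightarrow> nat \<Rightarrow> int" where
  "quotient_measure m i k = push_psum n m k (n + k + 1) i"

lemma quotient_measure_measure: "padic_measure quotient_measure"
  unfolding padic_measure_def
proof (intro conjI allI)
  fix m i k
  let ?e = "n + k + 1"
  \<comment> \<open>A shift by p^m moves each sampled point to the next one. The sum telescopes to
    two end points one full period apart.\<close>
  have "quotient_measure m (i + p^m) k - quotient_measure m i k
      = (\<Sum>j<p^?e. psum n (m + ?e) k (i + Suc j * p^m) - psum n (m + ?e) k (i + j * p^m))"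
    by (simp add: quotient_measure_def push_psum_def sum_subtractf algebra_simps)
  also have "\<dots> = psum n (m + ?e) k (i + p^?e * p^m) - psum n (m + ?e) k i"
    using sum_lessThan_telescope[of "\<lambda>j. psum n (m + ?e) k (i + j * p^m)" "p^?e"] by simp
  also have "p^?e * p^m = p^(m + ?e)" by (simp add: power_add)
  also have "[psum n (m + ?e) k (i + p^(m + ?e)) - psum n (m + ?e) k i = 0] (mod q k)"
    using psum_per[of "m + ?e" k i] by (simp add: cong_iff_dvd_diff)
  finally show "[quotient_measure m (i + p^m) k = quotient_measure m i k] (mod q k)"
    by (simp add: cong_iff_dvd_diff)
  \<comment> \<open>Pushing from level m + 1 + e to m + 1 and then to m is pushing by e + 1 steps,
    which agrees with e steps by stability.\<close>
  have "(\<Sum>j<p. quotient_measure (Suc m) (i + j * p^m) k) = push_psum n m k (Suc ?e) i"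
    using sum_lessThan_mult[of "\<lambda>j. psum n (m + Suc ?e) k (i + j * p^m)" p "p^?e"]
    by (simp add: quotient_measure_def push_psum_def algebra_simps)
  then show "[(\<Sum>j<p. quotient_measure (Suc m) (i + j * p^m) k) = quotient_measure m i k] (mod q k)"
    using push_psum_Suc[of k ?e m i] by (simp add: quotient_measure_def)
  have "[quotient_measure m i (Suc k) = push_psum n m k (Suc ?e) i] (mod q k)"
    unfolding quotient_measure_def push_psum_def using psum_coh by (simp add: cong_sum)
  then show "[quotient_measure m i (Suc k) = quotient_measure m i k] (mod q k)"
    using push_psum_Suc[of k ?e m i] cong_trans by (simp add: quotient_measure_def) blast
qed

lemma quotient_measure_eq:
  "[quotient_measure m (i + p^n) k - quotient_measure m i k = a m (i + p^n) k] (mod q k)"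
proof -
  let ?e = "n + k + 1"
  have "psum n (m + ?e) k (i + p^n + j * p^m) - psum n (m + ?e) k (i + j * p^m) = a (m + ?e) (i + p^n + j * p^m) k" for j
    using psum_step[of n "m + ?e" k "i + j * p^m"] by (simp add: ac_simps)
  then have "quotient_measure m (i + p^n) k - quotient_measure m i k = (\<Sum>j<p^?e. a (m + ?e) (i + p^n + j * p^m) k)"
    by (simp add: quotient_measure_def push_psum_def sum_subtractf[symmetric])
  then show ?thesis using measure_push_iterate[of m ?e "i + p^n" k] by simp
qed

end
end

lemma padic_measure_quotient:
  assumes "padic_measure a" "\<And>i k. [a n i k = 0] (mod q k)"
  obtains y where "padic_measure y" "\<And>m i k. [y m (i + p^n) k - y m i k = a m (i + p^n) k] (mod q k)"
  using quotient_measure_measure[OF assms] quotient_measure_eq[OF assms] by blast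

end

section \<open>The group \<open>\<Gamma>\<close> and its finite quotients\<close>

locale padic_group = padic p + \<Gamma>?: group \<Gamma>
  for p :: nat and \<Gamma> :: "'g monoid" (structure) +
  fixes T :: "'g topology" and \<phi> :: "'g \<Rightarrow> nat \<Rightarrow> int" and \<gamma> :: 'g
  assumes topspace: "topspace T = carrier \<Gamma>"
    and iso: "\<phi> \<in> iso \<Gamma> (add_monoid (Zp p))" and homeo: "homeomorphic_map T (Zp_topology p) \<phi>"
    and \<gamma>: "\<gamma> \<in> carrier \<Gamma>" and dense: "T closure_of generate \<Gamma> {\<gamma>} = carrier \<Gamma>"
begin

lemma \<phi>_closed: "g \<in> carrier \<Gamma> \<Longrightarrow> \<phi> g \<in> carrier (Zp p)"
  and \<phi>_mult: "g \<in> carrier \<Gamma> \<Longrightarrow> h \<in> carrier \<Gamma> \<Longrightarrow> \<phi> (g \<otimes> h) = \<phi> g \<oplus>\<^bsub>Zp p\<^esub> \<phi> h"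
  and \<phi>_inj: "inj_on \<phi> (carrier \<Gamma>)" and \<phi>_onto: "\<phi> ` carrier \<Gamma> = carrier (Zp p)"
  using iso by (auto simp: iso_def hom_def bij_betw_def)

lemma \<phi>_one: "\<phi> \<one> = \<zero>\<^bsub>Zp p\<^esub>"
  and \<phi>_inv: "g \<in> carrier \<Gamma> \<Longrightarrow> \<phi> (inv g) = \<ominus>\<^bsub>Zp p\<^esub> \<phi> g"
proof -
  interpret h: group_hom \<Gamma> "add_monoid (Zp p)" \<phi>
    using iso by unfold_locales (auto simp: iso_def)
  show "\<phi> \<one> = \<zero>\<^bsub>Zp p\<^esub>" using h.hom_one by simp
  show "g \<in> carrier \<Gamma> \<Longrightarrow> \<phi> (inv g) = \<ominus>\<^bsub>Zp p\<^esub> \<phi> g" using h.hom_inv by (simp add: a_inv_def)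
qed

lemma \<Gamma>_comm: "comm_group \<Gamma>"
proof (rule group_comm_groupI)
  fix x y assume "x \<in> carrier \<Gamma>" "y \<in> carrier \<Gamma>"
  then have "\<phi> (x \<otimes> y) = \<phi> (y \<otimes> x)" by (simp add: \<phi>_mult \<phi>_closed Zp.a_comm)
  then show "x \<otimes> y = y \<otimes> x"
    using \<phi>_inj \<open>x \<in> carrier \<Gamma>\<close> \<open>y \<in> carrier \<Gamma>\<close> by (auto dest: inj_onD)
qed

sublocale \<Gamma>?: comm_group \<Gamma> by (rule \<Gamma>_comm)

lemma \<phi>_nat_pow: "g \<in> carrier \<Gamma> \<Longrightarrow> \<phi> (g [^] (i::nat)) k = (int i * \<phi> g k) mod q k"
proof (induction i)
  case 0
  show ?case by (simp add: Zp_simps \<phi>_one)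
next
  case (Suc i)
  then show ?case by (simp add: \<phi>_mult Zp_simps mod_simps algebra_simps del: power_Suc)
qed

lemma \<phi>_int_pow: "g \<in> carrier \<Gamma> \<Longrightarrow> \<phi> (g [^] (i::int)) k = (i * \<phi> g k) mod q k"
proof (cases "i < 0")
  assume g: "g \<in> carrier \<Gamma>"
  case True
  then have "g [^] i = inv (g [^] nat (- i))" by (simp only: int_pow_def2 if_True)
  then have "\<phi> (g [^] i) k = (\<ominus>\<^bsub>Zp p\<^esub> \<phi> (g [^] nat (- i))) k" using g by (simp only: \<phi>_inv nat_pow_closed)
  also have "\<dots> = (- \<phi> (g [^] nat (- i)) k) mod q k" using g by (intro Zp_uminus \<phi>_closed nat_pow_closed)
  also have "\<phi> (g [^] nat (- i)) k = (- i * \<phi> g k) mod q k"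
    unfolding \<phi>_nat_pow[OF g] using True by (simp only: int_nat_eq) simp
  finally have "\<phi> (g [^] i) k = (- ((- i * \<phi> g k) mod q k)) mod q k" .
  then show ?thesis by (simp only: mod_minus_eq) simp
next
  assume g: "g \<in> carrier \<Gamma>"
  case False
  then have eq: "g [^] i = g [^] nat i" by (simp only: int_pow_def2 if_False)
  show ?thesis unfolding eq \<phi>_nat_pow[OF g] using False by simp
qed

text \<open>A component of an element determines all earlier ones, so a finite set of conditions on
  components reduces to agreement in a single late component.\<close>

lemma Zp_closure:
  assumes S: "S \<subseteq> carrier (Zp p)"
  shows "x \<in> Zp_topology p closure_of S \<longleftrightarrow> x \<in> carrier (Zp p) \<and> (\<forall>k. \<exists>s\<in>S. s k = x k)"
proof -
  let ?P = "product_topology (\<lambda>_::nat. discrete_topology (UNIV::int set)) UNIV"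
  have ts: "topspace (Zp_topology p) = carrier (Zp p)" by (simp add: Zp_topology_def)
  show ?thesis
  proof (intro iffI conjI allI)
    fix k assume x: "x \<in> Zp_topology p closure_of S"
    then show xc: "x \<in> carrier (Zp p)" using ts by (auto simp: in_closure_of)
    define U where "U = {y \<in> topspace ?P. y k \<in> {x k}} \<inter> carrier (Zp p)"
    have "openin ?P {y \<in> topspace ?P. y k \<in> {x k}}"
      by (rule openin_continuous_map_preimage[OF continuous_map_product_projection]) auto
    then have "openin (Zp_topology p) U"
      unfolding Zp_topology_def openin_subtopology U_def by blast
    moreover have "x \<in> U" using xc by (simp add: U_def)
    ultimately obtain s where "s \<in> S" "s \<in> U" using x unfolding in_closure_of by blast
    then show "\<exists>s\<in>S. s k = x k" by (intro bexI[of _ s]) (simp_all add: U_def)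
  next
    assume x: "x \<in> carrier (Zp p) \<and> (\<forall>k. \<exists>s\<in>S. s k = x k)"
    show "x \<in> Zp_topology p closure_of S"
      unfolding in_closure_of
    proof (intro conjI allI impI)
      show "x \<in> topspace (Zp_topology p)" using x ts by simp
      fix U assume U: "x \<in> U \<and> openin (Zp_topology p) U"
      then obtain W where W: "openin ?P W" "U = W \<inter> carrier (Zp p)"
        unfolding Zp_topology_def openin_subtopology by blast
      then obtain B where B: "x \<in> Pi\<^sub>E UNIV B" "finite {i. B i \<noteq> UNIV}" "Pi\<^sub>E UNIV B \<subseteq> W"
        using product_topology_open_contains_basis[of "\<lambda>_::nat. discrete_topology (UNIV::int set)" UNIV W x] U by auto
      obtain k where k: "\<And>i. B i \<noteq> UNIV \<Longrightarrow> i \<le> k"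
        using B(2) finite_nat_set_iff_bounded_le by auto
      obtain s where s: "s \<in> S" "s k = x k" using x by blast
      have "s i = x i" if "i \<le> k" for i
        using Zp_coherent[of s i k] Zp_coherent[of x i k] s x S that by auto
      then have "s i \<in> B i" for i using B(1) k by (cases "B i = UNIV") (auto simp: PiE_iff)
      then have "s \<in> Pi\<^sub>E UNIV B" by (simp add: PiE_iff)
      then show "\<exists>y. y \<in> S \<and> y \<in> U" using s W B S by blast
    qed
  qed
qed

text \<open>The homeomorphism \<phi> transports the closure to Z_p, where powers of \<open>a\<close>
  become integer multiples and closure means approximation in every component.\<close>

lemma closure_generate:
  assumes a: "a \<in> carrier \<Gamma>"
  shows "g \<in> T closure_of generate \<Gamma> {a} \<longleftrightarrow> g \<in> carrier \<Gamma> \<and> (\<forall>k. \<exists>i. [i * \<phi> a k = \<phi> g k] (mod q k))"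
proof -
  let ?S = "generate \<Gamma> {a}"
  have S: "?S = range (\<lambda>i::int. a [^] i)" using generate_pow[OF a] by auto
  have Sc: "?S \<subseteq> carrier \<Gamma>" using S a by auto
  have "Zp_topology p closure_of (\<phi> ` ?S) = \<phi> ` (T closure_of ?S)"
    using homeomorphic_map_closure_of[OF homeo] Sc topspace by auto
  moreover have "T closure_of ?S \<subseteq> carrier \<Gamma>" using closure_of_subset_topspace topspace by metis
  ultimately have "g \<in> T closure_of ?S \<longleftrightarrow> g \<in> carrier \<Gamma> \<and> \<phi> g \<in> Zp_topology p closure_of (\<phi> ` ?S)"
    using \<phi>_inj by (auto dest: inj_onD)
  also have "\<dots> \<longleftrightarrow> g \<in> carrier \<Gamma> \<and> (\<forall>k. \<exists>s\<in>\<phi> ` ?S. s k = \<phi> g k)"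
    using Zp_closure[of "\<phi> ` ?S"] Sc \<phi>_closed by auto
  also have "\<dots> \<longleftrightarrow> g \<in> carrier \<Gamma> \<and> (\<forall>k. \<exists>i. [i * \<phi> a k = \<phi> g k] (mod q k))"
    unfolding S using a \<phi>_closed[of g] Zp_mod_self[of "\<phi> g"] by (auto simp: \<phi>_int_pow cong_def simp del: power_Suc)
  finally show ?thesis .
qed

text \<open>The residue of the coordinate modulo p^m. It sits in component m - 1; the trivial level
  m = 0 has no component and is set to 0.\<close>

definition res :: "nat \<Rightarrow> 'g \<Rightarrow> int" where
  "res m g = (if m = 0 then 0 else \<phi> g (m - 1))"

lemma res_cong: "g \<in> carrier \<Gamma> \<Longrightarrow> m \<le> Suc k \<Longrightarrow> [\<phi> g k = res m g] (mod int p ^ m)"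
  using Zp_cong[OF \<phi>_closed, of g "m - 1" k] by (cases m) (auto simp: res_def)

lemma res_bounds: "g \<in> carrier \<Gamma> \<Longrightarrow> 0 \<le> res m g \<and> res m g < int p ^ m"
  using Zp_bounds[OF \<phi>_closed, of g "m - 1"] by (cases m) (auto simp: res_def)

lemma res_eqI: "g \<in> carrier \<Gamma> \<Longrightarrow> h \<in> carrier \<Gamma> \<Longrightarrow> [res m g = res m h] (mod int p ^ m) \<Longrightarrow> res m g = res m h"
  using res_bounds[of g m] res_bounds[of h m] by (simp add: cong_def)

lemma res_mult: "g \<in> carrier \<Gamma> \<Longrightarrow> h \<in> carrier \<Gamma> \<Longrightarrow> [res m (g \<otimes> h) = res m g + res m h] (mod int p ^ m)"
  by (cases m) (auto simp: res_def \<phi>_mult Zp_simps cong_def)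

lemma res_inv: "g \<in> carrier \<Gamma> \<Longrightarrow> [res m (inv g) = - res m g] (mod int p ^ m)"
  by (cases m) (auto simp: res_def \<phi>_inv Zp_uminus \<phi>_closed cong_def)

lemma res_pow: "g \<in> carrier \<Gamma> \<Longrightarrow> [res m (g [^] (i::nat)) = int i * res m g] (mod int p ^ m)"
  by (cases m) (auto simp: res_def \<phi>_nat_pow cong_def)

lemma res_onto: obtains g where "g \<in> carrier \<Gamma>" "\<phi> g = \<one>\<^bsub>Zp p\<^esub>"
  using \<phi>_onto Zp.one_closed by (metis imageE)

text \<open>If p divided the first component of \<gamma>, it would divide that of every element in
  the closure, yet some element has coordinate 1.\<close>

lemma \<gamma>_unit: "\<not> int p dvd \<phi> \<gamma> 0"
proof
  assume "int p dvd \<phi> \<gamma> 0"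
  obtain g where g: "g \<in> carrier \<Gamma>" "\<phi> g = \<one>\<^bsub>Zp p\<^esub>" by (rule res_onto)
  then have "\<forall>k. \<exists>i. [i * \<phi> \<gamma> k = \<phi> g k] (mod q k)"
    using closure_generate[OF \<gamma>, of g] dense by blast
  then obtain i where "[i * \<phi> \<gamma> 0 = \<phi> g 0] (mod q 0)" by blast
  then have "int p dvd i * \<phi> \<gamma> 0 - 1" using g by (simp add: Zp_simps cong_iff_dvd_diff)
  moreover have "int p dvd i * \<phi> \<gamma> 0" using \<open>int p dvd \<phi> \<gamma> 0\<close> by simp
  ultimately have "int p dvd 1" by (simp only: dvd_diff_right_iff)
  then show False using p_gt_1 by simp
qed

section \<open>The open subgroups of \<Gamma> and the finite quotients\<close>

abbreviation "GS m \<equiv> Gamma_sub p \<Gamma> T \<gamma> m"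
abbreviation "GQ m \<equiv> Gamma_quot p \<Gamma> T \<gamma> m"

lemma unit_coprime:
  assumes "g \<in> carrier \<Gamma>" "\<not> int p dvd \<phi> g 0" shows "coprime (\<phi> g k) (int p ^ m)"
proof -
  have "\<not> int p dvd \<phi> g k"
    using Zp_cong[OF \<phi>_closed[OF assms(1)], of 0 k] assms(2) cong_dvd_iff[of "\<phi> g k" "\<phi> g 0" "int p"] by simp
  then show ?thesis
    using prime_p by (simp add: prime_imp_coprime coprime_commute)
qed

text \<open>As \<gamma> corresponds to a unit of Z_p, the closed subgroup generated by its power p^m
  is p^m Z_p whatever the unit is. Later arguments use only this description, so that another
  generator can replace \<gamma>.\<close>

lemma GS_iff: "g \<in> GS m \<longleftrightarrow> g \<in> carrier \<Gamma> \<and> res m g = 0"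
proof -
  have P: "\<phi> (\<gamma> [^] (p ^ m)) k = (int p ^ m * \<phi> \<gamma> k) mod q k" for k
    using \<phi>_nat_pow[OF \<gamma>, of "p ^ m"] by simp
  have "g \<in> GS m \<longleftrightarrow> g \<in> carrier \<Gamma> \<and> (\<forall>k. \<exists>i. [i * (int p ^ m * \<phi> \<gamma> k) = \<phi> g k] (mod q k))"
    unfolding Gamma_sub_def using \<gamma> by (simp add: closure_generate P cong_def mod_simps del: power_Suc)
  also have "\<dots> \<longleftrightarrow> g \<in> carrier \<Gamma> \<and> res m g = 0"
  proof (intro conj_cong refl iffI allI)
    assume g: "g \<in> carrier \<Gamma>" and *: "\<forall>k. \<exists>i. [i * (int p ^ m * \<phi> \<gamma> k) = \<phi> g k] (mod q k)"
    show "res m g = 0"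
    proof (cases m)
      case (Suc k)
      then obtain i where "[i * (q k * \<phi> \<gamma> k) = \<phi> g k] (mod q k)" using * by blast
      then have "[\<phi> g k = 0] (mod q k)"
        by (metis cong_0_iff cong_sym cong_trans dvd_triv_left dvd_mult)
      then show ?thesis
        using Suc Zp_mod_self[OF \<phi>_closed[OF g], of k] by (simp add: res_def cong_def del: power_Suc)
    qed (simp add: res_def)
  next
    fix k assume g: "g \<in> carrier \<Gamma>" and 0: "res m g = 0"
    \<comment> \<open>From component m - 1 on, the component of \<gamma> is inverted modulo
      \<open>q k\<close>; the earlier components of \<open>g\<close> vanish together with component
      m - 1.\<close>
    show "\<exists>i. [i * (int p ^ m * \<phi> \<gamma> k) = \<phi> g k] (mod q k)"
    proof (cases "m \<le> Suc k")
      case True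
      then have "int p ^ m dvd \<phi> g k" using res_cong[OF g True] 0 by (simp add: cong_0_iff)
      then obtain t where t: "\<phi> g k = int p ^ m * t" by (auto elim: dvdE)
      obtain j where "[\<phi> \<gamma> k * j = 1] (mod q k)"
        using unit_coprime[OF \<gamma> \<gamma>_unit] cong_solve_coprime_int by blast
      then have "[(int p ^ m * t) * (\<phi> \<gamma> k * j) = (int p ^ m * t) * 1] (mod q k)"
        by (intro cong_mult cong_refl)
      then show ?thesis by (intro exI[of _ "t * j"]) (simp add: t ac_simps)
    next
      case False
      then have "m \<noteq> 0" "k \<le> m - 1" by auto
      then have "\<phi> g k = 0" using Zp_coherent[OF \<phi>_closed[OF g], of k "m - 1"] 0 by (simp add: res_def)
      then show ?thesis by (intro exI[of _ 0]) simp
    qed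
  qed
  finally show ?thesis .
qed

lemma GS_subgroup: "subgroup (GS m) \<Gamma>"
proof
  show "GS m \<subseteq> carrier \<Gamma>" by (auto simp: GS_iff)
  have "res m \<one> = 0" using res_pow[of \<one> m 0] res_bounds[of \<one> m] by (simp add: cong_def)
  then show "\<one> \<in> GS m" by (simp add: GS_iff)
  fix x y assume xy: "x \<in> GS m" "y \<in> GS m"
  then show "x \<otimes> y \<in> GS m"
    using res_mult[of x y m] res_bounds[of "x \<otimes> y" m] by (simp add: GS_iff cong_def)
  show "inv x \<in> GS m"
    using xy res_inv[of x m] res_bounds[of "inv x" m] by (simp add: GS_iff cong_def)
qed

lemma GS_normal: "GS m \<lhd> \<Gamma>"
  using GS_subgroup normal_iff_subgroup by blast

abbreviation "cl m g \<equiv> GS m #> g"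

lemma cl_eq_iff:
  assumes "g \<in> carrier \<Gamma>" "h \<in> carrier \<Gamma>" shows "cl m g = cl m h \<longleftrightarrow> res m g = res m h"
proof -
  have "cl m g = cl m h \<longleftrightarrow> g \<in> cl m h"
    using assms GS_subgroup repr_independence rcos_self by metis
  also have "\<dots> \<longleftrightarrow> g \<otimes> inv h \<in> GS m"
    using subgroup.rcos_module[OF GS_subgroup is_group, of h g] assms by auto
  also have "\<dots> \<longleftrightarrow> res m (g \<otimes> inv h) = 0" using assms by (simp add: GS_iff)
  also have "\<dots> \<longleftrightarrow> [res m g = res m h] (mod int p ^ m)"
  proof -
    have "[res m (g \<otimes> inv h) = res m g + - res m h] (mod int p ^ m)"
      using res_mult[of g "inv h" m] res_inv[of h m] assms cong_add[OF cong_refl] cong_trans by blast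
    moreover have "res m (g \<otimes> inv h) mod int p ^ m = res m (g \<otimes> inv h)"
      using res_bounds[of "g \<otimes> inv h" m] assms by simp
    ultimately show ?thesis by (simp add: cong_def cong_iff_dvd_diff mod_eq_dvd_iff dvd_eq_mod_eq_0)
  qed
  also have "\<dots> \<longleftrightarrow> res m g = res m h" using res_eqI assms by auto
  finally show ?thesis .
qed

lemma GQ_carrier: "carrier (GQ m) = cl m ` carrier \<Gamma>"
  by (auto simp: Gamma_quot_def FactGroup_def RCOSETS_def)

lemma GQ_mult: "g \<in> carrier \<Gamma> \<Longrightarrow> h \<in> carrier \<Gamma> \<Longrightarrow> cl m g \<otimes>\<^bsub>GQ m\<^esub> cl m h = cl m (g \<otimes> h)"
  by (simp add: Gamma_quot_def normal.rcos_sum[OF GS_normal])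

lemma GQ_comm_group: "comm_group (GQ m)"
  unfolding Gamma_quot_def by (rule abelian_FactGroup[OF GS_subgroup])

lemma GQ_one: "\<one>\<^bsub>GQ m\<^esub> = cl m \<one>"
  using subgroup.subset[OF GS_subgroup] by (simp add: Gamma_quot_def coset_mult_one)

lemma GQ_inv: assumes "g \<in> carrier \<Gamma>" shows "inv\<^bsub>GQ m\<^esub> cl m g = cl m (inv g)"
proof -
  interpret Q: comm_group "GQ m" by (rule GQ_comm_group)
  show ?thesis
    by (rule Q.inv_equality) (use assms in \<open>auto simp: GQ_mult GQ_one GQ_carrier\<close>)
qed

lemma GQ_finite: "finite (carrier (GQ m))"
proof -
  have "finite (res m ` carrier \<Gamma>)"
    by (rule finite_subset[of _ "{0..<int p ^ m}"]) (use res_bounds in auto)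
  moreover have "bij_betw (\<lambda>c. res m (SOME g. g \<in> carrier \<Gamma> \<and> c = cl m g)) (carrier (GQ m)) (res m ` carrier \<Gamma>)"
    (is "bij_betw ?f _ _")
  proof -
    have *: "?f (cl m g) = res m g" if "g \<in> carrier \<Gamma>" for g
      using someI[of "\<lambda>h. h \<in> carrier \<Gamma> \<and> cl m g = cl m h" g] cl_eq_iff that by metis
    show ?thesis
      unfolding GQ_carrier bij_betw_def inj_on_def image_image using * cl_eq_iff by auto
  qed
  ultimately show ?thesis using bij_betw_finite by blast
qed

lemma GS_Suc_subset: "GS (Suc m) \<subseteq> GS m"
proof
  fix g assume "g \<in> GS (Suc m)"
  then have g: "g \<in> carrier \<Gamma>" "\<phi> g m = 0" by (auto simp: GS_iff res_def)
  then have "[res m g = 0] (mod int p ^ m)" using res_cong[OF g(1), of m m] by (simp add: cong_sym)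
  then show "g \<in> GS m" using g res_bounds[OF g(1), of m] by (simp add: GS_iff cong_def)
qed

lemma GS_cl_Suc:
  assumes "g \<in> carrier \<Gamma>" shows "GS m <#> cl (Suc m) g = cl m g"
proof -
  interpret S: subgroup "GS m" \<Gamma> by (rule GS_subgroup)
  have "GS m <#> GS (Suc m) = GS m"
  proof
    show "GS m <#> GS (Suc m) \<subseteq> GS m" using GS_Suc_subset by (auto simp: set_mult_def)
    have "\<one> \<in> GS (Suc m)" using subgroup.one_closed[OF GS_subgroup] .
    then show "GS m \<subseteq> GS m <#> GS (Suc m)"
      using S.subset unfolding set_mult_def by force
  qed
  moreover have "GS m <#> cl (Suc m) g = (GS m <#> GS (Suc m)) #> g"
    using assms subgroup.subset[OF GS_subgroup] by (intro setmult_rcos_assoc) auto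
  ultimately show ?thesis by simp
qed

lemma GQ_hom: "(\<lambda>c. GS m <#> c) \<in> hom (GQ (Suc m)) (GQ m)"
  by (rule homI) (auto simp: GQ_carrier GS_cl_Suc GQ_mult)

end

section \<open>The Iwasawa algebra\<close>

context group_ring_setup
begin

lemma RG_a_inv: assumes "x \<in> carrier RG" shows "\<ominus>\<^bsub>RG\<^esub> x = (\<lambda>g\<in>carrier G. \<ominus>\<^bsub>R\<^esub> x g)"
proof -
  interpret RG: cring RG by (rule RG_cring)
  show ?thesis
    by (rule RG.minus_equality)
      (use assms in \<open>auto simp: group_ring_def R.l_neg PiE_iff fun_eq_iff\<close>)
qed

lemma RG_minus_apply:
  assumes "x \<in> carrier RG" "y \<in> carrier RG" "g \<in> carrier G"
  shows "(x \<ominus>\<^bsub>RG\<^esub> y) g = x g \<ominus>\<^bsub>R\<^esub> y g"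
  unfolding a_minus_def RG_a_inv[OF assms(2)] using assms by (simp add: group_ring_def)

end

context padic_group
begin

abbreviation "LR m \<equiv> layer_ring p \<Gamma> T \<gamma> m"
abbreviation "tr m \<equiv> group_ring_map (Zp p) (GQ (Suc m)) (GQ m) (\<lambda>c. GS m <#> c)"
abbreviation "\<Lambda> \<equiv> Iwasawa p \<Gamma> T \<gamma>"
abbreviation "ge \<equiv> group_elt p \<Gamma> T \<gamma>"

lemma LR_setup: "group_ring_setup (Zp p) (GQ m)"
  by (intro group_ring_setup.intro group_ring_setup_axioms.intro Zp.is_cring GQ_comm_group GQ_finite)

lemma LR_cring: "cring (LR m)"
  unfolding layer_ring_def by (rule group_ring_setup.RG_cring[OF LR_setup])

sublocale IS: ring_system "layer_ring p \<Gamma> T \<gamma>" tr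
  rewrites "ring_lim (layer_ring p \<Gamma> T \<gamma>) tr \<equiv> \<Lambda>"
proof -
  show "ring_system (layer_ring p \<Gamma> T \<gamma>) tr"
    unfolding layer_ring_def
    by (intro ring_system.intro group_ring_map_hom Zp.is_cring GQ_comm_group GQ_finite GQ_hom
        group_ring_setup.RG_cring[OF LR_setup])
qed (simp add: Iwasawa_def)

sublocale \<Lambda>: cring \<Lambda> by (rule IS.ring_lim_cring)

lemma \<Lambda>_carrier: "x \<in> carrier \<Lambda> \<longleftrightarrow> (\<forall>m. x m \<in> carrier (LR m) \<and> tr m (x (Suc m)) = x m)"
  by (rule IS.ring_lim_carrier)

lemma LR_carrier: "x \<in> carrier (LR m) \<longleftrightarrow> x \<in> carrier (GQ m) \<rightarrow>\<^sub>E carrier (Zp p)"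
  by (simp add: layer_ring_def group_ring_def)

lemma \<Lambda>_level: "x \<in> carrier \<Lambda> \<Longrightarrow> x m \<in> carrier (LR m)"
  and \<Lambda>_trans: "x \<in> carrier \<Lambda> \<Longrightarrow> tr m (x (Suc m)) = x m"
  by (auto simp: \<Lambda>_carrier)

lemma LR_apply_closed: "x \<in> carrier (LR m) \<Longrightarrow> c \<in> carrier (GQ m) \<Longrightarrow> x c \<in> carrier (Zp p)"
  by (auto simp: LR_carrier)

lemma \<Lambda>_apply_closed: "x \<in> carrier \<Lambda> \<Longrightarrow> c \<in> carrier (GQ m) \<Longrightarrow> x m c \<in> carrier (Zp p)"
  using LR_apply_closed \<Lambda>_level by blast

lemma \<Lambda>_add_level: "(x \<oplus>\<^bsub>\<Lambda>\<^esub> y) m = x m \<oplus>\<^bsub>LR m\<^esub> y m"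
  and \<Lambda>_mult_level: "(x \<otimes>\<^bsub>\<Lambda>\<^esub> y) m = x m \<otimes>\<^bsub>LR m\<^esub> y m"
  and \<Lambda>_zero_level: "\<zero>\<^bsub>\<Lambda>\<^esub> m = \<zero>\<^bsub>LR m\<^esub>"
  and \<Lambda>_one_level: "\<one>\<^bsub>\<Lambda>\<^esub> m = \<one>\<^bsub>LR m\<^esub>"
  by (simp_all add: Iwasawa_def ring_lim_def)

lemma \<Lambda>_add_apply: "c \<in> carrier (GQ m) \<Longrightarrow> (x \<oplus>\<^bsub>\<Lambda>\<^esub> y) m c = x m c \<oplus>\<^bsub>Zp p\<^esub> y m c"
  and \<Lambda>_zero_apply: "c \<in> carrier (GQ m) \<Longrightarrow> \<zero>\<^bsub>\<Lambda>\<^esub> m c = \<zero>\<^bsub>Zp p\<^esub>"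
  by (simp_all add: \<Lambda>_add_level \<Lambda>_zero_level layer_ring_def group_ring_def)

lemma \<Lambda>_minus_level:
  assumes "x \<in> carrier \<Lambda>" "y \<in> carrier \<Lambda>" shows "(x \<ominus>\<^bsub>\<Lambda>\<^esub> y) m = x m \<ominus>\<^bsub>LR m\<^esub> y m"
proof -
  interpret e: ring_hom_cring \<Lambda> "LR m" "\<lambda>x. x m" by (rule IS.eval_hom_cring)
  show ?thesis using assms unfolding a_minus_def by simp
qed

lemma \<Lambda>_minus_apply:
  assumes "x \<in> carrier \<Lambda>" "y \<in> carrier \<Lambda>" "c \<in> carrier (GQ m)"
  shows "(x \<ominus>\<^bsub>\<Lambda>\<^esub> y) m c = x m c \<ominus>\<^bsub>Zp p\<^esub> y m c"
  using group_ring_setup.RG_minus_apply[OF LR_setup, of "x m" m "y m" c] assms \<Lambda>_level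
  unfolding \<Lambda>_minus_level[OF assms(1,2)] layer_ring_def by blast

lemma \<Lambda>_finsum_apply:
  assumes "f \<in> A \<rightarrow> carrier \<Lambda>" "c \<in> carrier (GQ m)"
  shows "(\<Oplus>\<^bsub>\<Lambda>\<^esub>i\<in>A. f i) m c = (\<Oplus>\<^bsub>Zp p\<^esub>i\<in>A. f i m c)"
  using assms(1)
proof (induction A rule: infinite_finite_induct)
  case (insert x F)
  then have "\<And>i. i \<in> insert x F \<Longrightarrow> f i m c \<in> carrier (Zp p)"
    using \<Lambda>_apply_closed assms(2) by auto
  then show ?case using insert assms(2)
    by (simp add: \<Lambda>.finsum_insert Zp.finsum_insert Pi_iff \<Lambda>_add_apply)
qed (use assms(2) in \<open>auto simp: \<Lambda>_zero_apply \<Lambda>.finsum_infinite Zp.finsum_infinite\<close>)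

lemma LR_zero_iff:
  assumes "x \<in> carrier (LR m)" shows "x = \<zero>\<^bsub>LR m\<^esub> \<longleftrightarrow> (\<forall>c\<in>carrier (GQ m). x c = \<zero>\<^bsub>Zp p\<^esub>)"
  using assms by (auto simp: LR_carrier PiE_iff layer_ring_def group_ring_def fun_eq_iff extensional_def)

lemma LR_eqI:
  assumes "x \<in> carrier (LR m)" "y \<in> carrier (LR m)" "\<And>c. c \<in> carrier (GQ m) \<Longrightarrow> x c = y c"
  shows "x = y"
  using assms by (intro extensionalityI[of _ "carrier (GQ m)"]) (auto simp: LR_carrier PiE_iff)

lemma cl_closed: "g \<in> carrier \<Gamma> \<Longrightarrow> cl m g \<in> carrier (GQ m)"
  by (simp add: GQ_carrier)

lemma tr_apply: "c \<in> carrier (GQ m) \<Longrightarrow>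
    tr m x c = (\<Oplus>\<^bsub>Zp p\<^esub>c'\<in>{c' \<in> carrier (GQ (Suc m)). GS m <#> c' = c}. x c')"
  by (simp add: group_ring_map_def)

text \<open>The element z [g] of \<Lambda> for a p-adic scalar z. At z = 1 it is the group element;
  at g = 1 it is a section of the augmentation.\<close>

definition scaled_elt :: "(nat \<Rightarrow> int) \<Rightarrow> 'g \<Rightarrow> 'g iwasawa_elt" where
  "scaled_elt z g m = (\<lambda>c\<in>carrier (GQ m). if c = cl m g then z else \<zero>\<^bsub>Zp p\<^esub>)"

lemma ge_eq: "ge g = scaled_elt \<one>\<^bsub>Zp p\<^esub> g"
  by (simp add: scaled_elt_def group_elt_def basis_elt_def fun_eq_iff)

lemma scaled_elt_closed:
  assumes z: "z \<in> carrier (Zp p)" and g: "g \<in> carrier \<Gamma>"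
  shows "scaled_elt z g \<in> carrier \<Lambda>"
  unfolding \<Lambda>_carrier
proof (intro allI conjI)
  fix m
  show L: "scaled_elt z g m \<in> carrier (LR m)" for m
    using z by (auto simp: LR_carrier scaled_elt_def)
  have "tr m (scaled_elt z g (Suc m)) c = scaled_elt z g m c" if c: "c \<in> carrier (GQ m)" for c
  proof -
    let ?F = "{c' \<in> carrier (GQ (Suc m)). GS m <#> c' = c}"
    have "tr m (scaled_elt z g (Suc m)) c = (\<Oplus>\<^bsub>Zp p\<^esub>c'\<in>?F. if c' = cl (Suc m) g then z else \<zero>\<^bsub>Zp p\<^esub>)"
      unfolding tr_apply[OF c] using z by (intro Zp.finsum_cong') (auto simp: scaled_elt_def)
    also have "\<dots> = (if c = cl m g then z else \<zero>\<^bsub>Zp p\<^esub>)"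
    proof (cases "c = cl m g")
      case True
      then have "cl (Suc m) g \<in> ?F" using g by (simp add: cl_closed GS_cl_Suc)
      then show ?thesis using True Zp.finsum_delta[of ?F "cl (Suc m) g" "\<lambda>_. z"] z GQ_finite by simp
    next
      case False
      then have "c' \<noteq> cl (Suc m) g" if "c' \<in> ?F" for c' using that GS_cl_Suc[OF g] by auto
      then have "(\<Oplus>\<^bsub>Zp p\<^esub>c'\<in>?F. if c' = cl (Suc m) g then z else \<zero>\<^bsub>Zp p\<^esub>) = (\<Oplus>\<^bsub>Zp p\<^esub>c'\<in>?F. \<zero>\<^bsub>Zp p\<^esub>)"
        by (intro Zp.finsum_cong') auto
      then show ?thesis using False by (simp add: Zp.finsum_zero)
    qed
    finally show ?thesis using c by (simp add: scaled_elt_def)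
  qed
  then show "tr m (scaled_elt z g (Suc m)) = scaled_elt z g m"
    by (auto simp: fun_eq_iff group_ring_map_def scaled_elt_def)
qed

lemma ge_closed: "g \<in> carrier \<Gamma> \<Longrightarrow> ge g \<in> carrier \<Lambda>"
  unfolding ge_eq by (rule scaled_elt_closed) auto

lemma ge_one: "ge \<one> = \<one>\<^bsub>\<Lambda>\<^esub>"
  by (simp add: group_elt_def fun_eq_iff \<Lambda>_one_level layer_ring_def group_ring_def GQ_one)

lemma ge_mult_apply:
  assumes g: "g \<in> carrier \<Gamma>" and x: "x \<in> carrier \<Lambda>" and c: "c \<in> carrier (GQ m)"
  shows "(ge g \<otimes>\<^bsub>\<Lambda>\<^esub> x) m c = x m (inv\<^bsub>GQ m\<^esub> cl m g \<otimes>\<^bsub>GQ m\<^esub> c)"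
  using group_ring_setup.basis_elt_mult[OF LR_setup cl_closed[OF g] _ c, of "x m"] \<Lambda>_level[OF x, of m]
  by (simp add: \<Lambda>_mult_level group_elt_def layer_ring_def)

lemma ge_mult_cl:
  assumes "g \<in> carrier \<Gamma>" "x \<in> carrier \<Lambda>" "h \<in> carrier \<Gamma>"
  shows "(ge g \<otimes>\<^bsub>\<Lambda>\<^esub> x) m (cl m h) = x m (cl m (inv g \<otimes> h))"
  using assms by (simp add: ge_mult_apply cl_closed GQ_inv GQ_mult)

lemma \<Lambda>_eqI:
  assumes "x \<in> carrier \<Lambda>" "y \<in> carrier \<Lambda>" "\<And>m g. g \<in> carrier \<Gamma> \<Longrightarrow> x m (cl m g) = y m (cl m g)"
  shows "x = y"
proof
  show "x m = y m" for m
    by (rule LR_eqI) (use assms \<Lambda>_level in \<open>auto simp: GQ_carrier\<close>)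
qed

lemma ge_mult: "g \<in> carrier \<Gamma> \<Longrightarrow> h \<in> carrier \<Gamma> \<Longrightarrow> ge g \<otimes>\<^bsub>\<Lambda>\<^esub> ge h = ge (g \<otimes> h)"
proof (rule \<Lambda>_eqI)
  fix m x assume gh: "g \<in> carrier \<Gamma>" "h \<in> carrier \<Gamma>" and x: "x \<in> carrier \<Gamma>"
  interpret Q: comm_group "GQ m" by (rule GQ_comm_group)
  have "cl m (inv g \<otimes> x) = cl m h \<longleftrightarrow> cl m x = cl m (g \<otimes> h)"
  proof -
    have "cl m (inv g \<otimes> x) = inv\<^bsub>GQ m\<^esub> cl m g \<otimes>\<^bsub>GQ m\<^esub> cl m x" "cl m (g \<otimes> h) = cl m g \<otimes>\<^bsub>GQ m\<^esub> cl m h"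
      using gh x by (simp_all add: GQ_inv GQ_mult)
    then show ?thesis
      using cl_closed[OF gh(1), of m] cl_closed[OF gh(2), of m] cl_closed[OF x, of m] Q.inv_solve_left'
      by auto
  qed
  then show "(ge g \<otimes>\<^bsub>\<Lambda>\<^esub> ge h) m (cl m x) = ge (g \<otimes> h) m (cl m x)"
    using gh x by (simp add: ge_mult_cl ge_closed) (simp add: group_elt_def basis_elt_def cl_closed)
qed (auto intro: ge_closed)

lemma ge_inv_cancel:
  assumes "g \<in> carrier \<Gamma>" "x \<in> carrier \<Lambda>"
  shows "ge g \<otimes>\<^bsub>\<Lambda>\<^esub> (ge (inv g) \<otimes>\<^bsub>\<Lambda>\<^esub> x) = x"
  using assms by (simp add: \<Lambda>.m_assoc[symmetric] ge_closed ge_mult ge_one)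

subsection \<open>Augmentation\<close>

text \<open>The group at level 0 is trivial, so the augmentation is the single coefficient
  there.\<close>

definition aug :: "'g iwasawa_elt \<Rightarrow> nat \<Rightarrow> int" where
  "aug x = x 0 (cl 0 \<one>)"

lemma cl_0: "g \<in> carrier \<Gamma> \<Longrightarrow> cl 0 g = cl 0 \<one>"
  by (simp add: cl_eq_iff res_def)

lemma GQ_0: "carrier (GQ 0) = {cl 0 \<one>}"
  unfolding GQ_carrier
proof
  show "cl 0 ` carrier \<Gamma> \<subseteq> {cl 0 \<one>}" by (rule image_subsetI) (metis cl_0 singletonI)
qed simp

lemma aug_closed: "x \<in> carrier \<Lambda> \<Longrightarrow> aug x \<in> carrier (Zp p)"
  unfolding aug_def by (rule \<Lambda>_apply_closed) (simp_all add: cl_closed)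

lemma aug_add: "aug (x \<oplus>\<^bsub>\<Lambda>\<^esub> y) = aug x \<oplus>\<^bsub>Zp p\<^esub> aug y"
  by (simp add: aug_def \<Lambda>_add_apply cl_closed)

lemma aug_minus: "x \<in> carrier \<Lambda> \<Longrightarrow> y \<in> carrier \<Lambda> \<Longrightarrow> aug (x \<ominus>\<^bsub>\<Lambda>\<^esub> y) = aug x \<ominus>\<^bsub>Zp p\<^esub> aug y"
  by (simp add: aug_def \<Lambda>_minus_apply cl_closed)

lemma aug_ge_mult: "g \<in> carrier \<Gamma> \<Longrightarrow> x \<in> carrier \<Lambda> \<Longrightarrow> aug (ge g \<otimes>\<^bsub>\<Lambda>\<^esub> x) = aug x"
  using cl_0[of "inv g"] by (simp add: aug_def ge_mult_cl)

lemma aug_scaled_elt: "aug (scaled_elt z \<one>) = z"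
  by (simp add: aug_def scaled_elt_def cl_closed)

lemma aug_zero_iff: "x \<in> carrier \<Lambda> \<Longrightarrow> aug x = \<zero>\<^bsub>Zp p\<^esub> \<longleftrightarrow> x 0 = \<zero>\<^bsub>LR 0\<^esub>"
  using LR_zero_iff[OF \<Lambda>_level, of x 0] by (simp add: aug_def GQ_0)

lemma scaled_elt_add:
  assumes "z \<in> carrier (Zp p)" "w \<in> carrier (Zp p)" "g \<in> carrier \<Gamma>"
  shows "scaled_elt (z \<oplus>\<^bsub>Zp p\<^esub> w) g = scaled_elt z g \<oplus>\<^bsub>\<Lambda>\<^esub> scaled_elt w g"
  by (rule \<Lambda>_eqI) (use assms in \<open>auto simp: \<Lambda>_add_apply cl_closed scaled_elt_def
      intro!: scaled_elt_closed \<Lambda>.a_closed\<close>)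

end

subsection \<open>Coordinates with respect to a topological generator\<close>

text \<open>\<open>b\<close> is a second topological generator; it will be instantiated with the
  voltage of a loop. Its powers name the elements of each finite quotient.\<close>

locale padic_group_gen = padic_group p \<Gamma> T \<phi> \<gamma>
  for p and \<Gamma> :: "'g monoid" (structure) and T \<phi> \<gamma> +
  fixes b :: 'g
  assumes b: "b \<in> carrier \<Gamma>" and b_unit: "\<not> int p dvd \<phi> b 0"
begin

abbreviation "cs m i \<equiv> cl m (b [^] (i::nat))"

lemma cs_closed: "cs m i \<in> carrier (GQ m)"
  using b by (simp add: cl_closed)

lemma res_b_coprime: "coprime (res m b) (int p ^ m)"
  using unit_coprime[OF b b_unit] by (cases m) (auto simp: res_def)

lemma cs_eq_iff: "cs m i = cs m j \<longleftrightarrow> [int i = int j] (mod int p ^ m)"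
proof -
  have "cs m i = cs m j \<longleftrightarrow> res m (b [^] i) = res m (b [^] j)" using b by (simp add: cl_eq_iff)
  also have "\<dots> \<longleftrightarrow> [res m (b [^] i) = res m (b [^] j)] (mod int p ^ m)"
    using b res_eqI by auto
  also have "\<dots> \<longleftrightarrow> [int i * res m b = int j * res m b] (mod int p ^ m)"
    using res_pow[OF b, of m i] res_pow[OF b, of m j] by (simp add: cong_def)
  also have "\<dots> \<longleftrightarrow> [int i = int j] (mod int p ^ m)"
    by (rule cong_mult_rcancel[OF res_b_coprime])
  finally show ?thesis .
qed

lemma cs_periodic: "cs m (i + t * p ^ m) = cs m i"
  by (simp add: cs_eq_iff cong_iff_dvd_diff)

lemma cs_mod: "cs m (i mod p ^ m) = cs m i"
  by (simp add: cs_eq_iff cong_def zmod_int)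

lemma GQ_cs: "carrier (GQ m) = cs m ` {..<p ^ m}"
proof
  show "carrier (GQ m) \<subseteq> cs m ` {..<p ^ m}"
  proof
    fix c assume "c \<in> carrier (GQ m)"
    then obtain g where g: "g \<in> carrier \<Gamma>" "c = cl m g" by (auto simp: GQ_carrier)
    obtain t where t: "[res m b * t = 1] (mod int p ^ m)"
      using cong_solve_coprime_int[OF res_b_coprime] by blast
    define i where "i = nat ((res m g * t) mod int p ^ m)"
    have pos: "int p ^ m > 0" using p_gt_1 by simp
    have i: "int i = (res m g * t) mod int p ^ m" using pos by (simp add: i_def)
    have "[int i * res m b = res m g * (res m b * t)] (mod int p ^ m)"
      unfolding i by (simp add: cong_def mod_simps ac_simps)
    moreover have "[res m g * (res m b * t) = res m g * 1] (mod int p ^ m)"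
      by (intro cong_mult cong_refl t)
    ultimately have "[int i * res m b = res m g] (mod int p ^ m)"
      by (simp add: cong_def)
    then have "[res m (b [^] i) = res m g] (mod int p ^ m)" by (rule cong_trans[OF res_pow[OF b]])
    then have "res m (b [^] i) = res m g" using g b by (intro res_eqI) auto
    then have "cs m i = c" using g b by (simp add: cl_eq_iff)
    moreover have "i < p ^ m"
    proof -
      have "int i < int (p ^ m)" unfolding i using pos by simp
      then show ?thesis by simp
    qed
    ultimately show "c \<in> cs m ` {..<p ^ m}" by blast
  qed
qed (use cs_closed in auto)

lemma GQ_csE: assumes "c \<in> carrier (GQ m)" obtains i where "i < p ^ m" "c = cs m i"
  using assms unfolding GQ_cs by blast

lemma cs_inj: "i < p ^ m \<Longrightarrow> j < p ^ m \<Longrightarrow> cs m i = cs m j \<Longrightarrow> i = j"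
  by (simp add: cs_eq_iff cong_int_iff[symmetric] cong_def flip: of_nat_power of_nat_mod)

lemma GS_cs_Suc: "GS m <#> cs (Suc m) i = cs m i"
  using b by (simp add: GS_cl_Suc)

text \<open>The exponents modulo p^(m + 1) that reduce to i modulo p^m are the p values i + j
  p^m.\<close>

lemma cs_fibre: "bij_betw (\<lambda>j. cs (Suc m) (i + j * p ^ m)) {..<p} {c \<in> carrier (GQ (Suc m)). GS m <#> c = cs m i}"
  unfolding bij_betw_def
proof
  have pm: "int p ^ m \<noteq> 0" using p_gt_1 by simp
  show "inj_on (\<lambda>j. cs (Suc m) (i + j * p ^ m)) {..<p}"
  proof (rule inj_onI)
    fix j j' assume jj: "j \<in> {..<p}" "j' \<in> {..<p}" and "cs (Suc m) (i + j * p ^ m) = cs (Suc m) (i + j' * p ^ m)"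
    then have "int p ^ m * int p dvd int p ^ m * (int j - int j')"
      by (simp add: cs_eq_iff cong_iff_dvd_diff algebra_simps)
    then have "[int j = int j'] (mod int p)" using pm p_gt_1 by (simp add: cong_iff_dvd_diff)
    then show "j = j'" using jj by (simp add: cong_int_iff cong_def)
  qed
  show "(\<lambda>j. cs (Suc m) (i + j * p ^ m)) ` {..<p} = {c \<in> carrier (GQ (Suc m)). GS m <#> c = cs m i}"
  proof (intro equalityI subsetI)
    fix c assume "c \<in> (\<lambda>j. cs (Suc m) (i + j * p ^ m)) ` {..<p}"
    then show "c \<in> {c \<in> carrier (GQ (Suc m)). GS m <#> c = cs m i}"
      by (auto simp: cs_closed GS_cs_Suc cs_periodic)
  next
    fix c assume "c \<in> {c \<in> carrier (GQ (Suc m)). GS m <#> c = cs m i}"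
    then have c: "c \<in> carrier (GQ (Suc m))" "GS m <#> c = cs m i" by auto
    from c(1) obtain t where t: "c = cs (Suc m) t" by (rule GQ_csE)
    have "cs m t = cs m i" using c(2) unfolding t GS_cs_Suc .
    then obtain s where s: "int t - int i = int p ^ m * s" by (auto simp: cs_eq_iff cong_iff_dvd_diff elim: dvdE)
    define j where "j = nat (s mod int p)"
    have j: "int j = s mod int p" "j < p" using p_gt_1 by (simp_all add: j_def nat_less_iff)
    have "int t - (int i + int j * int p ^ m) = int p ^ m * (s - s mod int p)"
      using s j by (simp add: algebra_simps)
    moreover have "int p dvd s - s mod int p" by (simp add: dvd_minus_mod)
    ultimately have "cs (Suc m) t = cs (Suc m) (i + j * p ^ m)"
      by (simp add: cs_eq_iff cong_iff_dvd_diff mult_dvd_mono mult.commute)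
    then show "c \<in> (\<lambda>j. cs (Suc m) (i + j * p ^ m)) ` {..<p}" using t j by blast
  qed
qed

lemma tr_cs:
  assumes x: "x \<in> carrier (LR (Suc m))"
  shows "tr m x (cs m i) k = (\<Sum>j<p. x (cs (Suc m) (i + j * p ^ m)) k) mod q k"
proof -
  have "tr m x (cs m i) = (\<Oplus>\<^bsub>Zp p\<^esub>j\<in>{..<p}. x (cs (Suc m) (i + j * p ^ m)))"
    unfolding tr_apply[OF cs_closed]
    by (rule Zp.finsum_bij[OF cs_fibre]) (use LR_apply_closed[OF x] in auto)
  then show ?thesis
    using Zp_finsum[of "\<lambda>j. x (cs (Suc m) (i + j * p ^ m))" "{..<p}" k] LR_apply_closed[OF x cs_closed]
    by (simp del: power_Suc)
qed

text \<open>The exponent of \<open>b\<close> is a coordinate on \<Gamma>, through which \<Lambda>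
  becomes the algebra of Z_p-valued measures on Z_p; the transition maps are the
  push-forwards.\<close>

lemma \<Lambda>_measure:
  assumes x: "x \<in> carrier \<Lambda>" shows "padic_measure (\<lambda>m i k. x m (cs m i) k)"
  unfolding padic_measure_def
proof (intro conjI allI)
  fix m i k
  show "[x m (cs m (i + p ^ m)) k = x m (cs m i) k] (mod q k)"
    using cs_periodic[of m i 1] by simp
  have "x m (cs m i) k = (\<Sum>j<p. x (Suc m) (cs (Suc m) (i + j * p ^ m)) k) mod q k"
    unfolding tr_cs[OF \<Lambda>_level[OF x], symmetric] \<Lambda>_trans[OF x] ..
  then show "[(\<Sum>j<p. x (Suc m) (cs (Suc m) (i + j * p ^ m)) k) = x m (cs m i) k] (mod q k)"
    by (simp add: cong_def del: power_Suc)
  show "[x m (cs m i) (Suc k) = x m (cs m i) k] (mod q k)"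
    by (rule Zp_cong[OF \<Lambda>_apply_closed[OF x cs_closed]]) simp
qed

lemma \<Lambda>_of_measure:
  assumes y: "padic_measure y"
  obtains x where "x \<in> carrier \<Lambda>" "\<And>m i k. x m (cs m i) k = y m i k mod q k"
proof -
  have per: "[y m (i + t * p ^ m) k = y m i k] (mod q k)" for m i t k
    using cong_iterate[of "\<lambda>i. y m i k" "p ^ m" "q k" i t] y unfolding padic_measure_def by blast
  have y_mod: "[y m (i mod p ^ m) k = y m i k] (mod q k)" for m i k
    using cong_sym[OF per[of m "i mod p ^ m" "i div p ^ m" k]] by (simp only: mod_div_mult_eq)
  have zp: "(\<lambda>k. y m i k mod q k) \<in> carrier (Zp p)" for m i
    by (rule Zp_of_coherent) (use y in \<open>simp add: padic_measure_def\<close>)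
  \<comment> \<open>A coset is named by its unique exponent below p^m. Periodicity of
    \<open>y\<close> holds only up to congruence, and the reduction modulo \<open>q k\<close> turns
    it into equality.\<close>
  define idx where "idx m c = (THE i. i < p ^ m \<and> cs m i = c)" for m c
  have idx: "idx m (cs m i) = i mod p ^ m" for m i
    unfolding idx_def using p_pow_pos[of m] cs_mod cs_inj by (intro the_equality) (auto intro!: cs_inj)
  define x where "x m = (\<lambda>c\<in>carrier (GQ m). \<lambda>k. y m (idx m c) k mod q k)" for m
  have x: "x m (cs m i) k = y m i k mod q k" for m i k
    using y_mod[of m i k] by (simp add: x_def cs_closed idx cong_def del: power_Suc)
  have xL: "x m \<in> carrier (LR m)" for m
    using zp by (auto simp: LR_carrier x_def)
  have "tr m (x (Suc m)) = x m" for m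
  proof (rule LR_eqI)
    show "tr m (x (Suc m)) \<in> carrier (LR m)"
      using ring_hom_closed[OF IS.hom xL] .
    fix c assume "c \<in> carrier (GQ m)"
    then obtain i where c: "c = cs m i" by (rule GQ_csE)
    show "tr m (x (Suc m)) c = x m c"
    proof
      fix k
      have "tr m (x (Suc m)) c k = (\<Sum>j<p. y (Suc m) (i + j * p ^ m) k mod q k) mod q k"
        unfolding c tr_cs[OF xL] x ..
      also have "\<dots> = (\<Sum>j<p. y (Suc m) (i + j * p ^ m) k) mod q k" by (rule mod_sum_eq)
      also have "\<dots> = y m i k mod q k" using y by (auto simp: padic_measure_def cong_def)
      finally show "tr m (x (Suc m)) c k = x m c k" unfolding c x .
    qed
  qed (rule xL)
  then have "x \<in> carrier \<Lambda>" using xL by (simp add: \<Lambda>_carrier)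
  then show ?thesis using x that by blast
qed

lemma \<Lambda>_eq_csI:
  assumes "x \<in> carrier \<Lambda>" "y \<in> carrier \<Lambda>" "\<And>m i k. x m (cs m i) k = y m (cs m i) k"
  shows "x = y"
proof
  show "x m = y m" for m
  proof (rule LR_eqI)
    fix c assume "c \<in> carrier (GQ m)"
    then obtain i where "c = cs m i" by (rule GQ_csE)
    then show "x m c = y m c" using assms by auto
  qed (use assms \<Lambda>_level in auto)
qed

text \<open>Built on \<open>b\<close> and not on \<gamma>, so that \<open>omega 0\<close> times a
  vertex is a boundary when \<open>b\<close> is the voltage of a loop at that vertex.\<close>

definition omega :: "nat \<Rightarrow> 'g iwasawa_elt" where
  "omega n = ge (b [^] (p ^ n)) \<ominus>\<^bsub>\<Lambda>\<^esub> \<one>\<^bsub>\<Lambda>\<^esub>"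

lemma omega_closed: "omega n \<in> carrier \<Lambda>"
  using b by (simp add: omega_def ge_closed)

lemma omega_mult: "x \<in> carrier \<Lambda> \<Longrightarrow> omega n \<otimes>\<^bsub>\<Lambda>\<^esub> x = ge (b [^] (p ^ n)) \<otimes>\<^bsub>\<Lambda>\<^esub> x \<ominus>\<^bsub>\<Lambda>\<^esub> x"
  using b unfolding omega_def a_minus_def
  by (simp add: \<Lambda>.l_distr \<Lambda>.l_minus ge_closed)

text \<open>Multiplication by \<open>omega n\<close> is a difference operator with step p^n.
  Evaluation at \<open>i + p ^ n\<close> keeps all exponents natural numbers.\<close>

lemma omega_mult_cs:
  assumes x: "x \<in> carrier \<Lambda>"
  shows "(omega n \<otimes>\<^bsub>\<Lambda>\<^esub> x) m (cs m (i + p ^ n)) k = (x m (cs m i) k - x m (cs m (i + p ^ n)) k) mod q k"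
proof -
  have "inv (b [^] (p ^ n)) \<otimes> b [^] (i + p ^ n) = b [^] i"
    using b by (simp add: nat_pow_mult[symmetric] m_comm[of "b [^] i"] m_assoc[symmetric])
  then have "(ge (b [^] (p ^ n)) \<otimes>\<^bsub>\<Lambda>\<^esub> x) m (cs m (i + p ^ n)) = x m (cs m i)"
    using b x by (simp add: ge_mult_cl)
  then show ?thesis
    using b x by (simp add: omega_mult \<Lambda>_minus_apply cs_closed ge_closed Zp_minus \<Lambda>_apply_closed del: power_Suc)
qed

lemma cs_shift: obtains j where "cs m i = cs m (j + p ^ n)"
proof
  \<comment> \<open>The witness together with the shift is i + p^n p^m, which has the class of i at
    level m.\<close>
  have "[int i = int (i + p ^ n * (p ^ m - 1) + p ^ n)] (mod int p ^ m)"
  proof -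
    have eq: "i + p ^ n * (p ^ m - 1) + p ^ n = i + p ^ n * p ^ m"
      using p_pow_pos[of m] by (cases "p ^ m") auto
    show ?thesis unfolding eq by (simp add: cong_iff_dvd_diff)
  qed
  then show "cs m i = cs m ((i + p ^ n * (p ^ m - 1)) + p ^ n)" by (simp add: cs_eq_iff)
qed

text \<open>Vanishing at level n says that the measure has mass zero on each class modulo p^n, the
  condition under which the difference equation is solvable.\<close>

lemma omega_divides:
  assumes x: "x \<in> carrier \<Lambda>" and 0: "x n = \<zero>\<^bsub>LR n\<^esub>"
  obtains y where "y \<in> carrier \<Lambda>" "x = omega n \<otimes>\<^bsub>\<Lambda>\<^esub> y"
proof -
  let ?a = "\<lambda>m i k. x m (cs m i) k"
  have "[?a n i k = 0] (mod q k)" for i k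
    using LR_zero_iff[OF \<Lambda>_level[OF x], of n] 0 cs_closed by (simp add: Zp_simps)
  then obtain y where y: "padic_measure y"
    "\<And>m i k. [y m (i + p^n) k - y m i k = ?a m (i + p^n) k] (mod q k)"
    using padic_measure_quotient[OF \<Lambda>_measure[OF x]] by metis
  obtain z where z: "z \<in> carrier \<Lambda>" "\<And>m i k. z m (cs m i) k = y m i k mod q k"
    using \<Lambda>_of_measure[OF y(1)] by metis
  \<comment> \<open>The sign changes because the operator takes the value at i minus the value at i
    + p^n, opposite to the difference solved for \<open>y\<close>.\<close>
  have zc: "\<ominus>\<^bsub>\<Lambda>\<^esub> z \<in> carrier \<Lambda>" using z by simp
  have zm: "(\<ominus>\<^bsub>\<Lambda>\<^esub> z) m (cs m i) k = (- y m i k) mod q k" for m i k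
  proof -
    have "\<zero>\<^bsub>\<Lambda>\<^esub> \<ominus>\<^bsub>\<Lambda>\<^esub> z = \<ominus>\<^bsub>\<Lambda>\<^esub> z" using z(1) by (simp add: \<Lambda>.minus_eq)
    then have "(\<ominus>\<^bsub>\<Lambda>\<^esub> z) m (cs m i) k = (\<zero>\<^bsub>Zp p\<^esub> \<ominus>\<^bsub>Zp p\<^esub> z m (cs m i)) k"
      using \<Lambda>_minus_apply[OF \<Lambda>.zero_closed z(1) cs_closed, of m i] by (simp add: \<Lambda>_zero_apply cs_closed)
    also have "\<dots> = (- y m i k) mod q k"
      using z by (simp add: Zp_minus \<Lambda>_apply_closed cs_closed Zp_simps mod_minus_eq del: power_Suc)
    finally show ?thesis .
  qed
  have "x = omega n \<otimes>\<^bsub>\<Lambda>\<^esub> (\<ominus>\<^bsub>\<Lambda>\<^esub> z)"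
  proof (rule \<Lambda>_eq_csI)
    fix m i k
    obtain j where j: "cs m i = cs m (j + p ^ n)" by (rule cs_shift)
    have "(omega n \<otimes>\<^bsub>\<Lambda>\<^esub> (\<ominus>\<^bsub>\<Lambda>\<^esub> z)) m (cs m i) k = (- y m j k - - y m (j + p ^ n) k) mod q k"
      unfolding j omega_mult_cs[OF zc] zm by (rule mod_diff_eq)
    also have "\<dots> = ?a m (j + p ^ n) k mod q k" using y(2)[of m j k] by (simp add: cong_def)
    also have "\<dots> = x m (cs m i) k"
      unfolding j by (rule Zp_mod_self[OF \<Lambda>_apply_closed[OF x cs_closed]])
    finally show "x m (cs m i) k = (omega n \<otimes>\<^bsub>\<Lambda>\<^esub> (\<ominus>\<^bsub>\<Lambda>\<^esub> z)) m (cs m i) k" ..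
  qed (use x zc omega_closed in auto)
  then show ?thesis using that zc by blast
qed

lemma omega_level: "omega n n = \<zero>\<^bsub>LR n\<^esub>"
proof -
  have "omega n = omega n \<otimes>\<^bsub>\<Lambda>\<^esub> \<one>\<^bsub>\<Lambda>\<^esub>" using omega_closed by simp
  moreover have "(omega n \<otimes>\<^bsub>\<Lambda>\<^esub> \<one>\<^bsub>\<Lambda>\<^esub>) n c = \<zero>\<^bsub>Zp p\<^esub>" if c: "c \<in> carrier (GQ n)" for c
  proof
    fix k
    from c obtain i where i: "c = cs n i" by (rule GQ_csE)
    obtain j where j: "cs n i = cs n (j + p ^ n)" by (rule cs_shift)
    show "(omega n \<otimes>\<^bsub>\<Lambda>\<^esub> \<one>\<^bsub>\<Lambda>\<^esub>) n c k = \<zero>\<^bsub>Zp p\<^esub> k"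
      unfolding i j omega_mult_cs[OF \<Lambda>.one_closed] using cs_periodic[of n j 1] by (simp add: Zp_simps)
  qed
  ultimately show ?thesis using LR_zero_iff[OF \<Lambda>_level[OF omega_closed]] by simp
qed

lemma level_zero_iff:
  assumes "x \<in> carrier \<Lambda>"
  shows "x n = \<zero>\<^bsub>LR n\<^esub> \<longleftrightarrow> (\<exists>y\<in>carrier \<Lambda>. x = omega n \<otimes>\<^bsub>\<Lambda>\<^esub> y)"
proof
  assume "x n = \<zero>\<^bsub>LR n\<^esub>"
  then show "\<exists>y\<in>carrier \<Lambda>. x = omega n \<otimes>\<^bsub>\<Lambda>\<^esub> y" using omega_divides[OF assms] by metis
next
  interpret L: cring "LR n" by (rule LR_cring)
  assume "\<exists>y\<in>carrier \<Lambda>. x = omega n \<otimes>\<^bsub>\<Lambda>\<^esub> y"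
  then show "x n = \<zero>\<^bsub>LR n\<^esub>" using \<Lambda>_level by (auto simp: \<Lambda>_mult_level omega_level)
qed

text \<open>An element annihilated by \<open>omega n\<close> is a periodic measure, and such a
  measure is zero.\<close>

lemma omega_cancel:
  assumes y: "y \<in> carrier \<Lambda>" and 0: "omega n \<otimes>\<^bsub>\<Lambda>\<^esub> y = \<zero>\<^bsub>\<Lambda>\<^esub>"
  shows "y = \<zero>\<^bsub>\<Lambda>\<^esub>"
proof (rule \<Lambda>_eq_csI[OF y])
  fix m i k
  have "[y m (cs m (i + p ^ n)) k = y m (cs m i) k] (mod q k)" for m i k
  proof -
    have "(y m (cs m i) k - y m (cs m (i + p ^ n)) k) mod q k = 0"
      using omega_mult_cs[OF y, of n m i k] 0 by (simp add: \<Lambda>_zero_apply cs_closed Zp_simps)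
    then show ?thesis by (simp add: cong_iff_dvd_diff mod_eq_0_iff_dvd dvd_diff_commute)
  qed
  then have "[y m (cs m i) k = 0] (mod q k)" by (rule measure_periodic_zero[OF \<Lambda>_measure[OF y]])
  then show "y m (cs m i) k = \<zero>\<^bsub>\<Lambda>\<^esub> m (cs m i) k"
    using Zp_mod_self[OF \<Lambda>_apply_closed[OF y cs_closed[of m i]], of k]
    by (simp add: \<Lambda>_zero_apply cs_closed Zp_simps cong_def del: power_Suc)
qed simp

lemma level_onto: "(\<lambda>x. x n) ` carrier \<Lambda> = carrier (LR n)"
proof
  show "carrier (LR n) \<subseteq> (\<lambda>x. x n) ` carrier \<Lambda>"
  proof
    fix w assume w: "w \<in> carrier (LR n)"
    let ?I = "\<lambda>m c. {i \<in> {..<p ^ n}. cs m i = c}"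
    \<comment> \<open>The lift of \<open>w\<close> is a sum of point masses at the powers of
      \<open>b\<close> with exponents below p^n, one in each coset of level n.\<close>
    define x where "x m = (\<lambda>c\<in>carrier (GQ m). \<Oplus>\<^bsub>Zp p\<^esub>i\<in>?I m c. w (cs n i))" for m
    have wc: "w (cs n i) \<in> carrier (Zp p)" for i using LR_apply_closed[OF w cs_closed] .
    have xL: "x m \<in> carrier (LR m)" for m
      using wc by (auto simp: LR_carrier x_def intro!: Zp.finsum_closed)
    have "tr m (x (Suc m)) = x m" for m
    proof (rule LR_eqI)
      show "tr m (x (Suc m)) \<in> carrier (LR m)" using ring_hom_closed[OF IS.hom xL] .
      fix c assume c: "c \<in> carrier (GQ m)"
      let ?F = "{c' \<in> carrier (GQ (Suc m)). GS m <#> c' = c}"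
      have "tr m (x (Suc m)) c = (\<Oplus>\<^bsub>Zp p\<^esub>c'\<in>?F. \<Oplus>\<^bsub>Zp p\<^esub>i\<in>{i \<in> ?I m c. cs (Suc m) i = c'}. w (cs n i))"
        unfolding tr_apply[OF c]
      proof (rule Zp.finsum_cong'[OF refl])
        fix c' assume c': "c' \<in> ?F"
        then have "{i \<in> ?I m c. cs (Suc m) i = c'} = ?I (Suc m) c'" using GS_cs_Suc by auto
        then show "x (Suc m) c' = (\<Oplus>\<^bsub>Zp p\<^esub>i\<in>{i \<in> ?I m c. cs (Suc m) i = c'}. w (cs n i))"
          using c' by (simp add: x_def)
      qed (use wc in \<open>auto intro!: Zp.finsum_closed\<close>)
      also have "\<dots> = (\<Oplus>\<^bsub>Zp p\<^esub>i\<in>?I m c. w (cs n i))"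
        using GQ_finite wc by (intro Zp.finsum_fibres) (auto simp: cs_closed GS_cs_Suc)
      finally show "tr m (x (Suc m)) c = x m c" using c by (simp add: x_def)
    qed (rule xL)
    then have "x \<in> carrier \<Lambda>" using xL by (simp add: \<Lambda>_carrier)
    moreover have "x n = w"
    proof (rule LR_eqI[OF xL w])
      fix c assume c: "c \<in> carrier (GQ n)"
      then obtain i where i: "i < p ^ n" "c = cs n i" by (rule GQ_csE)
      then have "?I n c = {i}" using cs_inj by auto
      then show "x n c = w c" using c wc i by (simp add: x_def)
    qed
    ultimately show "w \<in> (\<lambda>x. x n) ` carrier \<Lambda>" by blast
  qed
qed (use \<Lambda>_level in auto)

end

section \<open>The chain complex over the Iwasawa algebra\<close>

text \<open>Arcs outside the orientation are reverses of arcs inside it, so invariance along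
  \<open>Ep\<close> extends to all arcs and then along the walks of the symmetric closure.\<close>

lemma connected_fin_graph:
  assumes H: "bidirected_digraph H \<kappa>" and Ep: "orientation H \<kappa> Ep" and conn: "Digraph_Component.connected H"
    and fin: "finite (verts H)" "finite (arcs H)"
  shows "fin_graph (verts H) Ep (head H) (tail H)"
proof
  interpret H: bidirected_digraph H \<kappa> by fact
  have Ep': "Ep \<subseteq> arcs H" "\<kappa> ` Ep = arcs H - Ep" using Ep by (auto simp: orientation_def)
  show "finite (verts H)" "finite Ep" using fin Ep' finite_subset by blast+
  show "e \<in> Ep \<Longrightarrow> head H e \<in> verts H" "e \<in> Ep \<Longrightarrow> tail H e \<in> verts H" for e using Ep' by auto
  have sc: "strongly_connected (mk_symmetric H)" using conn by (simp add: Digraph_Component.connected_def)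
  then show "verts H \<noteq> {}" by (simp add: strongly_connected_def)
  fix P :: "'a \<Rightarrow> bool" and u w
  assume P: "\<And>e. e \<in> Ep \<Longrightarrow> P (head H e) \<longleftrightarrow> P (tail H e)" and uw: "u \<in> verts H" "w \<in> verts H" "P u"
  have arc: "P (head H a) \<longleftrightarrow> P (tail H a)" if "a \<in> arcs H" for a
  proof (cases "a \<in> Ep")
    case False
    then have "a \<in> \<kappa> ` Ep" using that Ep' by auto
    then obtain e where e: "e \<in> Ep" "a = \<kappa> e" by blast
    then show ?thesis using P[of e] Ep'(1) by auto
  qed (rule P)
  interpret S: pair_wf_digraph "mk_symmetric H" ..
  have "u \<rightarrow>\<^sup>*\<^bsub>mk_symmetric H\<^esub> w" using sc uw by (auto simp: strongly_connected_def)
  then show "P w"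
  proof (induction rule: S.reachable_induct)
    case (step x y)
    then obtain a where "a \<in> arcs H" "(x, y) = (tail H a, head H a) \<or> (x, y) = (head H a, tail H a)"
      by (auto simp: parcs_mk_symmetric)
    then show ?case using arc[of a] step by auto
  qed (rule uw)
qed

locale iwasawa_graph = padic_group p \<Gamma> T \<phi> \<gamma>
  for p and \<Gamma> :: "'g monoid" (structure) and T \<phi> \<gamma> +
  fixes X :: "('v, 'e) pre_digraph" and \<iota> :: "'e \<Rightarrow> 'e" and Ep :: "'e set" and \<alpha> :: "'e \<Rightarrow> 'g"
  assumes X: "bidirected_digraph X \<iota>" and finX: "fin_digraph X" and Ep: "orientation X \<iota> Ep"
    and \<alpha>: "voltage_assignment X \<iota> \<Gamma> \<alpha>"
    and conn: "\<And>m. Digraph_Component.connected (derived_graph X (GQ m) (\<lambda>e. cl m (\<alpha> e)))"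
begin

abbreviation "V \<equiv> verts X"
abbreviation "hX \<equiv> head X"
abbreviation "tX \<equiv> tail X"
abbreviation "C \<equiv> free_module \<Lambda> Ep"
abbreviation "D \<equiv> free_module \<Lambda> V"
abbreviation "dI \<equiv> boundary_inf p \<Gamma> T \<gamma> X Ep \<alpha>"
abbreviation "sI \<equiv> star_inf p \<Gamma> T \<gamma> X Ep \<alpha>"
abbreviation "XQ m \<equiv> derived_graph X (GQ m) (\<lambda>e. cl m (\<alpha> e))"
abbreviation "VQ m \<equiv> V \<times> carrier (GQ m)"
abbreviation "EQ m \<equiv> Ep \<times> carrier (GQ m)"

lemma finite_V: "finite V" and finite_Ep: "finite Ep" and Ep_arcs: "Ep \<subseteq> arcs X"
proof -
  interpret fin_digraph X by (rule finX)
  show E: "Ep \<subseteq> arcs X" using Ep by (simp add: orientation_def)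
  show "finite V" by simp
  show "finite Ep" using finite_subset[OF E] by simp
qed

lemma edge_verts: "e \<in> Ep \<Longrightarrow> hX e \<in> V" "e \<in> Ep \<Longrightarrow> tX e \<in> V"
proof -
  interpret fin_digraph X by (rule finX)
  show "e \<in> Ep \<Longrightarrow> hX e \<in> V" "e \<in> Ep \<Longrightarrow> tX e \<in> V" using Ep_arcs by auto
qed

lemma \<alpha>_closed: "e \<in> Ep \<Longrightarrow> \<alpha> e \<in> carrier \<Gamma>"
  using \<alpha> Ep_arcs by (auto simp: voltage_assignment_def)

lemma cl_voltage: "voltage_assignment X \<iota> (GQ m) (\<lambda>e. cl m (\<alpha> e))"
  using \<alpha> by (auto simp: voltage_assignment_def cl_closed GQ_inv Pi_iff)

lemma XQ_fin_graph: "fin_graph (VQ m) (EQ m) (head (XQ m)) (tail (XQ m))"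
proof -
  interpret fin_digraph X by (rule finX)
  interpret Q: comm_group "GQ m" by (rule GQ_comm_group)
  have "fin_graph (verts (XQ m)) (EQ m) (head (XQ m)) (tail (XQ m))"
    by (rule connected_fin_graph[OF derived_graph_bidirected[OF X Q.is_group cl_voltage]
          derived_graph_orientation[OF X Q.is_group cl_voltage Ep] conn])
      (simp_all add: derived_graph_def GQ_finite)
  then show ?thesis by (simp add: derived_graph_def)
qed

sublocale fg: fin_graph_padic "VQ m" "EQ m" "head (XQ m)" "tail (XQ m)" p for m
  by (intro fin_graph_padic.intro XQ_fin_graph padic_axioms)

sublocale C: module \<Lambda> C by (rule \<Lambda>.free_module_module)
sublocale D: module \<Lambda> D by (rule \<Lambda>.free_module_module)

lemma C_iff: "x \<in> carrier C \<longleftrightarrow> x \<in> Ep \<rightarrow>\<^sub>E carrier \<Lambda>"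
  and D_iff: "y \<in> carrier D \<longleftrightarrow> y \<in> V \<rightarrow>\<^sub>E carrier \<Lambda>"
  using finite_V finite_Ep by (simp_all add: free_module_simps)

lemma C_apply: "x \<in> carrier C \<Longrightarrow> e \<in> Ep \<Longrightarrow> x e \<in> carrier \<Lambda>"
  and D_apply: "y \<in> carrier D \<Longrightarrow> v \<in> V \<Longrightarrow> y v \<in> carrier \<Lambda>"
  by (auto simp: C_iff D_iff)

abbreviation "\<delta> \<equiv> basis_elt \<Lambda> V"
abbreviation "\<epsilon> \<equiv> basis_elt \<Lambda> Ep"

section \<open>Coordinates of d and s at finite level and precision\<close>

definition dval :: "'e \<Rightarrow> 'v \<Rightarrow> 'g iwasawa_elt" where
  "dval e = (ge (\<alpha> e) \<odot>\<^bsub>D\<^esub> \<delta> (hX e)) \<ominus>\<^bsub>D\<^esub> \<delta> (tX e)"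

definition sval :: "'v \<Rightarrow> 'e \<Rightarrow> 'g iwasawa_elt" where
  "sval v = (\<Oplus>\<^bsub>C\<^esub>e\<in>{e \<in> Ep. hX e = v}. ge (inv (\<alpha> e)) \<odot>\<^bsub>C\<^esub> \<epsilon> e) \<ominus>\<^bsub>C\<^esub> (\<Oplus>\<^bsub>C\<^esub>e\<in>{e \<in> Ep. tX e = v}. \<epsilon> e)"

lemma dI_eq: "dI = lin_ext \<Lambda> Ep D dval"
  by (simp add: boundary_inf_def dval_def[abs_def] Let_def)

lemma sI_eq: "sI = lin_ext \<Lambda> V C sval"
  by (simp add: star_inf_def sval_def[abs_def] Let_def)

lemma dval_closed: "e \<in> Ep \<Longrightarrow> dval e \<in> carrier D"
  unfolding dval_def
  by (intro D.M.minus_closed D.smult_closed ge_closed \<alpha>_closed \<Lambda>.basis_elt_closed)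

lemma sval_terms:
  "(\<lambda>e. ge (inv (\<alpha> e)) \<odot>\<^bsub>C\<^esub> \<epsilon> e) \<in> {e \<in> Ep. hX e = v} \<rightarrow> carrier C"
  "(\<lambda>e. \<epsilon> e) \<in> {e \<in> Ep. tX e = v} \<rightarrow> carrier C"
  by (auto intro!: C.smult_closed ge_closed \<alpha>_closed \<Lambda>.basis_elt_closed inv_closed)

lemma sval_closed: "sval v \<in> carrier C"
  unfolding sval_def by (intro C.M.minus_closed C.M.finsum_closed sval_terms)

lemma dI_setup: "lin_ext_setup \<Lambda> D Ep dval"
  by (intro lin_ext_setup.intro lin_ext_setup_axioms.intro D.module_axioms) (auto intro: dval_closed)

lemma sI_setup: "lin_ext_setup \<Lambda> C V sval"
  by (intro lin_ext_setup.intro lin_ext_setup_axioms.intro C.module_axioms) (auto intro: sval_closed)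

lemmas dI_closed = lin_ext_setup.lin_ext_closed[OF dI_setup, folded dI_eq]
  and dI_add = lin_ext_setup.lin_ext_add[OF dI_setup, folded dI_eq]
  and dI_minus = lin_ext_setup.lin_ext_minus[OF dI_setup, folded dI_eq]
  and dI_smult = lin_ext_setup.lin_ext_smult[OF dI_setup, folded dI_eq]
  and dI_basis = lin_ext_setup.lin_ext_basis[OF dI_setup, folded dI_eq]
  and sI_closed = lin_ext_setup.lin_ext_closed[OF sI_setup, folded sI_eq]
  and sI_add = lin_ext_setup.lin_ext_add[OF sI_setup, folded sI_eq]
  and sI_minus = lin_ext_setup.lin_ext_minus[OF sI_setup, folded sI_eq]
  and sI_smult = lin_ext_setup.lin_ext_smult[OF sI_setup, folded sI_eq]

text \<open>The coefficients of d and of s both have the shape of a group element or zero minus one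
  or zero, so one computation serves both maps.\<close>

lemma term_coord:
  assumes x: "x \<in> carrier \<Lambda>" and g: "g \<in> carrier \<Gamma>" and h: "h \<in> carrier (GQ m)"
  shows "(x \<otimes>\<^bsub>\<Lambda>\<^esub> ((if P then ge g else \<zero>\<^bsub>\<Lambda>\<^esub>) \<ominus>\<^bsub>\<Lambda>\<^esub> (if Q then \<one>\<^bsub>\<Lambda>\<^esub> else \<zero>\<^bsub>\<Lambda>\<^esub>))) m h k
    = ((if P then x m (inv\<^bsub>GQ m\<^esub> cl m g \<otimes>\<^bsub>GQ m\<^esub> h) k else 0) - (if Q then x m h k else 0)) mod q k"
proof -
  have gc: "ge g \<in> carrier \<Lambda>" by (rule ge_closed[OF g])
  let ?a = "if P then ge g \<otimes>\<^bsub>\<Lambda>\<^esub> x else \<zero>\<^bsub>\<Lambda>\<^esub>" and ?b = "if Q then x else \<zero>\<^bsub>\<Lambda>\<^esub>"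
  have ab: "?a \<in> carrier \<Lambda>" "?b \<in> carrier \<Lambda>" using x gc by auto
  have "x \<otimes>\<^bsub>\<Lambda>\<^esub> ((if P then ge g else \<zero>\<^bsub>\<Lambda>\<^esub>) \<ominus>\<^bsub>\<Lambda>\<^esub> (if Q then \<one>\<^bsub>\<Lambda>\<^esub> else \<zero>\<^bsub>\<Lambda>\<^esub>)) = ?a \<ominus>\<^bsub>\<Lambda>\<^esub> ?b"
    unfolding a_minus_def using x gc by (auto simp: \<Lambda>.r_distr \<Lambda>.r_minus \<Lambda>.m_comm)
  moreover have "(?a \<ominus>\<^bsub>\<Lambda>\<^esub> ?b) m h k = (?a m h k - ?b m h k) mod q k"
    using ab h by (simp only: \<Lambda>_minus_apply Zp_minus \<Lambda>_apply_closed)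
  moreover have "?a m h k = (if P then x m (inv\<^bsub>GQ m\<^esub> cl m g \<otimes>\<^bsub>GQ m\<^esub> h) k else 0)"
    using x g h by (simp add: ge_mult_apply \<Lambda>_zero_apply Zp_simps)
  moreover have "?b m h k = (if Q then x m h k else 0)"
    using h by (simp add: \<Lambda>_zero_apply Zp_simps)
  ultimately show ?thesis by simp
qed

lemma \<Lambda>_finsum_coord:
  assumes "f \<in> A \<rightarrow> carrier \<Lambda>" "h \<in> carrier (GQ m)"
  shows "(\<Oplus>\<^bsub>\<Lambda>\<^esub>i\<in>A. f i) m h k = (\<Sum>i\<in>A. f i m h k) mod q k"
proof -
  have "(\<lambda>i. f i m h) \<in> A \<rightarrow> carrier (Zp p)" using assms \<Lambda>_apply_closed by blast
  then show ?thesis unfolding \<Lambda>_finsum_apply[OF assms] by (rule Zp_finsum)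
qed

lemma basis_apply: "s \<in> S \<Longrightarrow> basis_elt \<Lambda> S t s = (if t = s then \<one>\<^bsub>\<Lambda>\<^esub> else \<zero>\<^bsub>\<Lambda>\<^esub>)"
  by (auto simp: basis_elt_def)

lemma dval_apply:
  assumes "e \<in> Ep" "v \<in> V"
  shows "dval e v = (if hX e = v then ge (\<alpha> e) else \<zero>\<^bsub>\<Lambda>\<^esub>) \<ominus>\<^bsub>\<Lambda>\<^esub> (if tX e = v then \<one>\<^bsub>\<Lambda>\<^esub> else \<zero>\<^bsub>\<Lambda>\<^esub>)"
proof -
  note gc = ge_closed[OF \<alpha>_closed[OF assms(1)]]
  have "dval e v = (ge (\<alpha> e) \<odot>\<^bsub>D\<^esub> \<delta> (hX e)) v \<ominus>\<^bsub>\<Lambda>\<^esub> \<delta> (tX e) v"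
    using assms gc by (simp add: dval_def \<Lambda>.free_module_minus \<Lambda>.basis_elt_closed)
  then show ?thesis
    using assms gc by (simp add: free_module_simps basis_apply)
qed

lemma sval_apply:
  assumes "e \<in> Ep"
  shows "sval v e = (if hX e = v then ge (inv (\<alpha> e)) else \<zero>\<^bsub>\<Lambda>\<^esub>) \<ominus>\<^bsub>\<Lambda>\<^esub> (if tX e = v then \<one>\<^bsub>\<Lambda>\<^esub> else \<zero>\<^bsub>\<Lambda>\<^esub>)"
proof -
  have *: "(\<Oplus>\<^bsub>\<Lambda>\<^esub>e'\<in>{e' \<in> Ep. h e' = v}. if e' = e then f e' else \<zero>\<^bsub>\<Lambda>\<^esub>) = (if h e = v then f e else \<zero>\<^bsub>\<Lambda>\<^esub>)"
    if f: "\<And>e. e \<in> Ep \<Longrightarrow> f e \<in> carrier \<Lambda>" for f and h :: "'e \<Rightarrow> 'v"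
  proof (cases "h e = v")
    case True
    then show ?thesis using \<Lambda>.finsum_delta[of "{e' \<in> Ep. h e' = v}" e f] finite_Ep assms f by simp
  next
    case False
    then have "(\<Oplus>\<^bsub>\<Lambda>\<^esub>e'\<in>{e' \<in> Ep. h e' = v}. if e' = e then f e' else \<zero>\<^bsub>\<Lambda>\<^esub>) = (\<Oplus>\<^bsub>\<Lambda>\<^esub>e'\<in>{e' \<in> Ep. h e' = v}. \<zero>\<^bsub>\<Lambda>\<^esub>)"
      by (intro \<Lambda>.finsum_cong') auto
    then show ?thesis using False by (simp add: \<Lambda>.finsum_zero)
  qed
  note gc = ge_closed[OF inv_closed[OF \<alpha>_closed]]
  have 1: "(\<Oplus>\<^bsub>C\<^esub>e'\<in>{e' \<in> Ep. hX e' = v}. ge (inv (\<alpha> e')) \<odot>\<^bsub>C\<^esub> \<epsilon> e') e = (if hX e = v then ge (inv (\<alpha> e)) else \<zero>\<^bsub>\<Lambda>\<^esub>)"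
  proof -
    have "(\<Oplus>\<^bsub>C\<^esub>e'\<in>{e' \<in> Ep. hX e' = v}. ge (inv (\<alpha> e')) \<odot>\<^bsub>C\<^esub> \<epsilon> e') e
      = (\<Oplus>\<^bsub>\<Lambda>\<^esub>e'\<in>{e' \<in> Ep. hX e' = v}. (ge (inv (\<alpha> e')) \<odot>\<^bsub>C\<^esub> \<epsilon> e') e)"
      by (rule \<Lambda>.free_module_finsum[OF sval_terms(1) assms])
    also have "\<dots> = (\<Oplus>\<^bsub>\<Lambda>\<^esub>e'\<in>{e' \<in> Ep. hX e' = v}. if e' = e then ge (inv (\<alpha> e')) else \<zero>\<^bsub>\<Lambda>\<^esub>)"
      using assms gc by (intro \<Lambda>.finsum_cong') (auto simp: free_module_simps basis_apply)
    finally show ?thesis using *[of "\<lambda>e. ge (inv (\<alpha> e))" hX] gc by simp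
  qed
  have 2: "(\<Oplus>\<^bsub>C\<^esub>e'\<in>{e' \<in> Ep. tX e' = v}. \<epsilon> e') e = (if tX e = v then \<one>\<^bsub>\<Lambda>\<^esub> else \<zero>\<^bsub>\<Lambda>\<^esub>)"
  proof -
    have "(\<Oplus>\<^bsub>C\<^esub>e'\<in>{e' \<in> Ep. tX e' = v}. \<epsilon> e') e = (\<Oplus>\<^bsub>\<Lambda>\<^esub>e'\<in>{e' \<in> Ep. tX e' = v}. \<epsilon> e' e)"
      by (rule \<Lambda>.free_module_finsum[OF sval_terms(2) assms])
    also have "\<dots> = (\<Oplus>\<^bsub>\<Lambda>\<^esub>e'\<in>{e' \<in> Ep. tX e' = v}. if e' = e then \<one>\<^bsub>\<Lambda>\<^esub> else \<zero>\<^bsub>\<Lambda>\<^esub>)"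
      using assms by (intro \<Lambda>.finsum_cong') (auto simp: basis_apply)
    finally show ?thesis using *[of "\<lambda>_. \<one>\<^bsub>\<Lambda>\<^esub>" tX] by simp
  qed
  show ?thesis
    unfolding sval_def
    using \<Lambda>.free_module_minus[OF C.M.finsum_closed[OF sval_terms(1)] C.M.finsum_closed[OF sval_terms(2)]] assms
    by (simp add: 1 2)
qed

lemma dI_coord:
  assumes c: "c \<in> carrier C" and v: "v \<in> V" and h: "h \<in> carrier (GQ m)"
  shows "dI c v m h k = (\<Sum>e\<in>Ep. (if hX e = v then c e m (inv\<^bsub>GQ m\<^esub> cl m (\<alpha> e) \<otimes>\<^bsub>GQ m\<^esub> h) k else 0)
      - (if tX e = v then c e m h k else 0)) mod q k"
proof -
  have t: "(c e \<odot>\<^bsub>D\<^esub> dval e) v = c e \<otimes>\<^bsub>\<Lambda>\<^esub> ((if hX e = v then ge (\<alpha> e) else \<zero>\<^bsub>\<Lambda>\<^esub>) \<ominus>\<^bsub>\<Lambda>\<^esub> (if tX e = v then \<one>\<^bsub>\<Lambda>\<^esub> else \<zero>\<^bsub>\<Lambda>\<^esub>))"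
    if "e \<in> Ep" for e
    using that v by (simp add: free_module_simps dval_apply)
  have tc: "(\<lambda>e. c e \<odot>\<^bsub>D\<^esub> dval e) \<in> Ep \<rightarrow> carrier D"
    using c by (auto intro!: D.smult_closed dval_closed C_apply)
  have "dI c = (\<Oplus>\<^bsub>D\<^esub>e\<in>Ep. c e \<odot>\<^bsub>D\<^esub> dval e)"
    unfolding dI_eq by (rule lin_ext_setup.lin_ext_superset[OF dI_setup c finite_Ep]) auto
  then have "dI c v = (\<Oplus>\<^bsub>\<Lambda>\<^esub>e\<in>Ep. (c e \<odot>\<^bsub>D\<^esub> dval e) v)"
    using \<Lambda>.free_module_finsum[OF tc v] by simp
  then have "dI c v m h k = (\<Sum>e\<in>Ep. (c e \<odot>\<^bsub>D\<^esub> dval e) v m h k) mod q k"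
    using \<Lambda>_finsum_coord[of "\<lambda>e. (c e \<odot>\<^bsub>D\<^esub> dval e) v" Ep h m k] tc v h D_apply by auto
  also have "\<dots> = (\<Sum>e\<in>Ep. ((if hX e = v then c e m (inv\<^bsub>GQ m\<^esub> cl m (\<alpha> e) \<otimes>\<^bsub>GQ m\<^esub> h) k else 0)
      - (if tX e = v then c e m h k else 0)) mod q k) mod q k"
  proof (rule arg_cong[where f = "\<lambda>x. x mod q k"], rule sum.cong[OF refl])
    fix e assume e: "e \<in> Ep"
    show "(c e \<odot>\<^bsub>D\<^esub> dval e) v m h k = ((if hX e = v then c e m (inv\<^bsub>GQ m\<^esub> cl m (\<alpha> e) \<otimes>\<^bsub>GQ m\<^esub> h) k else 0)
      - (if tX e = v then c e m h k else 0)) mod q k"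
      unfolding t[OF e] by (rule term_coord[OF C_apply[OF c e] \<alpha>_closed[OF e] h])
  qed
  finally show ?thesis unfolding mod_sum_eq .
qed

lemma sI_coord:
  assumes y: "y \<in> carrier D" and e: "e \<in> Ep" and h: "h \<in> carrier (GQ m)"
  shows "sI y e m h k = (y (hX e) m (h \<otimes>\<^bsub>GQ m\<^esub> cl m (\<alpha> e)) k - y (tX e) m h k) mod q k"
proof -
  interpret Q: comm_group "GQ m" by (rule GQ_comm_group)
  have t: "(y v \<odot>\<^bsub>C\<^esub> sval v) e = y v \<otimes>\<^bsub>\<Lambda>\<^esub> ((if hX e = v then ge (inv (\<alpha> e)) else \<zero>\<^bsub>\<Lambda>\<^esub>) \<ominus>\<^bsub>\<Lambda>\<^esub> (if tX e = v then \<one>\<^bsub>\<Lambda>\<^esub> else \<zero>\<^bsub>\<Lambda>\<^esub>))"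
    for v
    using e by (simp add: free_module_simps sval_apply)
  \<comment> \<open>The inverse voltage in the star map makes the coefficient at \<open>h\<close>
    read \<open>y\<close> at h \<alpha>(e), the group component of the head of the edge (e,
    h).\<close>
  have i: "inv\<^bsub>GQ m\<^esub> cl m (inv (\<alpha> e)) \<otimes>\<^bsub>GQ m\<^esub> h = h \<otimes>\<^bsub>GQ m\<^esub> cl m (\<alpha> e)"
    using \<alpha>_closed[OF e] h by (simp add: GQ_inv Q.m_comm cl_closed)
  have tc: "(\<lambda>v. y v \<odot>\<^bsub>C\<^esub> sval v) \<in> V \<rightarrow> carrier C"
    using y by (auto intro!: C.smult_closed sval_closed D_apply)
  have "sI y = (\<Oplus>\<^bsub>C\<^esub>v\<in>V. y v \<odot>\<^bsub>C\<^esub> sval v)"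
    unfolding sI_eq by (rule lin_ext_setup.lin_ext_superset[OF sI_setup y finite_V]) auto
  then have "sI y e = (\<Oplus>\<^bsub>\<Lambda>\<^esub>v\<in>V. (y v \<odot>\<^bsub>C\<^esub> sval v) e)"
    using \<Lambda>.free_module_finsum[OF tc e] by simp
  then have "sI y e m h k = (\<Sum>v\<in>V. (y v \<odot>\<^bsub>C\<^esub> sval v) e m h k) mod q k"
    using \<Lambda>_finsum_coord[of "\<lambda>v. (y v \<odot>\<^bsub>C\<^esub> sval v) e" V h m k] tc e h C_apply by auto
  also have "\<dots> = (\<Sum>v\<in>V. ((if hX e = v then y v m (h \<otimes>\<^bsub>GQ m\<^esub> cl m (\<alpha> e)) k else 0)
      - (if tX e = v then y v m h k else 0)) mod q k) mod q k"
  proof (rule arg_cong[where f = "\<lambda>x. x mod q k"], rule sum.cong[OF refl])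
    fix v assume v: "v \<in> V"
    show "(y v \<odot>\<^bsub>C\<^esub> sval v) e m h k = ((if hX e = v then y v m (h \<otimes>\<^bsub>GQ m\<^esub> cl m (\<alpha> e)) k else 0)
      - (if tX e = v then y v m h k else 0)) mod q k"
      unfolding t term_coord[OF D_apply[OF y v] inv_closed[OF \<alpha>_closed[OF e]] h] i ..
  qed
  also have "\<dots> = (\<Sum>v\<in>V. (if hX e = v then y v m (h \<otimes>\<^bsub>GQ m\<^esub> cl m (\<alpha> e)) k else 0)
      - (if tX e = v then y v m h k else 0)) mod q k" by (rule mod_sum_eq)
  also have "(\<Sum>v\<in>V. (if hX e = v then y v m (h \<otimes>\<^bsub>GQ m\<^esub> cl m (\<alpha> e)) k else 0)
      - (if tX e = v then y v m h k else 0)) = y (hX e) m (h \<otimes>\<^bsub>GQ m\<^esub> cl m (\<alpha> e)) k - y (tX e) m h k"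
    using finite_V edge_verts[OF e] by (simp add: sum_subtractf)
  finally show ?thesis .
qed

text \<open>Level \<open>m\<close> and component \<open>k\<close> of a chain or divisor, read as an
  integral function on the cells of the derived graph. Through it integral graph theory applies to
  \<Lambda>-modules.\<close>

definition coords :: "nat \<Rightarrow> nat \<Rightarrow> ('i \<Rightarrow> 'g iwasawa_elt) \<Rightarrow> 'i \<times> 'g set \<Rightarrow> int" where
  "coords m k x = (\<lambda>(i, h). x i m h k)"

text \<open>The derived edge over \<open>e\<close> that ends in layer \<open>h\<close> is the one
  that starts in layer \<alpha>(e)^-1 h; each edge of the base thus contributes at most one incoming
  term.\<close>

lemma bd_XQ:
  assumes v: "v \<in> V" and h: "h \<in> carrier (GQ m)"
  shows "fg.bd m c (v, h) = (\<Sum>e\<in>Ep. (if hX e = v then c (e, inv\<^bsub>GQ m\<^esub> cl m (\<alpha> e) \<otimes>\<^bsub>GQ m\<^esub> h) else 0)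
     - (if tX e = v then c (e, h) else 0))"
proof -
  interpret Q: comm_group "GQ m" by (rule GQ_comm_group)
  have *: "(\<Sum>e\<in>{e \<in> Ep. P e}. f e) = (\<Sum>e\<in>Ep. if P e then f e else 0)" for P and f :: "'e \<Rightarrow> int"
    using finite_Ep by (intro sum.mono_neutral_cong_left) auto
  have 1: "(\<Sum>x\<in>{x \<in> EQ m. head (XQ m) x = (v, h)}. c x) = (\<Sum>e\<in>{e \<in> Ep. hX e = v}. c (e, inv\<^bsub>GQ m\<^esub> cl m (\<alpha> e) \<otimes>\<^bsub>GQ m\<^esub> h))"
  proof (rule sum.reindex_bij_witness[where i = "\<lambda>e. (e, inv\<^bsub>GQ m\<^esub> cl m (\<alpha> e) \<otimes>\<^bsub>GQ m\<^esub> h)" and j = fst])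
    fix x assume x: "x \<in> {x \<in> EQ m. head (XQ m) x = (v, h)}"
    then obtain e g where e: "x = (e, g)" "e \<in> Ep" "g \<in> carrier (GQ m)" "hX e = v" "g \<otimes>\<^bsub>GQ m\<^esub> cl m (\<alpha> e) = h"
      by (auto simp: derived_graph_def)
    note a = cl_closed[OF \<alpha>_closed[OF e(2)], of m]
    have "inv\<^bsub>GQ m\<^esub> cl m (\<alpha> e) \<otimes>\<^bsub>GQ m\<^esub> h = g"
      using e(3) a unfolding e(5)[symmetric] by (simp add: Q.m_comm[of g] Q.m_assoc[symmetric])
    then show "(fst x, inv\<^bsub>GQ m\<^esub> cl m (\<alpha> (fst x)) \<otimes>\<^bsub>GQ m\<^esub> h) = x"
      "c (fst x, inv\<^bsub>GQ m\<^esub> cl m (\<alpha> (fst x)) \<otimes>\<^bsub>GQ m\<^esub> h) = c x"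
      "fst x \<in> {e \<in> Ep. hX e = v}" using e by auto
  next
    fix e assume e: "e \<in> {e \<in> Ep. hX e = v}"
    then have a: "cl m (\<alpha> e) \<in> carrier (GQ m)" using cl_closed \<alpha>_closed by auto
    have "inv\<^bsub>GQ m\<^esub> cl m (\<alpha> e) \<otimes>\<^bsub>GQ m\<^esub> h \<otimes>\<^bsub>GQ m\<^esub> cl m (\<alpha> e) = h"
      using a h by (simp add: Q.m_comm[of _ "cl m (\<alpha> e)"] Q.m_assoc[symmetric])
    then show "(e, inv\<^bsub>GQ m\<^esub> cl m (\<alpha> e) \<otimes>\<^bsub>GQ m\<^esub> h) \<in> {x \<in> EQ m. head (XQ m) x = (v, h)}"
      using e a h by (simp add: derived_graph_def)
  qed auto
  have 2: "(\<Sum>x\<in>{x \<in> EQ m. tail (XQ m) x = (v, h)}. c x) = (\<Sum>e\<in>{e \<in> Ep. tX e = v}. c (e, h))"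
    by (rule sum.reindex_bij_witness[where i = "\<lambda>e. (e, h)" and j = fst]) (use h in \<open>auto simp: derived_graph_def\<close>)
  show ?thesis
    unfolding fg.bd_def 1 2 unfolding * by (rule sum_subtractf[symmetric])
qed

lemma st_XQ: "fg.st m y (e, h) = y (hX e, h \<otimes>\<^bsub>GQ m\<^esub> cl m (\<alpha> e)) - y (tX e, h)"
  unfolding fg.st_def by (simp add: derived_graph_def)

lemma dI_bd:
  assumes "c \<in> carrier C" "v \<in> V" "h \<in> carrier (GQ m)"
  shows "dI c v m h k = fg.bd m (coords m k c) (v, h) mod q k"
  unfolding dI_coord[OF assms] bd_XQ[OF assms(2,3)] coords_def prod.case ..

lemma sI_st:
  assumes "y \<in> carrier D" "e \<in> Ep" "h \<in> carrier (GQ m)"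
  shows "sI y e m h k = fg.st m (coords m k y) (e, h) mod q k"
  unfolding sI_coord[OF assms] st_XQ coords_def prod.case ..

text \<open>Only a congruence: the coordinates of \<open>sI y\<close> are already reduced modulo
  \<open>q k\<close> when the boundary is taken.\<close>

lemma dI_sI_lap:
  assumes y: "y \<in> carrier D" and v: "v \<in> V" and h: "h \<in> carrier (GQ m)"
  shows "[fg.bd m (coords m k (sI y)) (v, h) = fg.lap m (coords m k y) (v, h)] (mod q k)"
proof -
  have "q k dvd fg.bd m (\<lambda>x. coords m k (sI y) x - fg.st m (coords m k y) x) (v, h)"
  proof (rule fg.bd_dvd)
    fix x assume "x \<in> EQ m"
    then obtain e g where x: "x = (e, g)" "e \<in> Ep" "g \<in> carrier (GQ m)" by blast
    have "coords m k (sI y) x = fg.st m (coords m k y) x mod q k"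
      unfolding x coords_def[of m k "sI y"] using sI_st[OF y x(2,3)] by simp
    then show "q k dvd coords m k (sI y) x - fg.st m (coords m k y) x"
      by (simp add: mod_eq_dvd_iff[symmetric] del: power_Suc)
  qed
  then show ?thesis unfolding fg.bd_diff fg.lap_def cong_iff_dvd_diff .
qed

lemma coords_coherent:
  assumes "x i \<in> carrier \<Lambda>" "h \<in> carrier (GQ m)"
  shows "[coords m (Suc k) x (i, h) = coords m k x (i, h)] (mod q k)"
  unfolding coords_def using Zp_cong[OF \<Lambda>_apply_closed[OF assms], of k "Suc k"] by simp

end

section \<open>Jacobians of finite graphs\<close>

lemma int_basis_elt: "s \<in> S \<Longrightarrow> basis_elt \<Z> S t s = of_bool (t = s)"
  by (auto simp: basis_elt_def)

lemma add_pow_eq_smult: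
  assumes "module \<Z> M" "x \<in> carrier M" shows "add_pow M k x = int k \<odot>\<^bsub>M\<^esub> x"
proof -
  interpret M: module \<Z> M by fact
  show ?thesis
  proof (induction k)
    case 0
    then show ?case using M.smult_l_null[OF assms(2)] by (simp add: add_pow_def)
  next
    case (Suc k)
    have "add_pow M (Suc k) x = int k \<odot>\<^bsub>M\<^esub> x \<oplus>\<^bsub>M\<^esub> x"
      using Suc by (simp add: add_pow_def)
    also have "\<dots> = (int k \<oplus>\<^bsub>\<Z>\<^esub> 1) \<odot>\<^bsub>M\<^esub> x"
      using M.smult_l_distr[of "int k" 1 x] M.smult_one[of x] assms(2) by simp
    finally show ?case by (simp add: add.commute)
  qed
qed

lemma p_power_torsion_group:
  assumes M: "module \<Z> M" shows "group (p_power_torsion p M)"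
proof -
  interpret M: module \<Z> M by (rule M)
  let ?T = "{x \<in> carrier M. \<exists>k::nat. add_pow M (p ^ k) x = \<zero>\<^bsub>M\<^esub>}"
  have T: "x \<in> ?T \<longleftrightarrow> x \<in> carrier M \<and> (\<exists>k. int (p ^ k) \<odot>\<^bsub>M\<^esub> x = \<zero>\<^bsub>M\<^esub>)" for x
    using add_pow_eq_smult[OF M] by auto
  have up: "int (p ^ (k + l)) \<odot>\<^bsub>M\<^esub> x = \<zero>\<^bsub>M\<^esub>"
    if "x \<in> carrier M" "int (p ^ k) \<odot>\<^bsub>M\<^esub> x = \<zero>\<^bsub>M\<^esub>" for x k l
    using M.smult_assoc1[of "int (p ^ l)" "int (p ^ k)" x] that M.smult_r_null[of "int (p ^ l)"]
    by (simp add: power_add mult.commute)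
  have "subgroup ?T (add_monoid M)"
  proof
    fix x y assume "x \<in> ?T" "y \<in> ?T"
    then obtain k l where kl: "x \<in> carrier M" "int (p ^ k) \<odot>\<^bsub>M\<^esub> x = \<zero>\<^bsub>M\<^esub>"
      "y \<in> carrier M" "int (p ^ l) \<odot>\<^bsub>M\<^esub> y = \<zero>\<^bsub>M\<^esub>" unfolding T by blast
    have "int (p ^ (k + l)) \<odot>\<^bsub>M\<^esub> (x \<oplus>\<^bsub>M\<^esub> y) = \<zero>\<^bsub>M\<^esub>"
      using up[of x k l] up[of y l k] kl M.smult_r_distr[of "int (p ^ (k + l))" x y] by (simp add: add.commute)
    then show "x \<otimes>\<^bsub>add_monoid M\<^esub> y \<in> ?T" unfolding T using kl by auto
  next
    fix x assume x: "x \<in> ?T"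
    then obtain k where k: "x \<in> carrier M" "int (p ^ k) \<odot>\<^bsub>M\<^esub> x = \<zero>\<^bsub>M\<^esub>" unfolding T by blast
    have z: "\<ominus>\<^bsub>M\<^esub> \<zero>\<^bsub>M\<^esub> = \<zero>\<^bsub>M\<^esub>" by (rule M.minus_equality) auto
    have "int (p ^ k) \<odot>\<^bsub>M\<^esub> (\<ominus>\<^bsub>M\<^esub> x) = \<zero>\<^bsub>M\<^esub>"
      using M.smult_r_minus[of "int (p ^ k)" x] k z by simp
    then have "\<ominus>\<^bsub>M\<^esub> x \<in> ?T" unfolding T using k by auto
    then show "inv\<^bsub>add_monoid M\<^esub> x \<in> ?T" by (simp add: a_inv_def)
  next
    have "int (p ^ 0) \<odot>\<^bsub>M\<^esub> \<zero>\<^bsub>M\<^esub> = \<zero>\<^bsub>M\<^esub>" by (rule M.smult_r_null) simp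
    then have "\<zero>\<^bsub>M\<^esub> \<in> ?T" unfolding T by blast
    then show "\<one>\<^bsub>add_monoid M\<^esub> \<in> ?T" by simp
  qed auto
  then have "group ((add_monoid M)\<lparr>carrier := ?T\<rparr>)"
    by (rule subgroup.subgroup_is_group) (rule M.a_group)
  then show ?thesis by (simp add: p_power_torsion_def)
qed

locale oriented_graph = fin_graph "verts H" Ep "head H" "tail H"
  for H :: "('v, 'e) pre_digraph" and Ep :: "'e set"
begin

abbreviation "CZ \<equiv> free_module \<Z> Ep"
abbreviation "DZ \<equiv> free_module \<Z> (verts H)"

sublocale CZ: module \<Z> CZ by (rule cring.free_module_module[OF int_is_cring])
sublocale DZ: module \<Z> DZ by (rule cring.free_module_module[OF int_is_cring])

lemma CZ_iff: "x \<in> carrier CZ \<longleftrightarrow> x \<in> extensional Ep"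
  and DZ_iff: "y \<in> carrier DZ \<longleftrightarrow> y \<in> extensional (verts H)"
  using finite_E finite_V by (auto simp: free_module_simps PiE_def)

lemma DZ_minus_apply: "x \<in> carrier DZ \<Longrightarrow> y \<in> carrier DZ \<Longrightarrow> v \<in> verts H \<Longrightarrow> (x \<ominus>\<^bsub>DZ\<^esub> y) v = x v - y v"
  and CZ_minus_apply: "x' \<in> carrier CZ \<Longrightarrow> y' \<in> carrier CZ \<Longrightarrow> e \<in> Ep \<Longrightarrow> (x' \<ominus>\<^bsub>CZ\<^esub> y') e = x' e - y' e"
  using cring.free_module_minus[OF int_is_cring, of x "verts H" y]
    cring.free_module_minus[OF int_is_cring, of x' Ep y'] by (simp_all add: int_a_minus_eq)

lemma lin_ext_int_apply:
  assumes M: "finite S" "finite S'" and f: "f \<in> S \<rightarrow> carrier (free_module \<Z> S')"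
    and x: "x \<in> carrier (free_module \<Z> S)" and t: "t \<in> S'"
  shows "lin_ext \<Z> S (free_module \<Z> S') f x t = (\<Sum>s\<in>S. x s * f s t)"
proof -
  interpret F: module \<Z> "free_module \<Z> S'" by (rule cring.free_module_module[OF int_is_cring])
  interpret L: lin_ext_setup \<Z> "free_module \<Z> S'" S f by unfold_locales (rule f)
  have eq: "lin_ext \<Z> S (free_module \<Z> S') f x = (\<Oplus>\<^bsub>free_module \<Z> S'\<^esub>s\<in>S. x s \<odot>\<^bsub>free_module \<Z> S'\<^esub> f s)"
    by (rule L.lin_ext_superset[OF x M(1)]) auto
  have "lin_ext \<Z> S (free_module \<Z> S') f x t = (\<Oplus>\<^bsub>\<Z>\<^esub>s\<in>S. (x s \<odot>\<^bsub>free_module \<Z> S'\<^esub> f s) t)"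
    unfolding eq
  proof (rule cring.free_module_finsum[OF int_is_cring Pi_I t])
    show "x s \<odot>\<^bsub>free_module \<Z> S'\<^esub> f s \<in> carrier (free_module \<Z> S')" if "s \<in> S" for s
      by (rule F.smult_closed[OF UNIV_I funcset_mem[OF f that]])
  qed
  also have "\<dots> = (\<Sum>s\<in>S. x s * f s t)"
    unfolding int_finsum_eq using t by (intro sum.cong refl) (simp add: free_module_simps(4))
  finally show ?thesis .
qed

lemma lin_ext_int_closed:
  assumes "f \<in> S \<rightarrow> carrier (free_module \<Z> S')" "x \<in> carrier (free_module \<Z> S)"
  shows "lin_ext \<Z> S (free_module \<Z> S') f x \<in> carrier (free_module \<Z> S')"
proof -
  interpret F: module \<Z> "free_module \<Z> S'" by (rule cring.free_module_module[OF int_is_cring])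
  interpret L: lin_ext_setup \<Z> "free_module \<Z> S'" S f by unfold_locales (rule assms)
  show ?thesis by (rule L.lin_ext_closed[OF assms(2)])
qed

lemma basis_closed: "basis_elt \<Z> S s \<in> carrier (free_module \<Z> S)"
  by (rule cring.basis_elt_closed[OF int_is_cring])

lemma boundary_closed: "x \<in> carrier CZ \<Longrightarrow> boundary H Ep x \<in> carrier DZ"
  unfolding boundary_def Let_def by (rule lin_ext_int_closed) (auto intro!: DZ.M.minus_closed basis_closed)

lemma boundary_apply:
  assumes x: "x \<in> carrier CZ" and v: "v \<in> verts H" shows "boundary H Ep x v = bd x v"
proof -
  have "boundary H Ep x v = (\<Sum>e\<in>Ep. x e * (basis_elt \<Z> (verts H) (head H e) \<ominus>\<^bsub>DZ\<^esub> basis_elt \<Z> (verts H) (tail H e)) v)"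
    unfolding boundary_def Let_def
    by (rule lin_ext_int_apply[OF finite_E finite_V _ x v]) (auto intro!: DZ.M.minus_closed basis_closed)
  also have "\<dots> = (\<Sum>e\<in>Ep. (if head H e = v then x e else 0) - (if tail H e = v then x e else 0))"
    using v by (intro sum.cong) (auto simp: DZ_minus_apply basis_closed int_basis_elt)
  also have "\<dots> = bd x v"
    unfolding bd_def sum_subtractf using finite_E
    by (intro arg_cong2[where f = minus] sum.mono_neutral_cong_right) auto
  finally show ?thesis .
qed

lemma star_terms: "(\<Oplus>\<^bsub>CZ\<^esub>e\<in>A. basis_elt \<Z> Ep e) \<in> carrier CZ"
  by (rule CZ.M.finsum_closed) (auto intro: basis_closed)

lemma star_closed: "y \<in> carrier DZ \<Longrightarrow> star H Ep y \<in> carrier CZ"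
  unfolding star_def Let_def by (rule lin_ext_int_closed) (auto intro!: CZ.M.minus_closed star_terms)

lemma star_apply:
  assumes y: "y \<in> carrier DZ" and e: "e \<in> Ep" shows "star H Ep y e = st y e"
proof -
  have sb: "(\<Oplus>\<^bsub>CZ\<^esub>e'\<in>{e' \<in> Ep. h e' = v}. basis_elt \<Z> Ep e') e = of_bool (h e = v)" for h :: "'e \<Rightarrow> 'v" and v
  proof -
    have "(\<Oplus>\<^bsub>CZ\<^esub>e'\<in>{e' \<in> Ep. h e' = v}. basis_elt \<Z> Ep e') e = (\<Oplus>\<^bsub>\<Z>\<^esub>e'\<in>{e' \<in> Ep. h e' = v}. basis_elt \<Z> Ep e' e)"
      by (rule cring.free_module_finsum[OF int_is_cring _ e]) (auto intro: basis_closed)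
    also have "\<dots> = of_bool (h e = v)"
      unfolding int_finsum_eq using e finite_E by (simp add: int_basis_elt of_bool_def sum.delta')
    finally show ?thesis .
  qed
  have "star H Ep y e = (\<Sum>v\<in>verts H. y v * ((\<Oplus>\<^bsub>CZ\<^esub>e\<in>{e \<in> Ep. head H e = v}. basis_elt \<Z> Ep e)
      \<ominus>\<^bsub>CZ\<^esub> (\<Oplus>\<^bsub>CZ\<^esub>e\<in>{e \<in> Ep. tail H e = v}. basis_elt \<Z> Ep e)) e)"
    unfolding star_def Let_def
    by (rule lin_ext_int_apply[OF finite_V finite_E _ y e]) (auto intro!: CZ.M.minus_closed star_terms)
  also have "\<dots> = (\<Sum>v\<in>verts H. (if head H e = v then y v else 0) - (if tail H e = v then y v else 0))"
    using e by (intro sum.cong) (auto simp: CZ_minus_apply star_terms sb)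
  also have "\<dots> = st y e" using finite_V e by (simp add: sum_subtractf st_def hd tl)
  finally show ?thesis .
qed

text \<open>The sum of ker d and im s is the preimage under d of the principal divisors. Equality in
  the Jacobian thus becomes a statement about Laplacians.\<close>

definition jac_rel :: "('e \<Rightarrow> int) set" where
  "jac_rel = {x \<in> carrier CZ. \<exists>Y. \<forall>v\<in>verts H. bd x v = lap Y v}"

lemma jac_rel_eq: "a_kernel CZ DZ (boundary H Ep) <+>\<^bsub>CZ\<^esub> star H Ep ` carrier DZ = jac_rel"
proof (intro equalityI subsetI)
  fix x assume "x \<in> a_kernel CZ DZ (boundary H Ep) <+>\<^bsub>CZ\<^esub> star H Ep ` carrier DZ"
  then obtain h y where h: "h \<in> carrier CZ" "boundary H Ep h = \<zero>\<^bsub>DZ\<^esub>" and y: "y \<in> carrier DZ"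
    and x: "x = h \<oplus>\<^bsub>CZ\<^esub> star H Ep y"
    by (auto simp: set_add_def' a_kernel_def kernel_def)
  have "bd x v = lap y v" if v: "v \<in> verts H" for v
  proof -
    have "bd x = bd (\<lambda>e. h e + st y e)"
      by (rule bd_cong) (use x y star_apply in \<open>simp add: free_module_simps\<close>)
    then have "bd x v = bd h v + lap y v" by (simp add: bd_add lap_def)
    also have "bd h v = 0" using boundary_apply[OF h(1) v] h(2) v by (simp add: free_module_simps)
    finally show ?thesis by simp
  qed
  then show "x \<in> jac_rel" using h y x star_closed unfolding jac_rel_def by blast
next
  fix x assume "x \<in> jac_rel"
  then obtain Y where x: "x \<in> carrier CZ" and Y: "\<And>v. v \<in> verts H \<Longrightarrow> bd x v = lap Y v"
    unfolding jac_rel_def by blast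
  define y where "y = restrict Y (verts H)"
  have y: "y \<in> carrier DZ" by (simp add: y_def DZ_iff)
  have lap_y: "lap y = lap Y" by (rule lap_cong) (simp add: y_def)
  let ?h = "x \<ominus>\<^bsub>CZ\<^esub> star H Ep y"
  have h: "?h \<in> carrier CZ" using x y star_closed by simp
  have bh: "bd ?h = bd (\<lambda>e. x e - st y e)"
    by (rule bd_cong) (use x y in \<open>simp add: CZ_minus_apply star_closed star_apply\<close>)
  have "boundary H Ep ?h = \<zero>\<^bsub>DZ\<^esub>"
  proof (rule extensionalityI[of _ "verts H"])
    show "boundary H Ep ?h \<in> extensional (verts H)" using boundary_closed[OF h] by (simp only: DZ_iff)
    show "\<zero>\<^bsub>DZ\<^esub> \<in> extensional (verts H)" by (simp add: free_module_simps)
    fix v assume v: "v \<in> verts H"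
    have "bd ?h v = bd x v - lap y v" unfolding bh by (simp add: bd_diff lap_def)
    then show "boundary H Ep ?h v = \<zero>\<^bsub>DZ\<^esub> v"
      using boundary_apply[OF h v] Y[OF v] v by (simp add: lap_y free_module_simps)
  qed
  moreover have "x = ?h \<oplus>\<^bsub>CZ\<^esub> star H Ep y"
    using x y star_closed[OF y] by (simp add: CZ.M.minus_eq CZ.M.a_assoc CZ.M.l_neg)
  ultimately show "x \<in> a_kernel CZ DZ (boundary H Ep) <+>\<^bsub>CZ\<^esub> star H Ep ` carrier DZ"
    unfolding set_add_def' a_kernel_def kernel_def using h y by auto
qed

lemma jacobian_eq: "jacobian H Ep = quot_module CZ jac_rel"
  by (simp add: jacobian_def Let_def jac_rel_eq)

lemma jac_rel_submodule: "submodule jac_rel \<Z> CZ"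
proof (rule CZ.submoduleI)
  have "bd \<zero>\<^bsub>CZ\<^esub> = bd (\<lambda>_. 0)" by (rule bd_cong) (simp add: free_module_simps)
  then have "bd \<zero>\<^bsub>CZ\<^esub> v = lap (\<lambda>_. 0) v" for v by (simp add: lap_def st_def[abs_def])
  then show "\<zero>\<^bsub>CZ\<^esub> \<in> jac_rel" unfolding jac_rel_def using CZ.M.zero_closed by blast
next
  fix a b assume "a \<in> jac_rel" "b \<in> jac_rel"
  then obtain Y Z where a: "a \<in> carrier CZ" "\<And>v. v \<in> verts H \<Longrightarrow> bd a v = lap Y v"
    and b: "b \<in> carrier CZ" "\<And>v. v \<in> verts H \<Longrightarrow> bd b v = lap Z v" unfolding jac_rel_def by blast
  have "bd (a \<oplus>\<^bsub>CZ\<^esub> b) = bd (\<lambda>e. a e + b e)" by (rule bd_cong) (simp add: free_module_simps)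
  then have "\<forall>v\<in>verts H. bd (a \<oplus>\<^bsub>CZ\<^esub> b) v = lap (\<lambda>v. Y v + Z v) v"
    using a b by (simp add: bd_add lap_add)
  then show "a \<oplus>\<^bsub>CZ\<^esub> b \<in> jac_rel" unfolding jac_rel_def using a b by blast
next
  fix r :: int and a assume "a \<in> jac_rel"
  then obtain Y where a: "a \<in> carrier CZ" "\<And>v. v \<in> verts H \<Longrightarrow> bd a v = lap Y v" unfolding jac_rel_def by blast
  have "bd (r \<odot>\<^bsub>CZ\<^esub> a) = bd (\<lambda>e. r * a e)" by (rule bd_cong) (simp add: free_module_simps)
  then have "\<forall>v\<in>verts H. bd (r \<odot>\<^bsub>CZ\<^esub> a) v = lap (\<lambda>v. r * Y v) v"
    using a by (simp add: bd_mult lap_mult)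
  then show "r \<odot>\<^bsub>CZ\<^esub> a \<in> jac_rel" unfolding jac_rel_def using a CZ.smult_closed[of r a] by auto
next
  fix a assume "a \<in> jac_rel"
  then obtain Y where a: "a \<in> carrier CZ" "\<And>v. v \<in> verts H \<Longrightarrow> bd a v = lap Y v" unfolding jac_rel_def by blast
  have "bd (\<ominus>\<^bsub>CZ\<^esub> a) = bd (\<lambda>e. (-1) * a e)"
    by (rule bd_cong) (simp add: cring.free_module_a_inv[OF int_is_cring a(1)] int_a_inv_eq)
  then have "\<forall>v\<in>verts H. bd (\<ominus>\<^bsub>CZ\<^esub> a) v = lap (\<lambda>v. (-1) * Y v) v"
    using a by (simp add: bd_mult lap_mult del: mult_minus1 mult_minus_left)
  then show "\<ominus>\<^bsub>CZ\<^esub> a \<in> jac_rel" unfolding jac_rel_def using a CZ.M.a_inv_closed[of a] by blast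
qed (auto simp: jac_rel_def)

lemma jacobian_module: "module \<Z> (jacobian H Ep)"
  unfolding jacobian_eq by (rule CZ.quot_module_module[OF jac_rel_submodule])

lemma jac_class_eq_iff:
  assumes "x \<in> carrier CZ" "y \<in> carrier CZ"
  shows "jac_rel +>\<^bsub>CZ\<^esub> x = jac_rel +>\<^bsub>CZ\<^esub> y \<longleftrightarrow> (\<exists>Y. \<forall>v\<in>verts H. bd x v - bd y v = lap Y v)"
proof -
  have "bd (x \<ominus>\<^bsub>CZ\<^esub> y) = bd (\<lambda>e. x e - y e)" by (rule bd_cong) (simp add: CZ_minus_apply assms)
  then have "x \<ominus>\<^bsub>CZ\<^esub> y \<in> jac_rel \<longleftrightarrow> (\<exists>Y. \<forall>v\<in>verts H. bd x v - bd y v = lap Y v)"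
    unfolding jac_rel_def using CZ.M.minus_closed[OF assms] by (simp add: bd_diff)
  then show ?thesis unfolding CZ.coset_eq_iff[OF jac_rel_submodule assms] .
qed

end

section \<open>Relations over the Iwasawa algebra\<close>

context padic_group_gen
begin

lemma free_level_zero_iff:
  assumes S: "finite S" and x: "x \<in> carrier (free_module \<Lambda> S)"
  shows "(\<forall>s\<in>S. x s n = \<zero>\<^bsub>LR n\<^esub>) \<longleftrightarrow>
    (\<exists>y\<in>carrier (free_module \<Lambda> S). x = omega n \<odot>\<^bsub>free_module \<Lambda> S\<^esub> y)"
proof -
  have iff: "z \<in> carrier (free_module \<Lambda> S) \<longleftrightarrow> z \<in> S \<rightarrow>\<^sub>E carrier \<Lambda>" for z
    using S by (simp add: free_module_simps)
  show ?thesis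
  proof
    assume 0: "\<forall>s\<in>S. x s n = \<zero>\<^bsub>LR n\<^esub>"
    have "\<exists>y\<in>carrier \<Lambda>. x s = omega n \<otimes>\<^bsub>\<Lambda>\<^esub> y" if s: "s \<in> S" for s
    proof -
      have "x s \<in> carrier \<Lambda>" using x s by (auto simp: iff)
      then show ?thesis using level_zero_iff[of "x s" n] 0 s by blast
    qed
    then have "\<forall>s\<in>S. \<exists>y\<in>carrier \<Lambda>. x s = omega n \<otimes>\<^bsub>\<Lambda>\<^esub> y" by blast
    then obtain y where y: "\<And>s. s \<in> S \<Longrightarrow> y s \<in> carrier \<Lambda>" "\<And>s. s \<in> S \<Longrightarrow> x s = omega n \<otimes>\<^bsub>\<Lambda>\<^esub> y s" by metis
    have "x = omega n \<odot>\<^bsub>free_module \<Lambda> S\<^esub> (\<lambda>s\<in>S. y s)"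
      by (rule extensionalityI[of _ S]) (use x y in \<open>auto simp: iff PiE_iff free_module_simps\<close>)
    then show "\<exists>y\<in>carrier (free_module \<Lambda> S). x = omega n \<odot>\<^bsub>free_module \<Lambda> S\<^esub> y"
      by (intro bexI[of _ "\<lambda>s\<in>S. y s"]) (use y in \<open>auto simp: iff\<close>)
  next
    assume "\<exists>y\<in>carrier (free_module \<Lambda> S). x = omega n \<odot>\<^bsub>free_module \<Lambda> S\<^esub> y"
    then obtain y where y: "y \<in> S \<rightarrow>\<^sub>E carrier \<Lambda>" "x = omega n \<odot>\<^bsub>free_module \<Lambda> S\<^esub> y" by (auto simp: iff)
    have "x s n = \<zero>\<^bsub>LR n\<^esub>" if s: "s \<in> S" for s
    proof -
      have "x s = omega n \<otimes>\<^bsub>\<Lambda>\<^esub> y s" "x s \<in> carrier \<Lambda>" "y s \<in> carrier \<Lambda>"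
        using s y x by (auto simp: iff free_module_simps)
      then show ?thesis using level_zero_iff[of "x s" n] by blast
    qed
    then show "\<forall>s\<in>S. x s n = \<zero>\<^bsub>LR n\<^esub>" by blast
  qed
qed

lemma free_omega_cancel:
  assumes "finite S" "x \<in> carrier (free_module \<Lambda> S)" "y \<in> carrier (free_module \<Lambda> S)"
    and eq: "omega n \<odot>\<^bsub>free_module \<Lambda> S\<^esub> x = omega n \<odot>\<^bsub>free_module \<Lambda> S\<^esub> y"
  shows "x = y"
proof -
  interpret F: module \<Lambda> "free_module \<Lambda> S" by (rule \<Lambda>.free_module_module)
  have "x s = y s" if s: "s \<in> S" for s
  proof -
    have c: "x s \<in> carrier \<Lambda>" "y s \<in> carrier \<Lambda>" using s assms by (auto simp: free_module_simps)
    have "omega n \<otimes>\<^bsub>\<Lambda>\<^esub> x s = omega n \<otimes>\<^bsub>\<Lambda>\<^esub> y s"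
      using fun_cong[OF eq, of s] s by (simp add: free_module_simps)
    then have "omega n \<otimes>\<^bsub>\<Lambda>\<^esub> (x s \<ominus>\<^bsub>\<Lambda>\<^esub> y s) = \<zero>\<^bsub>\<Lambda>\<^esub>"
      using c omega_closed unfolding a_minus_def
      by (simp add: \<Lambda>.r_distr \<Lambda>.r_minus \<Lambda>.r_neg)
    then have "x s \<ominus>\<^bsub>\<Lambda>\<^esub> y s = \<zero>\<^bsub>\<Lambda>\<^esub>" using omega_cancel c by simp
    then show ?thesis using c by simp
  qed
  then show ?thesis
    using assms by (intro extensionalityI[of _ S]) (auto simp: free_module_simps PiE_iff)
qed

end

context iwasawa_graph
begin

text \<open>Differences \<open>[h] w - [g] v\<close> of translated vertices that are boundaries form an equivalence
  relation, which is compatible with the edges of \<open>XQ 1\<close>. As \<open>XQ 1\<close> is connected, the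
  stabiliser of a vertex contains a topological generator \<open>b\<close>.\<close>

lemma paths:
  assumes v0: "v0 \<in> V" and w: "w \<in> V" and g: "g \<in> carrier \<Gamma>"
  shows "\<exists>h\<in>carrier \<Gamma>. cl 1 h = cl 1 g \<and> (\<exists>x\<in>carrier C. dI x = (ge h \<odot>\<^bsub>D\<^esub> \<delta> w) \<ominus>\<^bsub>D\<^esub> \<delta> v0)"
proof -
  define P where "P u \<longleftrightarrow> (\<exists>h\<in>carrier \<Gamma>. cl 1 h = snd u \<and>
    (\<exists>x\<in>carrier C. dI x = (ge h \<odot>\<^bsub>D\<^esub> \<delta> (fst u)) \<ominus>\<^bsub>D\<^esub> \<delta> v0))" for u
  interpret Q: comm_group "GQ 1" by (rule GQ_comm_group)
  have \<delta>c: "\<delta> v \<in> carrier D" for v by (rule \<Lambda>.basis_elt_closed)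
  \<comment> \<open>The translate of \<open>e\<close> by \<open>h\<close> runs from [h] times the
    tail to [h \<alpha>(e)] times the head: a walk collects its voltage exactly in \<Gamma>, while
    connectedness controls it at level 1 only.\<close>
  have edge: "dI (ge h \<odot>\<^bsub>C\<^esub> \<epsilon> e) = (ge (h \<otimes> \<alpha> e) \<odot>\<^bsub>D\<^esub> \<delta> (hX e)) \<ominus>\<^bsub>D\<^esub> (ge h \<odot>\<^bsub>D\<^esub> \<delta> (tX e))"
    if "h \<in> carrier \<Gamma>" "e \<in> Ep" for h e
  proof -
    have "dI (ge h \<odot>\<^bsub>C\<^esub> \<epsilon> e) = ge h \<odot>\<^bsub>D\<^esub> dval e"
      using that by (simp add: dI_smult dI_basis \<Lambda>.basis_elt_closed ge_closed)
    also have "\<dots> = (ge h \<odot>\<^bsub>D\<^esub> (ge (\<alpha> e) \<odot>\<^bsub>D\<^esub> \<delta> (hX e))) \<ominus>\<^bsub>D\<^esub> (ge h \<odot>\<^bsub>D\<^esub> \<delta> (tX e))"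
      unfolding dval_def using that \<alpha>_closed \<delta>c ge_closed by (intro D.smult_minus_r) auto
    also have "ge h \<odot>\<^bsub>D\<^esub> (ge (\<alpha> e) \<odot>\<^bsub>D\<^esub> \<delta> (hX e)) = ge (h \<otimes> \<alpha> e) \<odot>\<^bsub>D\<^esub> \<delta> (hX e)"
      using that \<alpha>_closed[OF that(2)] \<delta>c by (simp add: D.smult_assoc1[symmetric] ge_closed ge_mult)
    finally show ?thesis .
  qed
  have tele: "(a \<ominus>\<^bsub>D\<^esub> b) \<oplus>\<^bsub>D\<^esub> (b \<ominus>\<^bsub>D\<^esub> c) = a \<ominus>\<^bsub>D\<^esub> c"
    if "a \<in> carrier D" "b \<in> carrier D" "c \<in> carrier D" for a b c
    using that by (simp add: D.M.minus_eq D.M.a_assoc D.M.r_neg2 D.M.r_neg1)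
  have tele': "(a \<ominus>\<^bsub>D\<^esub> c) \<ominus>\<^bsub>D\<^esub> (a \<ominus>\<^bsub>D\<^esub> b) = b \<ominus>\<^bsub>D\<^esub> c"
    if "a \<in> carrier D" "b \<in> carrier D" "c \<in> carrier D" for a b c
  proof -
    have "(a \<ominus>\<^bsub>D\<^esub> c) = (b \<ominus>\<^bsub>D\<^esub> c) \<oplus>\<^bsub>D\<^esub> (a \<ominus>\<^bsub>D\<^esub> b)"
      using that tele[of a b c] by (simp add: D.M.a_comm)
    then show ?thesis using that by (simp add: D.M.minus_eq D.M.a_assoc D.M.r_neg)
  qed
  have "P (w, cl 1 g)"
  proof (rule fg.connected[of 1 P "(v0, cl 1 \<one>)"])
    fix x assume "x \<in> EQ 1"
    then obtain e c where x: "x = (e, c)" "e \<in> Ep" "c \<in> carrier (GQ 1)" by blast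
    note a = \<alpha>_closed[OF x(2)]
    have ht: "head (XQ 1) x = (hX e, c \<otimes>\<^bsub>GQ 1\<^esub> cl 1 (\<alpha> e))" "tail (XQ 1) x = (tX e, c)"
      by (simp_all add: x derived_graph_def)
    show "P (head (XQ 1) x) \<longleftrightarrow> P (tail (XQ 1) x)"
    proof
      assume "P (tail (XQ 1) x)"
      then obtain h y where h: "h \<in> carrier \<Gamma>" "cl 1 h = c" "y \<in> carrier C"
        "dI y = (ge h \<odot>\<^bsub>D\<^esub> \<delta> (tX e)) \<ominus>\<^bsub>D\<^esub> \<delta> v0" unfolding P_def ht by auto
      have ec: "ge h \<odot>\<^bsub>C\<^esub> \<epsilon> e \<in> carrier C" using h by (intro C.smult_closed ge_closed \<Lambda>.basis_elt_closed)
      have "dI ((ge h \<odot>\<^bsub>C\<^esub> \<epsilon> e) \<oplus>\<^bsub>C\<^esub> y) = (ge (h \<otimes> \<alpha> e) \<odot>\<^bsub>D\<^esub> \<delta> (hX e)) \<ominus>\<^bsub>D\<^esub> \<delta> v0"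
        unfolding dI_add[OF ec h(3)] h(4) edge[OF h(1) x(2)]
        using h a \<delta>c by (intro tele D.smult_closed ge_closed) auto
      moreover have "cl 1 (h \<otimes> \<alpha> e) = c \<otimes>\<^bsub>GQ 1\<^esub> cl 1 (\<alpha> e)" using h a by (simp add: GQ_mult[symmetric])
      ultimately show "P (head (XQ 1) x)" unfolding P_def ht fst_conv snd_conv
        using h a ec by (intro bexI[of _ "h \<otimes> \<alpha> e"] conjI bexI[of _ "(ge h \<odot>\<^bsub>C\<^esub> \<epsilon> e) \<oplus>\<^bsub>C\<^esub> y"]) auto
    next
      assume "P (head (XQ 1) x)"
      then obtain h' y where h': "h' \<in> carrier \<Gamma>" "cl 1 h' = c \<otimes>\<^bsub>GQ 1\<^esub> cl 1 (\<alpha> e)" "y \<in> carrier C"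
        "dI y = (ge h' \<odot>\<^bsub>D\<^esub> \<delta> (hX e)) \<ominus>\<^bsub>D\<^esub> \<delta> v0" unfolding P_def ht by auto
      \<comment> \<open>Walking back along \<open>e\<close>: the translate of \<open>e\<close> that
        ends at the head over h' starts over h' \<alpha>(e)^-1.\<close>
      define h where "h = h' \<otimes> inv (\<alpha> e)"
      have h: "h \<in> carrier \<Gamma>" "h \<otimes> \<alpha> e = h'" using h' a by (simp_all add: h_def m_assoc)
      have "cl 1 h = cl 1 h' \<otimes>\<^bsub>GQ 1\<^esub> inv\<^bsub>GQ 1\<^esub> cl 1 (\<alpha> e)"
        using h' a by (simp add: h_def GQ_mult[symmetric] GQ_inv)
      also have "\<dots> = c"
        unfolding h'(2) by (simp only: Q.m_assoc Q.inv_closed Q.r_inv Q.r_one x(3) cl_closed[OF a])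
      finally have hc: "cl 1 h = c" .
      have ec: "ge h \<odot>\<^bsub>C\<^esub> \<epsilon> e \<in> carrier C" using h by (intro C.smult_closed ge_closed \<Lambda>.basis_elt_closed)
      have "dI (y \<ominus>\<^bsub>C\<^esub> (ge h \<odot>\<^bsub>C\<^esub> \<epsilon> e)) = (ge h \<odot>\<^bsub>D\<^esub> \<delta> (tX e)) \<ominus>\<^bsub>D\<^esub> \<delta> v0"
        unfolding dI_minus[OF h'(3) ec] h'(4) edge[OF h(1) x(2)] h(2)
        using h h' \<delta>c by (intro tele' D.smult_closed ge_closed) auto
      then show "P (tail (XQ 1) x)" unfolding P_def ht fst_conv snd_conv
        using h h' hc ec by (intro bexI[of _ h] conjI bexI[of _ "y \<ominus>\<^bsub>C\<^esub> (ge h \<odot>\<^bsub>C\<^esub> \<epsilon> e)"]) auto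
    qed
  next
    show "P (v0, cl 1 \<one>)" unfolding P_def fst_conv snd_conv
    proof (intro bexI[of _ \<one>] conjI bexI[of _ "\<zero>\<^bsub>C\<^esub> \<ominus>\<^bsub>C\<^esub> \<zero>\<^bsub>C\<^esub>"])
      show "dI (\<zero>\<^bsub>C\<^esub> \<ominus>\<^bsub>C\<^esub> \<zero>\<^bsub>C\<^esub>) = (ge \<one> \<odot>\<^bsub>D\<^esub> \<delta> v0) \<ominus>\<^bsub>D\<^esub> \<delta> v0"
        unfolding dI_minus[OF C.M.zero_closed C.M.zero_closed]
        using dI_closed[OF C.M.zero_closed] \<delta>c[of v0] by (simp add: ge_one D.M.minus_eq D.M.r_neg)
    qed auto
  qed (use v0 w g cl_closed in auto)
  then show ?thesis by (auto simp: P_def)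
qed

text \<open>The class modulo level 1 fixes the first component of the voltage. Aiming at the class
  of an element with coordinate 1 yields a loop whose voltage is a p-adic unit.\<close>

lemma loop_generator:
  assumes v0: "v0 \<in> V"
  obtains b where "b \<in> carrier \<Gamma>" "\<not> int p dvd \<phi> b 0"
    "\<exists>x\<in>carrier C. dI x = (ge b \<odot>\<^bsub>D\<^esub> \<delta> v0) \<ominus>\<^bsub>D\<^esub> \<delta> v0"
proof -
  obtain g where g: "g \<in> carrier \<Gamma>" "\<phi> g = \<one>\<^bsub>Zp p\<^esub>" by (rule res_onto)
  obtain b where b: "b \<in> carrier \<Gamma>" "cl 1 b = cl 1 g"
    "\<exists>x\<in>carrier C. dI x = (ge b \<odot>\<^bsub>D\<^esub> \<delta> v0) \<ominus>\<^bsub>D\<^esub> \<delta> v0"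
    using paths[OF v0 v0 g(1)] by blast
  have "\<phi> b 0 = 1" using b(1,2) g by (simp add: cl_eq_iff res_def Zp_simps)
  then have "\<not> int p dvd \<phi> b 0" using p_gt_1 by simp
  then show ?thesis using that b by blast
qed

text \<open>At level n the divisor \<open>y\<close> is a harmonic p-adic function on the connected
  derived graph, so its values agree along each edge and its star vanishes. The injectivity of
  \<Gamma>^(n) into J(n) depends on this.\<close>

lemma lap_level_kernel:
  assumes y: "y \<in> carrier D" and 0: "\<And>v. v \<in> V \<Longrightarrow> dI (sI y) v n = \<zero>\<^bsub>LR n\<^esub>" and e: "e \<in> Ep"
  shows "sI y e n = \<zero>\<^bsub>LR n\<^esub>"
proof -
  have sy: "sI y \<in> carrier C" by (rule sI_closed[OF y])
  have "sI y e n h k = 0" if h: "h \<in> carrier (GQ n)" for h k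
  proof -
    have "[coords n k y (head (XQ n) (e, h)) = coords n k y (tail (XQ n) (e, h))] (mod q k)"
    proof (rule fg.padic_lap_kernel[of n "\<lambda>v k. coords n k y v"])
      fix x k assume "x \<in> VQ n"
      then obtain v g where x: "x = (v, g)" "v \<in> V" "g \<in> carrier (GQ n)" by blast
      show "[coords n (Suc k) y x = coords n k y x] (mod q k)"
        unfolding x by (rule coords_coherent[of y v g n, OF D_apply[OF y x(2)] x(3)])
      have "fg.bd n (coords n k (sI y)) (v, g) mod q k = dI (sI y) v n g k"
        using dI_bd[OF sy x(2,3)] by simp
      also have "\<dots> = 0" using 0[OF x(2)] x(3) by (simp add: layer_ring_def group_ring_def Zp_simps)
      finally have "[fg.bd n (coords n k (sI y)) (v, g) = 0] (mod q k)" by (simp add: cong_def)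
      then show "[fg.lap n (\<lambda>v. coords n k y v) x = 0] (mod q k)"
        unfolding x using dI_sI_lap[OF y x(2,3)] by (rule cong_trans[OF cong_sym, rotated])
    qed (use e h in auto)
    then have "fg.st n (coords n k y) (e, h) mod q k = 0"
      unfolding fg.st_def by (simp add: cong_iff_dvd_diff mod_eq_0_iff_dvd del: power_Suc)
    then show ?thesis using sI_st[OF y e h] by simp
  qed
  then show ?thesis
    using LR_zero_iff[OF \<Lambda>_level[OF C_apply[OF sy e]]] by (auto simp: fun_eq_iff Zp_simps)
qed

subsection \<open>Total augmentation\<close>

definition taug :: "('v \<Rightarrow> 'g iwasawa_elt) \<Rightarrow> nat \<Rightarrow> int" where
  "taug x = (\<Oplus>\<^bsub>Zp p\<^esub>v\<in>V. aug (x v))"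

lemma taug_closed: "x \<in> carrier D \<Longrightarrow> taug x \<in> carrier (Zp p)"
  unfolding taug_def by (intro Zp.finsum_closed) (auto intro: aug_closed D_apply)

lemma taug_add: "x \<in> carrier D \<Longrightarrow> y \<in> carrier D \<Longrightarrow> taug (x \<oplus>\<^bsub>D\<^esub> y) = taug x \<oplus>\<^bsub>Zp p\<^esub> taug y"
proof -
  assume xy: "x \<in> carrier D" "y \<in> carrier D"
  have "taug (x \<oplus>\<^bsub>D\<^esub> y) = (\<Oplus>\<^bsub>Zp p\<^esub>v\<in>V. aug (x v) \<oplus>\<^bsub>Zp p\<^esub> aug (y v))"
    unfolding taug_def using xy aug_closed D_apply
    by (intro Zp.finsum_cong') (auto simp: free_module_simps aug_add)
  then show ?thesis
    unfolding taug_def using xy aug_closed D_apply by (simp add: Zp.finsum_addf Pi_iff)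
qed

text \<open>At level 0 the voltages are trivial, and the claim is that a boundary on a finite graph
  has degree zero.\<close>

lemma taug_boundary:
  assumes c: "c \<in> carrier C" shows "taug (dI c) = \<zero>\<^bsub>Zp p\<^esub>"
proof
  fix k
  have d: "dI c \<in> carrier D" by (rule dI_closed[OF c])
  have "taug (dI c) k = (\<Sum>v\<in>V. aug (dI c v) k) mod q k"
    unfolding taug_def by (rule Zp_finsum) (auto intro: aug_closed D_apply d)
  also have "\<dots> = (\<Sum>v\<in>V. fg.bd 0 (coords 0 k c) (v, cl 0 \<one>) mod q k) mod q k"
    using dI_bd[OF c _ cl_closed[OF one_closed]] by (simp add: aug_def)
  also have "\<dots> = (\<Sum>v\<in>V. fg.bd 0 (coords 0 k c) (v, cl 0 \<one>)) mod q k" by (rule mod_sum_eq)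
  also have "(\<Sum>v\<in>V. fg.bd 0 (coords 0 k c) (v, cl 0 \<one>)) = (\<Sum>x\<in>VQ 0. fg.bd 0 (coords 0 k c) x)"
    unfolding GQ_0 by (rule sum.reindex_bij_witness[where i = fst and j = "\<lambda>v. (v, cl 0 \<one>)"]) auto
  also have "\<dots> = 0" by (rule fg.bd_sum_zero)
  finally show "taug (dI c) k = \<zero>\<^bsub>Zp p\<^esub> k" by (simp add: Zp_simps)
qed

lemma taug_scaled:
  assumes z: "z \<in> carrier (Zp p)" and v0: "v0 \<in> V"
  shows "taug (scaled_elt z \<one> \<odot>\<^bsub>D\<^esub> \<delta> v0) = z"
proof -
  have zc: "scaled_elt z \<one> \<in> carrier \<Lambda>" using z by (simp add: scaled_elt_closed)
  have "taug (scaled_elt z \<one> \<odot>\<^bsub>D\<^esub> \<delta> v0) = (\<Oplus>\<^bsub>Zp p\<^esub>v\<in>V. if v = v0 then z else \<zero>\<^bsub>Zp p\<^esub>)"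
    unfolding taug_def using z zc
    by (intro Zp.finsum_cong')
      (auto simp: free_module_simps basis_apply aug_scaled_elt, simp add: aug_def \<Lambda>_zero_apply cl_closed)
  also have "\<dots> = z" using finite_V v0 z by (intro Zp.finsum_delta) auto
  finally show ?thesis .
qed

text \<open>Modulo boundaries every vertex is a translate of \<open>v0\<close>, so all coefficients
  can be collected there. Translation preserves augmentations, and so does the collection.\<close>

lemma D_sum_decomp:
  assumes v0: "v0 \<in> V" and x: "x \<in> carrier D" and A: "A \<subseteq> V"
  shows "\<exists>c\<in>carrier C. \<exists>l\<in>carrier \<Lambda>.
    (\<Oplus>\<^bsub>D\<^esub>w\<in>A. x w \<odot>\<^bsub>D\<^esub> \<delta> w) = dI c \<oplus>\<^bsub>D\<^esub> (l \<odot>\<^bsub>D\<^esub> \<delta> v0) \<and> aug l = (\<Oplus>\<^bsub>Zp p\<^esub>w\<in>A. aug (x w))"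
  using finite_subset[OF A finite_V] A
proof (induction A)
  case empty
  have "dI \<zero>\<^bsub>C\<^esub> = \<zero>\<^bsub>D\<^esub>"
    using dI_minus[OF C.M.zero_closed C.M.zero_closed] dI_closed[OF C.M.zero_closed]
    by (simp add: C.M.minus_eq D.M.minus_eq C.M.r_neg D.M.r_neg)
  then show ?case
    by (intro bexI[of _ "\<zero>\<^bsub>C\<^esub>"] bexI[of _ "\<zero>\<^bsub>\<Lambda>\<^esub>"])
      (auto simp: aug_def \<Lambda>_zero_apply cl_closed \<Lambda>.basis_elt_closed)
next
  case (insert w A)
  have \<delta>c: "\<delta> v \<in> carrier D" for v by (rule \<Lambda>.basis_elt_closed)
  obtain c l where cl: "c \<in> carrier C" "l \<in> carrier \<Lambda>"
    "(\<Oplus>\<^bsub>D\<^esub>w\<in>A. x w \<odot>\<^bsub>D\<^esub> \<delta> w) = dI c \<oplus>\<^bsub>D\<^esub> (l \<odot>\<^bsub>D\<^esub> \<delta> v0)" "aug l = (\<Oplus>\<^bsub>Zp p\<^esub>w\<in>A. aug (x w))"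
    using insert by auto
  have w: "w \<in> V" and xc: "\<And>v. v \<in> insert w A \<Longrightarrow> x v \<in> carrier \<Lambda>" using insert x D_apply by auto
  obtain h y where h: "h \<in> carrier \<Gamma>" "y \<in> carrier C" "dI y = (ge h \<odot>\<^bsub>D\<^esub> \<delta> w) \<ominus>\<^bsub>D\<^esub> \<delta> v0"
    using paths[OF v0 w one_closed] by blast
  \<comment> \<open>A path gives [h] w - v0 as a boundary. The coefficient of w must therefore be
    written as a multiple of [h] before it is moved to \<open>v0\<close>.\<close>
  define r where "r = ge (inv h) \<otimes>\<^bsub>\<Lambda>\<^esub> x w"
  have r: "r \<in> carrier \<Lambda>" using xc h by (simp add: r_def ge_closed)
  have "r \<otimes>\<^bsub>\<Lambda>\<^esub> ge h = x w"
    using ge_inv_cancel[OF h(1) xc[of w]] r h ge_closed by (simp add: r_def \<Lambda>.m_comm)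
  then have "dI (r \<odot>\<^bsub>C\<^esub> y) = (x w \<odot>\<^bsub>D\<^esub> \<delta> w) \<ominus>\<^bsub>D\<^esub> (r \<odot>\<^bsub>D\<^esub> \<delta> v0)"
    using h r \<delta>c by (simp add: dI_smult D.smult_minus_r ge_closed D.smult_assoc1[symmetric])
  then have xw: "x w \<odot>\<^bsub>D\<^esub> \<delta> w = dI (r \<odot>\<^bsub>C\<^esub> y) \<oplus>\<^bsub>D\<^esub> (r \<odot>\<^bsub>D\<^esub> \<delta> v0)"
    using r xc[of w] \<delta>c by (simp add: D.M.minus_eq D.M.a_assoc D.M.l_neg)
  have "(\<Oplus>\<^bsub>D\<^esub>w\<in>insert w A. x w \<odot>\<^bsub>D\<^esub> \<delta> w) = (x w \<odot>\<^bsub>D\<^esub> \<delta> w) \<oplus>\<^bsub>D\<^esub> (\<Oplus>\<^bsub>D\<^esub>w\<in>A. x w \<odot>\<^bsub>D\<^esub> \<delta> w)"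
    using insert xc \<delta>c by (intro D.M.finsum_insert) auto
  also have "\<dots> = (dI (r \<odot>\<^bsub>C\<^esub> y) \<oplus>\<^bsub>D\<^esub> (r \<odot>\<^bsub>D\<^esub> \<delta> v0)) \<oplus>\<^bsub>D\<^esub> (dI c \<oplus>\<^bsub>D\<^esub> (l \<odot>\<^bsub>D\<^esub> \<delta> v0))"
    unfolding xw cl(3) ..
  also have "\<dots> = dI ((r \<odot>\<^bsub>C\<^esub> y) \<oplus>\<^bsub>C\<^esub> c) \<oplus>\<^bsub>D\<^esub> ((r \<oplus>\<^bsub>\<Lambda>\<^esub> l) \<odot>\<^bsub>D\<^esub> \<delta> v0)"
    using r cl h \<delta>c[of v0] dI_closed[of "r \<odot>\<^bsub>C\<^esub> y"] dI_closed[OF cl(1)]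
    by (simp add: dI_add D.smult_l_distr D.M.a_ac)
  finally have "(\<Oplus>\<^bsub>D\<^esub>w\<in>insert w A. x w \<odot>\<^bsub>D\<^esub> \<delta> w) = dI ((r \<odot>\<^bsub>C\<^esub> y) \<oplus>\<^bsub>C\<^esub> c) \<oplus>\<^bsub>D\<^esub> ((r \<oplus>\<^bsub>\<Lambda>\<^esub> l) \<odot>\<^bsub>D\<^esub> \<delta> v0)" .
  moreover have "aug (r \<oplus>\<^bsub>\<Lambda>\<^esub> l) = (\<Oplus>\<^bsub>Zp p\<^esub>w\<in>insert w A. aug (x w))"
    using insert xc cl h aug_closed by (simp add: aug_add r_def aug_ge_mult Zp.finsum_insert Pi_iff)
  ultimately show ?case using r cl h
    by (intro bexI[of _ "(r \<odot>\<^bsub>C\<^esub> y) \<oplus>\<^bsub>C\<^esub> c"] bexI[of _ "r \<oplus>\<^bsub>\<Lambda>\<^esub> l"] conjI) auto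
qed

lemma D_decomp:
  assumes v0: "v0 \<in> V" and x: "x \<in> carrier D"
  shows "\<exists>c\<in>carrier C. \<exists>l\<in>carrier \<Lambda>. x = dI c \<oplus>\<^bsub>D\<^esub> (l \<odot>\<^bsub>D\<^esub> \<delta> v0) \<and> aug l = taug x"
proof -
  let ?A = "{v \<in> V. x v \<noteq> \<zero>\<^bsub>\<Lambda>\<^esub>}"
  have "(\<Oplus>\<^bsub>Zp p\<^esub>w\<in>?A. aug (x w)) = taug x"
    unfolding taug_def using finite_V x aug_closed D_apply
    by (intro Zp.add.finprod_mono_neutral_cong_left) (auto simp: aug_def \<Lambda>_zero_apply cl_closed)
  moreover have "x = (\<Oplus>\<^bsub>D\<^esub>w\<in>?A. x w \<odot>\<^bsub>D\<^esub> \<delta> w)" by (rule \<Lambda>.free_module_decomp[OF x])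
  ultimately show ?thesis using D_sum_decomp[OF v0 x, of ?A] by auto
qed

end

section \<open>Comparison with the Jacobians of the layers\<close>

lemma (in abelian_group) minus_eq_iff:
  assumes "a \<in> carrier G" "b \<in> carrier G" "c \<in> carrier G"
  shows "a \<ominus> b = c \<longleftrightarrow> a = c \<oplus> b"
  using assms by (auto simp: minus_eq a_assoc l_neg r_neg)

lemma (in fin_graph) lap_dvd:
  assumes "\<And>v. v \<in> V \<Longrightarrow> k dvd y v" shows "k dvd lap y v"
  unfolding lap_def by (rule bd_dvd) (auto simp: st_def assms hd tl)

text \<open>Division of the coordinate by p^n identifies p^n Z_p with Z_p. The quotient loses
  \<open>n\<close> digits, hence the component k + n.\<close>

lemma (in padic_group) GS_Zp_iso:
  obtains z where "\<And>\<tau>. \<tau> \<in> GS n \<Longrightarrow> z \<tau> \<in> carrier (Zp p)"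
    "\<And>\<tau> \<sigma>. \<tau> \<in> GS n \<Longrightarrow> \<sigma> \<in> GS n \<Longrightarrow> z (\<tau> \<otimes> \<sigma>) = z \<tau> \<oplus>\<^bsub>Zp p\<^esub> z \<sigma>"
    "inj_on z (GS n)" "z ` GS n = carrier (Zp p)"
proof -
  define z where "z \<tau> k = \<phi> \<tau> (k + n) div int p ^ n" for \<tau> k
  have pn: "int p ^ n > 0" using p_gt_1 by simp
  have qn: "q (k + n) = int p ^ n * q k" for k by (simp add: power_add)
  have c: "\<tau> \<in> carrier \<Gamma>" if "\<tau> \<in> GS n" for \<tau> using that by (simp add: GS_iff)
  have z: "\<phi> \<tau> (k + n) = int p ^ n * z \<tau> k" if t: "\<tau> \<in> GS n" for \<tau> k
  proof -
    have "[\<phi> \<tau> (k + n) = res n \<tau>] (mod int p ^ n)" by (rule res_cong[OF c[OF t]]) simp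
    then show ?thesis using t by (simp add: GS_iff cong_0_iff z_def)
  qed
  have zc: "z \<tau> \<in> carrier (Zp p)" if t: "\<tau> \<in> GS n" for \<tau>
    unfolding Zp_carrier
  proof (intro allI conjI)
    fix k
    note P = \<phi>_closed[OF c[OF t]]
    show "0 \<le> z \<tau> k" using Zp_bounds(1)[OF P, of "k + n"] pn by (simp add: z_def pos_imp_zdiv_nonneg_iff)
    have "int p ^ n * z \<tau> k < int p ^ n * q k"
      using Zp_bounds(2)[OF P, of "k + n"] unfolding qn z[OF t] .
    then show "z \<tau> k < q k" using pn mult_less_cancel_left_pos by blast
    have "\<phi> \<tau> (Suc k + n) mod q (k + n) = \<phi> \<tau> (k + n)" by (rule Zp_coherent[OF P]) simp
    then have "int p ^ n * (z \<tau> (Suc k) mod q k) = int p ^ n * z \<tau> k"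
      unfolding qn z[OF t] mult_mod_right .
    then show "z \<tau> (Suc k) mod q k = z \<tau> k" using pn p_gt_1 by (simp del: power_Suc)
  qed
  have zm: "z (\<tau> \<otimes> \<sigma>) = z \<tau> \<oplus>\<^bsub>Zp p\<^esub> z \<sigma>" if t: "\<tau> \<in> GS n" and s: "\<sigma> \<in> GS n" for \<tau> \<sigma>
  proof
    fix k
    have ts: "\<tau> \<otimes> \<sigma> \<in> GS n" using subgroup.m_closed[OF GS_subgroup t s] .
    have "\<phi> (\<tau> \<otimes> \<sigma>) (k + n) = (\<phi> \<tau> (k + n) + \<phi> \<sigma> (k + n)) mod q (k + n)"
      using c[OF t] c[OF s] by (simp add: \<phi>_mult Zp_simps del: power_Suc)
    then have "int p ^ n * z (\<tau> \<otimes> \<sigma>) k = int p ^ n * ((z \<tau> k + z \<sigma> k) mod q k)"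
      unfolding qn z[OF t] z[OF s] z[OF ts] mult_mod_right distrib_left .
    then show "z (\<tau> \<otimes> \<sigma>) k = (z \<tau> \<oplus>\<^bsub>Zp p\<^esub> z \<sigma>) k" using pn p_gt_1 by (simp add: Zp_simps del: power_Suc)
  qed
  have "inj_on z (GS n)"
  proof (rule inj_onI)
    fix \<tau> \<sigma> assume t: "\<tau> \<in> GS n" and s: "\<sigma> \<in> GS n" and eq: "z \<tau> = z \<sigma>"
    have "\<phi> \<tau> k = \<phi> \<sigma> k" for k
    proof -
      have "\<phi> \<tau> (k + n) = \<phi> \<sigma> (k + n)" unfolding z[OF t] z[OF s] eq ..
      then show ?thesis
        using Zp_coherent[OF \<phi>_closed[OF c[OF t]], of k "k + n"]
          Zp_coherent[OF \<phi>_closed[OF c[OF s]], of k "k + n"] by simp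
    qed
    then have "\<phi> \<tau> = \<phi> \<sigma>" by blast
    then show "\<tau> = \<sigma>" using \<phi>_inj c[OF t] c[OF s] by (auto dest: inj_onD)
  qed
  moreover have "w \<in> z ` GS n" if w: "w \<in> carrier (Zp p)" for w
  proof -
    have "(\<lambda>j. (int p ^ n * w j) mod q j) \<in> carrier (Zp p)"
      by (rule Zp_of_coherent) (intro cong_mult cong_refl Zp_cong[OF w], simp)
    then obtain \<tau> where t: "\<tau> \<in> carrier \<Gamma>" "\<phi> \<tau> = (\<lambda>j. (int p ^ n * w j) mod q j)"
      using \<phi>_onto by (metis (no_types, lifting) imageE)
    have "res n \<tau> = 0" by (cases n) (simp_all add: res_def t(2))
    then have tn: "\<tau> \<in> GS n" using t by (simp add: GS_iff)
    have "z \<tau> k = w k" for k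
    proof -
      have "int p ^ n * z \<tau> k = int p ^ n * (w (k + n) mod q k)"
        unfolding z[OF tn, symmetric] t(2) qn mult_mod_right ..
      then show ?thesis using pn p_gt_1 Zp_coherent[OF w, of k "k + n"] by (simp del: power_Suc)
    qed
    then have "z \<tau> = w" by blast
    then show ?thesis using tn by blast
  qed
  ultimately show ?thesis using that[of z] zc zm by blast
qed

text \<open>Potentials on a derived graph are found as coherent integer sequences. They define
  elements at level n, which lift to \<Lambda> by surjectivity of the projection.\<close>

lemma (in padic_group_gen) lift_coherent:
  assumes S: "finite S"
    and f: "\<And>s h k. s \<in> S \<Longrightarrow> h \<in> carrier (GQ n) \<Longrightarrow> [f (s, h) (Suc k) = f (s, h) k] (mod q k)"
  obtains x where "x \<in> carrier (free_module \<Lambda> S)"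
    "\<And>s h k. s \<in> S \<Longrightarrow> h \<in> carrier (GQ n) \<Longrightarrow> x s n h k = f (s, h) k mod q k"
proof -
  have "\<exists>y\<in>carrier \<Lambda>. \<forall>h\<in>carrier (GQ n). \<forall>k. y n h k = f (s, h) k mod q k" if s: "s \<in> S" for s
  proof -
    let ?w = "\<lambda>h\<in>carrier (GQ n). \<lambda>k. f (s, h) k mod q k"
    have "(\<lambda>k. f (s, h) k mod q k) \<in> carrier (Zp p)" if "h \<in> carrier (GQ n)" for h
      by (rule Zp_of_coherent) (rule f[OF s that])
    then have "?w \<in> carrier (LR n)" by (auto simp: LR_carrier)
    then obtain y where "y \<in> carrier \<Lambda>" "y n = ?w" unfolding level_onto[symmetric] by auto
    then show ?thesis by (intro bexI[of _ y]) auto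
  qed
  then obtain y where y: "\<And>s. s \<in> S \<Longrightarrow> y s \<in> carrier \<Lambda>"
    "\<And>s h k. s \<in> S \<Longrightarrow> h \<in> carrier (GQ n) \<Longrightarrow> y s n h k = f (s, h) k mod q k" by metis
  show ?thesis
    by (rule that[of "\<lambda>s\<in>S. y s"]) (use y S in \<open>auto simp: free_module_simps\<close>)
qed

context iwasawa_graph
begin

section \<open>Deck transformations and Jacobians of the derived graphs\<close>

abbreviation "Jac n \<equiv> jacobian (XQ n) (EQ n)"

lemma XQ_oriented: "oriented_graph (XQ n) (EQ n)"
proof -
  have "verts (XQ n) = VQ n" by (simp add: derived_graph_def)
  then show ?thesis by (intro oriented_graph.intro) (simp only: XQ_fin_graph)
qed

lemma verts_XQ: "verts (XQ n) = VQ n"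
  by (simp add: derived_graph_def)

text \<open>Deck transformations translate by \<open>s\<close>, and heads are formed by
  multiplication with a voltage; the two commute.\<close>

lemma bd_deck:
  assumes s: "s \<in> carrier (GQ n)" and v: "v \<in> V" and h: "h \<in> carrier (GQ n)"
  shows "fg.bd n (deck_edges Ep (GQ n) s z) (v, h) = fg.bd n z (v, inv\<^bsub>GQ n\<^esub> s \<otimes>\<^bsub>GQ n\<^esub> h)"
proof -
  interpret Q: comm_group "GQ n" by (rule GQ_comm_group)
  have sh: "inv\<^bsub>GQ n\<^esub> s \<otimes>\<^bsub>GQ n\<^esub> h \<in> carrier (GQ n)" using s h by simp
  show ?thesis
    unfolding bd_XQ[OF v h] bd_XQ[OF v sh]
  proof (rule sum.cong[OF refl])
    fix e assume e: "e \<in> Ep"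
    then have a: "cl n (\<alpha> e) \<in> carrier (GQ n)" by (simp add: cl_closed \<alpha>_closed)
    show "(if hX e = v then deck_edges Ep (GQ n) s z (e, inv\<^bsub>GQ n\<^esub> cl n (\<alpha> e) \<otimes>\<^bsub>GQ n\<^esub> h) else 0)
        - (if tX e = v then deck_edges Ep (GQ n) s z (e, h) else 0)
      = (if hX e = v then z (e, inv\<^bsub>GQ n\<^esub> cl n (\<alpha> e) \<otimes>\<^bsub>GQ n\<^esub> (inv\<^bsub>GQ n\<^esub> s \<otimes>\<^bsub>GQ n\<^esub> h)) else 0)
        - (if tX e = v then z (e, inv\<^bsub>GQ n\<^esub> s \<otimes>\<^bsub>GQ n\<^esub> h) else 0)"
      using e a s h by (simp add: deck_edges_def Q.m_lcomm)
  qed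
qed

lemma lap_deck:
  assumes s: "s \<in> carrier (GQ n)" and v: "v \<in> V" and h: "h \<in> carrier (GQ n)"
  shows "fg.lap n (\<lambda>(v, h). Y (v, inv\<^bsub>GQ n\<^esub> s \<otimes>\<^bsub>GQ n\<^esub> h)) (v, h) = fg.lap n Y (v, inv\<^bsub>GQ n\<^esub> s \<otimes>\<^bsub>GQ n\<^esub> h)"
proof -
  interpret Q: comm_group "GQ n" by (rule GQ_comm_group)
  have "fg.bd n (fg.st n (\<lambda>(v, h). Y (v, inv\<^bsub>GQ n\<^esub> s \<otimes>\<^bsub>GQ n\<^esub> h))) = fg.bd n (deck_edges Ep (GQ n) s (fg.st n Y))"
  proof (rule fg.bd_cong)
    fix x assume "x \<in> EQ n"
    then obtain e g where x: "x = (e, g)" "e \<in> Ep" "g \<in> carrier (GQ n)" by blast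
    have "cl n (\<alpha> e) \<in> carrier (GQ n)" using x by (simp add: cl_closed \<alpha>_closed)
    then show "fg.st n (\<lambda>(v, h). Y (v, inv\<^bsub>GQ n\<^esub> s \<otimes>\<^bsub>GQ n\<^esub> h)) x = deck_edges Ep (GQ n) s (fg.st n Y) x"
      using x s by (simp add: st_XQ deck_edges_def Q.m_assoc)
  qed
  then show ?thesis unfolding fg.lap_def using bd_deck[OF s v h] by simp
qed

lemma deck_jacobian_class:
  assumes s: "s \<in> carrier (GQ n)" and x: "x \<in> carrier (free_module \<Z> (EQ n))"
  defines "N \<equiv> oriented_graph.jac_rel (XQ n) (EQ n)"
  shows "deck_jacobian Ep (GQ n) s (N +>\<^bsub>free_module \<Z> (EQ n)\<^esub> x)
    = N +>\<^bsub>free_module \<Z> (EQ n)\<^esub> deck_edges Ep (GQ n) s x"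
proof -
  interpret Q: comm_group "GQ n" by (rule GQ_comm_group)
  interpret O: oriented_graph "XQ n" "EQ n" by (rule XQ_oriented)
  let ?d = "deck_edges Ep (GQ n)"
  have dc: "?d s z \<in> carrier O.CZ" for s z unfolding O.CZ_iff by (auto simp: deck_edges_def)
  have inverse: "?d s (?d (inv\<^bsub>GQ n\<^esub> s) z) = z" if "s \<in> carrier (GQ n)" "z \<in> carrier O.CZ" for s z
    by (rule extensionalityI[of _ "EQ n"])
      (use that in \<open>auto simp: deck_edges_def O.CZ_iff Q.m_assoc[symmetric]\<close>)
  have mem: "z \<in> N +>\<^bsub>O.CZ\<^esub> x \<longleftrightarrow> z \<in> carrier O.CZ \<and> (\<exists>Y. \<forall>w\<in>VQ n. O.bd z w - O.bd x w = O.lap Y w)"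
    if x: "x \<in> carrier O.CZ" for z x
  proof -
    interpret N: abelian_subgroup N O.CZ
      unfolding N_def by (rule O.CZ.submodule_abelian_subgroup[OF O.jac_rel_submodule])
    have "z \<in> N +>\<^bsub>O.CZ\<^esub> x \<longleftrightarrow> z \<in> carrier O.CZ \<and> N +>\<^bsub>O.CZ\<^esub> z = N +>\<^bsub>O.CZ\<^esub> x"
      using N.a_rcos_self O.CZ.M.a_repr_independence[OF _ x N.a_subgroup] O.CZ.M.a_r_coset_subset_G[OF N.a_subset x] by blast
    then show ?thesis unfolding N_def using O.jac_class_eq_iff[OF _ x] by (auto simp: verts_XQ)
  qed
  have step: "?d s z \<in> N +>\<^bsub>O.CZ\<^esub> ?d s x"
    if s: "s \<in> carrier (GQ n)" and x: "x \<in> carrier O.CZ" and z: "z \<in> N +>\<^bsub>O.CZ\<^esub> x" for s x z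
  proof -
    obtain Y where Y: "\<And>w. w \<in> VQ n \<Longrightarrow> O.bd z w - O.bd x w = O.lap Y w"
      using z mem[OF x] by blast
    have "\<forall>w\<in>VQ n. O.bd (?d s z) w - O.bd (?d s x) w = O.lap (\<lambda>(v, h). Y (v, inv\<^bsub>GQ n\<^esub> s \<otimes>\<^bsub>GQ n\<^esub> h)) w"
    proof
      fix w assume "w \<in> VQ n"
      then obtain v h where w: "w = (v, h)" "v \<in> V" "h \<in> carrier (GQ n)" by blast
      then have "(v, inv\<^bsub>GQ n\<^esub> s \<otimes>\<^bsub>GQ n\<^esub> h) \<in> VQ n" using s by simp
      from Y[OF this] show "O.bd (?d s z) w - O.bd (?d s x) w = O.lap (\<lambda>(v, h). Y (v, inv\<^bsub>GQ n\<^esub> s \<otimes>\<^bsub>GQ n\<^esub> h)) w"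
        unfolding w(1) bd_deck[OF s w(2,3)] lap_deck[OF s w(2,3)] .
    qed
    then show ?thesis using mem[OF dc] dc by blast
  qed
  show ?thesis unfolding deck_jacobian_def
  proof (intro equalityI subsetI)
    fix y assume "y \<in> ?d s ` (N +>\<^bsub>O.CZ\<^esub> x)"
    then show "y \<in> N +>\<^bsub>O.CZ\<^esub> ?d s x" using step[OF s x] by blast
  next
    fix y assume y: "y \<in> N +>\<^bsub>O.CZ\<^esub> ?d s x"
    \<comment> \<open>For the reverse inclusion, the first one is applied to the inverse deck
      transformation.\<close>
    have si: "inv\<^bsub>GQ n\<^esub> s \<in> carrier (GQ n)" using s by simp
    have "?d (inv\<^bsub>GQ n\<^esub> s) y \<in> N +>\<^bsub>O.CZ\<^esub> ?d (inv\<^bsub>GQ n\<^esub> s) (?d s x)" by (rule step[OF si dc y])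
    moreover have "?d (inv\<^bsub>GQ n\<^esub> s) (?d s x) = x" using inverse[OF si x] s by simp
    moreover have "?d s (?d (inv\<^bsub>GQ n\<^esub> s) y) = y" using y mem[OF dc] inverse[OF s] by blast
    ultimately show "y \<in> ?d s ` (N +>\<^bsub>O.CZ\<^esub> x)" by (metis image_eqI)
  qed
qed

text \<open>\<open>G\<close> truncates a p-adic chain to integers at component \<open>K\<close>,
  multiplies by the projector \<open>u\<close> and takes the class. Neither step is canonical on
  chains, but \<open>u * q K\<close> annihilates the Jacobian, so truncation becomes additive on
  classes.\<close>

lemma jacobian_projection:
  obtains G where
    "\<And>c. c \<in> carrier C \<Longrightarrow> G c \<in> carrier (p_power_torsion p (Jac n))"
    "\<And>j. j \<in> carrier (p_power_torsion p (Jac n)) \<Longrightarrow> \<exists>c\<in>carrier C. G c = j"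
    "\<And>c d. c \<in> carrier C \<Longrightarrow> d \<in> carrier C \<Longrightarrow> G (c \<oplus>\<^bsub>C\<^esub> d) = G c \<oplus>\<^bsub>Jac n\<^esub> G d"
    "\<And>c. c \<in> carrier C \<Longrightarrow> G c = \<zero>\<^bsub>Jac n\<^esub> \<longleftrightarrow>
       (\<exists>y\<in>carrier D. \<forall>v\<in>V. (dI c \<ominus>\<^bsub>D\<^esub> dI (sI y)) v n = \<zero>\<^bsub>LR n\<^esub>)"
    "\<And>\<sigma> c. \<sigma> \<in> carrier \<Gamma> \<Longrightarrow> c \<in> carrier C \<Longrightarrow>
       G (ge \<sigma> \<odot>\<^bsub>C\<^esub> c) = deck_jacobian Ep (GQ n) (cl n \<sigma>) (G c)"
proof -
  interpret O: oriented_graph "XQ n" "EQ n" by (rule XQ_oriented)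
  interpret Jm: module \<Z> "Jac n" by (rule O.jacobian_module)
  obtain v0 where v0: "v0 \<in> V" using fg.nonempty[of n] by blast
  obtain b where "b \<in> carrier \<Gamma>" "\<not> int p dvd \<phi> b 0" using loop_generator[OF v0] by blast
  then interpret B: padic_group_gen p \<Gamma> T \<phi> \<gamma> b by unfold_locales
  show ?thesis
  proof (rule fg.p_primary_projector[of n])
  fix u :: int and K a :: nat
  assume P1: "\<And>d. (\<Sum>v\<in>VQ n. d v) = 0 \<Longrightarrow> \<exists>Y. \<forall>v\<in>VQ n. O.lap Y v = u * q K * d v" and
    P2: "\<And>d. (\<Sum>v\<in>VQ n. d v) = 0 \<Longrightarrow> \<exists>Y. \<forall>v\<in>VQ n. O.lap Y v = int p ^ a * u * d v" and
    P3: "\<And>d Z j. (\<Sum>v\<in>VQ n. d v) = 0 \<Longrightarrow> (\<And>v. v \<in> VQ n \<Longrightarrow> O.lap Z v = int p ^ j * d v) \<Longrightarrow>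
       \<exists>Y. \<forall>v\<in>VQ n. O.lap Y v = d v - u * d v" and
    P4: "\<And>x Y. (\<And>v k. v \<in> VQ n \<Longrightarrow> [x v (Suc k) = x v k] (mod q k)) \<Longrightarrow> (\<And>k. (\<Sum>v\<in>VQ n. x v k) = 0) \<Longrightarrow>
       (\<And>v. v \<in> VQ n \<Longrightarrow> O.lap Y v = u * x v K) \<Longrightarrow>
       \<exists>y. (\<forall>v\<in>VQ n. \<forall>k. [y v (Suc k) = y v k] (mod q k)) \<and>
           (\<forall>v\<in>VQ n. \<forall>k. [O.lap (\<lambda>v. y v k) v = x v k] (mod q k))"
  define F where "F c = (\<lambda>x\<in>EQ n. u * coords n K c x)" for c :: "'e \<Rightarrow> 'g iwasawa_elt"
  define G where "G c = O.jac_rel +>\<^bsub>O.CZ\<^esub> F c" for c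
  have Fc: "F c \<in> carrier O.CZ" for c unfolding O.CZ_iff by (simp add: F_def)
  have bdF: "O.bd (F c) w = u * O.bd (coords n K c) w" for c w
  proof -
    have "O.bd (F c) = O.bd (\<lambda>x. u * coords n K c x)" by (rule O.bd_cong) (simp add: F_def)
    then show ?thesis by (simp only: O.bd_mult)
  qed
  note class_eq = O.jac_class_eq_iff[unfolded verts_XQ]
  note Q = O.CZ.quot_module_carrier[of O.jac_rel] O.CZ.quot_module_add[OF O.jac_rel_submodule]
    O.CZ.quot_module_smult[OF O.jac_rel_submodule] O.CZ.quot_module_class_zero_iff[OF O.jac_rel_submodule]
  \<comment> \<open>Truncation errors are multiples of \<open>q K\<close>; after multiplication by
    \<open>u\<close> their boundaries are principal.\<close>
  have same: "O.jac_rel +>\<^bsub>O.CZ\<^esub> x = O.jac_rel +>\<^bsub>O.CZ\<^esub> y"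
    if xy: "x \<in> carrier O.CZ" "y \<in> carrier O.CZ" and t: "\<And>e. e \<in> EQ n \<Longrightarrow> x e - y e = u * q K * t e" for x y t
  proof -
    obtain Y where Y: "\<forall>v\<in>VQ n. O.lap Y v = u * q K * O.bd t v" using P1[OF fg.bd_sum_zero[of n]] by blast
    have "O.bd (\<lambda>e. x e - y e) = O.bd (\<lambda>e. u * q K * t e)" by (rule O.bd_cong) (rule t)
    from fun_cong[OF this] have "O.bd x v - O.bd y v = u * q K * O.bd t v" for v
      unfolding O.bd_diff O.bd_mult .
    then show ?thesis unfolding class_eq[OF xy] using Y by (intro exI[of _ Y]) simp
  qed
  have zero: "O.jac_rel +>\<^bsub>O.CZ\<^esub> x = \<zero>\<^bsub>Jac n\<^esub> \<longleftrightarrow> (\<exists>Y. \<forall>v\<in>VQ n. O.bd x v = O.lap Y v)"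
    if x: "x \<in> carrier O.CZ" for x
  proof -
    have "O.jac_rel +>\<^bsub>O.CZ\<^esub> x = \<zero>\<^bsub>Jac n\<^esub> \<longleftrightarrow> x \<in> O.jac_rel"
      unfolding O.jacobian_eq by (rule Q(4)[OF x])
    then show ?thesis using x unfolding O.jac_rel_def verts_XQ by simp
  qed
  have torsion_iff: "j \<in> carrier (p_power_torsion p (Jac n)) \<longleftrightarrow>
    (\<exists>x k. x \<in> carrier O.CZ \<and> j = O.jac_rel +>\<^bsub>O.CZ\<^esub> x \<and> (\<exists>Y. \<forall>v\<in>VQ n. int p ^ k * O.bd x v = O.lap Y v))" for j
  proof -
    have "add_pow (Jac n) (p ^ k) (O.jac_rel +>\<^bsub>O.CZ\<^esub> x) = \<zero>\<^bsub>Jac n\<^esub> \<longleftrightarrow> (\<exists>Y. \<forall>v\<in>VQ n. int p ^ k * O.bd x v = O.lap Y v)"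
      if x: "x \<in> carrier O.CZ" for x and k :: nat
    proof -
      have jx: "O.jac_rel +>\<^bsub>O.CZ\<^esub> x \<in> carrier (Jac n)" using x unfolding O.jacobian_eq Q(1) by (rule imageI)
      have xk: "int (p ^ k) \<odot>\<^bsub>O.CZ\<^esub> x \<in> carrier O.CZ" using O.CZ.smult_closed x by simp
      have "add_pow (Jac n) (p ^ k) (O.jac_rel +>\<^bsub>O.CZ\<^esub> x) = int (p ^ k) \<odot>\<^bsub>Jac n\<^esub> (O.jac_rel +>\<^bsub>O.CZ\<^esub> x)"
        by (rule add_pow_eq_smult[OF O.jacobian_module jx])
      also have "\<dots> = O.jac_rel +>\<^bsub>O.CZ\<^esub> (int (p ^ k) \<odot>\<^bsub>O.CZ\<^esub> x)"
        unfolding O.jacobian_eq using x by (intro Q(3)) auto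
      finally have eq: "add_pow (Jac n) (p ^ k) (O.jac_rel +>\<^bsub>O.CZ\<^esub> x) = O.jac_rel +>\<^bsub>O.CZ\<^esub> (int (p ^ k) \<odot>\<^bsub>O.CZ\<^esub> x)" .
      have "O.bd (int (p ^ k) \<odot>\<^bsub>O.CZ\<^esub> x) = O.bd (\<lambda>e. int p ^ k * x e)"
        by (rule O.bd_cong) (simp add: free_module_simps)
      then have bdk: "O.bd (int (p ^ k) \<odot>\<^bsub>O.CZ\<^esub> x) v = int p ^ k * O.bd x v" for v by (simp only: O.bd_mult)
      show ?thesis unfolding eq zero[OF xk] bdk ..
    qed
    note tor = this
    have jc: "carrier (Jac n) = (\<lambda>x. O.jac_rel +>\<^bsub>O.CZ\<^esub> x) ` carrier O.CZ"
      unfolding O.jacobian_eq by (rule Q(1))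
    have pc: "carrier (p_power_torsion p (Jac n)) = {x \<in> carrier (Jac n). \<exists>k::nat. add_pow (Jac n) (p ^ k) x = \<zero>\<^bsub>Jac n\<^esub>}"
      by (simp add: p_power_torsion_def)
    show ?thesis
    proof
      assume "j \<in> carrier (p_power_torsion p (Jac n))"
      then obtain x and k :: nat where "x \<in> carrier O.CZ" "j = O.jac_rel +>\<^bsub>O.CZ\<^esub> x" "add_pow (Jac n) (p ^ k) j = \<zero>\<^bsub>Jac n\<^esub>"
        unfolding pc jc by blast
      then show "\<exists>x k. x \<in> carrier O.CZ \<and> j = O.jac_rel +>\<^bsub>O.CZ\<^esub> x \<and> (\<exists>Y. \<forall>v\<in>VQ n. int p ^ k * O.bd x v = O.lap Y v)"
        using tor[of x k] by blast
    next
      assume "\<exists>x k. x \<in> carrier O.CZ \<and> j = O.jac_rel +>\<^bsub>O.CZ\<^esub> x \<and> (\<exists>Y. \<forall>v\<in>VQ n. int p ^ k * O.bd x v = O.lap Y v)"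
      then obtain x k where x: "x \<in> carrier O.CZ" "j = O.jac_rel +>\<^bsub>O.CZ\<^esub> x" "\<exists>Y. \<forall>v\<in>VQ n. int p ^ k * O.bd x v = O.lap Y v" by blast
      then have "add_pow (Jac n) (p ^ k) j = \<zero>\<^bsub>Jac n\<^esub>" using tor[of x k] by blast
      moreover have "j \<in> carrier (Jac n)" unfolding jc using x by blast
      ultimately show "j \<in> carrier (p_power_torsion p (Jac n))" unfolding pc by blast
    qed
  qed
  show ?thesis
  proof (rule that[of G])
    fix c assume c: "c \<in> carrier C"
    show "G c \<in> carrier (p_power_torsion p (Jac n))"
    proof -
      obtain Y where "\<forall>v\<in>VQ n. O.lap Y v = int p ^ a * u * O.bd (coords n K c) v"
        using P2[OF fg.bd_sum_zero[of n]] by blast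
      then have "\<forall>v\<in>VQ n. int p ^ a * O.bd (F c) v = O.lap Y v" by (simp add: bdF)
      then show ?thesis unfolding torsion_iff G_def using Fc by blast
    qed
  next
    fix j assume "j \<in> carrier (p_power_torsion p (Jac n))"
    then obtain x k Z where x: "x \<in> carrier O.CZ" "j = O.jac_rel +>\<^bsub>O.CZ\<^esub> x"
      and Z: "\<And>v. v \<in> VQ n \<Longrightarrow> O.lap Z v = int p ^ k * O.bd x v" unfolding torsion_iff by metis
    obtain Y where Y: "\<forall>v\<in>VQ n. O.lap Y v = O.bd x v - u * O.bd x v"
      using P3[OF fg.bd_sum_zero[of n] Z] by blast
    \<comment> \<open>An integral representative \<open>x\<close> is lifted as a constant sequence.
      Its image is the class of u x, which equals that of x because \<open>u\<close> acts as the
      identity on p-power torsion.\<close>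
    obtain c where c: "c \<in> carrier C" "\<And>e h k. e \<in> Ep \<Longrightarrow> h \<in> carrier (GQ n) \<Longrightarrow> c e n h k = x (e, h) mod q k"
      using B.lift_coherent[OF finite_Ep, of n "\<lambda>s k. x s"] by auto
    let ?ux = "u \<odot>\<^bsub>O.CZ\<^esub> x"
    have ux: "?ux \<in> carrier O.CZ" using O.CZ.smult_closed x by simp
    have "O.bd ?ux = O.bd (\<lambda>e. u * x e)" by (rule O.bd_cong) (simp add: free_module_simps)
    then have bdu: "O.bd ?ux v = u * O.bd x v" for v by (simp only: O.bd_mult)
    have "G c = O.jac_rel +>\<^bsub>O.CZ\<^esub> ?ux"
      unfolding G_def
    proof (rule same[OF Fc ux])
      fix y assume "y \<in> EQ n"
      then obtain e h where y: "y = (e, h)" "e \<in> Ep" "h \<in> carrier (GQ n)" by blast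
      have "F c y = u * (x y mod q K)" using y c by (simp add: F_def coords_def del: power_Suc)
      moreover have "?ux y = u * x y" using y by (simp add: free_module_simps)
      ultimately have "F c y - ?ux y = u * (x y mod q K - x y)" by (simp only: right_diff_distrib)
      also have "x y mod q K - x y = q K * (- (x y div q K))"
        unfolding minus_mult_div_eq_mod[symmetric, of "x y" "q K"] by simp
      finally show "F c y - ?ux y = u * q K * (- (x y div q K))" by (simp only: mult.assoc)
    qed
    also have "\<dots> = j"
      unfolding x(2) class_eq[OF ux x(1)] bdu
    proof (intro exI ballI)
      show "u * O.bd x v - O.bd x v = O.lap (\<lambda>v. (-1) * Y v) v" if "v \<in> VQ n" for v
        unfolding O.lap_mult using bspec[OF Y that] by simp
    qed
    finally show "\<exists>c\<in>carrier C. G c = j" using c by blast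
  next
    fix c d assume c: "c \<in> carrier C" and d: "d \<in> carrier C"
    have "G (c \<oplus>\<^bsub>C\<^esub> d) = O.jac_rel +>\<^bsub>O.CZ\<^esub> (F c \<oplus>\<^bsub>O.CZ\<^esub> F d)"
      unfolding G_def
    proof (rule same[OF Fc O.CZ.M.a_closed[OF Fc Fc]])
      fix y assume "y \<in> EQ n"
      then obtain e h where y: "y = (e, h)" "e \<in> Ep" "h \<in> carrier (GQ n)" by blast
      let ?s = "coords n K c y + coords n K d y"
      have "F (c \<oplus>\<^bsub>C\<^esub> d) y = u * (?s mod q K)"
        using y c d by (simp add: F_def coords_def free_module_simps \<Lambda>_add_apply Zp_simps del: power_Suc)
      moreover have "(F c \<oplus>\<^bsub>O.CZ\<^esub> F d) y = u * ?s"
        using y by (simp add: F_def free_module_simps algebra_simps)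
      ultimately have "F (c \<oplus>\<^bsub>C\<^esub> d) y - (F c \<oplus>\<^bsub>O.CZ\<^esub> F d) y = u * (?s mod q K - ?s)"
        by (simp only: right_diff_distrib)
      also have "?s mod q K - ?s = q K * (- (?s div q K))"
        unfolding minus_mult_div_eq_mod[symmetric, of ?s "q K"] by simp
      finally show "F (c \<oplus>\<^bsub>C\<^esub> d) y - (F c \<oplus>\<^bsub>O.CZ\<^esub> F d) y = u * q K * (- (?s div q K))"
        by (simp only: mult.assoc)
    qed
    then show "G (c \<oplus>\<^bsub>C\<^esub> d) = G c \<oplus>\<^bsub>Jac n\<^esub> G d"
      unfolding G_def O.jacobian_eq by (simp add: Q(2)[OF Fc Fc])
  next
    fix c assume c: "c \<in> carrier C"
    have G0: "G c = \<zero>\<^bsub>Jac n\<^esub> \<longleftrightarrow> (\<exists>Y. \<forall>v\<in>VQ n. O.lap Y v = u * O.bd (coords n K c) v)"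
      unfolding G_def zero[OF Fc] bdF by (simp only: eq_commute)
    have coord: "(dI c \<ominus>\<^bsub>D\<^esub> dI (sI y)) v n h k
        = (O.bd (coords n k c) (v, h) - O.lap (coords n k y) (v, h)) mod q k"
      if y: "y \<in> carrier D" and v: "v \<in> V" and h: "h \<in> carrier (GQ n)" for y v h k
    proof -
      note dc = dI_closed[OF c] and sc = sI_closed[OF y] and dsc = dI_closed[OF sI_closed[OF y]]
      have "(dI c \<ominus>\<^bsub>D\<^esub> dI (sI y)) v n h k = (dI c v n h k - dI (sI y) v n h k) mod q k"
        using v h dc dsc
        by (simp add: \<Lambda>.free_module_minus \<Lambda>_minus_apply Zp_minus \<Lambda>_apply_closed D_apply del: power_Suc)
      also have "\<dots> = (O.bd (coords n k c) (v, h) - O.bd (coords n k (sI y)) (v, h)) mod q k"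
        unfolding dI_bd[OF c v h] dI_bd[OF sc v h] by (rule mod_diff_eq)
      also have "\<dots> = (O.bd (coords n k c) (v, h) - O.lap (coords n k y) (v, h)) mod q k"
        using cong_diff[OF cong_refl dI_sI_lap[OF y v h]] unfolding cong_def by blast
      finally show ?thesis .
    qed
    have level: "(dI c \<ominus>\<^bsub>D\<^esub> dI (sI y)) v n = \<zero>\<^bsub>LR n\<^esub> \<longleftrightarrow>
       (\<forall>h\<in>carrier (GQ n). \<forall>k. [O.bd (coords n k c) (v, h) = O.lap (coords n k y) (v, h)] (mod q k))"
      if y: "y \<in> carrier D" and v: "v \<in> V" for y v
    proof -
      have "(dI c \<ominus>\<^bsub>D\<^esub> dI (sI y)) v \<in> carrier \<Lambda>"
        using c y v by (intro D_apply D.M.minus_closed dI_closed sI_closed)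
      note L = LR_zero_iff[OF \<Lambda>_level[OF this], of n]
      show ?thesis unfolding L unfolding fun_eq_iff
        using coord[OF y v] by (simp add: Zp_simps cong_iff_dvd_diff mod_eq_0_iff_dvd del: power_Suc)
    qed
    show "G c = \<zero>\<^bsub>Jac n\<^esub> \<longleftrightarrow> (\<exists>y\<in>carrier D. \<forall>v\<in>V. (dI c \<ominus>\<^bsub>D\<^esub> dI (sI y)) v n = \<zero>\<^bsub>LR n\<^esub>)"
    proof
      assume "G c = \<zero>\<^bsub>Jac n\<^esub>"
      then obtain Y where Y: "\<And>v. v \<in> VQ n \<Longrightarrow> O.lap Y v = u * O.bd (coords n K c) v" unfolding G0 by blast
      have coh: "[O.bd (coords n (Suc k) c) v = O.bd (coords n k c) v] (mod q k)" for v k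
      proof -
        have "q k dvd O.bd (\<lambda>x. coords n (Suc k) c x - coords n k c x) v"
        proof (rule O.bd_dvd)
          fix x assume "x \<in> EQ n"
          then obtain e h where x: "x = (e, h)" "e \<in> Ep" "h \<in> carrier (GQ n)" by blast
          show "q k dvd coords n (Suc k) c x - coords n k c x"
            using coords_coherent[of c e h n k] C_apply[OF c] x by (simp add: cong_iff_dvd_diff)
        qed
        then show ?thesis by (simp only: O.bd_diff cong_iff_dvd_diff)
      qed
      \<comment> \<open>A condition at the single component \<open>K\<close> is turned by the
        projector into potentials for all components at once, coherent in k.\<close>
      obtain y where y: "\<forall>v\<in>VQ n. \<forall>k. [y v (Suc k) = y v k] (mod q k)"
        "\<forall>v\<in>VQ n. \<forall>k. [O.lap (\<lambda>v. y v k) v = O.bd (coords n k c) v] (mod q k)"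
        using P4[of "\<lambda>v k. O.bd (coords n k c) v" Y] coh fg.bd_sum_zero[of n] Y by blast
      obtain y' where y': "y' \<in> carrier D" "\<And>v h k. v \<in> V \<Longrightarrow> h \<in> carrier (GQ n) \<Longrightarrow> y' v n h k = y (v, h) k mod q k"
        using B.lift_coherent[OF finite_V, of n y] y(1) by auto
      have lapc: "[O.lap (coords n k y') w = O.lap (\<lambda>v. y v k) w] (mod q k)" for k w
      proof -
        have "q k dvd fg.lap n (\<lambda>x. coords n k y' x - y x k) w"
        proof (rule fg.lap_dvd)
          fix x assume "x \<in> VQ n"
          then obtain v h where x: "x = (v, h)" "v \<in> V" "h \<in> carrier (GQ n)" by blast
          then have "coords n k y' x = y x k mod q k" using y'(2) by (simp add: coords_def)
          then show "q k dvd coords n k y' x - y x k" by (simp add: mod_eq_dvd_iff[symmetric] del: power_Suc)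
        qed
        then show ?thesis by (simp only: fg.lap_diff cong_iff_dvd_diff)
      qed
      have "\<forall>v\<in>V. (dI c \<ominus>\<^bsub>D\<^esub> dI (sI y')) v n = \<zero>\<^bsub>LR n\<^esub>"
      proof
        fix v assume v: "v \<in> V"
        have "[O.bd (coords n k c) (v, h) = O.lap (coords n k y') (v, h)] (mod q k)"
          if h: "h \<in> carrier (GQ n)" for h k
        proof -
          have "[O.lap (\<lambda>v. y v k) (v, h) = O.bd (coords n k c) (v, h)] (mod q k)" using y(2) v h by blast
          from cong_trans[OF lapc this] show ?thesis by (rule cong_sym)
        qed
        then show "(dI c \<ominus>\<^bsub>D\<^esub> dI (sI y')) v n = \<zero>\<^bsub>LR n\<^esub>" unfolding level[OF y'(1) v] by blast
      qed
      then show "\<exists>y\<in>carrier D. \<forall>v\<in>V. (dI c \<ominus>\<^bsub>D\<^esub> dI (sI y)) v n = \<zero>\<^bsub>LR n\<^esub>" using y'(1) by blast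
    next
      assume "\<exists>y\<in>carrier D. \<forall>v\<in>V. (dI c \<ominus>\<^bsub>D\<^esub> dI (sI y)) v n = \<zero>\<^bsub>LR n\<^esub>"
      then obtain y where y: "y \<in> carrier D" "\<forall>v\<in>V. (dI c \<ominus>\<^bsub>D\<^esub> dI (sI y)) v n = \<zero>\<^bsub>LR n\<^esub>" by blast
      \<comment> \<open>Conversely, the boundary agrees with a Laplacian modulo \<open>q K\<close>.
        The quotient \<open>t\<close> of the error has degree zero, so \<open>u * q K * t\<close> is
        principal.\<close>
      define t where "t w = (O.bd (coords n K c) w - O.lap (coords n K y) w) div q K" for w
      have t: "O.bd (coords n K c) w - O.lap (coords n K y) w = q K * t w" if "w \<in> VQ n" for w
      proof -
        obtain v h where w: "w = (v, h)" "v \<in> V" "h \<in> carrier (GQ n)" using \<open>w \<in> VQ n\<close> by blast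
        have "[O.bd (coords n K c) w = O.lap (coords n K y) w] (mod q K)"
          using y(2) level[OF y(1) w(2)] w by blast
        then show ?thesis unfolding t_def cong_iff_dvd_diff by (rule dvd_mult_div_cancel[symmetric])
      qed
      have "q K * (\<Sum>w\<in>VQ n. t w) = (\<Sum>w\<in>VQ n. O.bd (coords n K c) w - O.lap (coords n K y) w)"
        using t by (simp add: sum_distrib_left)
      also have "\<dots> = 0" using fg.bd_sum_zero[of n] by (simp add: sum_subtractf O.lap_def)
      finally have "(\<Sum>w\<in>VQ n. t w) = 0" using p_gt_1 by simp
      then obtain Y where Y: "\<forall>v\<in>VQ n. O.lap Y v = u * q K * t v" using P1 by blast
      have "O.lap (\<lambda>v. u * coords n K y v + Y v) v = u * O.bd (coords n K c) v" if v: "v \<in> VQ n" for v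
      proof -
        have "O.lap (\<lambda>v. u * coords n K y v + Y v) v = u * (O.lap (coords n K y) v + q K * t v)"
          using bspec[OF Y v] by (simp add: O.lap_add O.lap_mult algebra_simps)
        also have "O.lap (coords n K y) v + q K * t v = O.bd (coords n K c) v" using t[OF v] by linarith
        finally show ?thesis .
      qed
      then show "G c = \<zero>\<^bsub>Jac n\<^esub>" unfolding G0 by blast
    qed
  next
    fix \<sigma> c assume \<sigma>: "\<sigma> \<in> carrier \<Gamma>" and c: "c \<in> carrier C"
    have "F (ge \<sigma> \<odot>\<^bsub>C\<^esub> c) = deck_edges Ep (GQ n) (cl n \<sigma>) (F c)"
    proof (rule extensionalityI[of _ "EQ n"])
      fix y assume "y \<in> EQ n"
      then obtain e h where y: "y = (e, h)" "e \<in> Ep" "h \<in> carrier (GQ n)" by blast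
      interpret Q: comm_group "GQ n" by (rule GQ_comm_group)
      have "inv\<^bsub>GQ n\<^esub> cl n \<sigma> \<otimes>\<^bsub>GQ n\<^esub> h \<in> carrier (GQ n)" using y cl_closed[OF \<sigma>] by simp
      then show "F (ge \<sigma> \<odot>\<^bsub>C\<^esub> c) y = deck_edges Ep (GQ n) (cl n \<sigma>) (F c) y"
        using y \<sigma> C_apply[OF c y(2)]
        by (simp add: F_def coords_def deck_edges_def free_module_simps ge_mult_apply)
    qed (auto simp: F_def deck_edges_def)
    then show "G (ge \<sigma> \<odot>\<^bsub>C\<^esub> c) = deck_jacobian Ep (GQ n) (cl n \<sigma>) (G c)"
      unfolding G_def using deck_jacobian_class[OF cl_closed[OF \<sigma>] Fc] by simp
  qed
  qed
qed

subsection \<open>The extension\<close>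

text \<open>Translation leaves augmentations unchanged. This puts \<open>omega n\<close>
  D(\<infinity>) into the image of d, and later it makes \<Gamma> act trivially on the image of
  \<open>f\<close>.\<close>

lemma taug_omega_free:
  assumes x: "x \<in> carrier D" and g: "g \<in> carrier \<Gamma>"
  shows "taug ((ge g \<odot>\<^bsub>D\<^esub> x) \<ominus>\<^bsub>D\<^esub> x) = \<zero>\<^bsub>Zp p\<^esub>"
proof -
  have gx: "ge g \<odot>\<^bsub>D\<^esub> x \<in> carrier D" using x g ge_closed by simp
  have "taug ((ge g \<odot>\<^bsub>D\<^esub> x) \<ominus>\<^bsub>D\<^esub> x) = (\<Oplus>\<^bsub>Zp p\<^esub>v\<in>V. \<zero>\<^bsub>Zp p\<^esub>)"
    unfolding taug_def
  proof (rule Zp.finsum_cong'[OF refl])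
    fix v assume v: "v \<in> V"
    have xv: "x v \<in> carrier \<Lambda>" by (rule D_apply[OF x v])
    have "((ge g \<odot>\<^bsub>D\<^esub> x) \<ominus>\<^bsub>D\<^esub> x) v = (ge g \<otimes>\<^bsub>\<Lambda>\<^esub> x v) \<ominus>\<^bsub>\<Lambda>\<^esub> x v"
      unfolding \<Lambda>.free_module_minus[OF gx x] using v by (simp add: free_module_simps)
    then show "aug (((ge g \<odot>\<^bsub>D\<^esub> x) \<ominus>\<^bsub>D\<^esub> x) v) = \<zero>\<^bsub>Zp p\<^esub>"
      using xv g by (simp add: aug_minus aug_ge_mult ge_closed aug_closed)
  qed simp
  then show ?thesis by (simp add: Zp.finsum_zero)
qed

lemma taug_minus:
  assumes "x \<in> carrier D" "y \<in> carrier D" shows "taug (x \<ominus>\<^bsub>D\<^esub> y) = taug x \<ominus>\<^bsub>Zp p\<^esub> taug y"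
proof -
  have "x = (x \<ominus>\<^bsub>D\<^esub> y) \<oplus>\<^bsub>D\<^esub> y" using assms by (simp add: D.M.minus_eq D.M.a_assoc D.M.l_neg)
  then have "taug x = taug (x \<ominus>\<^bsub>D\<^esub> y) \<oplus>\<^bsub>Zp p\<^esub> taug y"
    using taug_add[of "x \<ominus>\<^bsub>D\<^esub> y" y] assms by simp
  then show ?thesis
    using Zp.minus_eq_iff[of "taug x" "taug y" "taug (x \<ominus>\<^bsub>D\<^esub> y)"] taug_closed assms by simp
qed

lemma dI_sI_zero: "dI (sI \<zero>\<^bsub>D\<^esub>) = \<zero>\<^bsub>D\<^esub>"
proof -
  have "sI (\<zero>\<^bsub>D\<^esub> \<ominus>\<^bsub>D\<^esub> \<zero>\<^bsub>D\<^esub>) = sI \<zero>\<^bsub>D\<^esub> \<ominus>\<^bsub>C\<^esub> sI \<zero>\<^bsub>D\<^esub>" by (rule sI_minus) auto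
  then have s: "sI \<zero>\<^bsub>D\<^esub> = sI \<zero>\<^bsub>D\<^esub> \<ominus>\<^bsub>C\<^esub> sI \<zero>\<^bsub>D\<^esub>" by (simp add: D.M.minus_eq D.M.r_neg)
  have "dI (sI \<zero>\<^bsub>D\<^esub> \<ominus>\<^bsub>C\<^esub> sI \<zero>\<^bsub>D\<^esub>) = dI (sI \<zero>\<^bsub>D\<^esub>) \<ominus>\<^bsub>D\<^esub> dI (sI \<zero>\<^bsub>D\<^esub>)"
    by (intro dI_minus sI_closed) auto
  then show ?thesis using s dI_closed[OF sI_closed[OF D.M.zero_closed]]
    by (simp add: D.M.minus_eq D.M.r_neg)
qed

text \<open>Both J(n) and the p-part of the Jacobian are quotients of the chains, by
  \<open>Q\<close> and \<open>G\<close>. The map \<open>g\<close> is induced by \<open>G\<close>,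
  and \<open>f\<close> sends \<tau> to the class of a chain whose boundary is \<open>omega n\<close>
  times a divisor at one vertex with total augmentation \<open>z \<tau>\<close>.\<close>

lemma layer_extension:
  "\<exists>f g. short_exact (\<Gamma>\<lparr>carrier := GS n\<rparr>) f (add_monoid (J_layer p \<Gamma> T \<gamma> X Ep \<alpha> n)) g
        (p_power_torsion p (Jac n))
     \<and> (\<forall>\<sigma>\<in>carrier \<Gamma>. \<forall>\<tau>\<in>GS n. ge \<sigma> \<odot>\<^bsub>J_layer p \<Gamma> T \<gamma> X Ep \<alpha> n\<^esub> f \<tau> = f \<tau>)
     \<and> (\<forall>\<sigma>\<in>carrier \<Gamma>. \<forall>x\<in>carrier (J_layer p \<Gamma> T \<gamma> X Ep \<alpha> n).
          g (ge \<sigma> \<odot>\<^bsub>J_layer p \<Gamma> T \<gamma> X Ep \<alpha> n\<^esub> x) = deck_jacobian Ep (GQ n) (cl n \<sigma>) (g x))"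
proof -
  let ?J = "J_layer p \<Gamma> T \<gamma> X Ep \<alpha> n"
  obtain v0 where v0: "v0 \<in> V" using fg.nonempty[of n] by blast
  obtain b y\<^sub>b where b: "b \<in> carrier \<Gamma>" "\<not> int p dvd \<phi> b 0" "y\<^sub>b \<in> carrier C"
    "dI y\<^sub>b = (ge b \<odot>\<^bsub>D\<^esub> \<delta> v0) \<ominus>\<^bsub>D\<^esub> \<delta> v0" using loop_generator[OF v0] by blast
  interpret B: padic_group_gen p \<Gamma> T \<phi> \<gamma> b using b by unfold_locales
  define w where "w = B.omega n"
  have wc: "w \<in> carrier \<Lambda>" unfolding w_def by (rule B.omega_closed)
  have \<delta>c: "\<delta> v0 \<in> carrier D" by (rule \<Lambda>.basis_elt_closed)
  have omega_smult: "B.omega m \<odot>\<^bsub>D\<^esub> x = (ge (b [^] (p ^ m)) \<odot>\<^bsub>D\<^esub> x) \<ominus>\<^bsub>D\<^esub> x" if x: "x \<in> carrier D" for m x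
    using x b by (simp add: B.omega_def D.smult_minus_l ge_closed)
  \<comment> \<open>After all coefficients are collected at \<open>v0\<close>, a coefficient
    \<open>l\<close> of augmentation zero is left. It is a multiple of b - 1, and b - 1 times
    \<open>v0\<close> is the boundary of the loop.\<close>
  have image: "\<exists>c\<in>carrier C. dI c = x" if x: "x \<in> carrier D" and 0: "taug x = \<zero>\<^bsub>Zp p\<^esub>" for x
  proof -
    obtain c l where cl: "c \<in> carrier C" "l \<in> carrier \<Lambda>" "x = dI c \<oplus>\<^bsub>D\<^esub> (l \<odot>\<^bsub>D\<^esub> \<delta> v0)" "aug l = taug x"
      using D_decomp[OF v0 x] by blast
    have "l 0 = \<zero>\<^bsub>LR 0\<^esub>" using cl 0 by (simp add: aug_zero_iff)
    then obtain \<mu> where \<mu>: "\<mu> \<in> carrier \<Lambda>" "l = B.omega 0 \<otimes>\<^bsub>\<Lambda>\<^esub> \<mu>" using B.level_zero_iff[OF cl(2)] by blast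
    have "B.omega 0 \<odot>\<^bsub>D\<^esub> \<delta> v0 = dI y\<^sub>b" using omega_smult[OF \<delta>c, of 0] b by simp
    moreover have "l \<odot>\<^bsub>D\<^esub> \<delta> v0 = \<mu> \<odot>\<^bsub>D\<^esub> (B.omega 0 \<odot>\<^bsub>D\<^esub> \<delta> v0)"
      using \<mu> B.omega_closed[of 0] \<delta>c by (simp add: D.smult_assoc1[symmetric] \<Lambda>.m_comm)
    ultimately have "l \<odot>\<^bsub>D\<^esub> \<delta> v0 = dI (\<mu> \<odot>\<^bsub>C\<^esub> y\<^sub>b)" using \<mu> b by (simp add: dI_smult)
    then have "x = dI (c \<oplus>\<^bsub>C\<^esub> (\<mu> \<odot>\<^bsub>C\<^esub> y\<^sub>b))" using cl \<mu> b by (simp add: dI_add)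
    then show ?thesis using cl \<mu> b by (intro bexI[of _ "c \<oplus>\<^bsub>C\<^esub> (\<mu> \<odot>\<^bsub>C\<^esub> y\<^sub>b)"]) auto
  qed
  have taug_w: "taug (w \<odot>\<^bsub>D\<^esub> x) = \<zero>\<^bsub>Zp p\<^esub>" if x: "x \<in> carrier D" for x
    unfolding w_def omega_smult[OF x] using b by (intro taug_omega_free x) auto
  \<comment> \<open>A section of the total augmentation, supported at \<open>v0\<close>.\<close>
  define sc where "sc z = scaled_elt z \<one> \<odot>\<^bsub>D\<^esub> \<delta> v0" for z
  have scc: "sc z \<in> carrier D" if "z \<in> carrier (Zp p)" for z
    using that \<delta>c by (simp add: sc_def scaled_elt_closed)
  have sc_add: "sc (z \<oplus>\<^bsub>Zp p\<^esub> z') = sc z \<oplus>\<^bsub>D\<^esub> sc z'" if "z \<in> carrier (Zp p)" "z' \<in> carrier (Zp p)" for z z'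
    using that \<delta>c by (simp add: sc_def scaled_elt_add D.smult_l_distr scaled_elt_closed)
  have taug_sc: "taug (sc z) = z" if "z \<in> carrier (Zp p)" for z
    unfolding sc_def by (rule taug_scaled[OF that v0])

  define N where "N = sI ` carrier D <+>\<^bsub>C\<^esub> a_kernel C D dI"
  \<comment> \<open>As in the finite case, the relations are the preimage under d of im (d s), so
    J(\<infinity>) can be computed with boundaries.\<close>
  have N_iff: "x \<in> N \<longleftrightarrow> x \<in> carrier C \<and> (\<exists>y\<in>carrier D. dI x = dI (sI y))" for x
  proof
    assume "x \<in> N"
    then obtain y h where y: "y \<in> carrier D" and h: "h \<in> carrier C" "dI h = \<zero>\<^bsub>D\<^esub>" and x: "x = sI y \<oplus>\<^bsub>C\<^esub> h"
      unfolding N_def set_add_def' a_kernel_def kernel_def by auto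
    then have "dI x = dI (sI y)" using sI_closed[OF y] dI_closed[OF sI_closed[OF y]] by (simp add: dI_add)
    then show "x \<in> carrier C \<and> (\<exists>y\<in>carrier D. dI x = dI (sI y))" using x y h sI_closed by auto
  next
    assume "x \<in> carrier C \<and> (\<exists>y\<in>carrier D. dI x = dI (sI y))"
    then obtain y where x: "x \<in> carrier C" and y: "y \<in> carrier D" "dI x = dI (sI y)" by blast
    note sy = sI_closed[OF y(1)]
    have h: "x \<ominus>\<^bsub>C\<^esub> sI y \<in> carrier C" using x sy by simp
    have "dI (x \<ominus>\<^bsub>C\<^esub> sI y) = \<zero>\<^bsub>D\<^esub>"
      unfolding dI_minus[OF x sy] y(2) using dI_closed[OF sy] by (simp add: D.M.minus_eq D.M.r_neg)
    moreover have "x = sI y \<oplus>\<^bsub>C\<^esub> (x \<ominus>\<^bsub>C\<^esub> sI y)"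
      using x sy by (simp add: C.M.minus_eq C.M.a_lcomm C.M.r_neg)
    ultimately show "x \<in> N" unfolding N_def set_add_def' a_kernel_def kernel_def using y h by auto
  qed
  have N_sub: "submodule N \<Lambda> C"
  proof (rule C.submoduleI)
    fix a assume "a \<in> N"
    then obtain y where a: "a \<in> carrier C" "y \<in> carrier D" "dI a = dI (sI y)" unfolding N_iff by blast
    have neg: "\<ominus>\<^bsub>C\<^esub> a = (\<ominus>\<^bsub>\<Lambda>\<^esub> \<one>\<^bsub>\<Lambda>\<^esub>) \<odot>\<^bsub>C\<^esub> a" using a by (simp add: C.smult_l_minus)
    have "dI (\<ominus>\<^bsub>C\<^esub> a) = dI (sI ((\<ominus>\<^bsub>\<Lambda>\<^esub> \<one>\<^bsub>\<Lambda>\<^esub>) \<odot>\<^bsub>D\<^esub> y))"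
      unfolding neg using a sI_closed[OF a(2)] by (simp only: dI_smult sI_smult \<Lambda>.a_inv_closed \<Lambda>.one_closed)
    moreover have "(\<ominus>\<^bsub>\<Lambda>\<^esub> \<one>\<^bsub>\<Lambda>\<^esub>) \<odot>\<^bsub>D\<^esub> y \<in> carrier D" using a by (intro D.smult_closed) auto
    ultimately show "\<ominus>\<^bsub>C\<^esub> a \<in> N" unfolding N_iff using a by blast
  next
    fix a c assume "a \<in> N" "c \<in> N"
    then obtain y z where a: "a \<in> carrier C" "y \<in> carrier D" "dI a = dI (sI y)"
      and c: "c \<in> carrier C" "z \<in> carrier D" "dI c = dI (sI z)" unfolding N_iff by blast
    have "dI (a \<oplus>\<^bsub>C\<^esub> c) = dI (sI (y \<oplus>\<^bsub>D\<^esub> z))"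
      using a c sI_closed by (simp add: dI_add sI_add)
    moreover have "y \<oplus>\<^bsub>D\<^esub> z \<in> carrier D" using a c by simp
    ultimately show "a \<oplus>\<^bsub>C\<^esub> c \<in> N" unfolding N_iff using a c C.M.a_closed by blast
  next
    fix r a assume r: "r \<in> carrier \<Lambda>" and "a \<in> N"
    then obtain y where a: "a \<in> carrier C" "y \<in> carrier D" "dI a = dI (sI y)" unfolding N_iff by blast
    have "dI (r \<odot>\<^bsub>C\<^esub> a) = dI (sI (r \<odot>\<^bsub>D\<^esub> y))"
      using a r sI_closed by (simp add: dI_smult sI_smult)
    moreover have "r \<odot>\<^bsub>D\<^esub> y \<in> carrier D" using a r by simp
    ultimately show "r \<odot>\<^bsub>C\<^esub> a \<in> N" unfolding N_iff using a r C.smult_closed by blast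
  next
    have "dI (\<zero>\<^bsub>C\<^esub> \<ominus>\<^bsub>C\<^esub> \<zero>\<^bsub>C\<^esub>) = dI \<zero>\<^bsub>C\<^esub> \<ominus>\<^bsub>D\<^esub> dI \<zero>\<^bsub>C\<^esub>" by (rule dI_minus) auto
    then have "dI \<zero>\<^bsub>C\<^esub> = \<zero>\<^bsub>D\<^esub>"
      using dI_closed[OF C.M.zero_closed] by (simp add: C.M.minus_eq C.M.r_neg D.M.minus_eq D.M.r_neg)
    then show "\<zero>\<^bsub>C\<^esub> \<in> N" unfolding N_iff using dI_sI_zero C.M.zero_closed D.M.zero_closed by metis
  qed (auto simp: N_iff)

  have J: "?J = tensor_product \<Lambda> (quot_module C N) (ring_as_module (LR n) (\<lambda>x. x n))"
    by (simp add: J_layer_def J_inf_def N_def Let_def)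
  note base_change = tensor_quot_module[OF C.module_axioms N_sub LR_cring[of n] IS.eval_hom[of n]
      B.level_onto[of n] B.omega_closed[of n] B.level_zero_iff, folded J w_def]
  show ?thesis
  proof (rule base_change)
  fix Q assume JM: "module \<Lambda> ?J" and Q_onto: "Q ` carrier C = carrier ?J"
    and Q_add: "\<And>x y. x \<in> carrier C \<Longrightarrow> y \<in> carrier C \<Longrightarrow> Q (x \<oplus>\<^bsub>C\<^esub> y) = Q x \<oplus>\<^bsub>?J\<^esub> Q y"
    and Q_smult: "\<And>r x. r \<in> carrier \<Lambda> \<Longrightarrow> x \<in> carrier C \<Longrightarrow> Q (r \<odot>\<^bsub>C\<^esub> x) = r \<odot>\<^bsub>?J\<^esub> Q x"
    and Q_zero: "\<And>x. x \<in> carrier C \<Longrightarrow> Q x = \<zero>\<^bsub>?J\<^esub> \<longleftrightarrow> (\<exists>y\<in>carrier C. x \<ominus>\<^bsub>C\<^esub> w \<odot>\<^bsub>C\<^esub> y \<in> N)"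
  interpret JM: module \<Lambda> ?J by (rule JM)
  have Qc: "Q c \<in> carrier ?J" if "c \<in> carrier C" for c using Q_onto that by blast
  have Q_zero': "Q x = \<zero>\<^bsub>?J\<^esub> \<longleftrightarrow> (\<exists>y\<in>carrier D. \<exists>c\<in>carrier C. dI x = dI (sI y) \<oplus>\<^bsub>D\<^esub> w \<odot>\<^bsub>D\<^esub> dI c)"
    if x: "x \<in> carrier C" for x
  proof -
    have "x \<ominus>\<^bsub>C\<^esub> w \<odot>\<^bsub>C\<^esub> c \<in> N \<longleftrightarrow> (\<exists>y\<in>carrier D. dI x = dI (sI y) \<oplus>\<^bsub>D\<^esub> w \<odot>\<^bsub>D\<^esub> dI c)"
      if c: "c \<in> carrier C" for c
    proof -
      have wd: "w \<odot>\<^bsub>C\<^esub> c \<in> carrier C" "w \<odot>\<^bsub>D\<^esub> dI c \<in> carrier D" using c wc dI_closed by auto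
      have "dI (x \<ominus>\<^bsub>C\<^esub> w \<odot>\<^bsub>C\<^esub> c) = dI (sI y) \<longleftrightarrow> dI x = dI (sI y) \<oplus>\<^bsub>D\<^esub> w \<odot>\<^bsub>D\<^esub> dI c" if y: "y \<in> carrier D" for y
        unfolding dI_minus[OF x wd(1)] dI_smult[OF c wc]
        by (rule D.M.minus_eq_iff[OF dI_closed[OF x] wd(2) dI_closed[OF sI_closed[OF y]]])
      then show ?thesis unfolding N_iff using x wd by auto
    qed
    then show ?thesis unfolding Q_zero[OF x] by blast
  qed
  have Q_eq: "Q c = Q d \<longleftrightarrow> Q (c \<ominus>\<^bsub>C\<^esub> d) = \<zero>\<^bsub>?J\<^esub>" if c: "c \<in> carrier C" and d: "d \<in> carrier C" for c d
  proof -
    have cd: "c \<ominus>\<^bsub>C\<^esub> d \<in> carrier C" using c d by simp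
    have "c = (c \<ominus>\<^bsub>C\<^esub> d) \<oplus>\<^bsub>C\<^esub> d" using c d by (simp add: C.M.minus_eq C.M.a_assoc C.M.l_neg)
    then have "Q c = Q (c \<ominus>\<^bsub>C\<^esub> d) \<oplus>\<^bsub>?J\<^esub> Q d" using Q_add[OF cd d] by simp
    then show ?thesis using Qc[OF cd] Qc[OF d] by (simp add: JM.M.add.r_cancel_one)
  qed
  \<comment> \<open>A divisor of total augmentation zero is a boundary, so classes in J(n) can be
    compared without exhibiting a chain.\<close>
  have Q_eqI: "Q c = Q d"
    if c: "c \<in> carrier C" and d: "d \<in> carrier C" and y: "y \<in> carrier D"
      and x: "x \<in> carrier D" "taug x = \<zero>\<^bsub>Zp p\<^esub>"
      and eq: "dI c \<ominus>\<^bsub>D\<^esub> dI d = dI (sI y) \<oplus>\<^bsub>D\<^esub> w \<odot>\<^bsub>D\<^esub> x" for c d y x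
  proof -
    obtain e where e: "e \<in> carrier C" "dI e = x" using image[OF x] by blast
    have "dI (c \<ominus>\<^bsub>C\<^esub> d) = dI (sI y) \<oplus>\<^bsub>D\<^esub> w \<odot>\<^bsub>D\<^esub> dI e" unfolding dI_minus[OF c d] e(2) by (rule eq)
    then have "Q (c \<ominus>\<^bsub>C\<^esub> d) = \<zero>\<^bsub>?J\<^esub>" using Q_zero'[of "c \<ominus>\<^bsub>C\<^esub> d"] c d y e by auto
    then show ?thesis using Q_eq[OF c d] by simp
  qed
  have Q_eqI0: "Q c = Q d"
    if c: "c \<in> carrier C" and d: "d \<in> carrier C" and x: "x \<in> carrier D" "taug x = \<zero>\<^bsub>Zp p\<^esub>"
      and eq: "dI c \<ominus>\<^bsub>D\<^esub> dI d = w \<odot>\<^bsub>D\<^esub> x" for c d x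
    by (rule Q_eqI[OF c d D.M.zero_closed x]) (use eq dI_sI_zero wc x in simp)

  show ?thesis
  proof (rule jacobian_projection[of n])
  fix G assume
    Gc: "\<And>c. c \<in> carrier C \<Longrightarrow> G c \<in> carrier (p_power_torsion p (Jac n))" and
    G_onto: "\<And>j. j \<in> carrier (p_power_torsion p (Jac n)) \<Longrightarrow> \<exists>c\<in>carrier C. G c = j" and
    G_add: "\<And>c d. c \<in> carrier C \<Longrightarrow> d \<in> carrier C \<Longrightarrow> G (c \<oplus>\<^bsub>C\<^esub> d) = G c \<oplus>\<^bsub>Jac n\<^esub> G d" and
    G_zero: "\<And>c. c \<in> carrier C \<Longrightarrow> G c = \<zero>\<^bsub>Jac n\<^esub> \<longleftrightarrow>
       (\<exists>y\<in>carrier D. \<forall>v\<in>V. (dI c \<ominus>\<^bsub>D\<^esub> dI (sI y)) v n = \<zero>\<^bsub>LR n\<^esub>)" and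
    G_deck: "\<And>\<sigma> c. \<sigma> \<in> carrier \<Gamma> \<Longrightarrow> c \<in> carrier C \<Longrightarrow>
       G (ge \<sigma> \<odot>\<^bsub>C\<^esub> c) = deck_jacobian Ep (GQ n) (cl n \<sigma>) (G c)"
  interpret O: oriented_graph "XQ n" "EQ n" by (rule XQ_oriented)
  interpret Jm: module \<Z> "Jac n" by (rule O.jacobian_module)
  \<comment> \<open>The same description as in \<open>Q_zero'\<close>, except that
    \<open>omega n\<close> multiplies an arbitrary divisor and not only a boundary. The kernel of
    \<open>g\<close> consists of this difference.\<close>
  have G_zero': "G c = \<zero>\<^bsub>Jac n\<^esub> \<longleftrightarrow> (\<exists>y\<in>carrier D. \<exists>x\<in>carrier D. dI c = dI (sI y) \<oplus>\<^bsub>D\<^esub> w \<odot>\<^bsub>D\<^esub> x)"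
    if c: "c \<in> carrier C" for c
  proof -
    have "(\<forall>v\<in>V. (dI c \<ominus>\<^bsub>D\<^esub> dI (sI y)) v n = \<zero>\<^bsub>LR n\<^esub>) \<longleftrightarrow> (\<exists>x\<in>carrier D. dI c = dI (sI y) \<oplus>\<^bsub>D\<^esub> w \<odot>\<^bsub>D\<^esub> x)"
      if y: "y \<in> carrier D" for y
    proof -
      note d = dI_closed[OF c] dI_closed[OF sI_closed[OF y]]
      have "dI c \<ominus>\<^bsub>D\<^esub> dI (sI y) = w \<odot>\<^bsub>D\<^esub> x \<longleftrightarrow> dI c = dI (sI y) \<oplus>\<^bsub>D\<^esub> w \<odot>\<^bsub>D\<^esub> x" if x: "x \<in> carrier D" for x
        using D.M.minus_eq_iff[OF d, of "w \<odot>\<^bsub>D\<^esub> x"] D.M.a_comm[OF d(2), of "w \<odot>\<^bsub>D\<^esub> x"] x wc by simp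
      then show ?thesis
        using B.free_level_zero_iff[OF finite_V D.M.minus_closed[OF d], of n, folded w_def] by auto
    qed
    then show ?thesis unfolding G_zero[OF c] by blast
  qed
  have Gj: "G c \<in> carrier (Jac n)" if "c \<in> carrier C" for c
    using Gc[OF that] by (simp add: p_power_torsion_def)
  have G_cong: "G c = G d" if c: "c \<in> carrier C" and d: "d \<in> carrier C" and eq: "Q c = Q d" for c d
  proof -
    have cd: "c \<ominus>\<^bsub>C\<^esub> d \<in> carrier C" using c d by simp
    obtain y e where "y \<in> carrier D" "e \<in> carrier C" "dI (c \<ominus>\<^bsub>C\<^esub> d) = dI (sI y) \<oplus>\<^bsub>D\<^esub> w \<odot>\<^bsub>D\<^esub> dI e"
      using eq Q_eq[OF c d] Q_zero'[OF cd] by blast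
    then have "G (c \<ominus>\<^bsub>C\<^esub> d) = \<zero>\<^bsub>Jac n\<^esub>" using G_zero'[OF cd] dI_closed by blast
    moreover have "c = (c \<ominus>\<^bsub>C\<^esub> d) \<oplus>\<^bsub>C\<^esub> d" using c d by (simp add: C.M.minus_eq C.M.a_assoc C.M.l_neg)
    ultimately show ?thesis using G_add[OF cd d] Gj[OF d] by simp
  qed

  \<comment> \<open>A preimage under \<open>Q\<close> is chosen; \<open>G_cong\<close> makes the
    choice irrelevant.\<close>
  define g where "g j = G (SOME c. c \<in> carrier C \<and> Q c = j)" for j
  have gQ: "g (Q c) = G c" if c: "c \<in> carrier C" for c
  proof -
    have "\<exists>d. d \<in> carrier C \<and> Q d = Q c" using c by blast
    from someI_ex[OF this] show ?thesis unfolding g_def using G_cong c by blast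
  qed
  show ?thesis
  proof (rule GS_Zp_iso[of n])
  fix z assume z: "\<And>\<tau>. \<tau> \<in> GS n \<Longrightarrow> z \<tau> \<in> carrier (Zp p)"
    and z_mult: "\<And>\<tau> \<sigma>. \<tau> \<in> GS n \<Longrightarrow> \<sigma> \<in> GS n \<Longrightarrow> z (\<tau> \<otimes> \<sigma>) = z \<tau> \<oplus>\<^bsub>Zp p\<^esub> z \<sigma>"
    and z_inj: "inj_on z (GS n)" and z_onto: "z ` GS n = carrier (Zp p)"
  have wsc: "w \<odot>\<^bsub>D\<^esub> sc (z \<tau>) \<in> carrier D" if "\<tau> \<in> GS n" for \<tau> using scc[OF z[OF that]] wc by simp
  \<comment> \<open>Multiplication by \<open>w\<close> kills the total augmentation, so the divisor
    becomes a boundary although \<open>sc (z \<tau>)\<close> need not be one.\<close>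
  have "\<exists>c\<in>carrier C. dI c = w \<odot>\<^bsub>D\<^esub> sc (z \<tau>)" if "\<tau> \<in> GS n" for \<tau>
    by (rule image[OF wsc[OF that] taug_w[OF scc[OF z[OF that]]]])
  then obtain k where k: "\<And>\<tau>. \<tau> \<in> GS n \<Longrightarrow> k \<tau> \<in> carrier C"
    and dk: "\<And>\<tau>. \<tau> \<in> GS n \<Longrightarrow> dI (k \<tau>) = w \<odot>\<^bsub>D\<^esub> sc (z \<tau>)" by metis
  define f where "f \<tau> = Q (k \<tau>)" for \<tau>
  have taug_zero: "taug \<zero>\<^bsub>D\<^esub> = \<zero>\<^bsub>Zp p\<^esub>"
    using taug_minus[OF D.M.zero_closed D.M.zero_closed] taug_closed[OF D.M.zero_closed]
    by (simp add: D.M.minus_eq D.M.r_neg Zp.minus_eq Zp.r_neg)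

  \<comment> \<open>The chains \<open>k \<tau>\<close> are chosen independently of each other. Their
    boundaries are additive in \<tau>, and \<open>Q\<close> depends on the boundary only.\<close>
  have f_hom: "f (\<tau> \<otimes> \<sigma>) = f \<tau> \<oplus>\<^bsub>?J\<^esub> f \<sigma>" if t: "\<tau> \<in> GS n" and s: "\<sigma> \<in> GS n" for \<tau> \<sigma>
  proof -
    have ts: "\<tau> \<otimes> \<sigma> \<in> GS n" by (rule subgroup.m_closed[OF GS_subgroup t s])
    have "dI (k (\<tau> \<otimes> \<sigma>)) = dI (k \<tau> \<oplus>\<^bsub>C\<^esub> k \<sigma>)"
      using scc[OF z[OF t]] scc[OF z[OF s]] wc
      by (simp add: dI_add k t s dk ts z_mult sc_add z D.smult_r_distr)
    then have "dI (k (\<tau> \<otimes> \<sigma>)) \<ominus>\<^bsub>D\<^esub> dI (k \<tau> \<oplus>\<^bsub>C\<^esub> k \<sigma>) = w \<odot>\<^bsub>D\<^esub> \<zero>\<^bsub>D\<^esub>"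
      using dI_closed[OF k[OF ts]] wc by (simp add: D.M.minus_eq D.M.r_neg)
    then have "Q (k (\<tau> \<otimes> \<sigma>)) = Q (k \<tau> \<oplus>\<^bsub>C\<^esub> k \<sigma>)"
      using k t s ts taug_zero by (intro Q_eqI0[of _ _ "\<zero>\<^bsub>D\<^esub>"]) auto
    then show ?thesis by (simp add: f_def Q_add k t s)
  qed
  have f_inj: "inj_on f (GS n)"
  proof (rule inj_onI)
    fix \<tau> \<sigma> assume t: "\<tau> \<in> GS n" and s: "\<sigma> \<in> GS n" and "f \<tau> = f \<sigma>"
    define D1 where "D1 = sc (z \<tau>) \<ominus>\<^bsub>D\<^esub> sc (z \<sigma>)"
    have sct: "sc (z \<tau>) \<in> carrier D" "sc (z \<sigma>) \<in> carrier D" using scc z t s by auto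
    have D1: "D1 \<in> carrier D" using sct by (simp add: D1_def)
    obtain y c where yc: "y \<in> carrier D" "c \<in> carrier C" "dI (k \<tau> \<ominus>\<^bsub>C\<^esub> k \<sigma>) = dI (sI y) \<oplus>\<^bsub>D\<^esub> w \<odot>\<^bsub>D\<^esub> dI c"
      using \<open>f \<tau> = f \<sigma>\<close> Q_eq[OF k[OF t] k[OF s]] Q_zero'[of "k \<tau> \<ominus>\<^bsub>C\<^esub> k \<sigma>"] k[OF t] k[OF s] by (auto simp: f_def)
    note dc = dI_closed[OF yc(2)] and sy = sI_closed[OF yc(1)] and dsy = dI_closed[OF sI_closed[OF yc(1)]]
    have "dI (k \<tau> \<ominus>\<^bsub>C\<^esub> k \<sigma>) = w \<odot>\<^bsub>D\<^esub> D1"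
      unfolding D1_def D.smult_minus_r[OF wc sct] by (simp add: dI_minus k t s dk)
    then have "w \<odot>\<^bsub>D\<^esub> D1 = dI (sI y) \<oplus>\<^bsub>D\<^esub> w \<odot>\<^bsub>D\<^esub> dI c" using yc(3) by simp
    then have "w \<odot>\<^bsub>D\<^esub> D1 \<ominus>\<^bsub>D\<^esub> w \<odot>\<^bsub>D\<^esub> dI c = dI (sI y)"
      using D.M.minus_eq_iff[of "w \<odot>\<^bsub>D\<^esub> D1" "w \<odot>\<^bsub>D\<^esub> dI c" "dI (sI y)"] D1 wc dc dsy by simp
    \<comment> \<open>Now \<open>y\<close> is harmonic at level n, so \<open>sI y\<close> is itself
      a multiple of \<open>w\<close>. Cancelling \<open>w\<close> makes \<open>D1\<close> a
      boundary, and taking total augmentations gives \<open>z \<tau> = z \<sigma>\<close>.\<close>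
    then have wy: "dI (sI y) = w \<odot>\<^bsub>D\<^esub> (D1 \<ominus>\<^bsub>D\<^esub> dI c)" using D.smult_minus_r[OF wc D1 dc] by simp
    have Dc: "D1 \<ominus>\<^bsub>D\<^esub> dI c \<in> carrier D" using D1 dc by simp
    have "\<forall>v\<in>V. dI (sI y) v n = \<zero>\<^bsub>LR n\<^esub>"
      using B.free_level_zero_iff[OF finite_V dsy, of n, folded w_def] wy Dc by blast
    then have "\<forall>e\<in>Ep. sI y e n = \<zero>\<^bsub>LR n\<^esub>" using lap_level_kernel[OF yc(1)] by blast
    then obtain c' where c': "c' \<in> carrier C" "sI y = w \<odot>\<^bsub>C\<^esub> c'"
      using B.free_level_zero_iff[OF finite_Ep sy, of n, folded w_def] by blast
    have "w \<odot>\<^bsub>D\<^esub> dI c' = w \<odot>\<^bsub>D\<^esub> (D1 \<ominus>\<^bsub>D\<^esub> dI c)" using wy c' wc by (simp add: dI_smult)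
    then have "dI c' = D1 \<ominus>\<^bsub>D\<^esub> dI c"
      unfolding w_def by (rule B.free_omega_cancel[OF finite_V dI_closed[OF c'(1)] Dc])
    then have "taug (D1 \<ominus>\<^bsub>D\<^esub> dI c) = \<zero>\<^bsub>Zp p\<^esub>" using taug_boundary[OF c'(1)] by simp
    then have "taug D1 \<ominus>\<^bsub>Zp p\<^esub> \<zero>\<^bsub>Zp p\<^esub> = \<zero>\<^bsub>Zp p\<^esub>"
      unfolding taug_minus[OF D1 dc] taug_boundary[OF yc(2)] .
    then have "taug D1 = \<zero>\<^bsub>Zp p\<^esub>"
      unfolding Zp.minus_eq_iff[OF taug_closed[OF D1] Zp.zero_closed Zp.zero_closed] by simp
    then have "z \<tau> \<ominus>\<^bsub>Zp p\<^esub> z \<sigma> = \<zero>\<^bsub>Zp p\<^esub>"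
      unfolding D1_def taug_minus[OF sct] taug_sc[OF z[OF t]] taug_sc[OF z[OF s]] .
    then have "z \<tau> = z \<sigma>"
      unfolding Zp.minus_eq_iff[OF z[OF t] z[OF s] Zp.zero_closed] using z[OF s] by simp
    then show "\<tau> = \<sigma>" using z_inj t s by (auto dest: inj_onD)
  qed
  have gf: "g (f \<tau>) = \<zero>\<^bsub>Jac n\<^esub>" if t: "\<tau> \<in> GS n" for \<tau>
  proof -
    have "dI (k \<tau>) = dI (sI \<zero>\<^bsub>D\<^esub>) \<oplus>\<^bsub>D\<^esub> w \<odot>\<^bsub>D\<^esub> sc (z \<tau>)"
      using dk[OF t] wsc[OF t] by (simp add: dI_sI_zero)
    then show ?thesis
      unfolding f_def gQ[OF k[OF t]] using G_zero'[OF k[OF t]] scc[OF z[OF t]] D.M.zero_closed by blast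
  qed
  \<comment> \<open>In the formula for \<open>dI c\<close>, changing \<open>x\<close> by a divisor
    of total augmentation zero, that is by a boundary, does not change the class in J(n). So
    \<open>x\<close> may be replaced by \<open>sc (taug x)\<close>, which is the divisor used for
    some \<tau>.\<close>
  have ker: "j \<in> f ` GS n" if j: "j \<in> carrier ?J" and 0: "g j = \<zero>\<^bsub>Jac n\<^esub>" for j
  proof -
    obtain c where c: "c \<in> carrier C" "j = Q c" using j Q_onto by blast
    then obtain y x where yx: "y \<in> carrier D" "x \<in> carrier D" "dI c = dI (sI y) \<oplus>\<^bsub>D\<^esub> w \<odot>\<^bsub>D\<^esub> x"
      using 0 gQ G_zero' by auto
    have tx: "taug x \<in> carrier (Zp p)" by (rule taug_closed[OF yx(2)])
    then obtain \<tau> where t: "\<tau> \<in> GS n" "z \<tau> = taug x" using z_onto by (metis imageE)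
    have s: "sc (taug x) \<in> carrier D" by (rule scc[OF tx])
    have ws: "w \<odot>\<^bsub>D\<^esub> sc (taug x) \<in> carrier D" "w \<odot>\<^bsub>D\<^esub> x \<in> carrier D" using s yx wc by auto
    note dsy = dI_closed[OF sI_closed[OF yx(1)]]
    have "dI c \<ominus>\<^bsub>D\<^esub> dI (k \<tau>) = dI (sI y) \<oplus>\<^bsub>D\<^esub> (w \<odot>\<^bsub>D\<^esub> x \<ominus>\<^bsub>D\<^esub> w \<odot>\<^bsub>D\<^esub> sc (taug x))"
      unfolding dk[OF t(1)] t(2) yx(3) using ws dsy by (simp add: D.M.minus_eq D.M.a_assoc)
    then have "dI c \<ominus>\<^bsub>D\<^esub> dI (k \<tau>) = dI (sI y) \<oplus>\<^bsub>D\<^esub> w \<odot>\<^bsub>D\<^esub> (x \<ominus>\<^bsub>D\<^esub> sc (taug x))"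
      unfolding D.smult_minus_r[OF wc yx(2) s] .
    moreover have "taug (x \<ominus>\<^bsub>D\<^esub> sc (taug x)) = \<zero>\<^bsub>Zp p\<^esub>"
      unfolding taug_minus[OF yx(2) s] taug_sc[OF tx] using tx by simp
    moreover have "x \<ominus>\<^bsub>D\<^esub> sc (taug x) \<in> carrier D" using yx s by simp
    ultimately have "Q c = Q (k \<tau>)" using Q_eqI[OF c(1) k[OF t(1)] yx(1)] by blast
    then show ?thesis using c t by (auto simp: f_def)
  qed
  have f_trivial: "ge \<sigma> \<odot>\<^bsub>?J\<^esub> f \<tau> = f \<tau>" if \<sigma>: "\<sigma> \<in> carrier \<Gamma>" and t: "\<tau> \<in> GS n" for \<sigma> \<tau>
  proof -
    have gc: "ge \<sigma> \<in> carrier \<Lambda>" by (rule ge_closed[OF \<sigma>])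
    note s = scc[OF z[OF t]]
    have gs: "ge \<sigma> \<odot>\<^bsub>D\<^esub> sc (z \<tau>) \<in> carrier D" using gc s by simp
    have gk: "ge \<sigma> \<odot>\<^bsub>C\<^esub> k \<tau> \<in> carrier C" using gc k[OF t] by simp
    have "dI (ge \<sigma> \<odot>\<^bsub>C\<^esub> k \<tau>) = (ge \<sigma> \<otimes>\<^bsub>\<Lambda>\<^esub> w) \<odot>\<^bsub>D\<^esub> sc (z \<tau>)"
      unfolding dI_smult[OF k[OF t] gc] dk[OF t] by (rule D.smult_assoc1[symmetric, OF gc wc s])
    also have "\<dots> = w \<odot>\<^bsub>D\<^esub> (ge \<sigma> \<odot>\<^bsub>D\<^esub> sc (z \<tau>))"
      unfolding \<Lambda>.m_comm[OF gc wc] by (rule D.smult_assoc1[OF wc gc s])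
    finally have dg: "dI (ge \<sigma> \<odot>\<^bsub>C\<^esub> k \<tau>) = w \<odot>\<^bsub>D\<^esub> (ge \<sigma> \<odot>\<^bsub>D\<^esub> sc (z \<tau>))" .
    have "dI (ge \<sigma> \<odot>\<^bsub>C\<^esub> k \<tau>) \<ominus>\<^bsub>D\<^esub> dI (k \<tau>) = w \<odot>\<^bsub>D\<^esub> (ge \<sigma> \<odot>\<^bsub>D\<^esub> sc (z \<tau>) \<ominus>\<^bsub>D\<^esub> sc (z \<tau>))"
      unfolding dg dk[OF t] D.smult_minus_r[OF wc gs s] ..
    \<comment> \<open>Translating \<open>sc (z \<tau>)\<close> changes it by a divisor of total
      augmentation zero, which \<open>Q\<close> does not see after multiplication by
      \<open>w\<close>.\<close>
    then have "Q (ge \<sigma> \<odot>\<^bsub>C\<^esub> k \<tau>) = Q (k \<tau>)"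
      by (rule Q_eqI0[OF gk k[OF t] D.M.minus_closed[OF gs s] taug_omega_free[OF s \<sigma>]])
    then show ?thesis unfolding f_def using Q_smult[OF gc k[OF t]] by simp
  qed
  have g_hom: "g (i \<oplus>\<^bsub>?J\<^esub> j) = g i \<oplus>\<^bsub>Jac n\<^esub> g j" if ij: "i \<in> carrier ?J" "j \<in> carrier ?J" for i j
  proof -
    obtain c where c: "c \<in> carrier C" "i = Q c" using ij(1) Q_onto by blast
    obtain d where d: "d \<in> carrier C" "j = Q d" using ij(2) Q_onto by blast
    show ?thesis
      unfolding c(2) d(2) Q_add[OF c(1) d(1), symmetric] gQ[OF C.M.a_closed[OF c(1) d(1)]] gQ[OF c(1)] gQ[OF d(1)]
      by (rule G_add[OF c(1) d(1)])
  qed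
  have gc: "g j \<in> carrier (p_power_torsion p (Jac n))" if j: "j \<in> carrier ?J" for j
  proof -
    obtain c where "c \<in> carrier C" "j = Q c" using j Q_onto by blast
    then show ?thesis using gQ[OF \<open>c \<in> carrier C\<close>] Gc[OF \<open>c \<in> carrier C\<close>] by (simp only:)
  qed
  have g_deck: "g (ge \<sigma> \<odot>\<^bsub>?J\<^esub> j) = deck_jacobian Ep (GQ n) (cl n \<sigma>) (g j)"
    if \<sigma>: "\<sigma> \<in> carrier \<Gamma>" and j: "j \<in> carrier ?J" for \<sigma> j
  proof -
    obtain c where c: "c \<in> carrier C" "j = Q c" using j Q_onto by blast
    note gc = ge_closed[OF \<sigma>]
    show ?thesis
      unfolding c(2) Q_smult[OF gc c(1), symmetric] gQ[OF c(1)] gQ[OF C.smult_closed[OF gc c(1)]]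
      by (rule G_deck[OF \<sigma> c(1)])
  qed
  have groups: "group (\<Gamma>\<lparr>carrier := GS n\<rparr>)" "group (add_monoid ?J)" "group (p_power_torsion p (Jac n))"
    using subgroup.subgroup_is_group[OF GS_subgroup is_group] JM.M.a_group
      p_power_torsion_group[OF O.jacobian_module] by auto
  have torsion_simps: "mult (p_power_torsion p (Jac n)) = add (Jac n)" "\<one>\<^bsub>p_power_torsion p (Jac n)\<^esub> = \<zero>\<^bsub>Jac n\<^esub>"
    by (simp_all add: p_power_torsion_def)
  have fc: "f \<tau> \<in> carrier ?J" if "\<tau> \<in> GS n" for \<tau> unfolding f_def by (rule Qc[OF k[OF that]])
  have "short_exact (\<Gamma>\<lparr>carrier := GS n\<rparr>) f (add_monoid ?J) g (p_power_torsion p (Jac n))"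
    unfolding short_exact_def
  proof (intro conjI)
    show "group_hom (\<Gamma>\<lparr>carrier := GS n\<rparr>) (add_monoid ?J) f"
      using groups fc f_hom by (auto intro!: group_hom.intro group_hom_axioms.intro homI)
    show "group_hom (add_monoid ?J) (p_power_torsion p (Jac n)) g"
      using groups gc g_hom by (auto intro!: group_hom.intro group_hom_axioms.intro homI simp: torsion_simps)
    show "inj_on f (carrier (\<Gamma>\<lparr>carrier := GS n\<rparr>))" using f_inj by simp
    show "f ` carrier (\<Gamma>\<lparr>carrier := GS n\<rparr>) = kernel (add_monoid ?J) (p_power_torsion p (Jac n)) g"
      unfolding kernel_def torsion_simps using fc gf ker by auto
    show "g ` carrier (add_monoid ?J) = carrier (p_power_torsion p (Jac n))"
    proof (intro equalityI subsetI)
      fix j assume "j \<in> carrier (p_power_torsion p (Jac n))"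
      then obtain c where c: "c \<in> carrier C" "G c = j" using G_onto by blast
      show "j \<in> g ` carrier (add_monoid ?J)"
      proof (rule image_eqI)
        show "j = g (Q c)" unfolding gQ[OF c(1)] by (rule c(2)[symmetric])
        show "Q c \<in> carrier (add_monoid ?J)" unfolding monoid.simps partial_object.simps using Qc[OF c(1)] .
      qed
    next
      fix j assume "j \<in> g ` carrier (add_monoid ?J)"
      then obtain i where "i \<in> carrier ?J" "j = g i" unfolding monoid.simps partial_object.simps by (rule imageE)
      then show "j \<in> carrier (p_power_torsion p (Jac n))" using gc[of i] by (simp only:)
    qed
  qed
  then show ?thesis using f_trivial g_deck by blast
  qed
  qed
  qed
qed

end

theorem mainTheorem2:
  fixes p n :: nat
    and \<Gamma> :: "'g monoid" and T :: "'g topology" and \<phi> :: "'g \<Rightarrow> nat \<Rightarrow> int" and \<gamma> :: 'g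
    and X\<^sub>0 :: "('v, 'e) pre_digraph" and \<iota> :: "'e \<Rightarrow> 'e" and Ep :: "'e set" and \<alpha> :: "'e \<Rightarrow> 'g"
  defines "\<Gamma>\<^sub>q \<equiv> Gamma_quot p \<Gamma> T \<gamma>"
    and "\<alpha>\<^sub>q \<equiv> (\<lambda>m e. Gamma_sub p \<Gamma> T \<gamma> m #>\<^bsub>\<Gamma>\<^esub> \<alpha> e)"
  defines "X\<^sub>q \<equiv> (\<lambda>m. derived_graph X\<^sub>0 (\<Gamma>\<^sub>q m) (\<alpha>\<^sub>q m))"
    and "J \<equiv> J_layer p \<Gamma> T \<gamma> X\<^sub>0 Ep \<alpha>"
  assumes "prime p"
    and "group \<Gamma>" and "topspace T = carrier \<Gamma>"
    and "\<phi> \<in> iso \<Gamma> (add_monoid (Zp p))" and "homeomorphic_map T (Zp_topology p) \<phi>"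
    and "\<gamma> \<in> carrier \<Gamma>" and "T closure_of generate \<Gamma> {\<gamma>} = carrier \<Gamma>"
    and "bidirected_digraph X\<^sub>0 \<iota>" and "fin_digraph X\<^sub>0" and "Digraph_Component.connected X\<^sub>0"
    and "orientation X\<^sub>0 \<iota> Ep"
    and "voltage_assignment X\<^sub>0 \<iota> \<Gamma> \<alpha>"
    and "\<And>m. Digraph_Component.connected (X\<^sub>q m)"
  shows "\<exists>f g. short_exact
                 (\<Gamma>\<lparr>carrier := Gamma_sub p \<Gamma> T \<gamma> n\<rparr>) f
                 (add_monoid (J n)) g
                 (p_power_torsion p (jacobian (X\<^sub>q n) (Ep \<times> carrier (\<Gamma>\<^sub>q n))))
           \<and> (\<forall>\<sigma>\<in>carrier \<Gamma>. \<forall>\<tau>\<in>Gamma_sub p \<Gamma> T \<gamma> n. group_elt p \<Gamma> T \<gamma> \<sigma> \<odot>\<^bsub>J n\<^esub> f \<tau> = f \<tau>)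
           \<and> (\<forall>\<sigma>\<in>carrier \<Gamma>. \<forall>x\<in>carrier (J n).
                g (group_elt p \<Gamma> T \<gamma> \<sigma> \<odot>\<^bsub>J n\<^esub> x)
                  = deck_jacobian Ep (\<Gamma>\<^sub>q n) (Gamma_sub p \<Gamma> T \<gamma> n #>\<^bsub>\<Gamma>\<^esub> \<sigma>) (g x))"
proof -
  have "\<And>m. Digraph_Component.connected (derived_graph X\<^sub>0 (Gamma_quot p \<Gamma> T \<gamma> m) (\<lambda>e. Gamma_sub p \<Gamma> T \<gamma> m #>\<^bsub>\<Gamma>\<^esub> \<alpha> e))"
    using assms(17) unfolding assms(1-3) .
  then interpret iwasawa_graph p \<Gamma> T \<phi> \<gamma> X\<^sub>0 \<iota> Ep \<alpha>
    by (intro iwasawa_graph.intro iwasawa_graph_axioms.intro padic_group.intro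
        padic_group_axioms.intro padic.intro assms(5-16))
  show ?thesis unfolding assms(1-4) by (rule layer_extension)
qed

end
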